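(* Suppose $0<q<p$ and $1<p<\infty$, and let $1/r=1/q-1/p$. Let $n\ge1$ be an integer, let $U$ and $W$ be non-negative measurable functions on $\mathbb R^n$, and define $u$ and $w$ on $(0,\infty)$ by $u=U^*$ and $1/w=(1/W)^*$. Consider the following conditions. (MH): $$\bigg(\int_0^\infty\bigg(\int_0^x u\bigg)^{r/p}\bigg(\int_0^{1/x}w^{1-p'}\bigg)^{r/p'}u(x)\,dx\bigg)^{1/r}<\infty.$$ (BHJH): $$\bigg(\int_0^\infty\bigg(\int_x^\infty t^{-q/2}u(t)\,dt\bigg)^{r/p}\bigg(\int_{1/x}^\infty t^{-p'/2}w(t)^{1-p'}\,dt\bigg)^{r/p'}x^{-q/2}u(x)\,dx\bigg)^{1/r}<\infty.$$ (SEQ): $$\sup_{x_k}\bigg(\sum_{k\in\mathbb Z}\bigg(\int_{1/x_{k+1}}^{1/x_k}(x_{k+1}t-1)^{q/2}u(t)\,\frac{dt}{t^q}\bigg)^{r/q}\bigg(\int_0^{x_{k+1}}w\bigg)^{-r/p}\bigg)^{1/r}<\infty,$$ where the supremum is taken over all increasing sequences $x_k$, $k\in\mathbb Z$, of positive real numbers. (NH) (for $p>2$): $$\bigg(\int_0^\infty\bigg(\int_{1/x}^\infty\bigg(\frac1{t-1/x}\int_0^t w\bigg)^{-p/(p-2)}w(t)\,dt\bigg)^{(r/2)(p-2)/p}\bigg(\int_x^\infty t^{-q/2}u(t)\,dt\bigg)^{r/p}x^{-q/2}u(x)\,dx\bigg)^{1/r}<\infty.$$ (c): there exists a finite constant $\beta$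 such that for all $y>0$, $$y^{q/2}\int_y^\infty u(x)\,\frac{dx}{x^{q/2}}\le\beta\bigg(\int_0^y u(x)\,dx+y^{\max(1,q)}\int_y^\infty u(x)\,\frac{dx}{x^{\max(1,q)}}\bigg).$$ (d): $u\in B_{q/2}$. (e): $q>1$ and $t^{2-q}u(t)$ is a decreasing function of $t$. (f): $q>1$ and there exists a finite constant $\beta$ such that for all $y>0$, $$y^{p'/2}\int_y^\infty w(x)^{1-p'}\,\frac{dx}{x^{p'/2}}\le\beta\bigg(\int_0^y w(x)^{1-p'}\,dx+y^{p'}\int_y^\infty w(x)^{1-p'}\,\frac{dx}{x^{p'}}\bigg).$$ (g): $q>1$ and $w^{1-p'}\in B_{p'/2}$. (h): $q>1$ and $t^{2-p'}w(t)^{1-p'}$ is a decreasing function of $t$. Then there is a finite constant $C$ such that $$\bigg(\int_{\mathbb R^n}|\hat f(y)|^qU(y)\,dy\bigg)^{1/q}\le C\bigg(\int_{\mathbb R^n}|f(x)|^pW(x)\,dx\bigg)^{1/p},\quad f\in L^1(\mathbb R^n),$$ provided (MH) holds and at least one of (i), (ii), (iii) is satisfied: (i) $2\le q<p$ or $1<q<p\le2$; (ii) $1<q<2<p$ and at least one of the following holds: one or more of (c), (d), (e), (f), (g), (h); or (BHJH); or both (SEQ) and (NH); (iii) $0<q<1<p$ and at least one of the following holds: (c) or (d); or (BHJH); or $p\le2$ and (SEQ); or $p>2$ and both (SEQ) and (NH).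
   Context: The Fourier transform of $f\in L^1(\mathbb R^n)$ is $\hat f(x)=\int_{\mathbb R^n}e^{-2\pi i x\cdot y}f(y)\,dy$. For a $\mu$-measurable function $f$, the non-increasing rearrangement is $f^*(t)=\inf\{\alpha>0:\mu_f(\alpha)\le t\}$, $t>0$, where $\mu_f(\alpha)=\mu\{x:|f(x)|>\alpha\}$; here $\mu$ is Lebesgue measure on $\mathbb R^n$. The functions $u$ and $w$ take values in $[0,\infty]$, $u$ is non-increasing and $w$ is non-decreasing. Conjugate indices: $1/p+1/p'=1$. For $s>0$, a non-negative function $f$ on $(0,\infty)$ is in $B_s$ if there exists a constant $\beta<\infty$ such that $y^s\int_y^\infty f(x)\,\frac{dx}{x^s}\le\beta\int_0^y f(x)\,dx$ for all $y>0$. "Decreasing" means non-increasing. Usual conventions: $1/0=\infty$, $1/\infty=0$, $0\cdot\infty=0$, negative powers of $0$ are $\infty$, and negative powers of $\infty$ are $0$. *)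

theory Defs
  imports "HOL-Analysis.Analysis"
begin

text \<open>Real powers on \<open>[0,\<infinity>]\<close>, with negative powers of \<open>0\<close> equal to \<open>\<infinity>\<close> and
  negative powers of \<open>\<infinity>\<close> equal to \<open>0\<close>. The conventions \<open>1/0 = \<infinity>\<close>, \<open>1/\<infinity> = 0\<close> and
  \<open>0 \<cdot> \<infinity> = 0\<close> are already those of \<open>ennreal\<close>.\<close>

definition powe :: "ennreal \<Rightarrow> real \<Rightarrow> ennreal" (infixr "powe" 80) where
  "x powe a =
     (if a = 0 then 1
      else if x = 0 then (if a > 0 then 0 else \<infinity>)
      else if x = \<infinity> then (if a > 0 then \<infinity> else 0)
      else ennreal (enn2real x powr a))"

definition fourier :: "(real ^ 'n \<Rightarrow> complex) \<Rightarrow> real ^ 'n \<Rightarrow> complex" where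
  "fourier f x =
     (LINT y|lebesgue. exp (- (2 * complex_of_real pi * \<i> * complex_of_real (x \<bullet> y))) * f y)"

definition distr_fun :: "'a measure \<Rightarrow> ('a \<Rightarrow> ennreal) \<Rightarrow> real \<Rightarrow> ennreal" where
  "distr_fun M f \<alpha> = emeasure M {x \<in> space M. f x > ennreal \<alpha>}"

text \<open>The non-increasing rearrangement of a non-negative function; the infimum of the empty set
  is \<open>\<infinity>\<close>.\<close>

definition rearrangement :: "'a measure \<Rightarrow> ('a \<Rightarrow> ennreal) \<Rightarrow> real \<Rightarrow> ennreal" where
  "rearrangement M f t = Inf {ennreal \<alpha> |\<alpha>. \<alpha> > 0 \<and> distr_fun M f \<alpha> \<le> ennreal t}"

text \<open>Weights on \<open>(0,\<infinity>)\<close> are functions \<open>real \<Rightarrow> ennreal\<close> whose values outside \<open>(0,\<infinity>)\<close> are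
  never used.\<close>

definition B_class :: "real \<Rightarrow> (real \<Rightarrow> ennreal) set" where
  "B_class s = {f. \<exists>\<beta><\<infinity>. \<forall>y>0.
     ennreal (y powr s) * (\<integral>\<^sup>+x\<in>{y<..}. f x / ennreal (x powr s) \<partial>lborel)
       \<le> \<beta> * (\<integral>\<^sup>+x\<in>{0<..<y}. f x \<partial>lborel)}"

text \<open>Throughout, \<open>p'\<close> is the conjugate index of \<open>p\<close>, and \<open>1/r = 1/q - 1/p\<close>.\<close>

definition cond_MH :: "real \<Rightarrow> real \<Rightarrow> real \<Rightarrow> (real \<Rightarrow> ennreal) \<Rightarrow> (real \<Rightarrow> ennreal) \<Rightarrow> bool" where
  "cond_MH p p' r u w \<longleftrightarrow>
     (\<integral>\<^sup>+x\<in>{0<..}.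
        (\<integral>\<^sup>+t\<in>{0<..<x}. u t \<partial>lborel) powe (r / p) *
        (\<integral>\<^sup>+t\<in>{0<..<1 / x}. w t powe (1 - p') \<partial>lborel) powe (r / p') *
        u x \<partial>lborel) powe (1 / r) < \<infinity>"

definition cond_BHJH ::
  "real \<Rightarrow> real \<Rightarrow> real \<Rightarrow> real \<Rightarrow> (real \<Rightarrow> ennreal) \<Rightarrow> (real \<Rightarrow> ennreal) \<Rightarrow> bool" where
  "cond_BHJH p p' q r u w \<longleftrightarrow>
     (\<integral>\<^sup>+x\<in>{0<..}.
        (\<integral>\<^sup>+t\<in>{x<..}. ennreal (t powr (- q / 2)) * u t \<partial>lborel) powe (r / p) *
        (\<integral>\<^sup>+t\<in>{1 / x<..}. ennreal (t powr (- p' / 2)) * w t powe (1 - p') \<partial>lborel)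
          powe (r / p') *
        ennreal (x powr (- q / 2)) * u x \<partial>lborel) powe (1 / r) < \<infinity>"

text \<open>Increasing sequences are understood in the weak sense.\<close>

definition cond_SEQ ::
  "real \<Rightarrow> real \<Rightarrow> real \<Rightarrow> (real \<Rightarrow> ennreal) \<Rightarrow> (real \<Rightarrow> ennreal) \<Rightarrow> bool" where
  "cond_SEQ p q r u w \<longleftrightarrow>
     (SUP x\<in>{x :: int \<Rightarrow> real. mono x \<and> (\<forall>k. x k > 0)}.
        (\<Sum>\<^sub>\<infinity>k\<in>UNIV.
           (\<integral>\<^sup>+t\<in>{1 / x (k + 1)<..<1 / x k}.
              ennreal ((x (k + 1) * t - 1) powr (q / 2)) * u t / ennreal (t powr q) \<partial>lborel)
             powe (r / q) *
           (\<integral>\<^sup>+t\<in>{0<..<x (k + 1)}. w t \<partial>lborel) powe (- r / p)) powe (1 / r)) < \<infinity>"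

text \<open>Only meaningful for \<open>p > 2\<close>.\<close>

definition cond_NH ::
  "real \<Rightarrow> real \<Rightarrow> real \<Rightarrow> (real \<Rightarrow> ennreal) \<Rightarrow> (real \<Rightarrow> ennreal) \<Rightarrow> bool" where
  "cond_NH p q r u w \<longleftrightarrow>
     (\<integral>\<^sup>+x\<in>{0<..}.
        (\<integral>\<^sup>+t\<in>{1 / x<..}.
           (ennreal (1 / (t - 1 / x)) * (\<integral>\<^sup>+s\<in>{0<..<t}. w s \<partial>lborel)) powe (- p / (p - 2)) *
           w t \<partial>lborel) powe ((r / 2) * (p - 2) / p) *
        (\<integral>\<^sup>+t\<in>{x<..}. ennreal (t powr (- q / 2)) * u t \<partial>lborel) powe (r / p) *
        ennreal (x powr (- q / 2)) * u x \<partial>lborel) powe (1 / r) < \<infinity>"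

definition cond_c :: "real \<Rightarrow> (real \<Rightarrow> ennreal) \<Rightarrow> bool" where
  "cond_c q u \<longleftrightarrow> (\<exists>\<beta><\<infinity>. \<forall>y>0.
     ennreal (y powr (q / 2)) * (\<integral>\<^sup>+x\<in>{y<..}. u x / ennreal (x powr (q / 2)) \<partial>lborel)
       \<le> \<beta> * ((\<integral>\<^sup>+x\<in>{0<..<y}. u x \<partial>lborel) +
              ennreal (y powr max 1 q) *
                (\<integral>\<^sup>+x\<in>{y<..}. u x / ennreal (x powr max 1 q) \<partial>lborel)))"

definition cond_d :: "real \<Rightarrow> (real \<Rightarrow> ennreal) \<Rightarrow> bool" where
  "cond_d q u \<longleftrightarrow> u \<in> B_class (q / 2)"

definition cond_e :: "real \<Rightarrow> (real \<Rightarrow> ennreal) \<Rightarrow> bool" where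
  "cond_e q u \<longleftrightarrow> q > 1 \<and> antimono_on {0<..} (\<lambda>t. ennreal (t powr (2 - q)) * u t)"

definition cond_f :: "real \<Rightarrow> real \<Rightarrow> (real \<Rightarrow> ennreal) \<Rightarrow> bool" where
  "cond_f p' q w \<longleftrightarrow> q > 1 \<and> (\<exists>\<beta><\<infinity>. \<forall>y>0.
     ennreal (y powr (p' / 2)) *
         (\<integral>\<^sup>+x\<in>{y<..}. w x powe (1 - p') / ennreal (x powr (p' / 2)) \<partial>lborel)
       \<le> \<beta> * ((\<integral>\<^sup>+x\<in>{0<..<y}. w x powe (1 - p') \<partial>lborel) +
              ennreal (y powr p') *
                (\<integral>\<^sup>+x\<in>{y<..}. w x powe (1 - p') / ennreal (x powr p') \<partial>lborel)))"

definition cond_g :: "real \<Rightarrow> real \<Rightarrow> (real \<Rightarrow> ennreal) \<Rightarrow> bool" where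
  "cond_g p' q w \<longleftrightarrow> q > 1 \<and> (\<lambda>t. w t powe (1 - p')) \<in> B_class (p' / 2)"

definition cond_h :: "real \<Rightarrow> real \<Rightarrow> (real \<Rightarrow> ennreal) \<Rightarrow> bool" where
  "cond_h p' q w \<longleftrightarrow>
     q > 1 \<and> antimono_on {0<..} (\<lambda>t. ennreal (t powr (2 - p')) * w t powe (1 - p'))"

end

theory Submission
  imports Defs "HOL-Probability.Probability"
begin

text \<open>
  The Fourier transform has type \<open>(1,\<infinity>)\<close> and \<open>(2,2)\<close>. Let \<open>g\<close>
  be the transform of \<open>f\<close>. Splitting \<open>f\<close> at a height of its rearrangement \<open>F =
  f\<^sup>*\<close> bounds \<open>\<integral>\<^sub>0\<^sup>z (g\<^sup>*)\<^sup>2\<close> by \<open>C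
  \<integral>\<^sub>0\<^sup>z (\<integral>\<^sub>0\<^sup>1\<^sup>/\<^sup>t F)\<^sup>2 dt\<close>, and a
  majorization argument turns the weighted Fourier inequality into two inequalities for non-increasing
  \<open>F\<close> on \<open>(0,\<infinity>)\<close>: a Hardy inequality for
  \<open>\<integral>\<^sub>0\<^sup>1\<^sup>/\<^sup>x F\<close>, and, when \<open>q < 2\<close>, a tail
  inequality for \<open>(\<integral>\<^sub>1\<^sub>/\<^sub>x\<^sup>\<infinity>
  F\<^sup>2)\<^sup>1\<^sup>/\<^sup>2\<close>. Condition (MH) gives the former. Since \<open>q < p\<close>, both
  are proved by cutting \<open>(0,\<infinity>)\<close> at points where the function to be estimated halves. The
  tail inequality is covered by the Hardy inequality under (c), (d), (e), follows from (BHJH) by Hardy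
  inequalities in both directions, and follows from (SEQ) (with (NH) if \<open>p > 2\<close>) by a
  discretization at the levels of \<open>F\<close> together with Sawyer's duality principle for non-increasing
  functions. The cases with \<open>1 < q < p \<le> 2\<close> and (f), (g), (h) are obtained by duality.
\<close>

text \<open>The weight w enters only through \<open>\<kappa>\<close>, the rearrangement of 1/W:
  \<open>inverse \<kappa>\<close> is w and \<open>\<kappa> powe (p' - 1)\<close> is w^(1-p').
  Majorization compares integrals of G^2 against non-increasing weights, and G^(q-2) is such a
  weight only for q \<ge> 2. For smaller q what remains is the bound of z G(z)^2 by the integral of
  G^2 over (0,z), and the second term of its estimate is the subject of the tail inequality. Since q
  < p, sums over pieces cannot be controlled by a supremum; Hoelder with exponents p/q and r/q
  splits them into the norm of F and a functional of the weights, where 1 - q/p = q/r. Some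
  estimates bound a quantity by a power of itself, so it must be known to be finite beforehand;
  hence the truncation of u in the majorization and of U in the duality. (MH) yields finite weights
  only if neither weight vanishes identically, and these two cases are treated separately. Duality
  replaces (p,q) by (q',p') and exchanges u with w^(1-p'); it preserves (MH), and (f), (g), (h)
  become (c), (d), (e).\<close>

abbreviation nnl :: "'a::euclidean_space set \<Rightarrow> ('a \<Rightarrow> ennreal) \<Rightarrow> ennreal" where
 "nnl A f \<equiv> \<integral>\<^sup>+x\<in>A. f x \<partial>lborel"

section \<open>Powers of extended nonnegative reals\<close>

lemma powe_0 [simp]: "x powe 0 = 1"
 by (simp add: powe_def)

lemma powe_1 [simp]: "x powe 1 = x"
 by (cases x) (auto simp: powe_def)

lemma zero_powe [simp]: "a > 0 \<Longrightarrow> 0 powe a = 0"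
 by (simp add: powe_def)

lemma top_powe [simp]: "a > 0 \<Longrightarrow> \<infinity> powe a = \<infinity>" "a > 0 \<Longrightarrow> \<top> powe a = \<top>"
 by (simp_all add: powe_def)

lemma one_powe [simp]: "1 powe a = 1"
 by (simp add: powe_def)

lemma ennreal_powe: "x > 0 \<or> (x = 0 \<and> a > 0) \<Longrightarrow> ennreal x powe a = ennreal (x powr a)"
 by (auto simp: powe_def)

lemma powe_eq_0_iff: "a > 0 \<Longrightarrow> x powe a = 0 \<longleftrightarrow> x = 0"
 by (auto simp: powe_def ennreal_eq_0_iff not_le enn2real_eq_0_iff)

lemma powe_eq_top_iff: "a > 0 \<Longrightarrow> x powe a = \<top> \<longleftrightarrow> x = \<top>"
 by (auto simp: powe_def)

lemma powe_less_top_iff: "a > 0 \<Longrightarrow> x powe a < \<top> \<longleftrightarrow> x < \<top>"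
 using powe_eq_top_iff[of a x] by (auto simp: less_top)

lemma powe_cases [case_names zero pos top]:
 assumes "x = 0 \<Longrightarrow> P" "\<And>c. c > 0 \<Longrightarrow> x = ennreal c \<Longrightarrow> P" "x = \<top> \<Longrightarrow> P"
 shows P
proof (cases x)
 case (real r)
 then show ?thesis using assms(1) assms(2)[of r] by (cases "r = 0") auto
qed (rule assms(3))

lemma powe_mono: "0 \<le> a \<Longrightarrow> x \<le> y \<Longrightarrow> x powe a \<le> y powe a"
 by (cases x rule: powe_cases; cases y rule: powe_cases)
   (auto simp: powe_def powr_mono2 top_unique)

lemma powe_mult: "0 < a \<Longrightarrow> (x * y) powe a = x powe a * y powe a"
 by (cases x rule: powe_cases; cases y rule: powe_cases)
   (auto simp: powe_def powr_mult ennreal_mult_top ennreal_top_mult simp flip: ennreal_mult)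

lemma powe_powe: "(x powe a) powe b = x powe (a * b)"
 by (cases x rule: powe_cases)
   (auto simp: powe_def powr_powr zero_less_mult_iff mult_less_0_iff)

lemma powe_add: "0 \<le> a \<Longrightarrow> 0 \<le> b \<Longrightarrow> x powe (a + b) = x powe a * x powe b"
 by (cases x rule: powe_cases)
   (auto simp: powe_def powr_add ennreal_mult_top ennreal_top_mult simp flip: ennreal_mult)

lemma powe_2: "x powe 2 = x * x"
 using powe_add[of 1 1 x] by simp

lemma powe_minus: "x powe (- a) = inverse (x powe a)"
 by (cases x rule: powe_cases)
   (auto simp: powe_def inverse_ennreal powr_minus)

lemma inverse_powe: "inverse x powe a = inverse (x powe a)"
 by (cases x rule: powe_cases) (auto simp: powe_def inverse_ennreal powr_def ln_inverse exp_minus)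

lemma measurable_powe [measurable (raw)]:
 assumes "f \<in> borel_measurable M" shows "(\<lambda>x. f x powe a) \<in> borel_measurable M"
proof -
 have e: "enn2real \<in> borel_measurable borel" by simp
 have "(\<lambda>x. ennreal (enn2real x powr a)) \<in> borel_measurable borel"
  by (intro measurable_compose[OF _ measurable_ennreal] powr_real_measurable e borel_measurable_const)
 then have "(\<lambda>x. x powe a) \<in> borel_measurable borel"
  unfolding powe_def by (intro measurable_If borel_measurable_const) simp_all
 from measurable_compose[OF assms this] show ?thesis .
qed

lemma powe_le_iff: "0 < a \<Longrightarrow> x powe a \<le> y \<longleftrightarrow> x \<le> y powe (1 / a)"
proof -
 assume a: "0 < a"
 have "x powe a \<le> y \<Longrightarrow> x \<le> y powe (1 / a)"
  using powe_mono[of "1/a" "x powe a" y] a by (simp add: powe_powe)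
 moreover have "x \<le> y powe (1 / a) \<Longrightarrow> x powe a \<le> y"
  using powe_mono[of "a" x "y powe (1/a)"] a by (simp add: powe_powe)
 ultimately show ?thesis by blast
qed

lemma powe_less_iff: "0 < a \<Longrightarrow> y < x powe a \<longleftrightarrow> y powe (1 / a) < x"
 using powe_le_iff[of a x y] by (metis not_le)

text \<open>\<open>powe_le_iff\<close> makes \<open>powe a\<close> and \<open>powe (1 / a)\<close>
  adjoint, and a lower adjoint preserves all suprema.\<close>

lemma powe_SUP:
 assumes a: "0 < a"
 shows "(SUP i\<in>I. f i) powe a = (SUP i\<in>I. f i powe a)"
proof (rule antisym)
 show "(SUP i\<in>I. f i) powe a \<le> (SUP i\<in>I. f i powe a)"
  unfolding powe_le_iff[OF a]
  by (rule SUP_least, subst powe_le_iff[OF a, symmetric]) (rule SUP_upper)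
 show "(SUP i\<in>I. f i powe a) \<le> (SUP i\<in>I. f i) powe a"
  by (intro SUP_least powe_mono SUP_upper) (use a in auto)
qed

lemma powe_add_le:
 assumes "0 < a" shows "(x + y) powe a \<le> ennreal (2 powr a) * (x powe a + y powe a)"
proof -
 have "x + y \<le> 2 * max x y" by (simp add: mult_2 add_mono)
 then have "(x + y) powe a \<le> (2 * max x y) powe a" using assms by (intro powe_mono) auto
 also have "\<dots> = ennreal (2 powr a) * (max x y powe a)"
  using assms ennreal_powe[of 2 a] by (simp add: powe_mult)
 also have "max x y powe a \<le> x powe a + y powe a"
  by (auto simp: max_def)
 finally show ?thesis by (simp add: mult_left_mono)
qed

lemma powe_subadd_real:
 fixes x y :: real
 assumes "0 < a" "a \<le> 1" "0 \<le> x" "0 \<le> y" shows "(x + y) powr a \<le> x powr a + y powr a"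
proof (cases "x + y = 0")
 case False
 then have s: "x + y > 0" using assms by auto
 have *: "z / (x + y) \<le> (z / (x+y)) powr a" if "0 \<le> z" "z \<le> x + y" for z
 proof (cases "z = 0")
  case False
  then show ?thesis using that s powr_mono'[of a 1 "z / (x+y)"] assms by (simp add: powr_one)
 qed (use assms in auto)
 have "1 = x / (x + y) + y / (x + y)" using s by (simp add: add_divide_distrib[symmetric])
 also have "\<dots> \<le> (x / (x+y)) powr a + (y / (x + y)) powr a"
  using *[of x] *[of y] assms by (intro add_mono) auto
 also have "\<dots> = (x powr a + y powr a) / (x + y) powr a"
  using assms s by (simp add: powr_divide add_divide_distrib)
 finally show ?thesis using s by (simp add: field_simps)
qed (use assms in auto)

lemma powe_subadd:
 assumes "0 < a" "a \<le> 1" shows "(x + y) powe a \<le> x powe a + y powe a"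
proof (cases "x = \<top> \<or> y = \<top>")
 case False
 then obtain r s where "x = ennreal r" "y = ennreal s" "0 \<le> r" "0 \<le> s"
  by (metis ennreal_cases)
 then show ?thesis using powe_subadd_real[OF assms, of r s] assms
  by (cases "r = 0"; cases "s = 0")
    (auto simp: ennreal_powe simp flip: ennreal_plus)
qed (use assms in auto)

lemma powe_superadd:
 assumes "1 \<le> a" shows "x powe a + y powe a \<le> (x + y) powe a"
proof -
 have *: "z powe a \<le> z * (x + y) powe (a - 1)" if "z \<le> x + y" for z
  using powe_add[of 1 "a - 1" z] assms that by (auto intro!: mult_left_mono powe_mono)
 have "x powe a + y powe a \<le> x * (x + y) powe (a - 1) + y * (x + y) powe (a - 1)"
  by (intro add_mono *) auto
 also have "\<dots> = (x + y) powe a"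
  using powe_add[of 1 "a - 1" "x + y"] assms by (simp add: distrib_right)
 finally show ?thesis .
qed

lemma powe_sum_superadd:
 assumes "1 \<le> a" "finite I" shows "(\<Sum>i\<in>I. f i powe a) \<le> (\<Sum>i\<in>I. f i) powe a"
 using assms(2)
proof (induction rule: finite_induct)
 case (insert i I)
 then show ?case using powe_superadd[OF assms(1), of "f i" "sum f I"]
  by (auto intro: order_trans[OF add_left_mono])
qed (use assms(1) in auto)

lemma powe_sum_subadd:
 assumes "0 < a" "a \<le> 1" "finite I" shows "(\<Sum>i\<in>I. f i) powe a \<le> (\<Sum>i\<in>I. f i powe a)"
 using assms(3)
proof (induction rule: finite_induct)
 case (insert i I)
 then show ?case using powe_subadd[OF assms(1,2), of "f i" "sum f I"]
  by (auto intro: order_trans[OF _ add_left_mono])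
qed (use assms in auto)

lemma powe_suminf_subadd:
 fixes f :: "nat \<Rightarrow> ennreal"
 assumes "0 < a" "a \<le> 1" shows "(\<Sum>i. f i) powe a \<le> (\<Sum>i. f i powe a)"
proof -
 have "(\<Sum>i. f i) powe a = (SUP n. (\<Sum>i<n. f i) powe a)"
  by (simp only: suminf_eq_SUP powe_SUP[OF assms(1)])
 also have "\<dots> \<le> (SUP n. (\<Sum>i<n. f i powe a))"
  by (intro SUP_mono') (rule powe_sum_subadd[OF assms finite_lessThan])
 finally show ?thesis by (simp only: suminf_eq_SUP)
qed

lemma powe_Young:
 assumes "0 < a" "a < 1"
 shows "x powe a * y powe (1 - a) \<le> ennreal a * x + ennreal (1 - a) * y"
 using assms
proof (cases x rule: powe_cases; cases y rule: powe_cases)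
 fix c d :: real assume cd: "c > 0" "d > 0" "x = ennreal c" "y = ennreal d"
 have "c powr a * d powr (1 - a) \<le> a * c + (1 - a) * d"
  using Youngs_inequality_0[of a "1 - a" c d] assms cd by auto
 then show ?thesis using cd assms
  by (auto simp: ennreal_powe simp flip: ennreal_mult ennreal_plus)
qed (auto simp: ennreal_mult_top ennreal_top_mult)

text \<open>Young's inequality for the functions divided by their integrals. This normalization is
  possible only if both integrals are positive and finite; a vanishing integral makes the product
  vanish almost everywhere, and otherwise an infinite one makes the right side infinite.\<close>

lemma nn_integral_Hoelder:
 assumes [measurable]: "f \<in> borel_measurable M" "g \<in> borel_measurable M"
  and a: "0 < a" "a < 1"
 shows "(\<integral>\<^sup>+x. f x powe a * g x powe (1 - a) \<partial>M) \<le>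
  (\<integral>\<^sup>+x. f x \<partial>M) powe a * (\<integral>\<^sup>+x. g x \<partial>M) powe (1 - a)"
proof -
 let ?F = "\<integral>\<^sup>+x. f x \<partial>M" and ?G = "\<integral>\<^sup>+x. g x \<partial>M"
 consider "?F = 0" | "?G = 0" | "?F \<noteq> 0" "?G \<noteq> 0" "?F = \<top> \<or> ?G = \<top>"
  | "?F \<noteq> 0" "?G \<noteq> 0" "?F \<noteq> \<top>" "?G \<noteq> \<top>" by blast
 then show ?thesis
 proof cases
  case 1
  then have "AE x in M. f x = 0" by (simp add: nn_integral_0_iff_AE)
  then have "(\<integral>\<^sup>+x. f x powe a * g x powe (1 - a) \<partial>M) = (\<integral>\<^sup>+x. 0 \<partial>M)"
   by (intro nn_integral_cong_AE) (use a in auto)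
  then show ?thesis by simp
 next
  case 2
  then have "AE x in M. g x = 0" by (simp add: nn_integral_0_iff_AE)
  then have "(\<integral>\<^sup>+x. f x powe a * g x powe (1 - a) \<partial>M) = (\<integral>\<^sup>+x. 0 \<partial>M)"
   by (intro nn_integral_cong_AE) (use a in auto)
  then show ?thesis by simp
 next
  case 3
  then have "?F powe a * ?G powe (1 - a) = \<top>"
   using a by (auto simp: ennreal_top_mult ennreal_mult_top powe_eq_0_iff)
  then show ?thesis by simp
 next
  case 4
  then obtain c d where cd: "?F = ennreal c" "?G = ennreal d" "c > 0" "d > 0"
   by (metis ennreal_cases ennreal_0 le_less)
  have *: "f x powe a * g x powe (1 - a) \<le>
    ennreal (c powr a * d powr (1-a)) * (ennreal (a / c) * f x + ennreal ((1 - a) / d) * g x)" for x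
  proof -
   have e: "z = ennreal e * (ennreal (1/e) * z)" if "e > 0" for e z
    using that by (simp add: mult.assoc[symmetric] flip: ennreal_mult)
   have "f x powe a * g x powe (1 - a) =
    (ennreal c powe a * (ennreal (1/c) * f x) powe a) * (ennreal d powe (1-a) * (ennreal (1/d) * g x) powe (1-a))"
    using a by (subst e[OF cd(3), of "f x"], subst e[OF cd(4), of "g x"]) (simp add: powe_mult)
   also have "\<dots> = ennreal (c powr a * d powr (1-a)) * ((ennreal (1/c) * f x) powe a * (ennreal (1/d) * g x) powe (1-a))"
    using cd by (simp add: ennreal_powe ennreal_mult algebra_simps)
   also have "\<dots> \<le> ennreal (c powr a * d powr (1-a)) * (ennreal a * (ennreal (1/c) * f x) + ennreal (1-a) * (ennreal (1/d) * g x))"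
    by (intro mult_left_mono powe_Young a) auto
   finally show ?thesis using a cd by (simp add: mult.assoc[symmetric] flip: ennreal_mult)
  qed
  have "(\<integral>\<^sup>+x. f x powe a * g x powe (1 - a) \<partial>M) \<le>
   (\<integral>\<^sup>+x. ennreal (c powr a * d powr (1-a)) * (ennreal (a / c) * f x + ennreal ((1 - a) / d) * g x) \<partial>M)"
   by (intro nn_integral_mono *)
  also have "\<dots> = ennreal (c powr a * d powr (1-a)) * (ennreal (a / c) * ennreal c + ennreal ((1 - a) / d) * ennreal d)"
   by (simp add: nn_integral_cmult nn_integral_add cd)
  also have "\<dots> = ennreal (c powr a * d powr (1-a))"
   using cd a by (simp flip: ennreal_mult ennreal_plus)
  also have "\<dots> = ?F powe a * ?G powe (1 - a)"
   using cd by (simp add: ennreal_powe ennreal_mult)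
  finally show ?thesis .
 qed
qed

lemma suminf_Hoelder:
 fixes f g :: "nat \<Rightarrow> ennreal"
 assumes "0 < a" "a < 1"
 shows "(\<Sum>i. f i powe a * g i powe (1 - a)) \<le> (\<Sum>i. f i) powe a * (\<Sum>i. g i) powe (1 - a)"
proof -
 have "f \<in> borel_measurable (count_space UNIV)" "g \<in> borel_measurable (count_space UNIV)"
  by auto
 from nn_integral_Hoelder[OF this assms] show ?thesis
  unfolding nn_integral_count_space_nat .
qed

section \<open>Rearrangements and majorization\<close>

lemma antimono_borel_measurable [measurable (raw)]:
 fixes f :: "real \<Rightarrow> ennreal"
 assumes "antimono f" shows "f \<in> borel_measurable borel"
proof (rule borel_measurableI_greater)
 fix y
 have "is_interval {x. y < f x}"
  unfolding is_interval_1 using assms by (auto simp: antimono_def intro: less_le_trans)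
 then show "{x \<in> space borel. y < f x} \<in> sets borel"
  using real_interval_borel_measurable by simp
qed

text \<open>Superlevel sets of non-increasing functions on the half-line have this form. Whether the
  endpoint belongs to the set is left undecided, which is harmless for Lebesgue measure;
  \<open>m = 0\<close> covers the empty set.\<close>

lemma downward_closed_cases:
 fixes S :: "real set"
 assumes "S \<subseteq> {0<..}" "\<And>x y. x \<in> S \<Longrightarrow> 0 < y \<Longrightarrow> y \<le> x \<Longrightarrow> y \<in> S"
 obtains "S = {0<..}" | m where "0 \<le> m" "{0<..<m} \<subseteq> S" "S \<subseteq> {0<..m}"
proof (cases "S = {} \<or> bdd_above S")
 case True
 show thesis
 proof (cases "S = {}")
  case True then show ?thesis using that(2)[of 0] by auto
 next
  case False
  with True have b: "bdd_above S" by auto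
  have "S \<subseteq> {0<..Sup S}" using assms(1) cSup_upper[OF _ b] by auto
  moreover have "{0<..<Sup S} \<subseteq> S"
  proof
   fix x assume x: "x \<in> {0<..<Sup S}"
   then obtain y where "y \<in> S" "x < y" using less_cSup_iff[OF False b] by auto
   then show "x \<in> S" using assms(2)[of y x] x by auto
  qed
  moreover have "0 \<le> Sup S" using False cSup_upper[OF _ b] assms(1) by fastforce
  ultimately show ?thesis using that(2) by blast
 qed
next
 case False
 have "S = {0<..}"
 proof (rule antisym[OF assms(1)], rule subsetI)
  fix x :: real assume x: "x \<in> {0<..}"
  have "\<exists>y\<in>S. x < y" using False by (auto simp: bdd_above_def not_le)
  then show "x \<in> S" using assms(2) x by (metis greaterThan_iff less_imp_le)
 qed
 then show thesis using that(1) by blast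
qed

lemma nn_integral_Ioi_SUP:
 fixes f :: "real \<Rightarrow> ennreal"
 assumes [measurable]: "f \<in> borel_measurable borel"
 shows "nnl {0<..} f = (SUP n::nat. \<integral>\<^sup>+t\<in>{0<..<real n}. f t \<partial>lborel)"
proof -
 have "(SUP n::nat. f t * indicator {0<..<real n} t) = f t * indicator {0<..} t" for t
 proof (rule antisym)
  show "(SUP n::nat. f t * indicator {0<..<real n} t) \<le> f t * indicator {0<..} t"
   by (intro SUP_least) (auto simp: indicator_def)
  obtain n :: nat where "t < real n" using reals_Archimedean2 by blast
  then have "f t * indicator {0<..} t \<le> f t * indicator {0<..<real n} t"
   by (auto simp: indicator_def)
  then show "f t * indicator {0<..} t \<le> (SUP n::nat. f t * indicator {0<..<real n} t)"
   by (rule SUP_upper2[OF UNIV_I])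
 qed
 then have "nnl {0<..} f = (\<integral>\<^sup>+t. (SUP n::nat. f t * indicator {0<..<real n} t) \<partial>lborel)"
  by simp
 also have "\<dots> = (SUP n::nat. \<integral>\<^sup>+t\<in>{0<..<real n}. f t \<partial>lborel)"
  by (intro nn_integral_monotone_convergence_SUP)
    (auto simp: incseq_def le_fun_def indicator_def)
 finally show ?thesis .
qed

text \<open>An initial segment is an interval up to its endpoint, or the whole half-line, which is
  reached by monotone convergence.\<close>

lemma nn_integral_downward_closed_mono:
 fixes a b :: "real \<Rightarrow> ennreal"
 assumes [measurable]: "a \<in> borel_measurable borel" "b \<in> borel_measurable borel"
  and ab: "\<And>z. 0 < z \<Longrightarrow> nnl {0<..<z} a \<le> nnl {0<..<z} b"
  and S: "S \<subseteq> {0<..}" "\<And>x y. x \<in> S \<Longrightarrow> 0 < y \<Longrightarrow> y \<le> x \<Longrightarrow> y \<in> S"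
 shows "(\<integral>\<^sup>+t\<in>S. a t \<partial>lborel) \<le> (\<integral>\<^sup>+t\<in>S. b t \<partial>lborel)"
proof -
 have ab0: "nnl {0<..<z} a \<le> nnl {0<..<z} b" for z
  using ab[of z] by (cases "0 < z") auto
 show ?thesis
 proof (rule downward_closed_cases[OF S])
  assume 1: "S = {0<..}"
  show ?thesis unfolding 1 nn_integral_Ioi_SUP[OF assms(1)] nn_integral_Ioi_SUP[OF assms(2)]
   by (intro SUP_mono' ab0)
 next
  fix m assume 2: "0 \<le> m" "{0<..<m} \<subseteq> S" "S \<subseteq> {0<..m}"
  have *: "(\<integral>\<^sup>+t\<in>S. c t \<partial>lborel) = nnl {0<..<m} c" for c :: "real \<Rightarrow> ennreal"
  proof (rule nn_integral_cong_AE)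
   have "AE t in lborel. t \<noteq> m" by (rule AE_lborel_singleton)
   then show "AE t in lborel. c t * indicator S t = c t * indicator {0<..<m} t"
    by eventually_elim (use 2 in \<open>auto simp: indicator_def\<close>)
  qed
  show ?thesis unfolding * by (rule ab0)
 qed
qed

section \<open>Layer-cake formulas\<close>

lemma emeasure_lborel_Ici: "emeasure lborel {a::real..} = \<top>"
proof (rule ccontr)
 assume "emeasure lborel {a..} \<noteq> \<top>"
 then obtain r where r: "emeasure lborel {a..} = ennreal r" "0 \<le> r" by (cases "emeasure lborel {a..}") auto
 have "ennreal (r + 1) = emeasure lborel {a..a + r + 1}" using r by simp
 also have "\<dots> \<le> emeasure lborel {a..}" by (intro emeasure_mono) auto
 finally show False using r by (simp add: ennreal_le_iff)
qed

lemma emeasure_lborel_Ioi: "emeasure lborel {a::real<..} = \<top>"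
proof -
 have "emeasure lborel {a + 1..} \<le> emeasure lborel {a<..}" by (intro emeasure_mono) auto
 then show ?thesis by (simp add: emeasure_lborel_Ici top_unique)
qed

lemma ennreal_layer_less:
 fixes x :: ennreal
 shows "(\<integral>\<^sup>+l. indicator {l. 0 \<le> l \<and> ennreal l < x} l \<partial>lborel) = x"
proof (cases x)
 case (real r)
 then have "{l. 0 \<le> l \<and> ennreal l < x} = {0..<r}" by (auto simp: ennreal_less_iff)
 then show ?thesis using real by simp
next
 case top
 then have "{l. 0 \<le> l \<and> ennreal l < x} = {0..}" by auto
 then show ?thesis using top emeasure_lborel_Ici[of 0] by (simp add: atLeast_def)
qed

lemma ennreal_layer_le:
 fixes x :: ennreal
 shows "(\<integral>\<^sup>+l. indicator {l. 0 \<le> l \<and> ennreal l \<le> x} l \<partial>lborel) = x"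
proof (cases x)
 case (real r)
 then have "{l. 0 \<le> l \<and> ennreal l \<le> x} = {0..r}" by auto
 then show ?thesis using real by simp
next
 case top
 then have "{l. 0 \<le> l \<and> ennreal l \<le> x} = {0..}" by auto
 then show ?thesis using top emeasure_lborel_Ici[of 0] by (simp add: atLeast_def)
qed

text \<open>Tonelli on the region under the graph. The level sets are described by an abstract
  predicate so that strict levels (\<open>ennreal_layer_less\<close>) and weak levels
  (\<open>ennreal_layer_le\<close>) are both covered; the weak ones occur for reciprocals.\<close>

lemma nn_integral_layers:
 assumes "sigma_finite_measure M"
  and [measurable]: "Measurable.pred (M \<Otimes>\<^sub>M lborel) (\<lambda>z. P (fst z) (snd z))"
  and f: "\<And>x. (\<integral>\<^sup>+l. indicator {l. P x l} l \<partial>(lborel :: real measure)) = f x"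
 shows "(\<integral>\<^sup>+x. f x \<partial>M) = (\<integral>\<^sup>+l. emeasure M {x \<in> space M. P x l} \<partial>lborel)"
proof -
 interpret M: sigma_finite_measure M by fact
 interpret P: pair_sigma_finite M "lborel :: real measure" ..
 have pm [measurable]: "Measurable.pred M (\<lambda>x. P x l)" for l
  using measurable_compose[OF measurable_Pair2'[of l lborel M] assms(2)] by simp
 have "(\<integral>\<^sup>+x. f x \<partial>M) = (\<integral>\<^sup>+x. \<integral>\<^sup>+l. indicator {l. P x l} l \<partial>lborel \<partial>M)"
  by (simp add: f)
 also have "\<dots> = (\<integral>\<^sup>+l. \<integral>\<^sup>+x. indicator {l. P x l} l \<partial>M \<partial>lborel)"
  by (intro P.Fubini'[symmetric]) simp
 also have "\<dots> = (\<integral>\<^sup>+l. emeasure M {x \<in> space M. P x l} \<partial>lborel)"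
 proof (rule nn_integral_cong)
  fix l :: real
  have "(\<integral>\<^sup>+x. indicator {l. P x l} l \<partial>M) = (\<integral>\<^sup>+x. indicator {x \<in> space M. P x l} x \<partial>M)"
   by (intro nn_integral_cong) (auto simp: indicator_def)
  also have "\<dots> = emeasure M {x \<in> space M. P x l}"
   by (intro nn_integral_indicator) simp
  finally show "(\<integral>\<^sup>+x. indicator {l. P x l} l \<partial>M) = emeasure M {x \<in> space M. P x l}" .
 qed
 finally show ?thesis .
qed

lemma nn_integral_mult_layers:
 assumes "sigma_finite_measure M"
  and [measurable]: "Measurable.pred (M \<Otimes>\<^sub>M lborel) (\<lambda>z. P (fst z) (snd z))"
   "Measurable.pred (M \<Otimes>\<^sub>M lborel) (\<lambda>z. Q (fst z) (snd z))"
  and f: "\<And>x. (\<integral>\<^sup>+l. indicator {l. P x l} l \<partial>(lborel :: real measure)) = f x"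
  and g: "\<And>x. (\<integral>\<^sup>+l. indicator {l. Q x l} l \<partial>(lborel :: real measure)) = g x"
  and [measurable]: "f \<in> borel_measurable M"
 shows "(\<integral>\<^sup>+x. f x * g x \<partial>M) =
  (\<integral>\<^sup>+l. \<integral>\<^sup>+k. emeasure M {x \<in> space M. P x l \<and> Q x k} \<partial>lborel \<partial>lborel)"
proof -
 interpret M: sigma_finite_measure M by fact
 interpret P: pair_sigma_finite M "lborel :: real measure" ..
 have pm [measurable]: "Measurable.pred M (\<lambda>x. P x l)" for l
  using measurable_compose[OF measurable_Pair2'[of l lborel M] assms(2)] by simp
 have qm2: "(\<lambda>k. indicator {k. Q x k} k :: ennreal) \<in> borel_measurable lborel" if "x \<in> space M" for x
  using measurable_compose[OF measurable_Pair1'[OF that, of lborel] assms(3)] by simp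
 have qm [measurable]: "Measurable.pred M (\<lambda>x. Q x l)" for l
  using measurable_compose[OF measurable_Pair2'[of l lborel M] assms(3)] by simp
 have "(\<integral>\<^sup>+x. f x * g x \<partial>M) = (\<integral>\<^sup>+x. \<integral>\<^sup>+k. f x * indicator {k. Q x k} k \<partial>lborel \<partial>M)"
  by (intro nn_integral_cong) (simp only: nn_integral_cmult[OF qm2] g)
 also have "\<dots> = (\<integral>\<^sup>+k. \<integral>\<^sup>+x. f x * indicator {k. Q x k} k \<partial>M \<partial>lborel)"
  by (intro P.Fubini'[symmetric]) simp
 also have "\<dots> = (\<integral>\<^sup>+k. \<integral>\<^sup>+l. emeasure M {x \<in> space M. P x l \<and> Q x k} \<partial>lborel \<partial>lborel)"
 proof (rule nn_integral_cong)
  fix k :: real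
  show "(\<integral>\<^sup>+x. f x * indicator {k. Q x k} k \<partial>M) = (\<integral>\<^sup>+l. emeasure M {x \<in> space M. P x l \<and> Q x k} \<partial>lborel)"
  proof (rule nn_integral_layers[OF assms(1)])
   fix x
   have "(\<integral>\<^sup>+ l. indicator {l. P x l \<and> Q x k} l \<partial>lborel) =
     (\<integral>\<^sup>+ l. indicator {l. P x l} l * indicator {k. Q x k} k \<partial>(lborel :: real measure))"
    by (intro nn_integral_cong) (auto simp: indicator_def)
   also have "\<dots> = f x * indicator {k. Q x k} k"
    by (cases "Q x k") (auto simp: f)
   finally show "(\<integral>\<^sup>+ l. indicator {l. P x l \<and> Q x k} l \<partial>lborel) = f x * indicator {k. Q x k} k" .
  qed simp
 qed
 also have "\<dots> = (\<integral>\<^sup>+l. \<integral>\<^sup>+k. emeasure M {x \<in> space M. P x l \<and> Q x k} \<partial>lborel \<partial>lborel)"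
 proof (rule lborel_pair.Fubini')
  have PP: "Measurable.pred ((lborel \<Otimes>\<^sub>M lborel) \<Otimes>\<^sub>M M) (\<lambda>z. P (snd z) (fst (fst z)))"
   using measurable_compose[of "\<lambda>z. (snd z, fst (fst z))" "(lborel \<Otimes>\<^sub>M lborel) \<Otimes>\<^sub>M M" "M \<Otimes>\<^sub>M lborel", OF _ assms(2)]
   by simp
  have QQ: "Measurable.pred ((lborel \<Otimes>\<^sub>M lborel) \<Otimes>\<^sub>M M) (\<lambda>z. Q (snd z) (snd (fst z)))"
   using measurable_compose[of "\<lambda>z. (snd z, snd (fst z))" "(lborel \<Otimes>\<^sub>M lborel) \<Otimes>\<^sub>M M" "M \<Otimes>\<^sub>M lborel", OF _ assms(3)]
   by simp
  have "(\<lambda>y. emeasure M (Pair y -` {z \<in> space ((lborel \<Otimes>\<^sub>M lborel) \<Otimes>\<^sub>M M). P (snd z) (fst (fst z)) \<and> Q (snd z) (snd (fst z))}))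
    \<in> borel_measurable (lborel \<Otimes>\<^sub>M (lborel :: real measure))"
   using PP QQ by (intro M.measurable_emeasure_Pair sets.sets_Collect_conj) (simp_all only: pred_def)
  also have "(\<lambda>y. emeasure M (Pair y -` {z \<in> space ((lborel \<Otimes>\<^sub>M lborel) \<Otimes>\<^sub>M M). P (snd z) (fst (fst z)) \<and> Q (snd z) (snd (fst z))}))
    = (\<lambda>(l, k). emeasure M {x \<in> space M. P x l \<and> Q x k})"
   by (auto simp: fun_eq_iff space_pair_measure intro!: arg_cong[where f="emeasure M"])
  finally show "(\<lambda>(l, k). emeasure M {x \<in> space M. P x l \<and> Q x k}) \<in> borel_measurable (lborel \<Otimes>\<^sub>M lborel)" .
 qed
 finally show ?thesis .
qed

text \<open>The weight is the integral of the indicators of its superlevel sets; these are initial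
  segments of the half-line, on each of which the hypothesis compares \<open>a\<close> and
  \<open>b\<close>.\<close>

lemma Hardy_majorization:
 fixes a b \<rho> :: "real \<Rightarrow> ennreal"
 assumes [measurable]: "a \<in> borel_measurable borel" "b \<in> borel_measurable borel"
  and ab: "\<And>z. 0 < z \<Longrightarrow> nnl {0<..<z} a \<le> nnl {0<..<z} b"
  and \<rho>: "antimono \<rho>"
 shows "nnl {0<..} (\<lambda>t. a t * \<rho> t) \<le> nnl {0<..} (\<lambda>t. b t * \<rho> t)"
proof -
 note [measurable] = antimono_borel_measurable[OF \<rho>]
 have *: "nnl {0<..} (\<lambda>t. c t * \<rho> t) =
  (\<integral>\<^sup>+l. (\<integral>\<^sup>+t\<in>{t. 0 < t \<and> 0 \<le> l \<and> ennreal l < \<rho> t}. c t \<partial>lborel) \<partial>lborel)"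
  if [measurable]: "c \<in> borel_measurable borel" for c :: "real \<Rightarrow> ennreal"
 proof -
  have "nnl {0<..} (\<lambda>t. c t * \<rho> t) =
   (\<integral>\<^sup>+t. \<integral>\<^sup>+l. c t * indicator {0<..} t * indicator {l. 0 \<le> l \<and> ennreal l < \<rho> t} l \<partial>lborel \<partial>lborel)"
   by (intro nn_integral_cong) (simp add: nn_integral_cmult ennreal_layer_less mult_ac)
  also have "\<dots> = (\<integral>\<^sup>+l. \<integral>\<^sup>+t. c t * indicator {0<..} t * indicator {l. 0 \<le> l \<and> ennreal l < \<rho> t} l \<partial>lborel \<partial>lborel)"
   by (intro lborel_pair.Fubini') simp
  also have "\<dots> = (\<integral>\<^sup>+l. (\<integral>\<^sup>+t\<in>{t. 0 < t \<and> 0 \<le> l \<and> ennreal l < \<rho> t}. c t \<partial>lborel) \<partial>lborel)"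
   by (intro nn_integral_cong) (auto simp: indicator_def)
  finally show ?thesis .
 qed
 show ?thesis unfolding *[OF assms(1)] *[OF assms(2)]
  by (intro nn_integral_mono nn_integral_downward_closed_mono[OF assms(1,2) ab])
    (auto intro: less_le_trans antimonoD[OF \<rho>])
qed

text \<open>Equimeasurability as a relation passes to powers, truncations and differences without
  evaluating the infimum in \<open>rearrangement\<close> again. Monotonicity can be asked on the
  whole line because \<open>rearrangement\<close> is constant on t \<le> 0.\<close>

definition is_rearrangement :: "'a measure \<Rightarrow> ('a \<Rightarrow> ennreal) \<Rightarrow> (real \<Rightarrow> ennreal) \<Rightarrow> bool" where
 "is_rearrangement M g \<gamma> \<longleftrightarrow> antimono \<gamma> \<and>
   (\<forall>c. emeasure lborel {t. 0 < t \<and> c < \<gamma> t} = emeasure M {x \<in> space M. c < g x})"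

lemma is_rearrangementD:
 assumes "is_rearrangement M g \<gamma>"
 shows "antimono \<gamma>" "\<gamma> \<in> borel_measurable borel"
  "emeasure lborel {t. 0 < t \<and> c < \<gamma> t} = emeasure M {x \<in> space M. c < g x}"
 using assms antimono_borel_measurable by (auto simp: is_rearrangement_def)

text \<open>The last assumption turns each strict superlevel set of \<Psi> o g into one of g, or
  into the empty set. For monotone \<Psi> it amounts to lower semicontinuity and
  \<open>\<Psi> 0 = 0\<close>.\<close>

lemma is_rearrangement_comp:
 assumes "is_rearrangement M g \<gamma>" "mono \<Psi>"
  and "\<And>c. (\<exists>d. \<forall>y. c < \<Psi> y \<longleftrightarrow> d < y) \<or> (\<forall>y. \<not> c < \<Psi> y)"
 shows "is_rearrangement M (\<lambda>x. \<Psi> (g x)) (\<lambda>t. \<Psi> (\<gamma> t))"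
 unfolding is_rearrangement_def
proof (intro conjI allI)
 show "antimono (\<lambda>t. \<Psi> (\<gamma> t))"
  using assms(1,2) by (auto simp: antimono_def mono_def is_rearrangement_def)
 fix c
 show "emeasure lborel {t. 0 < t \<and> c < \<Psi> (\<gamma> t)} = emeasure M {x \<in> space M. c < \<Psi> (g x)}"
  using assms(3)[of c] is_rearrangementD(3)[OF assms(1)] by auto
qed

lemma is_rearrangement_powe:
 assumes "is_rearrangement M g \<gamma>" "0 < a"
 shows "is_rearrangement M (\<lambda>x. g x powe a) (\<lambda>t. \<gamma> t powe a)"
 using assms(2)
 by (intro is_rearrangement_comp[OF assms(1)])
   (auto intro!: monoI powe_mono simp: powe_less_iff)

lemma is_rearrangement_diff:
 assumes "is_rearrangement M g \<gamma>" "d \<noteq> \<top>"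
 shows "is_rearrangement M (\<lambda>x. g x - d) (\<lambda>t. \<gamma> t - d)"
proof (intro is_rearrangement_comp[OF assms(1)] disjI1 exI allI)
 show "mono (\<lambda>x. x - d)" by (auto intro: monoI ennreal_minus_mono)
 fix c y
 show "(c < y - d) = (d + c < y)"
  using ennreal_minus_le_iff[of y d c] assms(2) by (auto simp: not_le[symmetric])
qed

lemma is_rearrangement_min:
 assumes "is_rearrangement M g \<gamma>"
 shows "is_rearrangement M (\<lambda>x. min (g x) d) (\<lambda>t. min (\<gamma> t) d)"
proof (intro is_rearrangement_comp[OF assms(1)])
 show "mono (\<lambda>x. min x d)" by (auto intro!: monoI min.mono)
 fix c show "(\<exists>e. \<forall>y. (c < min y d) = (e < y)) \<or> (\<forall>y. \<not> c < min y d)"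
  by (cases "c < d") auto
qed

lemma is_rearrangement_rearrangement:
 assumes [measurable]: "g \<in> borel_measurable M"
 shows "is_rearrangement M g (rearrangement M g)"
 unfolding is_rearrangement_def
proof (intro conjI allI)
 show "antimono (rearrangement M g)"
  unfolding antimono_def rearrangement_def
  by (auto intro!: Inf_superset_mono elim: order_trans[OF _ ennreal_leI])
 have anti: "distr_fun M g \<beta> \<le> distr_fun M g \<alpha>" if "\<alpha> \<le> \<beta>" for \<alpha> \<beta>
  unfolding distr_fun_def using that
  by (intro emeasure_mono) (auto intro: le_less_trans[OF ennreal_leI])
 \<comment> \<open>The relation behind equimeasurability: the set where the rearrangement exceeds c
   is the initial segment of length \<open>distr_fun M g c\<close>. The direction from right to left
   rests on the right continuity of the distribution function.\<close>
 have key: "ennreal c < rearrangement M g t \<longleftrightarrow> ennreal t < distr_fun M g c" if c: "0 \<le> c" for c t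
 proof
  assume *: "ennreal c < rearrangement M g t"
  show "ennreal t < distr_fun M g c"
  proof (rule ccontr)
   assume "\<not> ennreal t < distr_fun M g c"
   then have "distr_fun M g \<alpha> \<le> ennreal t" if "\<alpha> > c" for \<alpha>
    using anti[of c \<alpha>] that by auto
   then have "rearrangement M g t \<le> ennreal \<alpha>" if "\<alpha> > c" for \<alpha>
    unfolding rearrangement_def using that c by (intro Inf_lower) auto
   moreover obtain d where d: "ennreal c < d" "d < rearrangement M g t" using dense[OF *] by auto
   moreover obtain \<alpha> where "d = ennreal \<alpha>" "0 \<le> \<alpha>" using d by (cases d) auto
   ultimately show False using c by (auto simp: ennreal_less_iff not_le[symmetric])
  qed
 next
  assume *: "ennreal t < distr_fun M g c"
  have "(\<Union>n. {x \<in> space M. ennreal (c + 1 / Suc n) < g x}) = {x \<in> space M. ennreal c < g x}" (is "?L = ?R")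
  proof
   show "?L \<subseteq> ?R"
   proof
    fix x assume "x \<in> ?L"
    then obtain n where n: "x \<in> space M" "ennreal (c + 1 / Suc n) < g x" by auto
    have "ennreal c \<le> ennreal (c + 1 / Suc n)" by (intro ennreal_leI) auto
    then show "x \<in> ?R" using n by (auto intro: le_less_trans)
   qed
   show "?R \<subseteq> ?L"
   proof
    fix x assume x: "x \<in> ?R"
    then obtain d where d: "ennreal c < d" "d < g x" using dense by auto
    then obtain e where e: "d = ennreal e" "0 \<le> e" by (cases d) auto
    then have "c < e" using d c by (simp add: ennreal_less_iff)
    then obtain n where "1 / Suc n < e - c" using nat_approx_posE[of "e - c"] by auto
    then have "ennreal (c + 1 / Suc n) \<le> d" unfolding e by (intro ennreal_leI) auto
    then show "x \<in> ?L" using d x by (auto intro!: exI[of _ n] intro: le_less_trans)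
   qed
  qed
  then have "distr_fun M g c = emeasure M (\<Union>n. {x \<in> space M. ennreal (c + 1 / Suc n) < g x})"
   by (simp add: distr_fun_def)
  also have "\<dots> = (SUP n. emeasure M {x \<in> space M. ennreal (c + 1 / Suc n) < g x})"
  proof (rule SUP_emeasure_incseq[symmetric])
   show "incseq (\<lambda>n. {x \<in> space M. ennreal (c + 1 / real (Suc n)) < g x})"
    unfolding incseq_Suc_iff
   proof (intro allI subsetI)
    fix n x assume x: "x \<in> {x \<in> space M. ennreal (c + 1 / real (Suc n)) < g x}"
    have "ennreal (c + 1 / real (Suc (Suc n))) \<le> ennreal (c + 1 / real (Suc n))"
     by (intro ennreal_leI add_left_mono divide_left_mono) auto
    then show "x \<in> {x \<in> space M. ennreal (c + 1 / real (Suc (Suc n))) < g x}"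
     using x by (auto intro: le_less_trans)
   qed
  qed auto
  also have "\<dots> = (SUP n. distr_fun M g (c + 1 / Suc n))" by (simp add: distr_fun_def)
  finally obtain n where n: "ennreal t < distr_fun M g (c + 1 / Suc n)"
   using * by (auto simp: less_SUP_iff)
  have "ennreal (c + 1 / Suc n) \<le> rearrangement M g t"
   unfolding rearrangement_def
  proof (rule Inf_greatest, safe)
   fix \<alpha> :: real assume a: "0 < \<alpha>" "distr_fun M g \<alpha> \<le> ennreal t"
   then have "\<not> \<alpha> \<le> c + 1 / Suc n" using anti[of \<alpha> "c + 1 / Suc n"] n
    by (meson leD order.trans)
   then show "ennreal (c + 1 / real (Suc n)) \<le> ennreal \<alpha>" by (intro ennreal_leI) auto
  qed
  moreover have "ennreal c < ennreal (c + 1 / Suc n)" using c by (simp add: ennreal_less_iff)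
  ultimately show "ennreal c < rearrangement M g t" by (rule less_le_trans[rotated])
 qed
 fix c :: ennreal
 show "emeasure lborel {t. 0 < t \<and> c < rearrangement M g t} = emeasure M {x \<in> space M. c < g x}"
 proof (cases c)
  case (real d)
  let ?m = "distr_fun M g d"
  have "{t. 0 < t \<and> c < rearrangement M g t} = {t. 0 < t \<and> ennreal t < ?m}"
   using key[OF real(1)] real by auto
  also have "emeasure lborel \<dots> = ?m"
  proof (cases ?m)
   case (real r)
   then have "{t. 0 < t \<and> ennreal t < ?m} = {0<..<r}" by (auto simp: ennreal_less_iff)
   then show ?thesis using real by simp
  next
   case top
   then have "{t. 0 < t \<and> ennreal t < ?m} = {0<..}" by auto
   then show ?thesis using top by (simp add: emeasure_lborel_Ioi)
  qed
  finally show ?thesis using real by (simp add: distr_fun_def)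
 qed simp
qed

lemma is_rearrangement_integral:
 assumes "sigma_finite_measure M" and [measurable]: "g \<in> borel_measurable M"
  and r: "is_rearrangement M g \<gamma>"
 shows "(\<integral>\<^sup>+x. g x \<partial>M) = nnl {0<..} \<gamma>"
proof -
 note [measurable] = is_rearrangementD(2)[OF r]
 have "(\<integral>\<^sup>+x. g x \<partial>M) = (\<integral>\<^sup>+l. emeasure M {x \<in> space M. 0 \<le> l \<and> ennreal l < g x} \<partial>lborel)"
  by (rule nn_integral_layers[OF assms(1)]) (simp, rule ennreal_layer_less)
 also have "\<dots> = (\<integral>\<^sup>+l. emeasure lborel {t \<in> space lborel. 0 < t \<and> 0 \<le> l \<and> ennreal l < \<gamma> t} \<partial>lborel)"
 proof (rule nn_integral_cong)
  fix l :: real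
  show "emeasure M {x \<in> space M. 0 \<le> l \<and> ennreal l < g x} =
   emeasure lborel {t \<in> space lborel. 0 < t \<and> 0 \<le> l \<and> ennreal l < \<gamma> t}"
   using is_rearrangementD(3)[OF r, of "ennreal l"] by (cases "0 \<le> l") auto
 qed
 also have "\<dots> = nnl {0<..} \<gamma>"
 proof (rule nn_integral_layers[OF lborel.sigma_finite_measure_axioms, symmetric])
  fix t :: real
  show "(\<integral>\<^sup>+ l. indicator {l. 0 < t \<and> 0 \<le> l \<and> ennreal l < \<gamma> t} l \<partial>lborel) = \<gamma> t * indicator {0<..} t"
   using ennreal_layer_less[of "\<gamma> t"] by (cases "0 < t") auto
 qed simp
 finally show ?thesis .
qed

text \<open>By layers it suffices to compare the measures of intersections of superlevel sets. On
  the half-line these sets are nested, so the intersection has the smaller of the two measures,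
  which is an upper bound for the intersection in \<open>M\<close>.\<close>

lemma Hardy_Littlewood:
 assumes "sigma_finite_measure M"
  and [measurable]: "f \<in> borel_measurable M" "g \<in> borel_measurable M"
  and r: "is_rearrangement M f \<phi>" "is_rearrangement M g \<gamma>"
 shows "(\<integral>\<^sup>+x. f x * g x \<partial>M) \<le> nnl {0<..} (\<lambda>t. \<phi> t * \<gamma> t)"
proof -
 note [measurable] = is_rearrangementD(2)[OF r(1)] is_rearrangementD(2)[OF r(2)]
 have "(\<integral>\<^sup>+x. f x * g x \<partial>M) =
  (\<integral>\<^sup>+l. \<integral>\<^sup>+k. emeasure M {x \<in> space M. (0 \<le> l \<and> ennreal l < f x) \<and> (0 \<le> k \<and> ennreal k < g x)} \<partial>lborel \<partial>lborel)"
  by (rule nn_integral_mult_layers[OF assms(1)]) (simp_all add: ennreal_layer_less)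
 also have "\<dots> \<le> (\<integral>\<^sup>+l. \<integral>\<^sup>+k. emeasure lborel {t \<in> space lborel. (0 < t \<and> 0 \<le> l \<and> ennreal l < \<phi> t) \<and> (0 \<le> k \<and> ennreal k < \<gamma> t)} \<partial>lborel \<partial>lborel)"
 proof (intro nn_integral_mono)
  fix l k :: real
  let ?A = "{t. 0 < t \<and> ennreal l < \<phi> t}" and ?B = "{t. 0 < t \<and> ennreal k < \<gamma> t}"
  show "emeasure M {x \<in> space M. (0 \<le> l \<and> ennreal l < f x) \<and> (0 \<le> k \<and> ennreal k < g x)} \<le>
   emeasure lborel {t \<in> space lborel. (0 < t \<and> 0 \<le> l \<and> ennreal l < \<phi> t) \<and> (0 \<le> k \<and> ennreal k < \<gamma> t)}"
  proof (cases "0 \<le> l \<and> 0 \<le> k")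
   case True
   have "?A \<subseteq> ?B \<or> ?B \<subseteq> ?A"
   proof (rule disjCI, rule subsetI)
    fix t assume "\<not> ?B \<subseteq> ?A" "t \<in> ?A"
    then obtain s where s: "0 < s" "ennreal k < \<gamma> s" "\<not> ennreal l < \<phi> s" by auto
    then have "t \<le> s" using \<open>t \<in> ?A\<close> antimonoD[OF is_rearrangementD(1)[OF r(1)], of s t]
     by (cases "s \<le> t") (auto intro: less_le_trans)
    then show "t \<in> ?B" using \<open>t \<in> ?A\<close> s antimonoD[OF is_rearrangementD(1)[OF r(2)], of t s]
     by (auto intro: less_le_trans)
   qed
   then have c: "?A \<inter> ?B = ?A \<or> ?A \<inter> ?B = ?B" by blast
   have m: "emeasure M {x \<in> space M. ennreal l < f x \<and> ennreal k < g x} \<le> emeasure lborel ?A"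
    "emeasure M {x \<in> space M. ennreal l < f x \<and> ennreal k < g x} \<le> emeasure lborel ?B"
    unfolding is_rearrangementD(3)[OF r(1)] is_rearrangementD(3)[OF r(2)]
    by (auto intro!: emeasure_mono)
   have e1: "{t \<in> space lborel. (0 < t \<and> 0 \<le> l \<and> ennreal l < \<phi> t) \<and> (0 \<le> k \<and> ennreal k < \<gamma> t)} = ?A \<inter> ?B"
    using True by auto
   have e2: "{x \<in> space M. (0 \<le> l \<and> ennreal l < f x) \<and> (0 \<le> k \<and> ennreal k < g x)} = {x \<in> space M. ennreal l < f x \<and> ennreal k < g x}"
    using True by auto
   show ?thesis unfolding e1 e2 using c
   proof
    assume "?A \<inter> ?B = ?A" then show "emeasure M {x \<in> space M. ennreal l < f x \<and> ennreal k < g x} \<le> emeasure lborel (?A \<inter> ?B)"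
     using m(1) by (simp only:)
   next
    assume "?A \<inter> ?B = ?B" then show "emeasure M {x \<in> space M. ennreal l < f x \<and> ennreal k < g x} \<le> emeasure lborel (?A \<inter> ?B)"
     using m(2) by (simp only:)
   qed
  qed auto
 qed
 also have "\<dots> = (\<integral>\<^sup>+t. (\<phi> t * indicator {0<..} t) * \<gamma> t \<partial>lborel)"
 proof (rule nn_integral_mult_layers[OF lborel.sigma_finite_measure_axioms, symmetric])
  fix t :: real
  show "(\<integral>\<^sup>+ l. indicator {l. 0 < t \<and> 0 \<le> l \<and> ennreal l < \<phi> t} l \<partial>lborel) = \<phi> t * indicator {0<..} t"
   using ennreal_layer_less[of "\<phi> t"] by (cases "0 < t") auto
 qed (simp_all add: ennreal_layer_less)
 finally show ?thesis by (simp add: mult_ac)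
qed

lemma ennreal_inverse_less:
 fixes c z :: ennreal
 assumes "0 < c" shows "inverse z < c \<longleftrightarrow> inverse c < z"
proof (cases c)
 case (real r)
 with assms have r: "c = ennreal r" "r > 0" by auto
 show ?thesis
 proof (cases z)
  case (real y)
  then show ?thesis
  proof (cases "y = 0")
   case False
   then show ?thesis using r real by (simp add: inverse_ennreal ennreal_less_iff field_simps)
  qed (use r in \<open>auto simp: inverse_ennreal\<close>)
 qed (use r in \<open>auto simp: inverse_ennreal\<close>)
next
 case top
 show ?thesis unfolding top by (cases "z = 0") (auto simp: less_top[symmetric] zero_less_iff_neq_zero)
qed

text \<open>For a reciprocal the second level set is the complement of a superlevel set of Z, so
  differences of sets are compared. On the half-line the sets are nested, and the difference is
  empty or has exactly the difference of the measures; in \<open>M\<close> it has at least that. The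
  subtraction requires finite measure, hence \<open>fin\<close>.\<close>

lemma Hardy_Littlewood_reverse:
 assumes "sigma_finite_measure M"
  and [measurable]: "f \<in> borel_measurable M" "Z \<in> borel_measurable M"
  and r: "is_rearrangement M f \<phi>" "is_rearrangement M Z \<kappa>"
  and fin: "\<And>l. 0 < l \<Longrightarrow> emeasure M {x \<in> space M. ennreal l < f x} < \<top>"
 shows "nnl {0<..} (\<lambda>t. \<phi> t * inverse (\<kappa> t)) \<le> (\<integral>\<^sup>+x. f x * inverse (Z x) \<partial>M)"
proof -
 note [measurable] = is_rearrangementD(2)[OF r(1)] is_rearrangementD(2)[OF r(2)]
 have "nnl {0<..} (\<lambda>t. \<phi> t * inverse (\<kappa> t)) = (\<integral>\<^sup>+t. (\<phi> t * indicator {0<..} t) * inverse (\<kappa> t) \<partial>lborel)"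
  by (simp add: mult_ac)
 also have "\<dots> = (\<integral>\<^sup>+l. \<integral>\<^sup>+k. emeasure lborel {t \<in> space lborel. (0 < t \<and> 0 \<le> l \<and> ennreal l < \<phi> t) \<and> (0 \<le> k \<and> ennreal k \<le> inverse (\<kappa> t))} \<partial>lborel \<partial>lborel)"
 proof (rule nn_integral_mult_layers[OF lborel.sigma_finite_measure_axioms])
  fix t :: real
  show "(\<integral>\<^sup>+ l. indicator {l. 0 < t \<and> 0 \<le> l \<and> ennreal l < \<phi> t} l \<partial>lborel) = \<phi> t * indicator {0<..} t"
   using ennreal_layer_less[of "\<phi> t"] by (cases "0 < t") auto
 qed (simp_all add: ennreal_layer_le)
 also have "\<dots> \<le> (\<integral>\<^sup>+l. \<integral>\<^sup>+k. emeasure M {x \<in> space M. (0 \<le> l \<and> ennreal l < f x) \<and> (0 \<le> k \<and> ennreal k \<le> inverse (Z x))} \<partial>lborel \<partial>lborel)"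
 proof (rule nn_integral_mono_AE)
  \<comment> \<open>The level 0 is discarded as a null set: \<open>fin\<close> says nothing about l
    = 0, and below the reciprocal of the second level k is used.\<close>
  have "AE l in lborel. (l :: real) \<noteq> 0" by (rule AE_lborel_singleton)
  then show "AE l in lborel. (\<integral>\<^sup>+k. emeasure lborel {t \<in> space lborel. (0 < t \<and> 0 \<le> l \<and> ennreal l < \<phi> t) \<and> (0 \<le> k \<and> ennreal k \<le> inverse (\<kappa> t))} \<partial>lborel)
    \<le> (\<integral>\<^sup>+k. emeasure M {x \<in> space M. (0 \<le> l \<and> ennreal l < f x) \<and> (0 \<le> k \<and> ennreal k \<le> inverse (Z x))} \<partial>lborel)"
  proof eventually_elim
   fix l :: real assume l0: "l \<noteq> 0"
   show "(\<integral>\<^sup>+k. emeasure lborel {t \<in> space lborel. (0 < t \<and> 0 \<le> l \<and> ennreal l < \<phi> t) \<and> (0 \<le> k \<and> ennreal k \<le> inverse (\<kappa> t))} \<partial>lborel)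
    \<le> (\<integral>\<^sup>+k. emeasure M {x \<in> space M. (0 \<le> l \<and> ennreal l < f x) \<and> (0 \<le> k \<and> ennreal k \<le> inverse (Z x))} \<partial>lborel)"
   proof (rule nn_integral_mono_AE)
    have "AE k in lborel. (k :: real) \<noteq> 0" by (rule AE_lborel_singleton)
    then show "AE k in lborel. emeasure lborel {t \<in> space lborel. (0 < t \<and> 0 \<le> l \<and> ennreal l < \<phi> t) \<and> (0 \<le> k \<and> ennreal k \<le> inverse (\<kappa> t))}
     \<le> emeasure M {x \<in> space M. (0 \<le> l \<and> ennreal l < f x) \<and> (0 \<le> k \<and> ennreal k \<le> inverse (Z x))}"
    proof eventually_elim
     fix k :: real assume k0: "k \<noteq> 0"
     show "emeasure lborel {t \<in> space lborel. (0 < t \<and> 0 \<le> l \<and> ennreal l < \<phi> t) \<and> (0 \<le> k \<and> ennreal k \<le> inverse (\<kappa> t))}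
      \<le> emeasure M {x \<in> space M. (0 \<le> l \<and> ennreal l < f x) \<and> (0 \<le> k \<and> ennreal k \<le> inverse (Z x))}"
     proof (cases "0 < l \<and> 0 < k")
      case True
      let ?c = "inverse (ennreal k)"
      have k: "ennreal k \<le> inverse y \<longleftrightarrow> \<not> ?c < y" for y
       using ennreal_inverse_less[of "ennreal k" y] True by auto
      let ?A = "{t. 0 < t \<and> ennreal l < \<phi> t}" and ?B = "{t. 0 < t \<and> ?c < \<kappa> t}"
      let ?A' = "{x \<in> space M. ennreal l < f x}" and ?B' = "{x \<in> space M. ?c < Z x}"
      have e1: "{t \<in> space lborel. (0 < t \<and> 0 \<le> l \<and> ennreal l < \<phi> t) \<and> (0 \<le> k \<and> ennreal k \<le> inverse (\<kappa> t))} = ?A - ?B"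
       using True k by auto
      have e2: "{x \<in> space M. (0 \<le> l \<and> ennreal l < f x) \<and> (0 \<le> k \<and> ennreal k \<le> inverse (Z x))} = ?A' - ?B'"
       using True k by auto
      have m: "?A \<in> sets lborel" "?B \<in> sets lborel" by measurable
      have "?A \<subseteq> ?B \<or> ?B \<subseteq> ?A"
      proof (rule disjCI, rule subsetI)
       fix t assume "\<not> ?B \<subseteq> ?A" "t \<in> ?A"
       then obtain s where s: "0 < s" "?c < \<kappa> s" "\<not> ennreal l < \<phi> s" by auto
       then have "t \<le> s" using \<open>t \<in> ?A\<close> antimonoD[OF is_rearrangementD(1)[OF r(1)], of s t]
        by (cases "s \<le> t") (auto intro: less_le_trans)
       then show "t \<in> ?B" using \<open>t \<in> ?A\<close> s antimonoD[OF is_rearrangementD(1)[OF r(2)], of t s]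
        by (auto intro: less_le_trans)
      qed
      then show ?thesis
      proof
       assume "?A \<subseteq> ?B"
       then have "?A - ?B = {}" by blast
       then have "emeasure lborel (?A - ?B) = 0" by (simp only: emeasure_empty)
       then show ?thesis unfolding e1 by (simp only: zero_le)
      next
       assume BA: "?B \<subseteq> ?A"
       have fA: "emeasure lborel ?A < \<top>" using fin[of l] True is_rearrangementD(3)[OF r(1)] by simp
       then have "emeasure lborel ?B \<noteq> \<infinity>"
        using emeasure_mono[OF BA m(1)] by (auto simp: less_top[symmetric] top_unique)
       then have "emeasure lborel (?A - ?B) = emeasure lborel ?A - emeasure lborel ?B"
        by (intro emeasure_Diff m BA)
       also have "\<dots> = emeasure M ?A' - emeasure M ?B'"
        by (simp add: is_rearrangementD(3)[OF r(1)] is_rearrangementD(3)[OF r(2)])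
       also have "\<dots> \<le> emeasure M (?A' - ?B')"
       proof -
        have "emeasure M ?A' \<le> emeasure M ((?A' - ?B') \<union> ?B')" by (intro emeasure_mono) auto
        also have "\<dots> \<le> emeasure M (?A' - ?B') + emeasure M ?B'" by (intro emeasure_subadditive) auto
        finally show ?thesis
         using \<open>emeasure lborel ?B \<noteq> \<infinity>\<close> is_rearrangementD(3)[OF r(2)]
         by (simp add: ennreal_minus_le_iff add.commute)
       qed
       finally show ?thesis unfolding e1 e2 .
      qed
     qed (use l0 k0 in auto)
    qed
   qed
  qed
 qed
 also have "\<dots> = (\<integral>\<^sup>+x. f x * inverse (Z x) \<partial>M)"
  by (rule nn_integral_mult_layers[OF assms(1), symmetric]) (simp_all add: ennreal_layer_less ennreal_layer_le)
 finally show ?thesis .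
qed

section \<open>The Fourier transform on integrable functions\<close>

text \<open>The transform is first treated over \<open>lborel\<close>, where Tonelli, product
  formulas and Gaussian integrals are at hand; \<open>fourier_eq_FT\<close> transfers the results to
  \<open>lebesgue\<close>.\<close>

definition fker :: "'a::euclidean_space \<Rightarrow> 'a \<Rightarrow> complex" where
 "fker x y = exp (- (2 * complex_of_real pi * \<i> * complex_of_real (x \<bullet> y)))"

definition FT :: "('a::euclidean_space \<Rightarrow> complex) \<Rightarrow> 'a \<Rightarrow> complex" where
 "FT f x = (LINT y|lborel. fker x y * f y)"

lemma norm_fker [simp]: "norm (fker x y) = 1"
 unfolding fker_def norm_exp_eq_Re by simp

lemma fker_measurable [measurable]: "(\<lambda>(x, y). fker x y) \<in> borel_measurable (borel \<Otimes>\<^sub>M borel)"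
 unfolding fker_def split_beta by measurable

lemma fker_measurable' [measurable (raw)]:
 "f \<in> borel_measurable M \<Longrightarrow> g \<in> borel_measurable M \<Longrightarrow> (\<lambda>x. fker (f x) (g x)) \<in> borel_measurable M"
 unfolding fker_def by measurable

lemma fker_commute: "fker x y = fker y x"
 by (simp add: fker_def inner_commute)

lemma cnj_fker: "cnj (fker x y) = exp (2 * complex_of_real pi * \<i> * complex_of_real (x \<bullet> y))"
 by (simp add: fker_def exp_cnj)

lemma FT_measurable [measurable]:
 fixes f :: "'a::euclidean_space \<Rightarrow> complex"
 assumes [measurable]: "f \<in> borel_measurable borel"
 shows "FT f \<in> borel_measurable borel"
proof -
 have "(\<lambda>x. LINT y|lborel. fker x y * f y) \<in> borel_measurable borel"
  by (rule lborel.borel_measurable_lebesgue_integral) (simp add: split_beta)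
 then show ?thesis by (simp add: FT_def[abs_def])
qed

lemma integrable_fker:
 fixes f :: "'a::euclidean_space \<Rightarrow> complex"
 assumes "integrable lborel f" shows "integrable lborel (\<lambda>y. fker x y * f y)"
 by (rule Bochner_Integration.integrable_bound[OF assms])
   (use borel_measurable_integrable[OF assms] in \<open>auto simp: norm_mult\<close>)

lemma norm_FT_le:
 fixes f :: "'a::euclidean_space \<Rightarrow> complex"
 shows "ennreal (norm (FT f x)) \<le> (\<integral>\<^sup>+y. ennreal (norm (f y)) \<partial>lborel)"
proof (cases "integrable lborel (\<lambda>y. fker x y * f y)")
 case True
 have "ennreal (norm (FT f x)) \<le> (\<integral>\<^sup>+y. ennreal (norm (fker x y * f y)) \<partial>lborel)"
  unfolding FT_def by (rule integral_norm_bound_ennreal[OF True])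
 then show ?thesis by (simp add: norm_mult)
next
 case False
 then show ?thesis by (simp add: FT_def not_integrable_integral_eq)
qed

lemma FT_add:
 fixes f g :: "'a::euclidean_space \<Rightarrow> complex"
 assumes "integrable lborel f" "integrable lborel g"
 shows "FT (\<lambda>x. f x + g x) x = FT f x + FT g x"
 unfolding FT_def distrib_left
 by (intro Bochner_Integration.integral_add integrable_fker assms)

text \<open>Fubini, dominated by the product of the norms of \<open>a\<close> and \<open>b\<close>.
  It serves for the multiplication formula and, with the conjugate kernel, for the transform of a
  regularized transform.\<close>

lemma integral_kernel_swap:
 fixes a b :: "'a::euclidean_space \<Rightarrow> complex"
 assumes a: "integrable lborel a" and b: "integrable lborel b"
  and [measurable]: "(\<lambda>(x, y). \<kappa> x y) \<in> borel_measurable (borel \<Otimes>\<^sub>M borel)"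
  and \<kappa>: "\<And>x y. norm (\<kappa> x y) \<le> 1"
 shows "(LINT x|lborel. (LINT y|lborel. \<kappa> x y * a y) * b x) = (LINT y|lborel. a y * (LINT x|lborel. \<kappa> x y * b x))"
proof -
 note [measurable] = borel_measurable_integrable[OF a] borel_measurable_integrable[OF b]
 have "integrable (lborel \<Otimes>\<^sub>M lborel) (\<lambda>z. b (fst z) * a (snd z))"
 proof (rule lborel_pair.Fubini_integrable)
  show "integrable lborel (\<lambda>x. LINT y|lborel. norm (b (fst (x, y)) * a (snd (x, y))))"
   using a b by (simp add: norm_mult)
  show "AE x in lborel. integrable lborel (\<lambda>y. b (fst (x, y)) * a (snd (x, y)))"
   using a by simp
 qed simp
 then have i: "integrable (lborel \<Otimes>\<^sub>M lborel) (\<lambda>(x, y). \<kappa> x y * a y * b x)"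
 proof (rule Bochner_Integration.integrable_bound)
  show "(\<lambda>(x, y). \<kappa> x y * a y * b x) \<in> borel_measurable (lborel \<Otimes>\<^sub>M lborel)"
   unfolding split_beta by simp
  show "AE z in lborel \<Otimes>\<^sub>M lborel. norm (case z of (x, y) \<Rightarrow> \<kappa> x y * a y * b x) \<le> norm (b (fst z) * a (snd z))"
   using \<kappa> by (auto simp: norm_mult split_beta mult_ac intro!: AE_I2 mult_left_mono mult_left_le)
 qed
 have "(LINT x|lborel. (LINT y|lborel. \<kappa> x y * a y) * b x) = (LINT x|lborel. (LINT y|lborel. \<kappa> x y * a y * b x))"
  by simp
 also have "\<dots> = (LINT y|lborel. (LINT x|lborel. \<kappa> x y * a y * b x))"
  by (rule lborel_pair.Fubini_integral[OF i, symmetric])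
 also have "\<dots> = (LINT y|lborel. a y * (LINT x|lborel. \<kappa> x y * b x))"
 proof (rule Bochner_Integration.integral_cong[OF refl])
  fix y
  have "(LINT x|lborel. \<kappa> x y * a y * b x) = (LINT x|lborel. a y * (\<kappa> x y * b x))"
   by (simp add: mult_ac)
  then show "(LINT x|lborel. \<kappa> x y * a y * b x) = a y * (LINT x|lborel. \<kappa> x y * b x)" by simp
 qed
 finally show ?thesis .
qed

lemma FT_multiplication:
 fixes f g :: "'a::euclidean_space \<Rightarrow> complex"
 assumes "integrable lborel f" "integrable lborel g"
 shows "(LINT x|lborel. FT f x * g x) = (LINT y|lborel. f y * FT g y)"
 unfolding FT_def using integral_kernel_swap[OF assms fker_measurable]
 by (simp add: fker_commute)

text \<open>The characteristic function of the standard normal law at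
  \<open>2 * pi * z / \<epsilon>\<close> after a dilation by \<epsilon>; the factor
  \<open>sqrt (2 * pi)\<close> removes the normalization of the density.\<close>

lemma Gaussian_integral_1:
 fixes z \<epsilon> :: real
 assumes e: "\<epsilon> > 0"
 shows "integrable lborel (\<lambda>t. iexp (2 * pi * z * t) * exp (- (\<epsilon> * t)\<^sup>2 / 2))"
  "(LINT t|lborel. iexp (2 * pi * z * t) * exp (- (\<epsilon> * t)\<^sup>2 / 2)) = normal_density 0 (\<epsilon> / (2 * pi)) z"
proof -
 let ?a = "2 * pi * z / \<epsilon>"
 have "char std_normal_distribution ?a = (CLINT x|lborel. std_normal_density x *\<^sub>R iexp (?a * x))"
  unfolding char_def by (subst integral_density) auto
 then have "complex_of_real (exp (- ?a\<^sup>2 / 2)) = (CLINT x|lborel. std_normal_density x *\<^sub>R iexp (?a * x))"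
  by (simp add: char_std_normal_distribution)
 moreover have "integrable lborel (\<lambda>x. std_normal_density x *\<^sub>R iexp (?a * x))"
  by (rule Bochner_Integration.integrable_bound[OF integrable_normal_moment[of 1 0 0]]) auto
 ultimately have hb: "has_bochner_integral lborel (\<lambda>x. std_normal_density x *\<^sub>R iexp (?a * x)) (complex_of_real (exp (- ?a\<^sup>2 / 2)))"
  by (simp add: has_bochner_integral_iff)
 have "has_bochner_integral lborel (\<lambda>x. std_normal_density (0 + \<epsilon> * x) *\<^sub>R iexp (?a * (0 + \<epsilon> * x))) (complex_of_real (exp (- ?a\<^sup>2 / 2)) /\<^sub>R \<bar>\<epsilon>\<bar>)"
  using hb e by (subst (asm) lborel_has_bochner_integral_real_affine_iff[of \<epsilon> _ _ 0]) auto
 then have "has_bochner_integral lborel (\<lambda>x. sqrt (2 * pi) *\<^sub>R (std_normal_density (0 + \<epsilon> * x) *\<^sub>R iexp (?a * (0 + \<epsilon> * x)))) (sqrt (2 * pi) *\<^sub>R (complex_of_real (exp (- ?a\<^sup>2 / 2)) /\<^sub>R \<bar>\<epsilon>\<bar>))"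
  by (rule has_bochner_integral_scaleR_right)
 moreover have "sqrt (2 * pi) *\<^sub>R (std_normal_density (0 + \<epsilon> * x) *\<^sub>R iexp (?a * (0 + \<epsilon> * x))) = iexp (2 * pi * z * x) * exp (- (\<epsilon> * x)\<^sup>2 / 2)" for x
  using e by (simp add: std_normal_density_def scaleR_conv_of_real exp_of_real mult_ac)
 moreover have "sqrt (2 * pi) *\<^sub>R (complex_of_real (exp (- ?a\<^sup>2 / 2)) /\<^sub>R \<bar>\<epsilon>\<bar>) = normal_density 0 (\<epsilon> / (2 * pi)) z"
 proof -
  have "sqrt (2 * pi * (\<epsilon> / (2 * pi))\<^sup>2) = \<epsilon> / sqrt (2 * pi)"
   using e by (intro real_sqrt_unique) (simp_all add: power_divide field_simps power2_eq_square)
  moreover have "- ?a\<^sup>2 / 2 = - (z - 0)\<^sup>2 / (2 * (\<epsilon> / (2 * pi))\<^sup>2)"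
   using e by (simp add: field_simps power2_eq_square)
  ultimately have "sqrt (2 * pi) * (exp (- ?a\<^sup>2 / 2) / \<epsilon>) = normal_density 0 (\<epsilon> / (2 * pi)) z"
   unfolding normal_density_def by simp
  moreover have "sqrt (2 * pi) *\<^sub>R (complex_of_real x /\<^sub>R \<bar>\<epsilon>\<bar>) = complex_of_real (sqrt (2 * pi) * (x / \<epsilon>))" for x
   using e by (simp add: scaleR_conv_of_real divide_inverse)
  ultimately show ?thesis by (simp only:)
 qed
 ultimately have *: "has_bochner_integral lborel (\<lambda>t. iexp (2 * pi * z * t) * exp (- (\<epsilon> * t)\<^sup>2 / 2)) (normal_density 0 (\<epsilon> / (2 * pi)) z)"
  by simp
 show "integrable lborel (\<lambda>t. iexp (2 * pi * z * t) * exp (- (\<epsilon> * t)\<^sup>2 / 2))"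
  "(LINT t|lborel. iexp (2 * pi * z * t) * exp (- (\<epsilon> * t)\<^sup>2 / 2)) = normal_density 0 (\<epsilon> / (2 * pi)) z"
  using * by (simp_all only: has_bochner_integral_iff)
qed

section \<open>Gaussian regularization and the L2 bound\<close>

definition gauss :: "real \<Rightarrow> 'a::euclidean_space \<Rightarrow> real" where
 "gauss \<epsilon> \<xi> = (\<Prod>b\<in>Basis. exp (- (\<epsilon> * (\<xi> \<bullet> b))\<^sup>2 / 2))"

text \<open>The inverse transform of \<open>gauss \<epsilon>\<close> (\<open>gauss_Fourier\<close>),
  a probability density. Both functions are products over the coordinates, so that all integrals
  reduce to dimension one.\<close>

definition gaussK :: "real \<Rightarrow> 'a::euclidean_space \<Rightarrow> real" where
 "gaussK \<epsilon> z = (\<Prod>b\<in>Basis. normal_density 0 (\<epsilon> / (2 * pi)) (z \<bullet> b))"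

lemma gauss_measurable [measurable]: "gauss \<epsilon> \<in> borel_measurable borel"
 unfolding gauss_def[abs_def] by measurable

lemma gaussK_measurable [measurable]: "gaussK \<epsilon> \<in> borel_measurable borel"
 unfolding gaussK_def[abs_def] by measurable

lemma gauss_bounds: "0 < gauss \<epsilon> \<xi>" "gauss \<epsilon> \<xi> \<le> 1"
 unfolding gauss_def by (auto intro!: prod_pos prod_le_1)

lemma gaussK_nonneg: "0 \<le> gaussK \<epsilon> z"
 unfolding gaussK_def by (intro prod_nonneg) simp

lemma gaussK_minus: "gaussK \<epsilon> (x - y) = gaussK \<epsilon> (y - x)"
 unfolding gaussK_def by (intro prod.cong refl) (simp add: normal_density_def inner_diff_left power2_commute)

lemma gauss_Fourier:
 fixes z :: "'a::euclidean_space"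
 assumes e: "\<epsilon> > 0"
 shows "(LINT \<xi>|lborel. exp (2 * complex_of_real pi * \<i> * complex_of_real (z \<bullet> \<xi>)) * complex_of_real (gauss \<epsilon> \<xi>)) = gaussK \<epsilon> z"
proof -
 interpret product_sigma_finite "\<lambda>_::'a. lborel :: real measure" ..
 let ?f = "\<lambda>b t. iexp (2 * pi * (z \<bullet> b) * t) * exp (- (\<epsilon> * t)\<^sup>2 / 2)"
 have prod: "exp (2 * complex_of_real pi * \<i> * complex_of_real (z \<bullet> \<xi>)) * complex_of_real (gauss \<epsilon> \<xi>) = (\<Prod>b\<in>Basis. ?f b (\<xi> \<bullet> b))" for \<xi> :: 'a
 proof -
  have "exp (2 * complex_of_real pi * \<i> * complex_of_real (z \<bullet> \<xi>)) = (\<Prod>b\<in>Basis. iexp (2 * pi * (z \<bullet> b) * (\<xi> \<bullet> b)))"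
   by (subst euclidean_inner) (simp add: exp_sum[symmetric] sum_distrib_left mult_ac)
  then show ?thesis by (simp add: gauss_def prod.distrib of_real_prod exp_of_real)
 qed
 have "(LINT \<xi>|lborel. exp (2 * complex_of_real pi * \<i> * complex_of_real (z \<bullet> \<xi>)) * complex_of_real (gauss \<epsilon> \<xi>))
   = (LINT \<xi>|(lborel :: 'a measure). (\<Prod>b\<in>Basis. ?f b (\<xi> \<bullet> b)))"
  by (simp only: prod)
 also have "\<dots> = (LINT x|(\<Pi>\<^sub>M b\<in>(Basis :: 'a set). lborel). (\<Prod>b\<in>Basis. ?f b (x b)))"
  by (subst lborel_eq, subst integral_distr) (auto intro!: Bochner_Integration.integral_cong prod.cong)
 also have "\<dots> = (\<Prod>b\<in>(Basis :: 'a set). LINT t|lborel. ?f b t)"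
  by (rule product_integral_prod) (use Gaussian_integral_1[OF e] in auto)
 also have "\<dots> = gaussK \<epsilon> z"
  using Gaussian_integral_1(2)[OF e] by (simp add: gaussK_def)
 finally show ?thesis .
qed

lemma nn_integral_gauss_finite:
 assumes e: "\<epsilon> > 0"
 shows "integrable lborel (gauss \<epsilon> :: 'a::euclidean_space \<Rightarrow> real)"
proof (rule integrableI_nonneg)
 have 1: "(\<integral>\<^sup>+t. ennreal (exp (- (\<epsilon> * t)\<^sup>2 / 2)) \<partial>lborel) < \<infinity>"
 proof -
  have "integrable lborel (\<lambda>t. iexp (2 * pi * 0 * t) * exp (- (\<epsilon> * t)\<^sup>2 / 2))"
   by (rule Gaussian_integral_1(1)[OF e])
  then have "(\<integral>\<^sup>+t. ennreal (norm (iexp (2 * pi * 0 * t) * exp (- (\<epsilon> * t)\<^sup>2 / 2))) \<partial>lborel) < \<infinity>"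
   by (simp only: integrable_iff_bounded)
  then show ?thesis by (simp add: norm_mult)
 qed
 have "(\<integral>\<^sup>+\<xi>. ennreal (gauss \<epsilon> \<xi>) \<partial>(lborel :: 'a measure)) = (\<integral>\<^sup>+\<xi>. (\<Prod>b\<in>Basis. ennreal (exp (- (\<epsilon> * (\<xi> \<bullet> b))\<^sup>2 / 2))) \<partial>(lborel :: 'a measure))"
  by (simp add: gauss_def prod_ennreal)
 also have "\<dots> = (\<Prod>b\<in>(Basis :: 'a set). (\<integral>\<^sup>+t. ennreal (exp (- (\<epsilon> * t)\<^sup>2 / 2)) \<partial>lborel))"
  by (rule nn_integral_lborel_prod) auto
 also have "\<dots> < \<infinity>" using 1 by (simp add: power_less_top_ennreal)
 finally show "(\<integral>\<^sup>+\<xi>. ennreal (gauss \<epsilon> \<xi>) \<partial>(lborel :: 'a measure)) < \<infinity>" .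
qed (auto simp: less_imp_le[OF gauss_bounds(1)])

lemma nn_integral_gaussK:
 fixes y :: "'a::euclidean_space"
 assumes e: "\<epsilon> > 0"
 shows "(\<integral>\<^sup>+x. ennreal (gaussK \<epsilon> (x - y)) \<partial>lborel) = 1"
proof -
 have 1: "(\<integral>\<^sup>+t. ennreal (normal_density 0 (\<epsilon> / (2 * pi)) t) \<partial>lborel) = 1"
  using prob_space.emeasure_space_1[OF prob_space_normal_density[of "\<epsilon> / (2 * pi)" 0]] e
  by (simp add: emeasure_density)
 have "(\<integral>\<^sup>+x. ennreal (gaussK \<epsilon> (x - y)) \<partial>lborel) = (\<integral>\<^sup>+x. ennreal (gaussK \<epsilon> (x - y)) \<partial>distr lborel borel ((+) y))"
  by (simp add: lborel_distr_plus)
 also have "\<dots> = (\<integral>\<^sup>+x. ennreal (gaussK \<epsilon> x) \<partial>(lborel :: 'a measure))"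
  by (subst nn_integral_distr) auto
 also have "\<dots> = (\<integral>\<^sup>+x. (\<Prod>b\<in>Basis. ennreal (normal_density 0 (\<epsilon> / (2 * pi)) (x \<bullet> b))) \<partial>(lborel :: 'a measure))"
  by (simp add: gaussK_def prod_ennreal)
 also have "\<dots> = (\<Prod>b\<in>(Basis :: 'a set). (\<integral>\<^sup>+t. ennreal (normal_density 0 (\<epsilon> / (2 * pi)) t) \<partial>lborel))"
  by (rule nn_integral_lborel_prod) auto
 also have "\<dots> = 1" using 1 by simp
 finally show ?thesis .
qed

lemma cnj_measurable [measurable]: "cnj \<in> borel_measurable borel"
 by (intro borel_measurable_continuous_onI continuous_intros)

text \<open>Let g be \<open>gauss \<epsilon>\<close> times the conjugate of FT f. The multiplication
  formula turns the left side into the integral of f times FT g, and FT g is bounded by the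
  convolution of |f| with \<open>gaussK \<epsilon>\<close>. Symmetry and unit mass of this kernel
  give the estimate.\<close>

lemma FT_gauss_L2:
 fixes f :: "'a::euclidean_space \<Rightarrow> complex"
 assumes f: "integrable lborel f" and e: "\<epsilon> > 0"
 shows "(\<integral>\<^sup>+\<xi>. ennreal ((norm (FT f \<xi>))\<^sup>2 * gauss \<epsilon> \<xi>) \<partial>lborel) \<le> (\<integral>\<^sup>+x. ennreal ((norm (f x))\<^sup>2) \<partial>lborel)"
proof -
 note [measurable] = borel_measurable_integrable[OF f]
 have [measurable]: "f \<in> borel_measurable borel" by simp
 define B where "B = enn2real (\<integral>\<^sup>+y. ennreal (norm (f y)) \<partial>lborel)"
 have "(\<integral>\<^sup>+y. ennreal (norm (f y)) \<partial>lborel) < \<top>" using f by (simp add: integrable_iff_bounded)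
 then have B: "norm (FT f \<xi>) \<le> B" for \<xi>
  using norm_FT_le[of f \<xi>] by (cases "(\<integral>\<^sup>+y. ennreal (norm (f y)) \<partial>lborel)") (auto simp: B_def)
 have B0: "0 \<le> B" by (simp add: B_def)
 let ?g = "\<lambda>\<xi>. complex_of_real (gauss \<epsilon> \<xi>) * cnj (FT f \<xi>)"
 have gi: "integrable lborel (\<lambda>\<xi>::'a. complex_of_real (gauss \<epsilon> \<xi>))"
  using nn_integral_gauss_finite[OF e] by (simp only: complex_of_real_integrable_eq)
 have g: "integrable lborel ?g"
 proof (rule Bochner_Integration.integrable_bound[OF integrable_mult_right[OF nn_integral_gauss_finite[OF e], of B]])
  show "AE \<xi> in lborel. norm (?g \<xi>) \<le> norm (B * gauss \<epsilon> \<xi>)"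
  proof (rule AE_I2)
   fix \<xi> :: 'a
   have g0: "0 \<le> gauss \<epsilon> \<xi>" using gauss_bounds(1)[of \<epsilon> \<xi>] by simp
   have "gauss \<epsilon> \<xi> * norm (FT f \<xi>) \<le> gauss \<epsilon> \<xi> * B" by (rule mult_left_mono[OF B g0])
   then show "norm (?g \<xi>) \<le> norm (B * gauss \<epsilon> \<xi>)"
    using B0 g0 by (simp add: norm_mult mult.commute)
  qed
 qed simp
 have FTg: "norm (FT ?g x) \<le> LINT y|lborel. norm (f y) * gaussK \<epsilon> (x - y)" for x
 proof -
  have c: "cnj (FT f \<xi>) = (LINT y|lborel. cnj (fker \<xi> y) * cnj (f y))" for \<xi>
   unfolding FT_def using Bochner_Integration.integral_cnj[of lborel "\<lambda>y. fker \<xi> y * f y"] by simp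
  have "FT ?g x = (LINT \<xi>|lborel. fker x \<xi> * ?g \<xi>)" by (rule FT_def)
  also have "\<dots> = (LINT \<xi>|lborel. (LINT y|lborel. cnj (fker \<xi> y) * cnj (f y)) * (fker x \<xi> * complex_of_real (gauss \<epsilon> \<xi>)))"
   by (simp only: c mult_ac)
  also have "\<dots> = (LINT y|lborel. cnj (f y) * (LINT \<xi>|lborel. cnj (fker \<xi> y) * (fker x \<xi> * complex_of_real (gauss \<epsilon> \<xi>))))"
  proof (rule integral_kernel_swap)
   show "integrable lborel (\<lambda>y. cnj (f y))" using f by simp
   show "integrable lborel (\<lambda>\<xi>. fker x \<xi> * complex_of_real (gauss \<epsilon> \<xi>))"
    by (rule integrable_fker[OF gi])
  qed (auto simp: split_beta)
  also have "\<dots> = (LINT y|lborel. cnj (f y) * gaussK \<epsilon> (x - y))"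
  proof (intro Bochner_Integration.integral_cong refl arg_cong2[where f="(*)"])
   fix y
   have *: "cnj (fker \<xi> y) * (fker x \<xi> * complex_of_real (gauss \<epsilon> \<xi>)) = exp (2 * complex_of_real pi * \<i> * complex_of_real ((y - x) \<bullet> \<xi>)) * complex_of_real (gauss \<epsilon> \<xi>)" for \<xi>
    unfolding cnj_fker by (simp add: fker_def algebra_simps inner_diff_left inner_commute flip: exp_add)
   show "(LINT \<xi>|lborel. cnj (fker \<xi> y) * (fker x \<xi> * complex_of_real (gauss \<epsilon> \<xi>))) = complex_of_real (gaussK \<epsilon> (x - y))"
    unfolding * gauss_Fourier[OF e] by (simp add: gaussK_minus)
  qed
  finally have "norm (FT ?g x) \<le> (LINT y|lborel. norm (cnj (f y) * gaussK \<epsilon> (x - y)))"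
   by (metis integral_norm_bound)
  then show ?thesis by (simp add: norm_mult gaussK_nonneg)
 qed
 have FTg': "ennreal (norm (FT ?g x)) \<le> (\<integral>\<^sup>+y. ennreal (norm (f y) * gaussK \<epsilon> (x - y)) \<partial>lborel)" for x
 proof (cases "integrable lborel (\<lambda>y. norm (f y) * gaussK \<epsilon> (x - y))")
  case True
  then show ?thesis
   using FTg[of x] by (subst nn_integral_eq_integral) (auto simp: gaussK_nonneg ennreal_leI)
 next
  case False
  then show ?thesis using FTg[of x] by (simp add: not_integrable_integral_eq)
 qed
 have i2: "integrable lborel (\<lambda>\<xi>. FT f \<xi> * ?g \<xi>)"
 proof (rule Bochner_Integration.integrable_bound[OF integrable_mult_right[OF g, of "complex_of_real B"]])
  show "AE \<xi> in lborel. norm (FT f \<xi> * ?g \<xi>) \<le> norm (complex_of_real B * ?g \<xi>)"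
   using B B0 by (auto simp: norm_mult intro!: mult_right_mono)
 qed simp
 have eq: "FT f \<xi> * ?g \<xi> = complex_of_real ((norm (FT f \<xi>))\<^sup>2 * gauss \<epsilon> \<xi>)" for \<xi>
  using complex_norm_square[of "FT f \<xi>"] by simp
 have i3: "integrable lborel (\<lambda>\<xi>. (norm (FT f \<xi>))\<^sup>2 * gauss \<epsilon> \<xi>)"
  using i2 unfolding eq by (simp only: complex_of_real_integrable_eq)
 have "(\<integral>\<^sup>+\<xi>. ennreal ((norm (FT f \<xi>))\<^sup>2 * gauss \<epsilon> \<xi>) \<partial>lborel) = ennreal (LINT \<xi>|lborel. (norm (FT f \<xi>))\<^sup>2 * gauss \<epsilon> \<xi>)"
  by (rule nn_integral_eq_integral[OF i3]) (auto simp: less_imp_le[OF gauss_bounds(1)])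
 also have "\<dots> \<le> ennreal (norm (LINT \<xi>|lborel. FT f \<xi> * ?g \<xi>))"
  unfolding eq integral_complex_of_real by (intro ennreal_leI) simp
 also have "\<dots> = ennreal (norm (LINT x|lborel. f x * FT ?g x))"
  by (simp only: FT_multiplication[OF f g])
 also have "\<dots> \<le> (\<integral>\<^sup>+x. ennreal (norm (f x * FT ?g x)) \<partial>lborel)"
  by (cases "integrable lborel (\<lambda>x. f x * FT ?g x)") (auto simp: integral_norm_bound_ennreal not_integrable_integral_eq)
 also have "\<dots> \<le> (\<integral>\<^sup>+x. \<integral>\<^sup>+y. ennreal (norm (f x)) * ennreal (norm (f y) * gaussK \<epsilon> (x - y)) \<partial>lborel \<partial>lborel)"
  by (intro nn_integral_mono) (auto simp: norm_mult ennreal_mult nn_integral_cmult intro!: mult_left_mono FTg')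
 \<comment> \<open>Schur's test: the product of the norms is at most the mean of their squares, and
   in each half the kernel integrates to 1 in the other variable.\<close>
 also have "\<dots> \<le> (\<integral>\<^sup>+x. \<integral>\<^sup>+y. ennreal ((norm (f x))\<^sup>2 / 2) * ennreal (gaussK \<epsilon> (y - x)) + ennreal ((norm (f y))\<^sup>2 / 2) * ennreal (gaussK \<epsilon> (x - y)) \<partial>lborel \<partial>lborel)"
 proof (intro nn_integral_mono)
  fix x y
  have "norm (f x) * norm (f y) \<le> (norm (f x))\<^sup>2 / 2 + (norm (f y))\<^sup>2 / 2"
   using sum_squares_bound[of "norm (f x)" "norm (f y)"] by simp
  then have "norm (f x) * (norm (f y) * gaussK \<epsilon> (x - y)) \<le> ((norm (f x))\<^sup>2 / 2 + (norm (f y))\<^sup>2 / 2) * gaussK \<epsilon> (x - y)"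
   unfolding mult.assoc[symmetric] by (intro mult_right_mono gaussK_nonneg)
  then show "ennreal (norm (f x)) * ennreal (norm (f y) * gaussK \<epsilon> (x - y)) \<le> ennreal ((norm (f x))\<^sup>2 / 2) * ennreal (gaussK \<epsilon> (y - x)) + ennreal ((norm (f y))\<^sup>2 / 2) * ennreal (gaussK \<epsilon> (x - y))"
   by (simp add: gaussK_minus[of \<epsilon> y x] gaussK_nonneg distrib_right ennreal_leI flip: ennreal_mult ennreal_plus)
 qed
 also have "\<dots> = (\<integral>\<^sup>+x. \<integral>\<^sup>+y. ennreal ((norm (f x))\<^sup>2 / 2) * ennreal (gaussK \<epsilon> (y - x)) \<partial>lborel \<partial>lborel) + (\<integral>\<^sup>+x. \<integral>\<^sup>+y. ennreal ((norm (f y))\<^sup>2 / 2) * ennreal (gaussK \<epsilon> (x - y)) \<partial>lborel \<partial>lborel)"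
  by (simp add: nn_integral_add)
 also have "(\<integral>\<^sup>+x. \<integral>\<^sup>+y. ennreal ((norm (f y))\<^sup>2 / 2) * ennreal (gaussK \<epsilon> (x - y)) \<partial>lborel \<partial>lborel) = (\<integral>\<^sup>+y. \<integral>\<^sup>+x. ennreal ((norm (f y))\<^sup>2 / 2) * ennreal (gaussK \<epsilon> (x - y)) \<partial>lborel \<partial>lborel)"
  by (intro lborel_pair.Fubini') simp
 also have "(\<integral>\<^sup>+x. \<integral>\<^sup>+y. ennreal ((norm (f x))\<^sup>2 / 2) * ennreal (gaussK \<epsilon> (y - x)) \<partial>lborel \<partial>lborel) + \<dots> = (\<integral>\<^sup>+x. ennreal ((norm (f x))\<^sup>2 / 2) + ennreal ((norm (f x))\<^sup>2 / 2) \<partial>lborel)"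
  by (simp add: nn_integral_cmult nn_integral_gaussK[OF e] nn_integral_add)
 also have "\<dots> = (\<integral>\<^sup>+x. ennreal ((norm (f x))\<^sup>2) \<partial>lborel)"
  by (simp flip: ennreal_plus)
 finally show ?thesis .
qed

text \<open>The cutoffs \<open>gauss (1 / Suc n)\<close> tend to 1 pointwise, and Fatou's lemma
  passes to the limit in \<open>FT_gauss_L2\<close>.\<close>

lemma Plancherel_le:
 fixes f :: "'a::euclidean_space \<Rightarrow> complex"
 assumes f: "integrable lborel f"
 shows "(\<integral>\<^sup>+\<xi>. ennreal ((norm (FT f \<xi>))\<^sup>2) \<partial>lborel) \<le> (\<integral>\<^sup>+x. ennreal ((norm (f x))\<^sup>2) \<partial>lborel)"
proof -
 note [measurable] = borel_measurable_integrable[OF f]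
 have [measurable]: "f \<in> borel_measurable borel" by simp
 let ?h = "\<lambda>n \<xi>. ennreal ((norm (FT f \<xi>))\<^sup>2 * gauss (1 / Suc n) \<xi>)"
 have "(\<lambda>n. ?h n \<xi>) \<longlonglongrightarrow> ennreal ((norm (FT f \<xi>))\<^sup>2)" for \<xi>
 proof -
  have "(\<lambda>n. 1 / real (Suc n)) \<longlonglongrightarrow> 0" by (rule LIMSEQ_Suc[OF lim_1_over_n])
  then have "(\<lambda>n. (norm (FT f \<xi>))\<^sup>2 * gauss (1 / Suc n) \<xi>) \<longlonglongrightarrow> (norm (FT f \<xi>))\<^sup>2 * gauss 0 \<xi>"
   unfolding gauss_def by (intro tendsto_intros) auto
  then show ?thesis by (intro tendsto_ennrealI) (simp add: gauss_def)
 qed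
 then have "liminf (\<lambda>n. ?h n \<xi>) = ennreal ((norm (FT f \<xi>))\<^sup>2)" for \<xi>
  by (intro lim_imp_Liminf) auto
 then have "(\<integral>\<^sup>+\<xi>. ennreal ((norm (FT f \<xi>))\<^sup>2) \<partial>lborel) = (\<integral>\<^sup>+\<xi>. liminf (\<lambda>n. ?h n \<xi>) \<partial>lborel)"
  by simp
 also have "\<dots> \<le> liminf (\<lambda>n. \<integral>\<^sup>+\<xi>. ?h n \<xi> \<partial>lborel)"
  by (rule nn_integral_liminf) simp
 also have "\<dots> \<le> liminf (\<lambda>n::nat. \<integral>\<^sup>+x. ennreal ((norm (f x))\<^sup>2) \<partial>lborel)"
  by (intro Liminf_mono always_eventually allI FT_gauss_L2[OF f]) simp
 also have "\<dots> = (\<integral>\<^sup>+x. ennreal ((norm (f x))\<^sup>2) \<partial>lborel)"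
  by (simp add: Liminf_const)
 finally show ?thesis .
qed

section \<open>From Lebesgue to Borel measurable functions\<close>

lemma sigma_finite_lebesgue: "sigma_finite_measure (lebesgue :: 'a::euclidean_space measure)"
proof
 obtain A :: "'a set set" where A: "countable A" "A \<subseteq> sets lborel" "\<Union> A = space lborel" "\<forall>a\<in>A. emeasure lborel a \<noteq> \<infinity>"
  using sigma_finite_measure.sigma_finite_countable[OF sigma_finite_lborel] by blast
 show "\<exists>A::'a set set. countable A \<and> A \<subseteq> sets lebesgue \<and> \<Union> A = space lebesgue \<and> (\<forall>a\<in>A. emeasure lebesgue a \<noteq> \<infinity>)"
 proof (intro exI[of _ A] conjI)
  show "A \<subseteq> sets lebesgue" using A(2) sets_completionI_sets by blast
  show "\<forall>a\<in>A. emeasure lebesgue a \<noteq> \<infinity>"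
   using A(2,4) by (auto simp: subset_iff)
 qed (use A in auto)
qed

lemma lebesgue_integrable_Borel_version:
 fixes f :: "'a::euclidean_space \<Rightarrow> complex"
 assumes f: "integrable lebesgue f"
 obtains g where "integrable lborel g" "g \<in> borel_measurable borel" "AE x in lebesgue. f x = g x"
proof -
 have re: "(\<lambda>x. Re (f x)) \<in> borel_measurable lebesgue" and im: "(\<lambda>x. Im (f x)) \<in> borel_measurable lebesgue"
  using borel_measurable_integrable[OF f] by auto
 obtain a b where [measurable]: "a \<in> borel_measurable lborel" "b \<in> borel_measurable lborel"
  and ab: "AE x in lborel. Re (f x) = a x" "AE x in lborel. Im (f x) = b x"
  using completion_ex_borel_measurable_real[OF re] completion_ex_borel_measurable_real[OF im] by blast
 let ?g = "\<lambda>x. Complex (a x) (b x)"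
 have eq: "?g = (\<lambda>x. complex_of_real (a x) + \<i> * complex_of_real (b x))"
  by (simp add: Complex_eq)
 have m [measurable]: "?g \<in> borel_measurable lborel" unfolding eq by measurable
 have ae: "AE x in lborel. f x = ?g x"
  using ab by eventually_elim (auto simp: complex_eq_iff)
 then have ae': "AE x in lebesgue. f x = ?g x" by (rule AE_completion)
 have "integrable lebesgue ?g"
  using f by (subst integrable_cong_AE[OF _ _ ae', symmetric]) (use borel_measurable_integrable[OF f] measurable_completion[OF m] in auto)
 then have "integrable lborel ?g" using m by (simp add: integrable_completion)
 then show thesis using that[of ?g] m ae' by simp
qed

lemma fourier_eq_FT:
 fixes f g :: "real ^ 'n \<Rightarrow> complex"
 assumes f: "integrable lebesgue f" and g: "g \<in> borel_measurable borel" and fg: "AE x in lebesgue. f x = g x"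
 shows "fourier f = FT g"
proof
 fix x
 have g': "(\<lambda>y. fker x y * g y) \<in> borel_measurable lborel" using g by measurable
 have fk: "(\<lambda>y. fker x y) \<in> borel_measurable lebesgue" by (rule measurable_completion) simp
 have "fourier f x = (LINT y|lebesgue. fker x y * f y)" by (simp add: fourier_def fker_def)
 also have "\<dots> = (LINT y|lebesgue. fker x y * g y)"
  using fg by (intro integral_cong_AE) (use fk borel_measurable_integrable[OF f] measurable_completion[OF g'] in \<open>auto elim: eventually_mono\<close>)
 also have "\<dots> = FT g x" unfolding FT_def using g' by (simp add: integral_completion)
 finally show "fourier f x = FT g x" .
qed

section \<open>Non-increasing majorants of the transform\<close>

definition lint :: "(real \<Rightarrow> ennreal) \<Rightarrow> real \<Rightarrow> ennreal" where
 "lint f x = nnl {0<..<x} f"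

definition rint :: "(real \<Rightarrow> ennreal) \<Rightarrow> real \<Rightarrow> ennreal" where
 "rint f x = nnl {x<..} f"

lemma mono_borel_measurable:
 fixes f :: "real \<Rightarrow> ennreal"
 assumes "mono f" shows "f \<in> borel_measurable borel"
proof (rule borel_measurableI_greater)
 fix y
 have "is_interval {x. y < f x}"
  unfolding is_interval_1 using assms by (auto simp: mono_def intro: less_le_trans)
 then show "{x \<in> space borel. y < f x} \<in> sets borel"
  using real_interval_borel_measurable by simp
qed

lemma lint_mono: "x \<le> y \<Longrightarrow> lint f x \<le> lint f y"
 unfolding lint_def by (intro nn_integral_mono) (auto simp: indicator_def)

lemma rint_antimono: "x \<le> y \<Longrightarrow> rint f y \<le> rint f x"
 unfolding rint_def by (intro nn_integral_mono) (auto simp: indicator_def)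

lemma lint_measurable [measurable]: "lint f \<in> borel_measurable borel"
 by (rule mono_borel_measurable) (auto intro!: monoI lint_mono)

lemma rint_measurable [measurable]: "rint f \<in> borel_measurable borel"
 by (rule antimono_borel_measurable) (auto intro!: antimonoI rint_antimono)

lemma lint_ge:
 assumes "antimono f" "0 < x" shows "ennreal x * f x \<le> lint f x"
proof -
 have "ennreal x * f x = nnl {0<..<x} (\<lambda>t. f x)"
  using assms(2) by (simp add: nn_integral_cmult_indicator mult.commute)
 also have "\<dots> \<le> lint f x"
  unfolding lint_def by (intro nn_integral_mono) (auto simp: indicator_def intro: antimonoD[OF assms(1)])
 finally show ?thesis .
qed

text \<open>These are the properties that the rearrangement of an integrable function has; they make
  \<open>lint F\<close> finite and F finite on the open half-line.\<close>

definition admissible :: "(real \<Rightarrow> ennreal) \<Rightarrow> bool" where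
 "admissible F \<longleftrightarrow> antimono F \<and> nnl {0<..} F < \<top>"

lemma admissibleD:
 assumes "admissible F"
 shows "antimono F" "F \<in> borel_measurable borel" "lint F x < \<top>" "0 < x \<Longrightarrow> F x < \<top>"
proof -
 show a: "antimono F" using assms by (simp add: admissible_def)
 then show "F \<in> borel_measurable borel" by measurable
 have "lint F x \<le> nnl {0<..} F" for x
  unfolding lint_def by (intro nn_integral_mono) (auto simp: indicator_def)
 then show l: "lint F x < \<top>" for x using assms by (auto simp: admissible_def intro: le_less_trans)
 show "F x < \<top>" if "0 < x"
 proof (rule ccontr)
  assume "\<not> F x < \<top>"
  then have "F x = \<top>" using less_top by blast
  then have "ennreal x * F x = \<top>" using that by (simp add: ennreal_mult_top)
  then show False using lint_ge[OF a that] l[of x] by (simp add: top_unique)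
 qed
qed

lemma ennreal_add_powe_2: "(x + y) powe 2 \<le> 2 * (x powe 2 + y powe 2)"
proof (cases "x = \<top> \<or> y = \<top>")
 case True
 then show ?thesis by (auto simp: ennreal_mult_top)
next
 case False
 then obtain a b where ab: "x = ennreal a" "y = ennreal b" "0 \<le> a" "0 \<le> b"
  by (metis ennreal_cases)
 have "(a + b) * (a + b) \<le> 2 * (a * a + b * b)"
  using sum_squares_bound[of a b] by (simp add: power2_eq_square algebra_simps)
 then have "ennreal ((a + b) * (a + b)) \<le> ennreal (2 * (a * a + b * b))" by (rule ennreal_leI)
 moreover have "(x + y) powe 2 = ennreal ((a + b) * (a + b))"
  unfolding powe_2 using ab by (simp only: ennreal_plus[symmetric] ennreal_mult add_nonneg_nonneg)
 moreover have "2 * (x powe 2 + y powe 2) = ennreal (2 * (a * a + b * b))"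
  unfolding powe_2 using ab by (simp add: ennreal_mult)
 ultimately show ?thesis by (simp only:)
qed

lemma ennreal_powe_2: "0 \<le> x \<Longrightarrow> ennreal x powe 2 = ennreal (x\<^sup>2)"
 by (simp add: powe_2 power2_eq_square ennreal_mult)

text \<open>The splitting of \<open>f\<close> at height \<open>F (1/z)\<close> combines the trivial bounds of the Fourier transform
 from \<open>L\<^sup>1\<close> to \<open>L\<^sup>\<infinity>\<close> and from \<open>L\<^sup>2\<close> to \<open>L\<^sup>2\<close>.\<close>

lemma FT_rearrangement_square:
 fixes f :: "real ^ 'n \<Rightarrow> complex"
 assumes f: "integrable lborel f"
  and F: "is_rearrangement lebesgue (\<lambda>x. ennreal (norm (f x))) F"
  and G: "is_rearrangement lebesgue (\<lambda>x. ennreal (norm (FT f x))) G"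
  and F': "admissible F" and z: "0 < z"
 shows "lint (\<lambda>t. G t powe 2) z \<le> 4 * (ennreal z * lint F (1 / z) powe 2) + 2 * rint (\<lambda>t. F t powe 2) (1 / z)"
proof -
 interpret L: sigma_finite_measure "lebesgue :: (real ^ 'n) measure" by (rule sigma_finite_lebesgue)
 have [measurable]: "f \<in> borel_measurable borel" using borel_measurable_integrable[OF f] by simp
 have toL: "g \<in> borel_measurable borel \<Longrightarrow> g \<in> borel_measurable lebesgue" for g :: "real ^ 'n \<Rightarrow> ennreal"
  by (rule measurable_completion) simp
 note [measurable] = is_rearrangementD(2)[OF F] is_rearrangementD(2)[OF G]
 note anti = is_rearrangementD(1)[OF F]
 let ?H = "lint F (1 / z)"
 define c where "c = F (1 / z)"
 have cfin: "c < \<top>" unfolding c_def using admissibleD(4)[OF F'] z by simp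
 then obtain c0 where c0: "c = ennreal c0" "0 \<le> c0" by (cases c) auto
 \<comment> \<open>f is clipped radially at the height c, so that the norm of the excess f1 is
   exactly the positive part of |f| - c. The excess is estimated from L1 to the supremum norm, the
   clipped part by Plancherel.\<close>
 define f2 where "f2 x = (if norm (f x) \<le> c0 then f x else (c0 / norm (f x)) *\<^sub>R f x)" for x
 define f1 where "f1 x = f x - f2 x" for x
 have [measurable]: "f2 \<in> borel_measurable borel" unfolding f2_def[abs_def] by measurable
 have [measurable]: "f1 \<in> borel_measurable borel" unfolding f1_def[abs_def] by measurable
 have nf2: "norm (f2 x) = min (norm (f x)) c0" for x
  using c0(2) by (auto simp: f2_def)
 have nf1: "norm (f1 x) = (if norm (f x) \<le> c0 then 0 else norm (f x) - c0)" for x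
 proof (cases "norm (f x) \<le> c0")
  case False
  then have n0: "norm (f x) > 0" using c0(2) by linarith
  have "f1 x = (1 - c0 / norm (f x)) *\<^sub>R f x" using False by (simp add: f1_def f2_def scaleR_diff_left)
  then have "norm (f1 x) = \<bar>1 - c0 / norm (f x)\<bar> * norm (f x)" by simp
  also have "\<dots> = norm (f x) - c0" using False n0 by (simp add: abs_if field_simps)
  finally show ?thesis using False by simp
 qed (simp add: f1_def f2_def)
 have i2: "integrable lborel f2"
  by (rule Bochner_Integration.integrable_bound[OF f]) (auto simp: nf2)
 have i1: "integrable lborel f1" unfolding f1_def by (intro Bochner_Integration.integrable_diff f i2)
 define A where "A = (\<integral>\<^sup>+x. ennreal (norm (f1 x)) \<partial>lborel)"
 have "A = (\<integral>\<^sup>+x. ennreal (norm (f x)) - c \<partial>lebesgue)"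
  unfolding A_def nn_integral_completion using c0
  by (intro nn_integral_cong) (auto simp: nf1 ennreal_minus ennreal_neg)
 also have "\<dots> = nnl {0<..} (\<lambda>t. F t - c)"
  using cfin by (intro is_rearrangement_integral sigma_finite_lebesgue is_rearrangement_diff[OF F] toL) auto
 also have "\<dots> \<le> ?H" unfolding lint_def
 proof (intro nn_integral_mono)
  fix t :: real
  show "(F t - c) * indicator {0<..} t \<le> F t * indicator {0<..<1 / z} t"
  proof (cases "t < 1 / z")
   case False
   then have "F t \<le> c" unfolding c_def by (intro antimonoD[OF anti]) simp
   then show ?thesis using cfin by (simp add: diff_eq_0_ennreal)
  qed (auto simp: indicator_def)
 qed
 finally have AH: "A \<le> ?H" .
 then have Afin: "A < \<top>" using admissibleD(3)[OF F'] by (rule le_less_trans)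
 \<comment> \<open>An upper bound for the contribution of f1 to |FT f|^2, so whatever exceeds this
   level comes from f2. On (0,z) the level costs \<open>c' * z\<close>, while the excess is
   integrated over the whole half-line.\<close>
 define c' where "c' = 2 * A powe 2"
 have c'fin: "c' < \<top>" using Afin by (simp add: c'_def powe_2 ennreal_mult_less_top)
 have FTf: "ennreal (norm (FT f x)) powe 2 \<le> c' + 2 * ennreal (norm (FT f2 x)) powe 2" for x
 proof -
  have "FT f x = FT f1 x + FT f2 x"
   using FT_add[OF i1 i2, of x] by (simp add: f1_def)
  then have "ennreal (norm (FT f x)) \<le> ennreal (norm (FT f1 x)) + ennreal (norm (FT f2 x))"
   by (simp add: norm_triangle_ineq ennreal_leI flip: ennreal_plus)
  also have "\<dots> \<le> A + ennreal (norm (FT f2 x))"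
   unfolding A_def by (intro add_right_mono norm_FT_le)
  finally have "ennreal (norm (FT f x)) powe 2 \<le> (A + ennreal (norm (FT f2 x))) powe 2"
   by (intro powe_mono) auto
  also have "\<dots> \<le> 2 * (A powe 2 + ennreal (norm (FT f2 x)) powe 2)" by (rule ennreal_add_powe_2)
  finally show ?thesis by (simp add: c'_def distrib_left)
 qed
 have "lint (\<lambda>t. G t powe 2) z \<le> (\<integral>\<^sup>+t. c' * indicator {0<..<z} t + (G t powe 2 - c') * indicator {0<..} t \<partial>lborel)"
  unfolding lint_def
 proof (intro nn_integral_mono)
  fix t :: real
  have "G t powe 2 \<le> c' + (G t powe 2 - c')"
   by (metis add_diff_self_ennreal linorder_le_cases order_refl)
  then show "G t powe 2 * indicator {0<..<z} t \<le> c' * indicator {0<..<z} t + (G t powe 2 - c') * indicator {0<..} t"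
   by (auto simp: indicator_def)
 qed
 also have "\<dots> = c' * ennreal z + nnl {0<..} (\<lambda>t. G t powe 2 - c')"
  using z by (simp add: nn_integral_add nn_integral_cmult_indicator)
 also have "nnl {0<..} (\<lambda>t. G t powe 2 - c') = (\<integral>\<^sup>+x. ennreal (norm (FT f x)) powe 2 - c' \<partial>lebesgue)"
  using c'fin
  by (intro is_rearrangement_integral[symmetric] sigma_finite_lebesgue is_rearrangement_diff is_rearrangement_powe G toL) auto
 also have "\<dots> \<le> (\<integral>\<^sup>+x. 2 * ennreal ((norm (FT f2 x))\<^sup>2) \<partial>lborel)"
  unfolding nn_integral_completion using FTf c'fin
  by (intro nn_integral_mono) (simp add: ennreal_minus_le_iff ennreal_powe_2)
 also have "\<dots> \<le> 2 * (\<integral>\<^sup>+x. ennreal ((norm (f2 x))\<^sup>2) \<partial>lborel)"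
  by (subst nn_integral_cmult) (auto intro!: mult_left_mono Plancherel_le[OF i2])
 also have "(\<integral>\<^sup>+x. ennreal ((norm (f2 x))\<^sup>2) \<partial>lborel) = (\<integral>\<^sup>+x. (min (ennreal (norm (f x))) c) powe 2 \<partial>lebesgue)"
  unfolding nn_integral_completion using c0
  by (intro nn_integral_cong) (simp add: nf2 ennreal_powe_2[symmetric] min_def ennreal_le_iff)
 also have "\<dots> = nnl {0<..} (\<lambda>t. min (F t) c powe 2)"
  by (intro is_rearrangement_integral sigma_finite_lebesgue is_rearrangement_powe is_rearrangement_min F toL) auto
 also have "\<dots> \<le> (\<integral>\<^sup>+t. c powe 2 * indicator {0<..1 / z} t + F t powe 2 * indicator {1 / z<..} t \<partial>lborel)"
  by (intro nn_integral_mono) (auto simp: indicator_def intro!: powe_mono)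
 also have "\<dots> = c powe 2 * ennreal (1 / z) + rint (\<lambda>t. F t powe 2) (1 / z)"
  using z by (simp add: nn_integral_add nn_integral_cmult_indicator rint_def)
 \<comment> \<open>The plateau of the clipped function on (0,1/z] is absorbed by the first term, as
   F(1/z)/z is at most the integral of F over (0,1/z).\<close>
 also have "c powe 2 * ennreal (1 / z) \<le> ennreal z * ?H powe 2"
 proof -
  have "c powe 2 * ennreal (1 / z) = ennreal z * (ennreal (1 / z) * F (1 / z)) powe 2"
   using z c0 by (simp add: c_def[symmetric] powe_2 mult_ac flip: ennreal_mult)
  also have "\<dots> \<le> ennreal z * ?H powe 2"
   using z by (intro mult_left_mono powe_mono lint_ge anti) auto
  finally show ?thesis .
 qed
 also have "c' * ennreal z \<le> 2 * (ennreal z * ?H powe 2)"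
  unfolding c'_def using powe_mono[OF _ AH, of 2] by (simp add: mult_ac mult_left_mono)
 finally have "lint (\<lambda>t. G t powe 2) z \<le> 2 * (ennreal z * ?H powe 2) + 2 * (ennreal z * ?H powe 2 + rint (\<lambda>t. F t powe 2) (1 / z))"
  by (simp add: add_mono mult_left_mono)
 also have "\<dots> = (2 + 2) * (ennreal z * ?H powe 2) + 2 * rint (\<lambda>t. F t powe 2) (1 / z)"
  by (simp only: distrib_left distrib_right add.assoc)
 finally show ?thesis by simp
qed

text \<open>F(y)^2 is the integral of y F(y)^2 over t in (0,1/y), and y F(y) is at most
  \<open>lint F y\<close>. Tonelli then collects, for each t < z, at most the square of
  \<open>lint F (1 / t)\<close>.\<close>

lemma rint_square_le:
 assumes F: "admissible F" and z: "0 < z"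
 shows "rint (\<lambda>t. F t powe 2) (1 / z) \<le> lint (\<lambda>t. lint F (1 / t) powe 2) z"
proof -
 note [measurable] = admissibleD(2)[OF F]
 have lo: "(\<integral>\<^sup>+y. ennreal y * F y powe 2 * indicator {y. 0 < y \<and> y < 1 / t} y \<partial>lborel) \<le> lint F (1 / t) powe 2" if t: "0 < t" for t
 proof -
  have "(\<integral>\<^sup>+y. ennreal y * F y powe 2 * indicator {y. 0 < y \<and> y < 1 / t} y \<partial>lborel) \<le> (\<integral>\<^sup>+y. lint F (1 / t) * (F y * indicator {0<..<1 / t} y) \<partial>lborel)"
  proof (intro nn_integral_mono)
   fix y :: real
   have "ennreal y * F y \<le> lint F (1 / t)" if "0 < y" "y < 1 / t"
    using lint_ge[OF admissibleD(1)[OF F] that(1)] lint_mono[of y "1/t" F] that by (auto intro: order_trans)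
   then show "ennreal y * F y powe 2 * indicator {y. 0 < y \<and> y < 1 / t} y \<le> lint F (1 / t) * (F y * indicator {0<..<1 / t} y)"
    by (auto simp: indicator_def powe_2 mult.assoc[symmetric] intro!: mult_right_mono)
  qed
  also have "\<dots> = lint F (1 / t) powe 2"
   by (simp add: nn_integral_cmult powe_2) (simp add: lint_def)
  finally show ?thesis .
 qed
 have "rint (\<lambda>t. F t powe 2) (1 / z) \<le> (\<integral>\<^sup>+y. \<integral>\<^sup>+t. ennreal y * F y powe 2 * indicator {y. 0 < y \<and> y < 1 / t} y * indicator {0<..<z} t \<partial>lborel \<partial>lborel)"
  unfolding rint_def
 proof (intro nn_integral_mono)
  fix y :: real
  show "F y powe 2 * indicator {1 / z<..} y \<le> (\<integral>\<^sup>+t. ennreal y * F y powe 2 * indicator {y. 0 < y \<and> y < 1 / t} y * indicator {0<..<z} t \<partial>lborel)"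
  proof (cases "1 / z < y")
   case True
   then have y: "0 < y" using z by (meson less_trans zero_less_divide_1_iff)
   have "1 / y \<le> z" using True y z by (simp add: field_simps)
   then have "(\<integral>\<^sup>+t. ennreal y * F y powe 2 * indicator {0<..<1 / y} t \<partial>lborel) \<le> (\<integral>\<^sup>+t. ennreal y * F y powe 2 * indicator {y. 0 < y \<and> y < 1 / t} y * indicator {0<..<z} t \<partial>lborel)"
   proof (intro nn_integral_mono)
    fix t :: real
    have "t < z \<and> y < 1 / t" if "0 < t" "t < 1 / y"
     using that y less_le_trans[OF that(2) \<open>1 / y \<le> z\<close>] by (simp add: pos_less_divide_eq mult.commute)
    then show "ennreal y * F y powe 2 * indicator {0<..<1 / y} t \<le> ennreal y * F y powe 2 * indicator {y. 0 < y \<and> y < 1 / t} y * indicator {0<..<z} t"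
     using y by (auto simp: indicator_def)
   qed
   moreover have "(\<integral>\<^sup>+t. ennreal y * F y powe 2 * indicator {0<..<1 / y} t \<partial>lborel) = ennreal y * F y powe 2 * ennreal (1 / y)"
    using y by (simp add: nn_integral_cmult_indicator)
   moreover have "ennreal y * F y powe 2 * ennreal (1 / y) = F y powe 2 * ennreal (y * (1 / y))"
    using y by (simp only: mult_ac ennreal_mult less_imp_le zero_le_divide_1_iff)
   ultimately show ?thesis using True y by simp
  qed simp
 qed
 also have "\<dots> = (\<integral>\<^sup>+t. \<integral>\<^sup>+y. ennreal y * F y powe 2 * indicator {y. 0 < y \<and> y < 1 / t} y * indicator {0<..<z} t \<partial>lborel \<partial>lborel)"
  by (intro lborel_pair.Fubini') simp
 also have "\<dots> \<le> lint (\<lambda>t. lint F (1 / t) powe 2) z"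
  unfolding lint_def[of "\<lambda>t. lint F (1 / t) powe 2"]
 proof (intro nn_integral_mono)
  fix t :: real
  show "(\<integral>\<^sup>+y. ennreal y * F y powe 2 * indicator {y. 0 < y \<and> y < 1 / t} y * indicator {0<..<z} t \<partial>lborel) \<le> lint F (1 / t) powe 2 * indicator {0<..<z} t"
   using lo[of t] by (cases "t \<in> {0<..<z}") auto
 qed
 finally show ?thesis .
qed

text \<open>\<open>lint F (1 / t)\<close> decreases in t, so z times its square at z is at most the
  integral of the square over (0,z). With \<open>rint_square_le\<close> for the second term the
  constants 4 and 2 add up to 6.\<close>

lemma FT_rearrangement_majorized:
 fixes f :: "real ^ 'n \<Rightarrow> complex"
 assumes f: "integrable lborel f"
  and F: "is_rearrangement lebesgue (\<lambda>x. ennreal (norm (f x))) F"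
  and G: "is_rearrangement lebesgue (\<lambda>x. ennreal (norm (FT f x))) G"
  and F': "admissible F" and z: "0 < z"
 shows "lint (\<lambda>t. G t powe 2) z \<le> lint (\<lambda>t. 6 * lint F (1 / t) powe 2) z"
proof -
 have "ennreal z * lint F (1 / z) powe 2 = nnl {0<..<z} (\<lambda>t. lint F (1 / z) powe 2)"
  using z by (subst nn_integral_cmult_indicator) (auto simp: mult.commute)
 also have "\<dots> \<le> lint (\<lambda>t. lint F (1 / t) powe 2) z"
  unfolding lint_def[of "\<lambda>t. lint F (1 / t) powe 2"] using z
  by (intro nn_integral_mono) (auto simp: indicator_def field_simps intro!: powe_mono lint_mono)
 finally have 1: "ennreal z * lint F (1 / z) powe 2 \<le> lint (\<lambda>t. lint F (1 / t) powe 2) z" .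
 have "lint (\<lambda>t. G t powe 2) z \<le> 4 * (ennreal z * lint F (1 / z) powe 2) + 2 * rint (\<lambda>t. F t powe 2) (1 / z)"
  by (rule FT_rearrangement_square[OF assms])
 also have "\<dots> \<le> 4 * lint (\<lambda>t. lint F (1 / t) powe 2) z + 2 * lint (\<lambda>t. lint F (1 / t) powe 2) z"
  by (intro add_mono mult_left_mono 1 rint_square_le[OF F' z]) auto
 also have "\<dots> = (4 + 2) * lint (\<lambda>t. lint F (1 / t) powe 2) z" by (simp only: distrib_right)
 also have "\<dots> = lint (\<lambda>t. 6 * lint F (1 / t) powe 2) z"
  unfolding lint_def[of "\<lambda>t. 6 * _ t"] lint_def[of "\<lambda>t. lint F (1 / t) powe 2"]
  by (simp add: mult.assoc nn_integral_cmult)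
 finally show ?thesis .
qed

text \<open>A power of x on the right is absorbed into the left side; for x = \<top> the division
  would be impossible.\<close>

lemma ennreal_powe_cancel:
 assumes "x \<le> c * (y powe \<alpha> * x powe (1 - \<alpha>))" "x < \<top>" "0 < \<alpha>" "\<alpha> \<le> 1"
 shows "x \<le> c powe (1 / \<alpha>) * y"
proof (cases "x = 0")
 case False
 have "x powe \<alpha> \<le> c * y powe \<alpha>"
 proof (cases "\<alpha> = 1")
  case False
  then have a: "0 < 1 - \<alpha>" using assms(4) by simp
  have f: "x powe (1 - \<alpha>) \<noteq> 0" "x powe (1 - \<alpha>) < \<top>"
   using a \<open>x \<noteq> 0\<close> assms(2) by (auto simp: powe_eq_0_iff powe_less_top_iff)
  have "x powe (1 - \<alpha>) * x powe \<alpha> = x"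
   using powe_add[of "1 - \<alpha>" \<alpha> x] a assms(3) by simp
  with assms(1) have "x powe (1 - \<alpha>) * x powe \<alpha> \<le> x powe (1 - \<alpha>) * (c * y powe \<alpha>)"
   by (simp add: mult_ac)
  then show ?thesis using f ennreal_mult_le_mult_iff by (metis less_top)
 qed (use assms in simp)
 then have "(x powe \<alpha>) powe (1 / \<alpha>) \<le> (c * y powe \<alpha>) powe (1 / \<alpha>)"
  using assms(3) by (intro powe_mono) auto
 then show ?thesis using assms(3) by (simp add: powe_powe powe_mult)
qed simp

text \<open>With the non-increasing weight \<rho> = G^(q-2) v, majorization bounds the integral of
  G^q v by that of H^2 G^(q-2) v, and Hoelder with exponent q/2 leaves a power of the left side that
  is absorbed.\<close>

lemma majorization_power:
 fixes G H u :: "real \<Rightarrow> ennreal"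
 assumes q: "2 \<le> q" and G: "antimono G" "B < \<top>" "\<And>t. 0 < t \<Longrightarrow> G t \<le> B"
  and [measurable]: "H \<in> borel_measurable borel" and u: "antimono u"
  and le: "\<And>z. 0 < z \<Longrightarrow> lint (\<lambda>t. G t powe 2) z \<le> lint (\<lambda>t. c * H t powe 2) z"
 shows "nnl {0<..} (\<lambda>t. G t powe q * u t) \<le> c powe (q / 2) * nnl {0<..} (\<lambda>t. H t powe q * u t)"
proof -
 note [measurable] = antimono_borel_measurable[OF G(1)] antimono_borel_measurable[OF u]
 \<comment> \<open>Truncations of u in height and support; together with the bound B on G they make
   the quantity to be absorbed finite.\<close>
 define v where "v N t = min (u t) (of_nat N) * indicator {..real N} t" for N :: nat and t
 have v: "antimono (v N)" for N
  unfolding v_def by (auto simp: antimono_def indicator_def intro: min.coboundedI1 antimonoD[OF u])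
 note [measurable] = antimono_borel_measurable[OF v]
 have vu: "v N t \<le> u t" for N t unfolding v_def by (auto simp: indicator_def)
 have SUPv: "(SUP N. v N t) = u t" for t
 proof (rule antisym)
  show "(SUP N. v N t) \<le> u t" by (intro SUP_least vu)
  obtain N0 :: nat where N0: "t \<le> real N0" using real_arch_simple by blast
  show "u t \<le> (SUP N. v N t)"
  proof (rule ccontr)
   assume "\<not> u t \<le> (SUP N. v N t)"
   then have *: "(SUP N. v N t) < u t" by simp
   then obtain b where b: "(SUP N. v N t) < b" "b < u t" using dense by auto
   then have "b < \<top>" by (meson less_le_trans top_greatest)
   then obtain N1 :: nat where N1: "b < of_nat N1" using ennreal_Ex_less_of_nat by blast
   have "v (max N0 N1) t = min (u t) (of_nat (max N0 N1))" using N0 by (simp add: v_def)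
   moreover have "b \<le> of_nat (max N0 N1)" using N1 by (meson less_imp_le max.cobounded2 of_nat_mono order_trans)
   ultimately have "b \<le> v (max N0 N1) t" using b(2) by auto
   also have "\<dots> \<le> (SUP N. v N t)" by (rule SUP_upper) simp
   finally show False using b(1) by simp
  qed
 qed
 have vmono: "v N t \<le> v (Suc N) t" for N t
  unfolding v_def by (auto simp: indicator_def intro!: min.coboundedI2 add_increasing)
 have main: "nnl {0<..} (\<lambda>t. G t powe q * v N t) \<le> c powe (q / 2) * nnl {0<..} (\<lambda>t. H t powe q * u t)" for N
 proof -
  define \<rho> where "\<rho> t = G t powe (q - 2) * v N t" for t
  have \<rho>: "antimono \<rho>"
   unfolding \<rho>_def using q by (intro antimonoI mult_mono powe_mono antimonoD[OF G(1)] antimonoD[OF v]) auto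
  define X where "X = nnl {0<..} (\<lambda>t. G t powe q * v N t)"
  define Y where "Y = nnl {0<..} (\<lambda>t. H t powe q * v N t)"
  have Xfin: "X < \<top>"
  proof -
   have "X \<le> (\<integral>\<^sup>+t. (B powe q * of_nat N) * indicator {0<..real N} t \<partial>lborel)"
    unfolding X_def
   proof (intro nn_integral_mono)
    fix t :: real
    show "G t powe q * v N t * indicator {0<..} t \<le> (B powe q * of_nat N) * indicator {0<..real N} t"
     using G(3)[of t] q by (auto simp: v_def indicator_def intro!: mult_mono powe_mono)
   qed
   also have "\<dots> = B powe q * of_nat N * ennreal (real N)" by (simp add: nn_integral_cmult_indicator)
   also have "\<dots> < \<top>" using G(2) q by (simp add: ennreal_mult_less_top powe_less_top_iff of_nat_less_top)
   finally show ?thesis .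
  qed
  have eq: "x powe q = x powe 2 * x powe (q - 2)" for x
   using powe_add[of 2 "q - 2" x] q by simp
  have "X = nnl {0<..} (\<lambda>t. G t powe 2 * \<rho> t)"
   unfolding X_def \<rho>_def eq by (simp add: mult_ac)
  also have "\<dots> \<le> nnl {0<..} (\<lambda>t. (c * H t powe 2) * \<rho> t)"
   by (rule Hardy_majorization[OF _ _ _ \<rho>]) (use le in \<open>auto simp: lint_def\<close>)
  also have "\<dots> = c * nnl {0<..} (\<lambda>t. H t powe 2 * \<rho> t)"
   using antimono_borel_measurable[OF \<rho>] by (simp add: mult.assoc nn_integral_cmult)
  also have "nnl {0<..} (\<lambda>t. H t powe 2 * \<rho> t) \<le> Y powe (2 / q) * X powe (1 - 2 / q)"
  proof (cases "q = 2")
   case True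
   then show ?thesis by (simp add: \<rho>_def Y_def)
  next
   case False
   then have q2: "2 < q" using q by simp
   let ?f = "\<lambda>t. H t powe q * v N t * indicator {0<..} t" and ?g = "\<lambda>t. G t powe q * v N t * indicator {0<..} t"
   have i: "indicator {0<..} t powe a = (indicator {0<..} t :: ennreal)" if "0 < a" for a and t :: real
    using that by (auto simp: indicator_def)
   have "H t powe 2 * \<rho> t * indicator {0<..} t = ?f t powe (2/q) * ?g t powe (1 - 2/q)" for t
   proof -
    have "?f t powe (2/q) * ?g t powe (1 - 2/q) = H t powe 2 * G t powe (q - 2) * (v N t powe (2/q) * v N t powe (1 - 2/q)) * (indicator {0<..} t * indicator {0<..} t)"
     using q2 i[of "2/q"] i[of "1 - 2/q"] by (simp add: powe_mult powe_powe mult_ac right_diff_distrib)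
    also have "v N t powe (2/q) * v N t powe (1 - 2/q) = v N t"
     using q2 powe_add[of "2/q" "1 - 2/q" "v N t"] by simp
    finally show ?thesis by (auto simp: \<rho>_def indicator_def mult.assoc)
   qed
   then have "nnl {0<..} (\<lambda>t. H t powe 2 * \<rho> t) = (\<integral>\<^sup>+t. ?f t powe (2/q) * ?g t powe (1 - 2/q) \<partial>lborel)" by simp
   also have "\<dots> \<le> Y powe (2/q) * X powe (1 - 2/q)"
    unfolding X_def Y_def using q2 by (intro nn_integral_Hoelder) auto
   finally show ?thesis .
  qed
  finally have "X \<le> c * (Y powe (2 / q) * X powe (1 - 2 / q))" by (simp add: mult_left_mono)
  then have "X \<le> c powe (1 / (2 / q)) * Y" using q Xfin by (intro ennreal_powe_cancel) auto
  also have "\<dots> \<le> c powe (q / 2) * nnl {0<..} (\<lambda>t. H t powe q * u t)"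
   unfolding Y_def using vu by (auto intro!: mult_left_mono nn_integral_mono mult_right_mono)
  finally show ?thesis unfolding X_def .
 qed
 have "nnl {0<..} (\<lambda>t. G t powe q * u t) = (\<integral>\<^sup>+t. (SUP N. G t powe q * v N t * indicator {0<..} t) \<partial>lborel)"
  by (intro nn_integral_cong) (simp add: SUP_mult_left_ennreal SUP_mult_right_ennreal SUPv flip: SUPv)
 also have "\<dots> = (SUP N. \<integral>\<^sup>+t. G t powe q * v N t * indicator {0<..} t \<partial>lborel)"
  using vmono by (intro nn_integral_monotone_convergence_SUP) (auto intro!: incseq_SucI le_funI mult_mono)
 also have "\<dots> \<le> c powe (q / 2) * nnl {0<..} (\<lambda>t. H t powe q * u t)"
  by (intro SUP_least main)
 finally show ?thesis .
qed

section \<open>Reduction to inequalities for non-increasing functions\<close>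

definition fourier_ineq :: "real \<Rightarrow> real \<Rightarrow> (real ^ 'n \<Rightarrow> ennreal) \<Rightarrow> (real ^ 'n \<Rightarrow> ennreal) \<Rightarrow> bool" where
 "fourier_ineq p q U W \<longleftrightarrow> (\<exists>C<\<infinity>. \<forall>f :: real ^ 'n \<Rightarrow> complex. integrable lebesgue f \<longrightarrow>
   (\<integral>\<^sup>+y. ennreal (norm (fourier f y) powr q) * U y \<partial>lebesgue) powe (1 / q)
    \<le> C * (\<integral>\<^sup>+x. ennreal (norm (f x) powr p) * W x \<partial>lebesgue) powe (1 / p))"

text \<open>With \<kappa> the rearrangement of 1/W this is the p-th power of the norm of F with
  weight w.\<close>

definition wnorm :: "real \<Rightarrow> (real \<Rightarrow> ennreal) \<Rightarrow> (real \<Rightarrow> ennreal) \<Rightarrow> ennreal" where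
 "wnorm p \<kappa> F = nnl {0<..} (\<lambda>t. F t powe p * inverse (\<kappa> t))"

text \<open>Stated for q-th powers, so that no outer roots are carried along. Only F of finite norm
  are tested, which forces F to vanish almost everywhere where \<kappa> does.\<close>

definition hardy_ineq :: "real \<Rightarrow> real \<Rightarrow> (real \<Rightarrow> ennreal) \<Rightarrow> (real \<Rightarrow> ennreal) \<Rightarrow> bool" where
 "hardy_ineq p q u \<kappa> \<longleftrightarrow> (\<exists>C<\<top>. \<forall>F. admissible F \<longrightarrow> wnorm p \<kappa> F < \<top> \<longrightarrow>
   nnl {0<..} (\<lambda>x. lint F (1 / x) powe q * u x) \<le> C * wnorm p \<kappa> F powe (q / p))"

text \<open>The function to be integrated is the second term of
  \<open>FT_rearrangement_square\<close>, divided by the point and raised to the power q/2.\<close>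

definition tail_ineq :: "real \<Rightarrow> real \<Rightarrow> (real \<Rightarrow> ennreal) \<Rightarrow> (real \<Rightarrow> ennreal) \<Rightarrow> bool" where
 "tail_ineq p q u \<kappa> \<longleftrightarrow> (\<exists>C<\<top>. \<forall>F. admissible F \<longrightarrow> wnorm p \<kappa> F < \<top> \<longrightarrow>
   nnl {0<..} (\<lambda>x. rint (\<lambda>t. F t powe 2) (1 / x) powe (q / 2) * (ennreal (x powr (- q / 2)) * u x))
    \<le> C * wnorm p \<kappa> F powe (q / p))"

lemma ennreal_norm_powe: "0 < a \<Longrightarrow> ennreal (norm x powr a) = ennreal (norm x) powe a"
 by (subst ennreal_powe) auto

lemma fourier_ineqI:
 fixes U W :: "real ^ 'n \<Rightarrow> ennreal"
 assumes pq: "0 < p" "0 < q" and C: "C < \<top>"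
  and *: "\<And>f g. integrable lebesgue f \<Longrightarrow> integrable lborel g \<Longrightarrow> g \<in> borel_measurable borel \<Longrightarrow>
   AE x in lebesgue. f x = g x \<Longrightarrow>
   (\<integral>\<^sup>+x. ennreal (norm (f x)) powe p * W x \<partial>lebesgue) < \<top> \<Longrightarrow>
   (\<integral>\<^sup>+y. ennreal (norm (FT g y)) powe q * U y \<partial>lebesgue)
    \<le> C * (\<integral>\<^sup>+x. ennreal (norm (f x)) powe p * W x \<partial>lebesgue) powe (q / p)"
 shows "fourier_ineq p q U W"
 unfolding fourier_ineq_def
\<comment> \<open>The summand 1 keeps the constant positive: if the norm on the right is infinite, a
  constant 0 would make the product 0.\<close>
proof (intro exI[of _ "C powe (1 / q) + 1"] conjI allI impI)
 show "C powe (1 / q) + 1 < \<infinity>" using C pq by (simp add: powe_less_top_iff)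
 fix f :: "real ^ 'n \<Rightarrow> complex" assume f: "integrable lebesgue f"
 obtain g where g: "integrable lborel g" "g \<in> borel_measurable borel" "AE x in lebesgue. f x = g x"
  using lebesgue_integrable_Borel_version[OF f] .
 let ?M = "\<integral>\<^sup>+x. ennreal (norm (f x)) powe p * W x \<partial>lebesgue"
 have "(\<integral>\<^sup>+y. ennreal (norm (FT g y)) powe q * U y \<partial>lebesgue) powe (1 / q) \<le> (C powe (1 / q) + 1) * ?M powe (1 / p)"
 proof (cases "?M < \<top>")
  case True
  have "(\<integral>\<^sup>+y. ennreal (norm (FT g y)) powe q * U y \<partial>lebesgue) powe (1 / q) \<le> (C * ?M powe (q / p)) powe (1 / q)"
   using pq by (intro powe_mono *[OF f g True]) auto
  also have "\<dots> = C powe (1 / q) * ?M powe (1 / p)" using pq by (simp add: powe_mult powe_powe)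
  finally show ?thesis by (rule order_trans) (intro mult_right_mono, auto)
 next
  case False
  then have "?M = \<top>" using less_top by blast
  then have "?M powe (1 / p) = \<top>" using pq by (simp only: powe_eq_top_iff zero_less_divide_1_iff)
  moreover have "C powe (1 / q) + 1 \<noteq> 0" by simp
  ultimately have "(C powe (1 / q) + 1) * ?M powe (1 / p) = \<top>" by (simp only: ennreal_mult_top if_False)
  then show ?thesis by (simp only: top_greatest)
 qed
 then show "(\<integral>\<^sup>+y. ennreal (norm (fourier f y) powr q) * U y \<partial>lebesgue) powe (1 / q)
    \<le> (C powe (1 / q) + 1) * (\<integral>\<^sup>+x. ennreal (norm (f x) powr p) * W x \<partial>lebesgue) powe (1 / p)"
  using pq by (simp only: fourier_eq_FT[OF f g(2,3)] ennreal_norm_powe)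
qed

lemma ennreal_inverse_inverse [simp]: "inverse (inverse x) = (x :: ennreal)"
 by (cases x rule: powe_cases) (auto simp: inverse_ennreal)

lemma borel_lebesgue: "g \<in> borel_measurable borel \<Longrightarrow> g \<in> borel_measurable lebesgue"
 by (rule measurable_completion) simp

text \<open>\<open>Hardy_Littlewood_reverse\<close> for Z = 1/W; the finiteness of the superlevel
  sets is Markov's inequality for the integrable g.\<close>

lemma rearrangement_norm:
 fixes f g :: "real ^ 'n \<Rightarrow> complex"
 assumes g: "integrable lborel g" "g \<in> borel_measurable borel" "AE x in lebesgue. f x = g x"
  and [measurable]: "W \<in> borel_measurable lebesgue"
  and \<kappa>: "is_rearrangement lebesgue (\<lambda>x. inverse (W x)) \<kappa>" and p: "0 < p"
 defines "F \<equiv> rearrangement lebesgue (\<lambda>x. ennreal (norm (g x)))"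
 shows "is_rearrangement lebesgue (\<lambda>x. ennreal (norm (g x))) F" "admissible F"
  "wnorm p \<kappa> F \<le> (\<integral>\<^sup>+x. ennreal (norm (f x)) powe p * W x \<partial>lebesgue)"
proof -
 have gm [measurable]: "(\<lambda>x. ennreal (norm (g x))) \<in> borel_measurable lebesgue"
  using g(2) by (intro borel_lebesgue) simp
 show F: "is_rearrangement lebesgue (\<lambda>x. ennreal (norm (g x))) F"
  unfolding F_def by (rule is_rearrangement_rearrangement[OF gm])
 have fin: "(\<integral>\<^sup>+x. ennreal (norm (g x)) \<partial>lebesgue) < \<top>"
  using g(1) by (simp add: nn_integral_completion integrable_iff_bounded)
 then show "admissible F"
  using is_rearrangement_integral[OF sigma_finite_lebesgue gm F] is_rearrangementD(1)[OF F] by (simp add: admissible_def)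
 have "wnorm p \<kappa> F \<le> (\<integral>\<^sup>+x. ennreal (norm (g x)) powe p * inverse (inverse (W x)) \<partial>lebesgue)"
  unfolding wnorm_def
 proof (rule Hardy_Littlewood_reverse[OF sigma_finite_lebesgue _ _ is_rearrangement_powe[OF F p] \<kappa>])
  fix l :: real assume l: "0 < l"
  let ?c = "ennreal (l powr (1 / p))"
  have "{x \<in> space lebesgue. ennreal l < ennreal (norm (g x)) powe p} = {x \<in> space lebesgue. ?c < ennreal (norm (g x))}"
   by (simp only: powe_less_iff[OF p] ennreal_powe[OF disjI1[OF l]])
  also have "emeasure lebesgue \<dots> \<le> emeasure lebesgue {x \<in> space lebesgue. 1 \<le> ennreal (1 / l powr (1 / p)) * ennreal (norm (g x))}"
  proof (rule emeasure_mono, safe)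
   fix x assume "?c < ennreal (norm (g x))"
   then have "1 \<le> 1 / l powr (1 / p) * norm (g x)" using l by (simp add: ennreal_less_iff field_simps)
   then have "ennreal 1 \<le> ennreal (1 / l powr (1 / p) * norm (g x))" by (rule ennreal_leI)
   also have "\<dots> = ennreal (1 / l powr (1 / p)) * ennreal (norm (g x))" by (rule ennreal_mult) auto
   finally show "1 \<le> ennreal (1 / l powr (1 / p)) * ennreal (norm (g x))" by (simp only: ennreal_1)
  qed measurable
  also have "\<dots> \<le> ennreal (1 / l powr (1 / p)) * (\<integral>\<^sup>+x. ennreal (norm (g x)) * indicator (space lebesgue) x \<partial>lebesgue)"
   by (rule nn_integral_Markov_inequality) measurable
  also have "(\<integral>\<^sup>+x. ennreal (norm (g x)) * indicator (space lebesgue) x \<partial>lebesgue) = (\<integral>\<^sup>+x. ennreal (norm (g x)) \<partial>lebesgue)"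
   by (intro nn_integral_cong) simp
  also have "ennreal (1 / l powr (1 / p)) * (\<integral>\<^sup>+x. ennreal (norm (g x)) \<partial>lebesgue) < \<top>" using fin by (simp add: ennreal_mult_less_top)
  finally show "emeasure lebesgue {x \<in> space lebesgue. ennreal l < ennreal (norm (g x)) powe p} < \<top>" .
 qed auto
 also have "\<dots> = (\<integral>\<^sup>+x. ennreal (norm (f x)) powe p * W x \<partial>lebesgue)"
  using g(3) by (intro nn_integral_cong_AE) auto
 finally show "wnorm p \<kappa> F \<le> (\<integral>\<^sup>+x. ennreal (norm (f x)) powe p * W x \<partial>lebesgue)" .
qed

text \<open>For q \<ge> 2 the majorization of the squares passes to the power q against u. Otherwise
  only the bound of z G(z)^2 by the integral of G^2 over (0,z) is used, and
  \<open>FT_rearrangement_square\<close> splits it into a Hardy term and a tail term.\<close>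

theorem fourier_ineq_of_hardy:
 fixes U W :: "real ^ 'n \<Rightarrow> ennreal"
 assumes pq: "0 < p" "0 < q"
  and [measurable]: "U \<in> borel_measurable lebesgue" "W \<in> borel_measurable lebesgue"
  and u: "is_rearrangement lebesgue U u"
  and \<kappa>: "is_rearrangement lebesgue (\<lambda>x. inverse (W x)) \<kappa>"
  and H: "hardy_ineq p q u \<kappa>" and T: "2 \<le> q \<or> tail_ineq p q u \<kappa>"
 shows "fourier_ineq p q U W"
proof -
 note [measurable] = is_rearrangementD(2)[OF u] is_rearrangementD(2)[OF \<kappa>]
 obtain C1 where C1: "C1 < \<top>" "\<And>F. admissible F \<Longrightarrow> wnorm p \<kappa> F < \<top> \<Longrightarrow>
   nnl {0<..} (\<lambda>x. lint F (1 / x) powe q * u x) \<le> C1 * wnorm p \<kappa> F powe (q / p)"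
  using H unfolding hardy_ineq_def by blast
 have "\<exists>C<\<top>. \<forall>(f :: real ^ 'n \<Rightarrow> complex) F G. integrable lborel f \<longrightarrow> is_rearrangement lebesgue (\<lambda>x. ennreal (norm (f x))) F \<longrightarrow>
   is_rearrangement lebesgue (\<lambda>x. ennreal (norm (FT f x :: complex))) G \<longrightarrow> admissible F \<longrightarrow> wnorm p \<kappa> F < \<top> \<longrightarrow>
   nnl {0<..} (\<lambda>t. G t powe q * u t) \<le> C * wnorm p \<kappa> F powe (q / p)"
  using T
 proof
  assume q: "2 \<le> q"
  show ?thesis
  proof (intro exI[of _ "6 powe (q / 2) * C1"] conjI allI impI)
   show "6 powe (q / 2) * C1 < \<top>"
    using C1(1) q by (simp add: ennreal_mult_less_top powe_less_top_iff)
   fix f :: "real ^ 'n \<Rightarrow> complex" and F G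
   assume f: "integrable lborel f" and F: "is_rearrangement lebesgue (\<lambda>x. ennreal (norm (f x))) F"
    and G: "is_rearrangement lebesgue (\<lambda>x. ennreal (norm (FT f x :: complex))) G"
    and F': "admissible F" "wnorm p \<kappa> F < \<top>"
   define B where "B = (\<integral>\<^sup>+y. ennreal (norm (f y)) \<partial>lborel)"
   have B: "B < \<top>" using f by (simp add: B_def integrable_iff_bounded)
   \<comment> \<open>FT f is bounded by the L1 norm of f, hence so is its rearrangement;
     \<open>majorization_power\<close> asks for this bound.\<close>
   have GB: "G t \<le> B" if "0 < t" for t
   proof (rule ccontr)
    assume *: "\<not> G t \<le> B"
    have "{x \<in> space lebesgue. B < ennreal (norm (FT f x))} = {}"
     using norm_FT_le[of f] by (auto simp: B_def not_less)
    then have "emeasure lborel {t. 0 < t \<and> B < G t} = 0"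
     using is_rearrangementD(3)[OF G, of B] by simp
    moreover have "emeasure lborel {0<..<t} \<le> emeasure lborel {t. 0 < t \<and> B < G t}"
    proof (rule emeasure_mono)
     note [measurable] = is_rearrangementD(2)[OF G]
     show "{t. 0 < t \<and> B < G t} \<in> sets lborel" by measurable
     show "{0<..<t} \<subseteq> {t. 0 < t \<and> B < G t}"
      using * antimonoD[OF is_rearrangementD(1)[OF G]] by (auto simp: not_le intro: less_le_trans)
    qed
    ultimately show False using that by simp
   qed
   have [measurable]: "F \<in> borel_measurable borel" by (rule admissibleD(2)[OF F'(1)])
   have "nnl {0<..} (\<lambda>t. G t powe q * u t) \<le> 6 powe (q / 2) * nnl {0<..} (\<lambda>t. lint F (1 / t) powe q * u t)"
    by (rule majorization_power[OF q is_rearrangementD(1)[OF G] B GB _ is_rearrangementD(1)[OF u]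
     FT_rearrangement_majorized[OF f F G F'(1)]]) simp_all
   also have "\<dots> \<le> 6 powe (q / 2) * (C1 * wnorm p \<kappa> F powe (q / p))"
    by (intro mult_left_mono C1(2) F') auto
   finally show "nnl {0<..} (\<lambda>t. G t powe q * u t) \<le> 6 powe (q / 2) * C1 * wnorm p \<kappa> F powe (q / p)"
    by (simp add: mult.assoc)
  qed
 next
  assume "tail_ineq p q u \<kappa>"
  then obtain C2 where C2: "C2 < \<top>" "\<And>F. admissible F \<Longrightarrow> wnorm p \<kappa> F < \<top> \<Longrightarrow>
   nnl {0<..} (\<lambda>x. rint (\<lambda>t. F t powe 2) (1 / x) powe (q / 2) * (ennreal (x powr (- q / 2)) * u x))
    \<le> C2 * wnorm p \<kappa> F powe (q / p)"
   unfolding tail_ineq_def by blast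
  define D where "D = ennreal (2 powr (q / 2)) * 4 powe (q / 2)"
  have D: "D < \<top>" using pq by (simp add: D_def ennreal_mult_less_top powe_less_top_iff)
  show ?thesis
  proof (intro exI[of _ "D * (C1 + C2)"] conjI allI impI)
   show "D * (C1 + C2) < \<top>" using D C1(1) C2(1) by (simp add: ennreal_mult_less_top)
   fix f :: "real ^ 'n \<Rightarrow> complex" and F G
   assume f: "integrable lborel f" and F: "is_rearrangement lebesgue (\<lambda>x. ennreal (norm (f x))) F"
    and G: "is_rearrangement lebesgue (\<lambda>x. ennreal (norm (FT f x :: complex))) G"
    and F': "admissible F" "wnorm p \<kappa> F < \<top>"
   have [measurable]: "F \<in> borel_measurable borel" "G \<in> borel_measurable borel"
    by (rule admissibleD(2)[OF F'(1)]) (rule is_rearrangementD(2)[OF G])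
   have pt: "G z powe q \<le> D * (lint F (1 / z) powe q + rint (\<lambda>t. F t powe 2) (1 / z) powe (q / 2) * ennreal (z powr (- q / 2)))" if z: "0 < z" for z
   proof -
    let ?T = "rint (\<lambda>t. F t powe 2) (1 / z)"
    have "ennreal z * G z powe 2 \<le> lint (\<lambda>t. G t powe 2) z"
     by (rule lint_ge[OF _ z]) (auto intro!: antimonoI powe_mono antimonoD[OF is_rearrangementD(1)[OF G]])
    also have "\<dots> \<le> 4 * (ennreal z * lint F (1 / z) powe 2) + 2 * ?T"
     by (rule FT_rearrangement_square[OF f F G F'(1) z])
    finally have "ennreal (1 / z) * (ennreal z * G z powe 2) \<le> ennreal (1 / z) * (4 * (ennreal z * lint F (1 / z) powe 2) + 2 * ?T)"
     by (rule mult_left_mono) simp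
    also have "\<dots> = 4 * (ennreal (1 / z) * ennreal z) * lint F (1 / z) powe 2 + 2 * (?T * ennreal (1 / z))"
     by (simp only: distrib_left mult_ac)
    also have "\<dots> \<le> 4 * lint F (1 / z) powe 2 + 4 * (?T * ennreal (1 / z))"
    proof (rule add_mono)
     show "4 * (ennreal (1 / z) * ennreal z) * lint F (1 / z) powe 2 \<le> 4 * lint F (1 / z) powe 2"
      using z by (simp flip: ennreal_mult)
     show "2 * (?T * ennreal (1 / z)) \<le> 4 * (?T * ennreal (1 / z))" by (rule mult_right_mono) auto
    qed
    also have "ennreal (1 / z) * (ennreal z * G z powe 2) = G z powe 2"
     using z by (simp add: mult.assoc[symmetric] flip: ennreal_mult)
    finally have "(G z powe 2) powe (q / 2) \<le> (4 * (lint F (1 / z) powe 2 + ?T * ennreal (1 / z))) powe (q / 2)"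
     using pq by (intro powe_mono) (auto simp: distrib_left)
    also have "\<dots> = 4 powe (q / 2) * (lint F (1 / z) powe 2 + ?T * ennreal (1 / z)) powe (q / 2)"
     by (rule powe_mult) (use pq in simp)
    also have "\<dots> \<le> 4 powe (q / 2) * (ennreal (2 powr (q / 2)) * ((lint F (1 / z) powe 2) powe (q / 2) + (?T * ennreal (1 / z)) powe (q / 2)))"
     using pq by (intro mult_left_mono powe_add_le) auto
    also have "(?T * ennreal (1 / z)) powe (q / 2) = ?T powe (q / 2) * ennreal (z powr (- q / 2))"
    proof -
     have "(1 / z) powr (q / 2) = z powr (- q / 2)"
      using z powr_minus_divide[of z "q / 2"] by (simp add: powr_divide)
     moreover have "ennreal (1 / z) powe (q / 2) = ennreal ((1 / z) powr (q / 2))"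
      by (rule ennreal_powe) (use z in simp)
     moreover have "(?T * ennreal (1 / z)) powe (q / 2) = ?T powe (q / 2) * ennreal (1 / z) powe (q / 2)"
      by (rule powe_mult) (use pq in simp)
     ultimately show ?thesis by (simp only:)
    qed
    finally show ?thesis using pq by (simp add: powe_powe D_def mult.assoc mult.left_commute)
   qed
   have "nnl {0<..} (\<lambda>t. G t powe q * u t) \<le>
    (\<integral>\<^sup>+z. D * (lint F (1 / z) powe q * u z * indicator {0<..} z + rint (\<lambda>t. F t powe 2) (1 / z) powe (q / 2) * (ennreal (z powr (- q / 2)) * u z) * indicator {0<..} z) \<partial>lborel)"
   proof (intro nn_integral_mono)
    fix z :: real
    show "G z powe q * u z * indicator {0<..} z \<le> D * (lint F (1 / z) powe q * u z * indicator {0<..} z + rint (\<lambda>t. F t powe 2) (1 / z) powe (q / 2) * (ennreal (z powr (- q / 2)) * u z) * indicator {0<..} z)"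
    proof (cases "0 < z")
     case True
     show ?thesis using mult_right_mono[OF pt[OF True], of "u z"] True
      by (simp add: distrib_left distrib_right mult_ac)
    qed simp
   qed
   also have "\<dots> = D * (nnl {0<..} (\<lambda>x. lint F (1 / x) powe q * u x) + nnl {0<..} (\<lambda>x. rint (\<lambda>t. F t powe 2) (1 / x) powe (q / 2) * (ennreal (x powr (- q / 2)) * u x)))"
    by (simp add: nn_integral_cmult nn_integral_add)
   also have "\<dots> \<le> D * (C1 * wnorm p \<kappa> F powe (q / p) + C2 * wnorm p \<kappa> F powe (q / p))"
    by (intro mult_left_mono add_mono C1(2) C2(2) F') auto
   finally show "nnl {0<..} (\<lambda>t. G t powe q * u t) \<le> D * (C1 + C2) * wnorm p \<kappa> F powe (q / p)"
    by (simp add: distrib_left distrib_right mult.assoc)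
  qed
 qed
 then obtain C where C: "C < \<top>" "\<And>(f :: real ^ 'n \<Rightarrow> complex) F G. integrable lborel f \<Longrightarrow> is_rearrangement lebesgue (\<lambda>x. ennreal (norm (f x))) F \<Longrightarrow>
   is_rearrangement lebesgue (\<lambda>x. ennreal (norm (FT f x :: complex))) G \<Longrightarrow> admissible F \<Longrightarrow> wnorm p \<kappa> F < \<top> \<Longrightarrow>
   nnl {0<..} (\<lambda>t. G t powe q * u t) \<le> C * wnorm p \<kappa> F powe (q / p)"
  by blast
 show ?thesis
 proof (rule fourier_ineqI[OF pq C(1)])
  fix f g :: "real ^ 'n \<Rightarrow> complex"
  assume f: "integrable lebesgue f" and g: "integrable lborel g" "g \<in> borel_measurable borel" "AE x in lebesgue. f x = g x"
   and M: "(\<integral>\<^sup>+x. ennreal (norm (f x)) powe p * W x \<partial>lebesgue) < \<top>"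
  define F where "F = rearrangement lebesgue (\<lambda>x. ennreal (norm (g x)))"
  have F: "is_rearrangement lebesgue (\<lambda>x. ennreal (norm (g x))) F" "admissible F"
   "wnorm p \<kappa> F \<le> (\<integral>\<^sup>+x. ennreal (norm (f x)) powe p * W x \<partial>lebesgue)"
   unfolding F_def by (rule rearrangement_norm[OF g _ \<kappa> pq(1)]; simp)+
  have Gm: "(\<lambda>x. ennreal (norm (FT g x))) \<in> borel_measurable lebesgue"
   using FT_measurable[OF g(2)] by (intro borel_lebesgue) simp
  let ?G = "rearrangement lebesgue (\<lambda>x. ennreal (norm (FT g x)))"
  have G: "is_rearrangement lebesgue (\<lambda>x. ennreal (norm (FT g x))) ?G"
   by (rule is_rearrangement_rearrangement[OF Gm])
  have "(\<integral>\<^sup>+y. ennreal (norm (FT g y)) powe q * U y \<partial>lebesgue) \<le> nnl {0<..} (\<lambda>t. ?G t powe q * u t)"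
   using Gm by (intro Hardy_Littlewood[OF sigma_finite_lebesgue _ _ is_rearrangement_powe[OF G pq(2)] u]) auto
  also have "\<dots> \<le> C * wnorm p \<kappa> F powe (q / p)"
   using F M by (intro C(2)[OF g(1) F(1) G F(2)]) auto
  also have "\<dots> \<le> C * (\<integral>\<^sup>+x. ennreal (norm (f x)) powe p * W x \<partial>lebesgue) powe (q / p)"
   using pq by (intro mult_left_mono powe_mono F) auto
  finally show "(\<integral>\<^sup>+y. ennreal (norm (FT g y)) powe q * U y \<partial>lebesgue)
    \<le> C * (\<integral>\<^sup>+x. ennreal (norm (f x)) powe p * W x \<partial>lebesgue) powe (q / p)" .
 qed
qed

section \<open>Duality for the Fourier inequality\<close>

lemma lebesgue_FT_multiplication:
 fixes f g f' g' :: "real ^ 'n \<Rightarrow> complex"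
 assumes f: "integrable lebesgue f" "integrable lborel f'" "f' \<in> borel_measurable borel" "AE x in lebesgue. f x = f' x"
  and g: "integrable lebesgue g" "integrable lborel g'" "g' \<in> borel_measurable borel" "AE x in lebesgue. g x = g' x"
 shows "(LINT x|lebesgue. FT f' x * g x) = (LINT x|lebesgue. f x * FT g' x)"
proof -
 have bl: "h \<in> borel_measurable borel \<Longrightarrow> h \<in> borel_measurable lebesgue" for h :: "real ^ 'n \<Rightarrow> complex"
  by (rule measurable_completion) simp
 note Ff = FT_measurable[OF f(3)] and Fg = FT_measurable[OF g(3)]
 have "(LINT x|lebesgue. FT f' x * g x) = (LINT x|lebesgue. FT f' x * g' x)"
  using g(4) bl[OF Ff] bl[OF g(3)] borel_measurable_integrable[OF g(1)] by (intro integral_cong_AE) auto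
 also have "\<dots> = (LINT x|lborel. FT f' x * g' x)" using Ff g(3) by (intro integral_completion) simp
 also have "\<dots> = (LINT x|lborel. f' x * FT g' x)" by (rule FT_multiplication[OF f(2) g(2)])
 also have "\<dots> = (LINT x|lebesgue. f' x * FT g' x)" using Fg f(3) by (intro integral_completion[symmetric]) simp
 also have "\<dots> = (LINT x|lebesgue. f x * FT g' x)"
  using f(4) bl[OF Fg] bl[OF f(3)] borel_measurable_integrable[OF f(1)] by (intro integral_cong_AE) auto
 finally show ?thesis .
qed

lemma conjugate_gt_1:
 fixes p p' :: real
 assumes "1 < p" "1 / p + 1 / p' = 1" shows "1 < p'"
proof -
 have "1 / p < 1" "0 < 1 / p" using assms(1) by auto
 then have *: "0 < 1 / p'" "1 / p' < 1" using assms(2) by linarith+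
 then have "0 < p'" by simp
 then show ?thesis using *(2) by (simp add: divide_less_eq)
qed

text \<open>The transform h of f is tested against k, the conjugate of h times |h|^(q-2) U, cut off
  to the sets \<open>E N\<close>. The multiplication formula moves the transform to k, Hoelder
  separates f from FT k, and the dual inequality returns a power of the same integral
  \<open>I N\<close>, which is absorbed.\<close>

theorem fourier_ineq_dual:
 fixes U W :: "real ^ 'n \<Rightarrow> ennreal"
 assumes p: "1 < p" "1 / p + 1 / p' = 1" and q: "1 < q" "1 / q + 1 / q' = 1"
  and [measurable]: "U \<in> borel_measurable lebesgue" "W \<in> borel_measurable lebesgue"
  and U: "AE x in lebesgue. U x < \<top>" and W: "AE x in lebesgue. W x \<noteq> 0"
  and dual: "fourier_ineq q' p' (\<lambda>x. inverse (W x) powe (p' - 1)) (\<lambda>x. inverse (U x powe (q' - 1)))"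
 shows "fourier_ineq p q U W"
proof -
 have p': "p' > 1" and q': "q' > 1" using conjugate_gt_1 p q by blast+
 obtain C where C: "C < \<top>" "\<And>f :: real ^ 'n \<Rightarrow> complex. integrable lebesgue f \<Longrightarrow>
   (\<integral>\<^sup>+y. ennreal (norm (fourier f y) powr p') * inverse (W y) powe (p' - 1) \<partial>lebesgue) powe (1 / p')
    \<le> C * (\<integral>\<^sup>+x. ennreal (norm (f x) powr q') * inverse (U x powe (q' - 1)) \<partial>lebesgue) powe (1 / q')"
  using dual unfolding fourier_ineq_def by auto
 show ?thesis
 proof (rule fourier_ineqI)
  show "C powe q < \<top>" using C(1) q by (simp add: powe_less_top_iff)
  fix f g :: "real ^ 'n \<Rightarrow> complex"
  assume f: "integrable lebesgue f" and g: "integrable lborel g" "g \<in> borel_measurable borel" "AE x in lebesgue. f x = g x"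
   and M: "(\<integral>\<^sup>+x. ennreal (norm (f x)) powe p * W x \<partial>lebesgue) < \<top>"
  note fm [measurable] = borel_measurable_integrable[OF f]
  define M where "M = (\<integral>\<^sup>+x. ennreal (norm (f x)) powe p * W x \<partial>lebesgue)"
  define h where "h = FT g"
  have hb: "h \<in> borel_measurable borel" unfolding h_def by (rule FT_measurable[OF g(2)])
  have h [measurable]: "h \<in> borel_measurable lebesgue" by (rule measurable_completion) (simp add: hb)
  obtain B where B: "0 \<le> B" "\<And>x. norm (h x) \<le> B"
  proof -
   have "(\<integral>\<^sup>+y. ennreal (norm (g y)) \<partial>lborel) < \<top>" using g(1) by (simp add: integrable_iff_bounded)
   then obtain B where "0 \<le> B" "(\<integral>\<^sup>+y. ennreal (norm (g y)) \<partial>lborel) = ennreal B"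
    by (cases "(\<integral>\<^sup>+y. ennreal (norm (g y)) \<partial>lborel)") auto
   then show thesis using norm_FT_le[of g] that[of B] by (auto simp: h_def)
  qed
  \<comment> \<open>On \<open>E N\<close> the weight U is at most N and the volume is finite, so
    that k is integrable and \<open>I N\<close> is finite. As U is finite almost everywhere, these
    sets exhaust the space up to a null set.\<close>
  define E where "E N = {x. U x \<le> of_nat N} \<inter> ball 0 (real N)" for N :: nat
  have E [measurable]: "E N \<in> sets lebesgue" for N
  proof -
   have "{x \<in> space lebesgue. U x \<le> of_nat N} \<in> sets lebesgue" by measurable
   moreover have "ball 0 (real N) \<in> sets (lebesgue :: (real ^ 'n) measure)" by simp
   ultimately show ?thesis unfolding E_def by (simp add: sets.Int)
  qed
  have EF: "emeasure lebesgue (E N) < \<top>" for N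
  proof -
   have "emeasure lebesgue (E N) \<le> emeasure lebesgue (ball 0 (real N) :: (real ^ 'n) set)"
    by (intro emeasure_mono) (auto simp: E_def)
   also have "\<dots> < \<top>" using emeasure_lborel_ball_finite[of 0 "real N"] by simp
   finally show ?thesis .
  qed
  define I where "I N = (\<integral>\<^sup>+x. ennreal (norm (h x)) powe q * U x * indicator (E N) x \<partial>lebesgue)" for N
  have IN: "I N \<le> C powe q * M powe (q / p)" for N
  proof -
   define k where "k x = (if x \<in> E N then cnj (h x) * complex_of_real (norm (h x) powr (q - 2) * enn2real (U x)) else 0)" for x
   have km [measurable]: "k \<in> borel_measurable lebesgue" unfolding k_def[abs_def] by measurable
   have UE: "U x = ennreal (enn2real (U x))" "enn2real (U x) \<le> real N" if "x \<in> E N" for x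
   proof -
    have u: "U x \<le> of_nat N" using that by (simp add: E_def)
    also have "\<dots> < \<top>" by (rule of_nat_less_top)
    finally show "U x = ennreal (enn2real (U x))" by simp
    then show "enn2real (U x) \<le> real N" using u by (metis ennreal_of_nat_eq_real_of_nat ennreal_le_iff of_nat_0_le_iff)
   qed
   have pw: "y * y powr (q - 2) = y powr (q - 1)" "y * (y * y powr (q - 2)) = y powr q" if "0 \<le> y" for y :: real
    using that q by (cases "y = 0"; simp add: powr_mult_base)+
   have nk: "norm (k x) = norm (h x) powr (q - 1) * enn2real (U x) * indicator (E N) x" for x
    using pw(1)[of "norm (h x)"] by (auto simp: k_def norm_mult mult.assoc[symmetric])
   have k: "integrable lebesgue k"
   proof (rule Bochner_Integration.integrable_bound)
    show "integrable lebesgue (\<lambda>x. B powr (q - 1) * real N * indicator (E N) x)"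
     using EF[of N] by (intro integrable_mult_right) (auto simp: integrable_indicator_iff less_top)
    show "AE x in lebesgue. norm (k x) \<le> norm (B powr (q - 1) * real N * indicator (E N) x)"
     using UE(2) B q by (auto simp: nk indicator_def intro!: AE_I2 mult_mono powr_mono2)
   qed simp
   obtain k' where k': "integrable lborel k'" "k' \<in> borel_measurable borel" "AE x in lebesgue. k x = k' x"
    using lebesgue_integrable_Borel_version[OF k] .
   let ?K = "FT k'"
   have Km [measurable]: "?K \<in> borel_measurable lebesgue"
    by (rule measurable_completion) (simp add: FT_measurable[OF k'(2)])
   have hk: "h x * k x = complex_of_real (norm (h x) powr q * enn2real (U x) * indicator (E N) x)" for x
   proof (cases "x \<in> E N")
    case True
    have "h x * k x = complex_of_real (norm (h x) * (norm (h x) * norm (h x) powr (q - 2)) * enn2real (U x))"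
     using True complex_norm_square[of "h x"] by (simp add: k_def power2_eq_square mult_ac)
    then show ?thesis using True pw(2)[of "norm (h x)"] by simp
   qed (simp add: k_def)
   have "integrable lebesgue (\<lambda>x. h x * k x)"
    by (rule Bochner_Integration.integrable_bound[OF integrable_mult_right[OF k, of "complex_of_real B"]])
      (use B in \<open>auto simp: norm_mult intro!: mult_right_mono\<close>)
   then have ihk: "integrable lebesgue (\<lambda>x. norm (h x) powr q * enn2real (U x) * indicator (E N) x)"
    unfolding hk by (simp only: complex_of_real_integrable_eq)
   have Ieq: "I N = ennreal (LINT x|lebesgue. norm (h x) powr q * enn2real (U x) * indicator (E N) x)"
   proof -
    have "I N = (\<integral>\<^sup>+x. ennreal (norm (h x) powr q * enn2real (U x) * indicator (E N) x) \<partial>lebesgue)"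
     unfolding I_def
    proof (rule nn_integral_cong)
     fix x
     show "ennreal (norm (h x)) powe q * U x * indicator (E N) x = ennreal (norm (h x) powr q * enn2real (U x) * indicator (E N) x)"
      using UE(1)[of x] q by (cases "x \<in> E N") (simp_all add: ennreal_mult ennreal_norm_powe)
    qed
    also have "\<dots> = ennreal (LINT x|lebesgue. norm (h x) powr q * enn2real (U x) * indicator (E N) x)"
     by (rule nn_integral_eq_integral[OF ihk]) auto
    finally show ?thesis .
   qed
   have "I N \<le> ennreal (norm (LINT x|lebesgue. h x * k x))"
    unfolding Ieq hk integral_complex_of_real by (intro ennreal_leI) simp
   also have "\<dots> = ennreal (norm (LINT x|lebesgue. f x * ?K x))"
    unfolding h_def by (simp only: lebesgue_FT_multiplication[OF f g k k'])
   also have "\<dots> \<le> (\<integral>\<^sup>+x. ennreal (norm (f x * ?K x)) \<partial>lebesgue)"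
    by (cases "integrable lebesgue (\<lambda>x. f x * ?K x)") (auto simp: integral_norm_bound_ennreal not_integrable_integral_eq)
   also have "\<dots> \<le> (\<integral>\<^sup>+x. (ennreal (norm (f x)) powe p * W x) powe (1 / p) * (ennreal (norm (?K x)) powe p' * inverse (W x) powe (p' - 1)) powe (1 - 1 / p) \<partial>lebesgue)"
   proof (rule nn_integral_mono_AE)
    have "AE x in lebesgue. ennreal (norm (f x)) powe p * W x \<noteq> \<infinity>"
     using M by (intro nn_integral_PInf_AE) auto
    with W show "AE x in lebesgue. ennreal (norm (f x * ?K x)) \<le> (ennreal (norm (f x)) powe p * W x) powe (1 / p) * (ennreal (norm (?K x)) powe p' * inverse (W x) powe (p' - 1)) powe (1 - 1 / p)"
    proof eventually_elim
     case (elim x)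
     have e1: "1 - 1 / p = 1 / p'" "(p' - 1) * (1 / p') = 1 / p" using p p' by (auto simp: field_simps)
     have pos: "0 < 1 / p" "0 < 1 / p'" using p p' by auto
     have *: "(ennreal (norm (f x)) powe p * W x) powe (1 / p) * (ennreal (norm (?K x)) powe p' * inverse (W x) powe (p' - 1)) powe (1 - 1 / p)
      = ennreal (norm (f x)) * ennreal (norm (?K x)) * (W x powe (1 / p) * inverse (W x) powe (1 / p))"
      unfolding e1(1) powe_mult[OF pos(1)] powe_mult[OF pos(2)] powe_powe e1(2) using p p' by (simp add: mult_ac)
     show ?case
     \<comment> \<open>Where W is infinite the finite norm makes f vanish; elsewhere the powers of W
       and of 1/W cancel.\<close>
     proof (cases "W x = \<top>")
      case True
      then have "f x = 0" using elim(2) p by (auto simp: ennreal_mult_top powe_eq_0_iff split: if_splits)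
      then show ?thesis by simp
     next
      case False
      then have "W x * inverse (W x) = 1" using elim(1)
       by (cases "W x" rule: powe_cases) (auto simp: inverse_ennreal simp flip: ennreal_mult)
      then have "W x powe (1 / p) * inverse (W x) powe (1 / p) = 1"
       unfolding powe_mult[OF pos(1), symmetric] by simp
      then show ?thesis unfolding * by (simp add: norm_mult ennreal_mult)
     qed
    qed
   qed
   also have "\<dots> \<le> M powe (1 / p) * (\<integral>\<^sup>+x. ennreal (norm (?K x)) powe p' * inverse (W x) powe (p' - 1) \<partial>lebesgue) powe (1 - 1 / p)"
    unfolding M_def using p by (intro nn_integral_Hoelder) auto
   also have "1 - 1 / p = 1 / p'" using p by simp
   also have "(\<integral>\<^sup>+x. ennreal (norm (?K x)) powe p' * inverse (W x) powe (p' - 1) \<partial>lebesgue) powe (1 / p') \<le>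
     C * (\<integral>\<^sup>+x. ennreal (norm (k x) powr q') * inverse (U x powe (q' - 1)) \<partial>lebesgue) powe (1 / q')"
    using C(2)[OF k] p' by (simp only: fourier_eq_FT[OF k k'(2,3)] ennreal_norm_powe)
   also have "(\<integral>\<^sup>+x. ennreal (norm (k x) powr q') * inverse (U x powe (q' - 1)) \<partial>lebesgue) \<le> I N"
    unfolding I_def
   proof (rule nn_integral_mono)
    fix x
    show "ennreal (norm (k x) powr q') * inverse (U x powe (q' - 1)) \<le> ennreal (norm (h x)) powe q * U x * indicator (E N) x"
    \<comment> \<open>On \<open>E N\<close> with U positive the exponents match: (q-1) q' = q and
      U^q' U^(1-q') = U. Elsewhere k vanishes, so that an infinite dual weight contributes
      0.\<close>
    proof (cases "x \<in> E N \<and> U x \<noteq> 0")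
     case True
     define t where "t = enn2real (U x)"
     have t1: "U x = ennreal t" using True UE(1)[of x] by (simp add: t_def)
     moreover have "0 \<le> t" by (simp add: t_def)
     ultimately have t: "U x = ennreal t" "t > 0" using True by (auto simp: less_le)
     have "(q - 1) * q' = q" using q q' by (auto simp: field_simps)
     then have "norm (k x) powr q' = norm (h x) powr q * t powr q'"
      using True t by (simp add: nk t_def[symmetric] powr_mult powr_powr)
     moreover have "t powr q' * inverse (t powr (q' - 1)) = t"
      using t(2) by (simp add: powr_diff)
     ultimately have "norm (k x) powr q' * inverse (t powr (q' - 1)) = norm (h x) powr q * t"
      by (simp add: mult.assoc)
     then have "ennreal (norm (k x) powr q') * inverse (U x powe (q' - 1)) = ennreal (norm (h x) powr q * t)"
      using t by (simp add: ennreal_powe inverse_ennreal flip: ennreal_mult)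
     also have "\<dots> = ennreal (norm (h x)) powe q * U x" using t q by (simp add: ennreal_mult ennreal_norm_powe)
     finally show ?thesis using True by simp
    next
     case False
     then have "norm (k x) = 0" by (auto simp: nk)
     then show ?thesis using q' by simp
    qed
   qed
   finally have "I N \<le> M powe (1 / p) * (C * I N powe (1 / q'))"
    using q' by (simp add: mult_left_mono powe_mono)
   \<comment> \<open>The factor \<open>1 powe (1 / q)\<close> is inserted to match the form of
     \<open>ennreal_powe_cancel\<close> with exponent 1/q.\<close>
   moreover have "I N \<le> M powe (1 / p) * (C * I N powe (1 / q')) \<Longrightarrow> I N \<le> (M powe (1 / p) * C) * (1 powe (1 / q) * I N powe (1 - 1 / q))"
   proof -
    assume "I N \<le> M powe (1 / p) * (C * I N powe (1 / q'))"
    moreover have "1 - 1 / q = 1 / q'" using q(2) by linarith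
    ultimately show ?thesis by (simp only: one_powe mult_1 mult.assoc)
   qed
   moreover have "I N < \<top>" unfolding Ieq by simp
   ultimately have "I N \<le> (M powe (1 / p) * C) powe (1 / (1 / q)) * 1"
    using q by (intro ennreal_powe_cancel) auto
   also have "\<dots> = C powe q * M powe (q / p)" using q by (simp add: powe_mult powe_powe mult.commute)
   finally show ?thesis .
  qed
  have inc: "E N \<subseteq> E (Suc N)" for N
   by (auto simp: E_def intro: order_trans add_increasing)
  have "(\<integral>\<^sup>+y. ennreal (norm (FT g y)) powe q * U y \<partial>lebesgue) = (\<integral>\<^sup>+x. (SUP N. ennreal (norm (h x)) powe q * U x * indicator (E N) x) \<partial>lebesgue)"
  proof (rule nn_integral_cong_AE)
   from U show "AE x in lebesgue. ennreal (norm (FT g x)) powe q * U x = (SUP N. ennreal (norm (h x)) powe q * U x * indicator (E N) x)"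
   proof eventually_elim
    case (elim x)
    obtain N1 :: nat where N1: "U x < of_nat N1" using ennreal_Ex_less_of_nat elim by blast
    obtain N2 :: nat where N2: "norm x < real N2" using reals_Archimedean2 by blast
    have "of_nat N1 \<le> (of_nat (max N1 N2) :: ennreal)" by (rule of_nat_mono) simp
    then have "U x \<le> of_nat (max N1 N2)" using N1 by (meson less_imp_le order_trans)
    then have "x \<in> E (max N1 N2)" using N2 by (auto simp: E_def)
    then have "ennreal (norm (FT g x)) powe q * U x \<le> (SUP N. ennreal (norm (h x)) powe q * U x * indicator (E N) x)"
     by (intro SUP_upper2[of "max N1 N2"]) (auto simp: h_def)
    moreover have "(SUP N. ennreal (norm (h x)) powe q * U x * indicator (E N) x) \<le> ennreal (norm (FT g x)) powe q * U x"
     by (intro SUP_least) (auto simp: h_def indicator_def)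
    ultimately show ?case by (rule antisym)
   qed
  qed
  also have "\<dots> = (SUP N. I N)"
   unfolding I_def using inc
   by (intro nn_integral_monotone_convergence_SUP incseq_SucI le_funI mult_left_mono) (auto simp: indicator_def)
  also have "\<dots> \<le> C powe q * M powe (q / p)" by (intro SUP_least IN)
  finally show "(\<integral>\<^sup>+y. ennreal (norm (FT g y)) powe q * U y \<partial>lebesgue)
    \<le> C powe q * (\<integral>\<^sup>+x. ennreal (norm (f x)) powe p * W x \<partial>lebesgue) powe (q / p)"
   by (simp add: M_def)
 qed (use p q in auto)
qed

section \<open>Level inequalities\<close>

text \<open>The measure with density g is finite and has no atoms, so its distribution function is
  continuous.\<close>

lemma continuous_enn2real_integrals:
 fixes g :: "real \<Rightarrow> ennreal"
 assumes [measurable]: "g \<in> borel_measurable borel" and fin: "(\<integral>\<^sup>+t. g t \<partial>lborel) < \<top>"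
 shows "continuous_on UNIV (\<lambda>x. enn2real (rint g x))" "((\<lambda>x. enn2real (rint g x)) \<longlongrightarrow> 0) at_top"
  "continuous_on UNIV (\<lambda>x. enn2real (nnl {..x} g))"
proof -
 define \<nu> where "\<nu> = density lborel g"
 interpret \<nu>: finite_borel_measure \<nu>
 proof (intro finite_borel_measure.intro finite_measureI finite_borel_measure_axioms.intro)
  have "emeasure \<nu> (space \<nu>) = (\<integral>\<^sup>+t. g t * indicator UNIV t \<partial>lborel)"
   unfolding \<nu>_def by (subst emeasure_density) auto
  then show "emeasure \<nu> (space \<nu>) \<noteq> \<infinity>" using fin by (auto simp: less_top)
  show "sets \<nu> = sets borel" by (simp add: \<nu>_def)
 qed
 have sing: "measure \<nu> {x} = 0" for x
 proof -
  have "emeasure \<nu> {x} = (\<integral>\<^sup>+t. g t * indicator {x} t \<partial>lborel)"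
   by (simp add: \<nu>_def emeasure_density)
  also have "\<dots> = (\<integral>\<^sup>+t. 0 \<partial>(lborel :: real measure))"
  proof (rule nn_integral_cong_AE)
   have "AE t in lborel. t \<noteq> x" by (rule AE_lborel_singleton)
   then show "AE t in lborel. g t * indicator {x} t = 0" by eventually_elim auto
  qed
  finally show ?thesis by (simp add: measure_def)
 qed
 have c: "continuous_on UNIV (cdf \<nu>)"
  using \<nu>.isCont_cdf sing by (simp add: continuous_at_imp_continuous_on)
 have m: "cdf \<nu> x = enn2real (nnl {..x} g)" for x
  unfolding cdf_def measure_def \<nu>_def by (simp add: emeasure_density)
 show "continuous_on UNIV (\<lambda>x. enn2real (nnl {..x} g))"
  using c unfolding m[abs_def] .
 have r: "enn2real (rint g x) = measure \<nu> (space \<nu>) - cdf \<nu> x" for x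
 proof -
  have "enn2real (rint g x) = measure \<nu> {x<..}"
   unfolding measure_def \<nu>_def rint_def by (simp add: emeasure_density)
  also have "{x<..} = space \<nu> - {..x}" by (auto simp: \<nu>_def)
  also have "measure \<nu> \<dots> = measure \<nu> (space \<nu>) - cdf \<nu> x"
   unfolding cdf_def by (rule \<nu>.finite_measure_compl) (simp add: \<nu>_def)
  finally show ?thesis .
 qed
 show "continuous_on UNIV (\<lambda>x. enn2real (rint g x))"
  unfolding r by (intro continuous_intros c)
 have "((\<lambda>x. measure \<nu> (space \<nu>) - cdf \<nu> x) \<longlongrightarrow> measure \<nu> (space \<nu>) - measure \<nu> (space \<nu>)) at_top"
  by (intro tendsto_intros \<nu>.cdf_lim_at_top)
 then show "((\<lambda>x. enn2real (rint g x)) \<longlongrightarrow> 0) at_top" unfolding r by simp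
qed

text \<open>The set where \<open>\<mu>{a<..x}\<close> exceeds half of \<open>\<mu>{a<..b}\<close> carries at least half of the mass.\<close>

lemma emeasure_Ioc_power_le:
 fixes \<mu> :: "real measure"
 assumes [measurable_cong]: "sets \<mu> = sets borel" and s: "0 < s"
 shows "emeasure \<mu> {a<..b} powe (s + 1) \<le> ennreal (2 powr (s + 1)) * (\<integral>\<^sup>+x\<in>{a<..b}. emeasure \<mu> {a<..x} powe s \<partial>\<mu>)"
proof -
 define A where "A x = emeasure \<mu> {a<..x}" for x
 have Am: "A x \<le> A y" if "x \<le> y" for x y
  unfolding A_def using that by (intro emeasure_mono) (auto simp: assms(1))
 have [measurable]: "A \<in> borel_measurable borel"
  by (rule mono_borel_measurable) (auto intro!: monoI Am)
 define J where "J = (\<integral>\<^sup>+x\<in>{a<..b}. A x powe s \<partial>\<mu>)"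
 \<comment> \<open>For 2c < A b the set T where A < c carries at most c; hence the set S where A
   \<ge> c carries at least c, and A^s \<ge> c^s on it.\<close>
 have key: "ennreal c powe (s + 1) \<le> J" if c: "0 < c" "ennreal (2 * c) < A b" for c
 proof -
  define S where "S = {x\<in>{a<..b}. ennreal c \<le> A x}"
  define T where "T = {x\<in>{a<..b}. A x < ennreal c}"
  have [measurable]: "S \<in> sets borel" "T \<in> sets borel" unfolding S_def T_def by measurable
  \<comment> \<open>T is an initial piece of the interval. If its supremum is not attained, T is
    exhausted by intervals that end before it; this detour is due to possible atoms of
    \<mu>.\<close>
  have T: "emeasure \<mu> T \<le> ennreal c"
  proof (cases "T = {}")
   case False
   have bdd: "bdd_above T" by (auto simp: T_def intro!: bdd_aboveI[of _ b])
   let ?t = "Sup T"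
   have sub: "T \<subseteq> {a<..?t}" using cSup_upper[OF _ bdd] by (auto simp: T_def)
   show ?thesis
   proof (cases "?t \<in> T")
    case True
    have "emeasure \<mu> T \<le> A ?t" unfolding A_def using sub by (intro emeasure_mono) (auto simp: assms(1))
    then show ?thesis using True by (auto simp: T_def)
   next
    case False': False
    have "T \<subseteq> (\<Union>n. {a<..?t - 1 / Suc n})"
    proof
     fix x assume x: "x \<in> T"
     then have "x < ?t" using sub False' by (metis greaterThanAtMost_iff less_le subsetD)
     then obtain n where "1 / Suc n < ?t - x" using nat_approx_posE[of "?t - x"] by auto
     then show "x \<in> (\<Union>n. {a<..?t - 1 / Suc n})" using x by (auto simp: T_def intro!: exI[of _ n])
    qed
    then have "emeasure \<mu> T \<le> emeasure \<mu> (\<Union>n. {a<..?t - 1 / Suc n})"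
     by (intro emeasure_mono) (auto simp: assms(1))
    also have "\<dots> = (SUP n. emeasure \<mu> {a<..?t - 1 / Suc n})"
    proof (rule SUP_emeasure_incseq[symmetric])
     show "incseq (\<lambda>n. {a<..?t - 1 / real (Suc n)})"
     proof (rule incseq_SucI)
      fix n
      have "1 / real (Suc (Suc n)) \<le> 1 / real (Suc n)" by (intro divide_left_mono) auto
      then show "{a<..?t - 1 / real (Suc n)} \<subseteq> {a<..?t - 1 / real (Suc (Suc n))}" by auto
     qed
    qed (auto simp: assms(1))
    also have "\<dots> \<le> ennreal c"
    proof (rule SUP_least)
     fix n
     have "?t - 1 / real (Suc n) < ?t" by simp
     then obtain y where y: "y \<in> T" "?t - 1 / real (Suc n) < y"
      using less_cSup_iff[OF False bdd] by blast
     have "emeasure \<mu> {a<..?t - 1 / real (Suc n)} \<le> A y"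
      using Am[of "?t - 1 / real (Suc n)" y] y by (simp add: A_def)
     then show "emeasure \<mu> {a<..?t - 1 / real (Suc n)} \<le> ennreal c"
      using y(1) by (auto simp: T_def)
    qed
    finally show ?thesis .
   qed
  qed simp
  have "ennreal c + ennreal c \<le> A b" using c by (simp add: less_imp_le flip: ennreal_plus)
  also have "A b \<le> emeasure \<mu> (S \<union> T)"
   unfolding A_def
  proof (rule emeasure_mono)
   show "{a<..b} \<subseteq> S \<union> T" by (auto simp: S_def T_def not_le)
   show "S \<union> T \<in> sets \<mu>" by measurable
  qed
  also have "\<dots> \<le> emeasure \<mu> S + emeasure \<mu> T" by (intro emeasure_subadditive) (auto simp: assms(1))
  also have "\<dots> \<le> emeasure \<mu> S + ennreal c" by (intro add_left_mono T)
  finally have S: "ennreal c \<le> emeasure \<mu> S" by (simp add: ennreal_add_left_cancel_le add.commute)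
  have "ennreal c powe (s + 1) = ennreal c powe s * ennreal c"
   using powe_add[of s 1 "ennreal c"] s by simp
  also have "\<dots> \<le> ennreal c powe s * emeasure \<mu> S" by (intro mult_left_mono S) simp
  also have "\<dots> = (\<integral>\<^sup>+x\<in>S. ennreal c powe s \<partial>\<mu>)" by (simp add: nn_integral_cmult_indicator assms(1))
  also have "\<dots> \<le> J" unfolding J_def
   using s by (intro nn_integral_mono) (auto simp: S_def indicator_def intro!: powe_mono)
  finally show ?thesis .
 qed
 \<comment> \<open>Arguing with all values below A b also covers A b = \<top>.\<close>
 have "A b \<le> 2 * J powe (1 / (s + 1))"
 proof (rule dense_le)
  fix x assume x: "x < A b"
  then obtain d where d: "x = ennreal d" "0 \<le> d" by (cases x) (auto simp: top_unique)
  show "x \<le> 2 * J powe (1 / (s + 1))"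
  proof (cases "d = 0")
   case False
   have "ennreal (d / 2) powe (s + 1) \<le> J" using key[of "d / 2"] x d False by simp
   then have "ennreal (d / 2) \<le> J powe (1 / (s + 1))" using s by (simp add: powe_le_iff)
   then have "2 * ennreal (d / 2) \<le> 2 * J powe (1 / (s + 1))" by (rule mult_left_mono) simp
   also have "2 * ennreal (d / 2) = ennreal 2 * ennreal (d / 2)" by simp
   also have "\<dots> = x" unfolding d using d(2) by (subst ennreal_mult[symmetric]) auto
   finally show ?thesis .
  qed (use d in simp)
 qed
 then have "A b powe (s + 1) \<le> (2 * J powe (1 / (s + 1))) powe (s + 1)"
  using s by (intro powe_mono) auto
 also have "\<dots> = ennreal (2 powr (s + 1)) * J"
  using s ennreal_powe[of 2 "s + 1"] by (simp add: powe_mult powe_powe)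
 finally show ?thesis by (simp add: A_def J_def)
qed

text \<open>The intermediate value theorem gives a next point with half the value. Along the
  sequence the values tend to 0, so every y with h y > 0 is passed after finitely many
  steps.\<close>

lemma halving_sequence:
 fixes h :: "real \<Rightarrow> real"
 assumes h: "continuous_on {0<..} h" "(h \<longlongrightarrow> 0) at_top" and e: "0 < \<epsilon>" "0 < h \<epsilon>"
  and anti: "\<And>x y. 0 < x \<Longrightarrow> x \<le> y \<Longrightarrow> h y \<le> h x"
 obtains x :: "nat \<Rightarrow> real" where "strict_mono x" "x 0 = \<epsilon>" "\<And>k. h (x k) = h \<epsilon> / 2 ^ k"
  "\<And>y. \<epsilon> < y \<Longrightarrow> 0 < h y \<Longrightarrow> \<exists>k. x k < y \<and> y \<le> x (Suc k)"
proof -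
 have ex: "\<exists>z>y. h z = h y / 2" if y: "0 < y" "0 < h y" for y
 proof -
  have "eventually (\<lambda>z. h z < h y / 2) at_top" using h(2) y by (intro order_tendstoD) auto
  then obtain N where N: "\<And>z. N \<le> z \<Longrightarrow> h z < h y / 2" by (auto simp: eventually_at_top_linorder)
  define z where "z = max N (y + 1)"
  have z: "z > y" "h z < h y / 2" using N[of z] by (auto simp: z_def)
  have "\<exists>x\<ge>y. x \<le> z \<and> h x = h y / 2"
   using z y by (intro IVT2' continuous_on_subset[OF h(1)]) auto
  then obtain w where "y \<le> w" "h w = h y / 2" by blast
  then show ?thesis using y by (intro exI[of _ w]) (auto simp: less_le)
 qed
 define nxt where "nxt y = (SOME z. y < z \<and> h z = h y / 2)" for y
 have nxt: "y < nxt y" "h (nxt y) = h y / 2" if "0 < y" "0 < h y" for y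
  using someI_ex[OF ex[OF that]] by (auto simp: nxt_def)
 define x where "x k = (nxt ^^ k) \<epsilon>" for k
 have x: "0 < x k \<and> h (x k) = h \<epsilon> / 2 ^ k" for k
 proof (induction k)
  case (Suc k)
  then have "0 < h (x k)" using e by simp
  then show ?case using nxt[of "x k"] Suc by (auto simp: x_def)
 qed (use e in \<open>auto simp: x_def\<close>)
 have sm: "strict_mono x"
 proof (rule strict_monoI_Suc)
  fix k show "x k < x (Suc k)" using nxt(1)[of "x k"] x[of k] e by (simp add: x_def)
 qed
 show thesis
 proof (rule that[OF sm])
  show "x 0 = \<epsilon>" by (simp add: x_def)
  show "h (x k) = h \<epsilon> / 2 ^ k" for k using x by blast
  fix y assume y: "\<epsilon> < y" "0 < h y"
  have ex: "\<exists>n. y \<le> x n"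
  proof -
   obtain n where n: "h \<epsilon> / h y < 2 ^ n" using real_arch_pow[of 2 "h \<epsilon> / h y"] by auto
   then have "h (x n) * 2 ^ n < h y * 2 ^ n" using x[of n] y e by (simp add: field_simps)
   then have "h (x n) < h y" by simp
   then have "\<not> x n < y" using anti[of "x n" y] x[of n] by auto
   then show ?thesis by (intro exI[of _ n]) simp
  qed
  define n where "n = (LEAST n. y \<le> x n)"
  have n: "y \<le> x n" unfolding n_def by (rule LeastI_ex[OF ex])
  moreover have "n \<noteq> 0" using n y by (cases "n = 0") (auto simp: x_def)
  then obtain k where k: "n = Suc k" by (cases n) auto
  moreover have "\<not> y \<le> x k" using not_less_Least[of k "\<lambda>n. y \<le> x n"] k by (simp add: n_def)
  ultimately show "\<exists>k. x k < y \<and> y \<le> x (Suc k)" by (intro exI[of _ k]) simp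
 qed
qed

lemma ennreal_le_suminf:
 fixes f :: "nat \<Rightarrow> ennreal" shows "f k \<le> (\<Sum>k. f k)"
 using sum_le_suminf[of f "{k}"] by simp

text \<open>On (x k, x (k+1)] the function h is at most h (x k), which by halving is 4 times its
  increment over the following interval. That increment is bounded by data at x (k+1) \<ge> y, and
  monotonicity carries E and K back to the points of the interval. Hoelder over k with exponents p/q
  and r/q separates the masses m from K, and \<open>emeasure_Ioc_power_le\<close> rebuilds an
  integral from the powers r/q of the measures of the intervals. E takes up errors that are
  estimated by other means.\<close>

lemma level_inequality:
 fixes \<mu> :: "real measure" and h :: "real \<Rightarrow> real" and E K :: "real \<Rightarrow> ennreal"
 assumes sets [measurable_cong]: "sets \<mu> = sets borel"
  and q: "0 < q" "q < p" and r: "1 / r = 1 / q - 1 / p"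
  and h: "continuous_on {0<..} h" "(h \<longlongrightarrow> 0) at_top" "\<And>x. 0 < x \<Longrightarrow> 0 \<le> h x"
  and anti: "\<And>x y. 0 < x \<Longrightarrow> x \<le> y \<Longrightarrow> h y \<le> h x"
  and E [measurable]: "E \<in> borel_measurable borel" and EA: "\<And>x y. 0 < x \<Longrightarrow> x \<le> y \<Longrightarrow> E y \<le> E x"
  and K [measurable]: "K \<in> borel_measurable borel" and KA: "\<And>x y. 0 < x \<Longrightarrow> x \<le> y \<Longrightarrow> K y \<le> K x"
  and step: "\<And>a b. 0 < a \<Longrightarrow> a < b \<Longrightarrow> ennreal (h a - h b) \<le> E a + m a b powe (1 / p) * K a"
  and summ: "\<And>x. strict_mono x \<Longrightarrow> 0 < x 0 \<Longrightarrow> (\<Sum>k. m (x k) (x (Suc k))) \<le> M"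
 shows "(\<integral>\<^sup>+x\<in>{0<..}. ennreal (h x) powe q \<partial>\<mu>) \<le>
  ennreal (2 * 8 powr q) * ((\<integral>\<^sup>+x\<in>{0<..}. E x powe q \<partial>\<mu>) +
   M powe (q / p) * (\<integral>\<^sup>+x\<in>{0<..}. K x powe r * emeasure \<mu> {0<..x} powe (r / p) \<partial>\<mu>) powe (q / r))"
proof -
 have p: "0 < p" using q by simp
 have "1 / r > 0" unfolding r using q by (simp add: divide_strict_left_mono frac_less2)
 then have r0: "0 < r" by simp
 have qr: "1 - q / p = q / r"
 proof -
  have "q * (1 / r) = q * (1 / q) - q * (1 / p)" unfolding r by (simp add: right_diff_distrib)
  then show ?thesis using q by simp
 qed
 have rq: "r / q = r / p + 1"
 proof -
  have "r * (1 / r) = r * (1 / q) - r * (1 / p)" unfolding r by (simp add: right_diff_distrib)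
  then show ?thesis using r0 by simp
 qed
 define A where "A x = emeasure \<mu> {0<..x}" for x
 have [measurable]: "A \<in> borel_measurable borel"
  by (rule mono_borel_measurable) (auto intro!: monoI emeasure_mono simp: A_def sets)
 define Z where "Z = (\<integral>\<^sup>+x\<in>{0<..}. K x powe r * A x powe (r / p) \<partial>\<mu>)"
 define EE where "EE = (\<integral>\<^sup>+x\<in>{0<..}. E x powe q \<partial>\<mu>)"
 define hh where "hh x = ennreal (h x) powe q * indicator {0<..} x" for x
 have hm: "h \<in> borel_measurable (restrict_space borel {0<..})"
  by (rule borel_measurable_continuous_on_restrict[OF h(1)])
 have "(\<lambda>x. ennreal (h x) powe q) \<in> borel_measurable (restrict_space borel {0<..})"
  using hm by measurable
 then have hhm [measurable]: "hh \<in> borel_measurable borel"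
  unfolding hh_def by (subst (asm) borel_measurable_restrict_space_iff_ennreal) auto
 \<comment> \<open>Halving needs a starting point with a finite positive value; the bound is uniform
   in \<epsilon>, which tends to 0 at the end.\<close>
 have main: "(\<integral>\<^sup>+x\<in>{\<epsilon><..}. hh x \<partial>\<mu>) \<le> ennreal (2 * 8 powr q) * (EE + M powe (q / p) * Z powe (q / r))" if e: "0 < \<epsilon>" for \<epsilon>
 proof (cases "0 < h \<epsilon>")
  case False
  have z: "hh x * indicator {\<epsilon><..} x = 0" for x
  proof (cases "\<epsilon> < x")
   case True
   then have "h x = 0" using anti[of \<epsilon> x] h(3)[of x] False e by simp
   then show ?thesis using q by (simp add: hh_def)
  qed simp
  show ?thesis by (simp only: z nn_integral_const mult_zero_left zero_le)
 next
  case True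
  obtain x :: "nat \<Rightarrow> real" where x: "strict_mono x" "x 0 = \<epsilon>" "\<And>k. h (x k) = h \<epsilon> / 2 ^ k"
   "\<And>y. \<epsilon> < y \<Longrightarrow> 0 < h y \<Longrightarrow> \<exists>k. x k < y \<and> y \<le> x (Suc k)"
   using halving_sequence[OF h(1,2) e True anti] by blast
  have xp: "0 < x k" for k
   using strict_mono_less_eq[OF x(1), of 0 k] x(2) e by auto
  have xl: "x k < x (Suc k)" for k using x(1) by (simp add: strict_mono_Suc_iff)
  define J where "J k = {x k<..x (Suc k)}" for k
  have [measurable]: "J k \<in> sets borel" for k by (simp add: J_def)
  have disj: "disjoint_family J"
   unfolding disjoint_family_on_def
  proof (intro ballI impI)
   fix i j :: nat assume "i \<noteq> j"
   then have "Suc i \<le> j \<or> Suc j \<le> i" by auto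
   then show "J i \<inter> J j = {}"
    using strict_mono_less_eq[OF x(1), of "Suc i" j] strict_mono_less_eq[OF x(1), of "Suc j" i] by (auto simp: J_def)
  qed
  have sumJ: "(\<Sum>k. \<integral>\<^sup>+y\<in>J k. f y \<partial>\<mu>) \<le> (\<integral>\<^sup>+y\<in>{0<..}. f y \<partial>\<mu>)" if [measurable]: "f \<in> borel_measurable borel" for f :: "real \<Rightarrow> ennreal"
  proof -
   have "(\<Sum>k. \<integral>\<^sup>+y\<in>J k. f y \<partial>\<mu>) = (\<integral>\<^sup>+y. (\<Sum>k. f y * indicator (J k) y) \<partial>\<mu>)"
    by (rule nn_integral_suminf[symmetric]) simp
   also have "\<dots> = (\<integral>\<^sup>+y. f y * indicator (\<Union>k. J k) y \<partial>\<mu>)"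
    by (simp add: suminf_indicator[OF disj])
   also have "\<dots> \<le> (\<integral>\<^sup>+y\<in>{0<..}. f y \<partial>\<mu>)"
    by (intro nn_integral_mono) (auto simp: indicator_def J_def dest: less_trans[OF xp])
   finally show ?thesis .
  qed
  define n where "n k = m (x (Suc k)) (x (Suc (Suc k)))" for k
  have nM: "(\<Sum>k. n k) \<le> M"
   unfolding n_def using summ[of "\<lambda>k. x (Suc k)"] x(1) xp by (simp add: strict_mono_Suc_iff)
  \<comment> \<open>8 = 4 * 2: the factor 4 from h (x k) = 4 (h (x (k+1)) - h (x (k+2))), the factor
    2 from the q-th power of a sum.\<close>
  have pt: "hh y \<le> ennreal (8 powr q) * (E y powe q + n k powe (q / p) * K (x (Suc k)) powe q)" if y: "y \<in> J k" for y k
  proof -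
   have y0: "0 < y" "x k < y" "y \<le> x (Suc k)" using y xp[of k] by (auto simp: J_def)
   have "h y \<le> h (x k)" using y0 xp[of k] by (intro anti) auto
   also have "\<dots> = 4 * (h (x (Suc k)) - h (x (Suc (Suc k))))" by (simp add: x(3) field_simps)
   finally have "ennreal (h y) \<le> ennreal (4 * (h (x (Suc k)) - h (x (Suc (Suc k)))))" by (rule ennreal_leI)
   also have "\<dots> = 4 * ennreal (h (x (Suc k)) - h (x (Suc (Suc k))))" by (subst ennreal_mult') simp_all
   also have "\<dots> \<le> 4 * (E (x (Suc k)) + n k powe (1 / p) * K (x (Suc k)))"
    unfolding n_def by (intro mult_left_mono step xp xl) simp
   also have "\<dots> \<le> 4 * (E y + n k powe (1 / p) * K (x (Suc k)))"
    by (intro mult_left_mono add_right_mono EA y0) simp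
   finally have "ennreal (h y) powe q \<le> (4 * (E y + n k powe (1 / p) * K (x (Suc k)))) powe q"
    using q by (intro powe_mono) auto
   also have "\<dots> = ennreal (4 powr q) * (E y + n k powe (1 / p) * K (x (Suc k))) powe q"
   proof -
    have "4 powe q = ennreal (4 powr q)" using ennreal_powe[of 4 q] by simp
    then show ?thesis by (simp only: powe_mult[OF q(1)])
   qed
   also have "\<dots> \<le> ennreal (4 powr q) * (ennreal (2 powr q) * (E y powe q + (n k powe (1 / p) * K (x (Suc k))) powe q))"
    using q by (intro mult_left_mono powe_add_le) auto
   also have "\<dots> = ennreal (8 powr q) * (E y powe q + n k powe (q / p) * K (x (Suc k)) powe q)"
    using q powr_mult[of 4 2 q] by (simp add: powe_mult powe_powe mult.assoc[symmetric] flip: ennreal_mult)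
   finally show ?thesis using y0 by (simp add: hh_def)
  qed
  have "(\<integral>\<^sup>+y\<in>{\<epsilon><..}. hh y \<partial>\<mu>) \<le> (\<integral>\<^sup>+y. (\<Sum>k. ennreal (8 powr q) * (E y powe q + n k powe (q / p) * K (x (Suc k)) powe q) * indicator (J k) y) \<partial>\<mu>)"
  proof (intro nn_integral_mono)
   fix y
   show "hh y * indicator {\<epsilon><..} y \<le> (\<Sum>k. ennreal (8 powr q) * (E y powe q + n k powe (q / p) * K (x (Suc k)) powe q) * indicator (J k) y)"
   proof (cases "\<epsilon> < y \<and> 0 < h y")
    case True
    then obtain k where k: "y \<in> J k" using x(4) by (auto simp: J_def)
    have "hh y * indicator {\<epsilon><..} y \<le> ennreal (8 powr q) * (E y powe q + n k powe (q / p) * K (x (Suc k)) powe q) * indicator (J k) y"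
     using pt[OF k] True k by simp
    also have "\<dots> \<le> (\<Sum>k. ennreal (8 powr q) * (E y powe q + n k powe (q / p) * K (x (Suc k)) powe q) * indicator (J k) y)"
     by (rule ennreal_le_suminf)
    finally show ?thesis .
   next
    case False
    then have zz: "hh y * indicator {\<epsilon><..} y = 0" using h(3)[of y] e q by (auto simp: hh_def indicator_def)
    show ?thesis unfolding zz by simp
   qed
  qed
  also have "\<dots> = (\<Sum>k. \<integral>\<^sup>+y. ennreal (8 powr q) * (E y powe q + n k powe (q / p) * K (x (Suc k)) powe q) * indicator (J k) y \<partial>\<mu>)"
   by (rule nn_integral_suminf) simp
  also have "\<dots> = (\<Sum>k. ennreal (8 powr q) * ((\<integral>\<^sup>+y\<in>J k. E y powe q \<partial>\<mu>) + n k powe (q / p) * K (x (Suc k)) powe q * emeasure \<mu> (J k)))"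
  proof (intro suminf_cong)
   fix k
   have "(\<integral>\<^sup>+y. ennreal (8 powr q) * (E y powe q + n k powe (q / p) * K (x (Suc k)) powe q) * indicator (J k) y \<partial>\<mu>)
    = (\<integral>\<^sup>+y. ennreal (8 powr q) * (E y powe q * indicator (J k) y + (n k powe (q / p) * K (x (Suc k)) powe q) * indicator (J k) y) \<partial>\<mu>)"
    by (simp add: distrib_right mult.assoc)
   also have "\<dots> = ennreal (8 powr q) * ((\<integral>\<^sup>+y\<in>J k. E y powe q \<partial>\<mu>) + n k powe (q / p) * K (x (Suc k)) powe q * emeasure \<mu> (J k))"
    by (subst nn_integral_cmult, simp, subst nn_integral_add) (simp_all add: nn_integral_cmult_indicator sets)
   finally show "(\<integral>\<^sup>+y. ennreal (8 powr q) * (E y powe q + n k powe (q / p) * K (x (Suc k)) powe q) * indicator (J k) y \<partial>\<mu>)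
    = ennreal (8 powr q) * ((\<integral>\<^sup>+y\<in>J k. E y powe q \<partial>\<mu>) + n k powe (q / p) * K (x (Suc k)) powe q * emeasure \<mu> (J k))" .
  qed
  also have "\<dots> = ennreal (8 powr q) * ((\<Sum>k. \<integral>\<^sup>+y\<in>J k. E y powe q \<partial>\<mu>) + (\<Sum>k. n k powe (q / p) * K (x (Suc k)) powe q * emeasure \<mu> (J k)))"
   by (simp add: suminf_add[OF summableI summableI] del: powe_0)
  also have "(\<Sum>k. \<integral>\<^sup>+y\<in>J k. E y powe q \<partial>\<mu>) \<le> EE" unfolding EE_def by (rule sumJ) simp
  also have "(\<Sum>k. n k powe (q / p) * K (x (Suc k)) powe q * emeasure \<mu> (J k)) = (\<Sum>k. n k powe (q / p) * (K (x (Suc k)) powe r * emeasure \<mu> (J k) powe (r / q)) powe (1 - q / p))"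
   unfolding qr using q r0 by (simp add: powe_mult powe_powe mult.assoc)
  also have "\<dots> \<le> (\<Sum>k. n k) powe (q / p) * (\<Sum>k. K (x (Suc k)) powe r * emeasure \<mu> (J k) powe (r / q)) powe (1 - q / p)"
   using q by (intro suminf_Hoelder) auto
  also have "\<dots> \<le> M powe (q / p) * (ennreal (2 powr (r / q)) * Z) powe (1 - q / p)"
  proof (intro mult_mono powe_mono nM)
   have "(\<Sum>k. K (x (Suc k)) powe r * emeasure \<mu> (J k) powe (r / q)) \<le> (\<Sum>k. ennreal (2 powr (r / q)) * (\<integral>\<^sup>+y\<in>J k. K y powe r * A y powe (r / p) \<partial>\<mu>))"
   proof (intro suminf_le summableI)
    fix k
    have "K (x (Suc k)) powe r * emeasure \<mu> (J k) powe (r / q) \<le> K (x (Suc k)) powe r * (ennreal (2 powr (r / q)) * (\<integral>\<^sup>+y\<in>J k. emeasure \<mu> {x k<..y} powe (r / p) \<partial>\<mu>))"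
     unfolding rq J_def using r0 p by (intro mult_left_mono emeasure_Ioc_power_le[OF sets]) auto
    also have "\<dots> = ennreal (2 powr (r / q)) * (K (x (Suc k)) powe r * (\<integral>\<^sup>+y\<in>J k. emeasure \<mu> {x k<..y} powe (r / p) \<partial>\<mu>))"
     by (simp add: mult_ac)
    also have "K (x (Suc k)) powe r * (\<integral>\<^sup>+y\<in>J k. emeasure \<mu> {x k<..y} powe (r / p) \<partial>\<mu>) = (\<integral>\<^sup>+y. K (x (Suc k)) powe r * (emeasure \<mu> {x k<..y} powe (r / p) * indicator (J k) y) \<partial>\<mu>)"
    proof (rule nn_integral_cmult[symmetric])
     have [measurable]: "(\<lambda>y. emeasure \<mu> {x k<..y}) \<in> borel_measurable borel"
      by (rule mono_borel_measurable) (auto intro!: monoI emeasure_mono simp: sets)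
     show "(\<lambda>y. emeasure \<mu> {x k<..y} powe (r / p) * indicator (J k) y) \<in> borel_measurable \<mu>" by measurable
    qed
    also have "\<dots> \<le> (\<integral>\<^sup>+y\<in>J k. K y powe r * A y powe (r / p) \<partial>\<mu>)"
    proof (intro nn_integral_mono)
     fix y
     have "emeasure \<mu> {x k<..y} \<le> A y" unfolding A_def using xp[of k] by (intro emeasure_mono) (auto simp: sets)
     then show "K (x (Suc k)) powe r * (emeasure \<mu> {x k<..y} powe (r / p) * indicator (J k) y) \<le> K y powe r * A y powe (r / p) * indicator (J k) y"
      using KA[of y "x (Suc k)"] xp[of k] r0 p by (auto simp: J_def indicator_def intro!: mult_mono powe_mono)
    qed
    finally show "K (x (Suc k)) powe r * emeasure \<mu> (J k) powe (r / q) \<le> ennreal (2 powr (r / q)) * (\<integral>\<^sup>+y\<in>J k. K y powe r * A y powe (r / p) \<partial>\<mu>)"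
     by (simp add: mult_left_mono)
   qed
   also have "\<dots> = ennreal (2 powr (r / q)) * (\<Sum>k. \<integral>\<^sup>+y\<in>J k. K y powe r * A y powe (r / p) \<partial>\<mu>)" by simp
   also have "\<dots> \<le> ennreal (2 powr (r / q)) * Z" unfolding Z_def by (intro mult_left_mono sumJ) auto
   finally show "(\<Sum>k. K (x (Suc k)) powe r * emeasure \<mu> (J k) powe (r / q)) \<le> ennreal (2 powr (r / q)) * Z" .
  qed (use q in auto)
  \<comment> \<open>The constant of \<open>emeasure_Ioc_power_le\<close> is 2^(r/q), and the power
    q/r reduces it to 2.\<close>
  also have "(ennreal (2 powr (r / q)) * Z) powe (1 - q / p) = 2 * Z powe (q / r)"
   unfolding qr using q r0 by (simp add: powe_mult ennreal_powe powr_powr)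
  finally have "(\<integral>\<^sup>+y\<in>{\<epsilon><..}. hh y \<partial>\<mu>) \<le> ennreal (8 powr q) * (EE + M powe (q / p) * (2 * Z powe (q / r)))"
   by (simp add: mult_left_mono add_mono)
  also have "\<dots> \<le> ennreal (8 powr q) * (2 * EE + M powe (q / p) * (2 * Z powe (q / r)))"
   by (intro mult_left_mono add_right_mono) (auto simp: mult_2)
  also have "\<dots> = (2 * ennreal (8 powr q)) * (EE + M powe (q / p) * Z powe (q / r))"
   by (simp only: distrib_left mult_ac)
  also have "2 * ennreal (8 powr q) = ennreal (2 * 8 powr q)" by (simp add: ennreal_mult)
  finally show ?thesis .
 qed
 have "(\<integral>\<^sup>+x\<in>{0<..}. ennreal (h x) powe q \<partial>\<mu>) = (\<integral>\<^sup>+x. (SUP n. hh x * indicator {1 / Suc n<..} x) \<partial>\<mu>)"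
 proof (intro nn_integral_cong antisym)
  fix x
  show "(SUP n. hh x * indicator {1 / Suc n<..} x) \<le> ennreal (h x) powe q * indicator {0<..} x"
   by (intro SUP_least) (auto simp: hh_def indicator_def)
  show "ennreal (h x) powe q * indicator {0<..} x \<le> (SUP n. hh x * indicator {1 / Suc n<..} x)"
  proof (cases "0 < x")
   case True
   then obtain n where "1 / Suc n < x" using nat_approx_posE by blast
   then show ?thesis by (intro SUP_upper2[of n]) (auto simp: hh_def)
  qed simp
 qed
 also have "\<dots> = (SUP n. \<integral>\<^sup>+x. hh x * indicator {1 / Suc n<..} x \<partial>\<mu>)"
 proof (rule nn_integral_monotone_convergence_SUP)
  show "incseq (\<lambda>n x. hh x * indicator {1 / real (Suc n)<..} x)"
  proof (intro incseq_SucI le_funI mult_left_mono)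
   fix n x
   have "1 / real (Suc (Suc n)) \<le> 1 / real (Suc n)" by (intro divide_left_mono) auto
   then show "indicator {1 / real (Suc n)<..} x \<le> (indicator {1 / real (Suc (Suc n))<..} x :: ennreal)"
    by (auto simp: indicator_def)
  qed simp
 qed simp
 also have "\<dots> \<le> ennreal (2 * 8 powr q) * (EE + M powe (q / p) * Z powe (q / r))"
  by (intro SUP_least main) simp
 finally show ?thesis by (simp add: EE_def Z_def A_def)
qed

section \<open>The conditions (MH) and (BHJH)\<close>

lemma exponent_identities:
 fixes p q r :: real
 assumes q: "0 < q" "q < p" and r: "1 / r = 1 / q - 1 / p"
 shows "0 < r" "1 - q / p = q / r" "r / q = r / p + 1"
proof -
 have "1 / r > 0" unfolding r using q by (simp add: divide_strict_left_mono frac_less2)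
 then show r0: "0 < r" by simp
 have "q * (1 / r) = q * (1 / q) - q * (1 / p)" unfolding r by (simp add: right_diff_distrib)
 then show "1 - q / p = q / r" using q by simp
 have "r * (1 / r) = r * (1 / q) - r * (1 / p)" unfolding r by (simp add: right_diff_distrib)
 then show "r / q = r / p + 1" using r0 by simp
qed

text \<open>(MH) without the outer root and with a free weight v in place of w^(1-p'), so that
  duality can exchange u and v.\<close>

definition mh_cond :: "real \<Rightarrow> real \<Rightarrow> real \<Rightarrow> (real \<Rightarrow> ennreal) \<Rightarrow> (real \<Rightarrow> ennreal) \<Rightarrow> bool" where
 "mh_cond p p' r u v \<longleftrightarrow>
   (nnl {0<..} (\<lambda>x. lint u x powe (r / p) * lint v (1 / x) powe (r / p') * u x)) < \<top>"

text \<open>Hoelder for F \<kappa>^(-1/p) and g \<kappa>^(1/p). The powers of \<kappa> cancel where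
  \<kappa> is positive and finite; where it is 0, finite \<open>wnorm\<close> forces F = 0 almost
  everywhere.\<close>

lemma weighted_Hoelder:
 fixes F g \<kappa> :: "real \<Rightarrow> ennreal"
 assumes p: "1 < p" "1 / p + 1 / p' = 1"
  and [measurable]: "F \<in> borel_measurable borel" "g \<in> borel_measurable borel" "\<kappa> \<in> borel_measurable borel" "A \<in> sets borel"
  and A: "A \<subseteq> {0<..}" and \<kappa>: "\<And>t. 0 < t \<Longrightarrow> \<kappa> t < \<top>" and fin: "wnorm p \<kappa> F < \<top>"
 shows "(\<integral>\<^sup>+t\<in>A. g t * F t \<partial>lborel) \<le> (\<integral>\<^sup>+t\<in>A. F t powe p * inverse (\<kappa> t) \<partial>lborel) powe (1 / p) *
   (\<integral>\<^sup>+t\<in>A. g t powe p' * \<kappa> t powe (p' - 1) \<partial>lborel) powe (1 / p')"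
proof -
 have p': "1 < p'" by (rule conjugate_gt_1[OF p])
 have e: "1 - 1 / p = 1 / p'" "(p' - 1) * (1 / p') = 1 / p" using p p' by (auto simp: field_simps)
 have pos: "0 < 1 / p" "0 < 1 / p'" using p p' by auto
 have i: "indicator A t powe a = (indicator A t :: ennreal)" if "0 < a" for a and t :: real
  using that by (auto simp: indicator_def)
 have "AE t in lborel. F t powe p * inverse (\<kappa> t) * indicator {0<..} t \<noteq> \<infinity>"
  using fin unfolding wnorm_def by (intro nn_integral_PInf_AE) auto
 then have "(\<integral>\<^sup>+t\<in>A. g t * F t \<partial>lborel) \<le>
  (\<integral>\<^sup>+t. (F t powe p * inverse (\<kappa> t) * indicator A t) powe (1 / p) * (g t powe p' * \<kappa> t powe (p' - 1) * indicator A t) powe (1 - 1 / p) \<partial>lborel)"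
 proof (intro nn_integral_mono_AE, eventually_elim)
  case (elim t)
  show ?case
  proof (cases "t \<in> A")
   case True
   then have t: "0 < t" using A by auto
   have *: "(F t powe p * inverse (\<kappa> t) * indicator A t) powe (1 / p) * (g t powe p' * \<kappa> t powe (p' - 1) * indicator A t) powe (1 - 1 / p)
     = F t * g t * (inverse (\<kappa> t) powe (1 / p) * \<kappa> t powe (1 / p))"
    unfolding e(1) powe_mult[OF pos(1)] powe_mult[OF pos(2)] powe_powe e(2) i[OF pos(1)] i[OF pos(2)]
    using p p' True by (simp add: mult_ac)
   show ?thesis
   proof (cases "\<kappa> t = 0")
    case True
    then have "F t = 0" using elim t p by (auto simp: ennreal_mult_top powe_eq_0_iff split: if_splits)
    then show ?thesis by simp
   next
    case False
    then have "inverse (\<kappa> t) * \<kappa> t = 1" using \<kappa>[OF t]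
     by (cases "\<kappa> t" rule: powe_cases) (auto simp: inverse_ennreal simp flip: ennreal_mult)
    then have "inverse (\<kappa> t) powe (1 / p) * \<kappa> t powe (1 / p) = 1"
     unfolding powe_mult[OF pos(1), symmetric] by simp
    then show ?thesis unfolding * using True by (simp add: mult.commute)
   qed
  qed simp
 qed
 also have "\<dots> \<le> (\<integral>\<^sup>+t\<in>A. F t powe p * inverse (\<kappa> t) \<partial>lborel) powe (1 / p) *
   (\<integral>\<^sup>+t\<in>A. g t powe p' * \<kappa> t powe (p' - 1) \<partial>lborel) powe (1 - 1 / p)"
  using p by (intro nn_integral_Hoelder) auto
 finally show ?thesis unfolding e(1) .
qed

lemma suminf_disjoint_le:
 fixes f :: "real \<Rightarrow> ennreal"
 assumes [measurable]: "f \<in> borel_measurable borel" "\<And>k. A k \<in> sets borel"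
  and A: "disjoint_family A" "\<And>k::nat. A k \<subseteq> {0<..}"
 shows "(\<Sum>k. \<integral>\<^sup>+t\<in>A k. f t \<partial>lborel) \<le> nnl {0<..} f"
proof -
 have "(\<Sum>k. \<integral>\<^sup>+t\<in>A k. f t \<partial>lborel) = (\<integral>\<^sup>+t. (\<Sum>k. f t * indicator (A k) t) \<partial>lborel)"
  by (rule nn_integral_suminf[symmetric]) simp
 also have "\<dots> = (\<integral>\<^sup>+t. f t * indicator (\<Union>k. A k) t \<partial>lborel)"
  by (simp add: suminf_indicator[OF A(1)])
 also have "\<dots> \<le> nnl {0<..} f"
  using A(2) by (intro nn_integral_mono) (auto simp: indicator_def)
 finally show ?thesis .
qed

lemma lint_split:
 assumes [measurable]: "f \<in> borel_measurable borel" and "0 < x" "x \<le> y"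
 shows "lint f y = lint f x + nnl {x..<y} f"
proof -
 have "lint f y = (\<integral>\<^sup>+t. f t * indicator {0<..<x} t + f t * indicator {x..<y} t \<partial>lborel)"
  unfolding lint_def using assms(2,3) by (intro nn_integral_cong) (auto simp: indicator_def)
 then show ?thesis by (simp add: lint_def nn_integral_add)
qed

lemma rint_split:
 assumes [measurable]: "f \<in> borel_measurable borel" and "x \<le> y"
 shows "rint f x = nnl {x<..y} f + rint f y"
proof -
 have "rint f x = (\<integral>\<^sup>+t. f t * indicator {x<..y} t + f t * indicator {y<..} t \<partial>lborel)"
  unfolding rint_def using assms(2) by (intro nn_integral_cong) (auto simp: indicator_def)
 then show ?thesis by (simp add: rint_def nn_integral_add)
qed

lemma lint_eq_Iic:
 assumes [measurable]: "f \<in> borel_measurable borel"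
 shows "nnl {..x} (\<lambda>t. f t * indicator {0<..} t) = lint f x"
 unfolding lint_def
proof (rule nn_integral_cong_AE)
 have "AE t in lborel. t \<noteq> x" by (rule AE_lborel_singleton)
 then show "AE t in lborel. f t * indicator {0<..} t * indicator {..x} t = f t * indicator {0<..<x} t"
  by eventually_elim (auto simp: indicator_def)
qed

lemma lint_eq_Ioc:
 assumes [measurable]: "f \<in> borel_measurable borel"
 shows "nnl {0<..x} f = lint f x"
 unfolding lint_def
proof (rule nn_integral_cong_AE)
 have "AE t in lborel. t \<noteq> x" by (rule AE_lborel_singleton)
 then show "AE t in lborel. f t * indicator {0<..x} t = f t * indicator {0<..<x} t"
  by eventually_elim (auto simp: indicator_def)
qed

lemma continuous_lint:
 assumes [measurable]: "f \<in> borel_measurable borel" and fin: "nnl {0<..} f < \<top>"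
 shows "continuous_on UNIV (\<lambda>x. enn2real (lint f x))"
 using continuous_enn2real_integrals(3)[of "\<lambda>t. f t * indicator {0<..} t"] fin
 by (simp only: lint_eq_Iic[OF assms(1)]) simp

lemma ennreal_diff_enn2real:
 assumes "x = y + z" "x < \<top>" shows "ennreal (enn2real x - enn2real y) = z"
proof -
 have "y < \<top>" "z < \<top>" using assms by auto
 then obtain a b where "y = ennreal a" "z = ennreal b" "0 \<le> a" "0 \<le> b" by (metis ennreal_cases less_irrefl)
 then show ?thesis unfolding assms(1) by (simp flip: ennreal_plus)
qed

text \<open>\<open>level_inequality\<close> for h x = \<open>lint F (1 / x)\<close> and the measure
  u dx, without error term. An increment of h is an integral of F over an interval, and
  \<open>weighted_Hoelder\<close> splits it into the share of that interval in the norm and a power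
  of \<open>lint v (1 / x)\<close>.\<close>

theorem hardy_of_mh_cond:
 fixes u \<kappa> :: "real \<Rightarrow> ennreal"
 assumes q: "0 < q" "q < p" and p: "1 < p" "1 / p + 1 / p' = 1" and r: "1 / r = 1 / q - 1 / p"
  and [measurable]: "u \<in> borel_measurable borel" "\<kappa> \<in> borel_measurable borel"
  and \<kappa>: "\<And>t. 0 < t \<Longrightarrow> \<kappa> t < \<top>"
  and mh: "mh_cond p p' r u (\<lambda>t. \<kappa> t powe (p' - 1))"
 shows "hardy_ineq p q u \<kappa>"
proof -
 note ei = exponent_identities[OF q r]
 have p': "1 < p'" by (rule conjugate_gt_1[OF p])
 define v where "v t = \<kappa> t powe (p' - 1)" for t
 have [measurable]: "v \<in> borel_measurable borel" unfolding v_def by measurable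
 define Z where "Z = nnl {0<..} (\<lambda>x. lint u x powe (r / p) * lint v (1 / x) powe (r / p') * u x)"
 have Z: "Z < \<top>" using mh unfolding mh_cond_def Z_def v_def .
 define \<mu> where "\<mu> = density lborel (\<lambda>x. u x * indicator {0<..} x)"
 have sets: "sets \<mu> = sets borel" by (simp add: \<mu>_def)
 have int\<mu>: "(\<integral>\<^sup>+x\<in>{0<..}. f x \<partial>\<mu>) = nnl {0<..} (\<lambda>x. f x * u x)" if [measurable]: "f \<in> borel_measurable borel" for f
  unfolding \<mu>_def by (subst nn_integral_density) (auto intro!: nn_integral_cong simp: indicator_def mult_ac)
 have A\<mu>: "emeasure \<mu> {0<..x} = lint u x" for x
  unfolding \<mu>_def lint_eq_Ioc[symmetric, OF \<open>u \<in> borel_measurable borel\<close>]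
  by (subst emeasure_density) (auto intro!: nn_integral_cong simp: indicator_def)
 show ?thesis unfolding hardy_ineq_def
 proof (intro exI[of _ "ennreal (2 * 8 powr q) * Z powe (q / r)"] conjI allI impI)
  show "ennreal (2 * 8 powr q) * Z powe (q / r) < \<top>"
   using Z q ei(1) by (simp add: ennreal_mult_less_top powe_less_top_iff)
  fix F assume F: "admissible F" and M: "wnorm p \<kappa> F < \<top>"
  note [measurable] = admissibleD(2)[OF F]
  define h where "h x = enn2real (lint F (1 / x))" for x
  have lf: "lint F x < \<top>" for x by (rule admissibleD(3)[OF F])
  have eh: "ennreal (h x) = lint F (1 / x)" for x using lf[of "1 / x"] by (simp add: h_def)
  have cont: "continuous_on UNIV (\<lambda>x. enn2real (lint F x))"
   using F by (intro continuous_lint) (auto simp: admissible_def)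
  have "(\<integral>\<^sup>+x\<in>{0<..}. ennreal (h x) powe q \<partial>\<mu>) \<le>
   ennreal (2 * 8 powr q) * ((\<integral>\<^sup>+x\<in>{0<..}. (0::ennreal) powe q \<partial>\<mu>) +
    wnorm p \<kappa> F powe (q / p) * (\<integral>\<^sup>+x\<in>{0<..}. (lint v (1 / x) powe (1 / p')) powe r * emeasure \<mu> {0<..x} powe (r / p) \<partial>\<mu>) powe (q / r))"
  \<comment> \<open>m a b is the share of [1/b,1/a) in the norm; along an increasing sequence these
    intervals are disjoint.\<close>
  proof (rule level_inequality[OF sets q r, where m = "\<lambda>a b. \<integral>\<^sup>+t\<in>{1 / b..<1 / a}. F t powe p * inverse (\<kappa> t) \<partial>lborel"])
   show "continuous_on {0<..} h"
    unfolding h_def by (rule continuous_on_compose2[OF cont]) (auto intro!: continuous_intros)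
   have "((\<lambda>x::real. 1 / x) \<longlongrightarrow> 0) at_top" by (rule tendsto_divide_0[OF tendsto_const filterlim_at_top_imp_at_infinity[OF filterlim_ident]])
   moreover have "isCont (\<lambda>x. enn2real (lint F x)) 0" using cont by (simp add: continuous_on_eq_continuous_at)
   ultimately have "(h \<longlongrightarrow> enn2real (lint F 0)) at_top" unfolding h_def by (rule isCont_tendsto_compose[rotated])
   then show "(h \<longlongrightarrow> 0) at_top" by (simp add: lint_def)
   show "0 \<le> h x" if "0 < x" for x by (simp add: h_def)
   show "h y \<le> h x" if "0 < x" "x \<le> y" for x y
    unfolding h_def using that lf by (intro enn2real_mono lint_mono) (auto simp: field_simps)
   show "(\<lambda>x. lint v (1 / x) powe (1 / p')) \<in> borel_measurable borel" by measurable
   show "lint v (1 / y) powe (1 / p') \<le> lint v (1 / x) powe (1 / p')" if "0 < x" "x \<le> y" for x y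
    using that p' by (intro powe_mono lint_mono) (auto simp: field_simps)
   fix a b :: real assume ab: "0 < a" "a < b"
   have iab: "1 / b < 1 / a" using ab by (simp add: field_simps)
   have "lint F (1 / a) = lint F (1 / b) + nnl {1 / b..<1 / a} F"
    using ab iab by (intro lint_split) auto
   then have "ennreal (h a - h b) = nnl {1 / b..<1 / a} F"
    unfolding h_def by (rule ennreal_diff_enn2real) (rule lf)
   also have "\<dots> = nnl {1 / b..<1 / a} (\<lambda>t. 1 * F t)" by simp
   also have "\<dots> \<le> nnl {1 / b..<1 / a} (\<lambda>t. F t powe p * inverse (\<kappa> t)) powe (1 / p) *
     nnl {1 / b..<1 / a} (\<lambda>t. 1 powe p' * \<kappa> t powe (p' - 1)) powe (1 / p')"
    using ab by (intro weighted_Hoelder p \<kappa> M) (auto intro: less_le_trans[of _ "1 / b"])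
   also have "\<dots> \<le> nnl {1 / b..<1 / a} (\<lambda>t. F t powe p * inverse (\<kappa> t)) powe (1 / p) * lint v (1 / a) powe (1 / p')"
    unfolding lint_def v_def using p' ab
    by (intro mult_left_mono powe_mono nn_integral_mono) (auto simp: indicator_def intro: less_le_trans[of _ "1 / b"])
   finally show "ennreal (h a - h b) \<le> 0 + nnl {1 / b..<1 / a} (\<lambda>t. F t powe p * inverse (\<kappa> t)) powe (1 / p) * lint v (1 / a) powe (1 / p')"
    by simp
  next
   fix x :: "nat \<Rightarrow> real" assume x: "strict_mono x" "0 < x 0"
   have xp: "0 < x k" for k using strict_mono_less_eq[OF x(1), of 0 k] x(2) by simp
   have "disjoint_family (\<lambda>k. {1 / x (Suc k)..<1 / x k})"
    unfolding disjoint_family_on_def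
   proof (intro ballI impI)
    fix i j :: nat assume "i \<noteq> j"
    then have "Suc i \<le> j \<or> Suc j \<le> i" by auto
    then have "x (Suc i) \<le> x j \<or> x (Suc j) \<le> x i" using strict_mono_less_eq[OF x(1)] by blast
    then have "1 / x j \<le> 1 / x (Suc i) \<or> 1 / x i \<le> 1 / x (Suc j)"
     using xp le_imp_inverse_le by (auto simp: divide_inverse)
    then show "{1 / x (Suc i)..<1 / x i} \<inter> {1 / x (Suc j)..<1 / x j} = {}" by auto
   qed
   then show "(\<Sum>k. \<integral>\<^sup>+t\<in>{1 / x (Suc k)..<1 / x k}. F t powe p * inverse (\<kappa> t) \<partial>lborel) \<le> wnorm p \<kappa> F"
    unfolding wnorm_def using xp
    by (intro suminf_disjoint_le) (auto intro: less_le_trans[of _ "1 / x (Suc _)"])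
  qed simp_all
  also have "(\<integral>\<^sup>+x\<in>{0<..}. (0::ennreal) powe q \<partial>\<mu>) = 0" using q by simp
  also have "(\<integral>\<^sup>+x\<in>{0<..}. (lint v (1 / x) powe (1 / p')) powe r * emeasure \<mu> {0<..x} powe (r / p) \<partial>\<mu>) = Z"
   unfolding A\<mu> by (subst int\<mu>) (simp_all add: Z_def powe_powe mult_ac)
  also have "(\<integral>\<^sup>+x\<in>{0<..}. ennreal (h x) powe q \<partial>\<mu>) = nnl {0<..} (\<lambda>x. lint F (1 / x) powe q * u x)"
   unfolding eh by (subst int\<mu>) simp_all
  finally show "nnl {0<..} (\<lambda>x. lint F (1 / x) powe q * u x) \<le> ennreal (2 * 8 powr q) * Z powe (q / r) * wnorm p \<kappa> F powe (q / p)"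
   by (simp add: mult_ac)
 qed
qed


text \<open>The image of x^(-q/2) u(x) dx under y = 1/x. Integration against it gives the left side
  of \<open>tail_ineq\<close>, and \<open>emeasure_umeas\<close> identifies its values on (0,x] with
  the factor involving u in (BHJH) and (NH).\<close>

definition umeas :: "real \<Rightarrow> (real \<Rightarrow> ennreal) \<Rightarrow> real measure" where
 "umeas q u = distr (density lborel (\<lambda>z. ennreal (z powr (- q / 2)) * u z * indicator {0<..} z)) borel (\<lambda>z. 1 / z)"

lemma sets_umeas [measurable_cong]: "sets (umeas q u) = sets borel"
 by (simp add: umeas_def)

lemma nn_integral_umeas:
 assumes [measurable]: "u \<in> borel_measurable borel" "f \<in> borel_measurable borel"
 shows "(\<integral>\<^sup>+y. f y \<partial>umeas q u) = nnl {0<..} (\<lambda>z. f (1 / z) * (ennreal (z powr (- q / 2)) * u z))"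
 unfolding umeas_def
 by (subst nn_integral_distr, simp, simp, subst nn_integral_density)
   (auto intro!: nn_integral_cong simp: mult_ac)

lemma nn_integral_umeas_Ioi:
 assumes [measurable]: "u \<in> borel_measurable borel" "f \<in> borel_measurable borel"
 shows "(\<integral>\<^sup>+y\<in>{0<..}. f y \<partial>umeas q u) = nnl {0<..} (\<lambda>z. f (1 / z) * (ennreal (z powr (- q / 2)) * u z))"
 by (subst nn_integral_umeas) (auto intro!: nn_integral_cong simp: indicator_def)

lemma emeasure_umeas:
 assumes [measurable]: "u \<in> borel_measurable borel" and x: "0 < x"
 shows "emeasure (umeas q u) {0<..x} = rint (\<lambda>z. ennreal (z powr (- q / 2)) * u z) (1 / x)"
proof -
 have "emeasure (umeas q u) {0<..x} = (\<integral>\<^sup>+y. indicator {0<..x} y \<partial>umeas q u)" by simp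
 also have "\<dots> = nnl {0<..} (\<lambda>z. indicator {0<..x} (1 / z) * (ennreal (z powr (- q / 2)) * u z))"
  by (rule nn_integral_umeas) auto
 also have "\<dots> = rint (\<lambda>z. ennreal (z powr (- q / 2)) * u z) (1 / x)"
  unfolding rint_def
 proof (rule nn_integral_cong_AE)
  have "AE t in lborel. t \<noteq> 1 / x" by (rule AE_lborel_singleton)
  then show "AE z in lborel. indicator {0<..x} (1 / z) * (ennreal (z powr (- q / 2)) * u z) * indicator {0<..} z
   = ennreal (z powr (- q / 2)) * u z * indicator {1 / x<..} z"
  proof eventually_elim
   case (elim z)
   show ?case
   proof (cases "0 < z")
    case True
    then have "1 / z \<le> x \<longleftrightarrow> 1 / x < z" using x elim by (auto simp: field_simps)
    then show ?thesis using True by (auto simp: indicator_def)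
   next
    case False
    then have "\<not> 1 / x < z" using x by (meson less_trans zero_less_divide_1_iff)
    then show ?thesis using False by simp
   qed
  qed
 qed
 finally show ?thesis .
qed

definition bhjh_cond :: "real \<Rightarrow> real \<Rightarrow> real \<Rightarrow> real \<Rightarrow> (real \<Rightarrow> ennreal) \<Rightarrow> (real \<Rightarrow> ennreal) \<Rightarrow> bool" where
 "bhjh_cond p p' q r u v \<longleftrightarrow>
   (nnl {0<..} (\<lambda>x. rint (\<lambda>t. ennreal (t powr (- q / 2)) * u t) x powe (r / p) *
    rint (\<lambda>t. ennreal (t powr (- p' / 2)) * v t) (1 / x) powe (r / p') *
    (ennreal (x powr (- q / 2)) * u x))) < \<top>"

text \<open>A localized embedding of the Lorentz space L(2,1) into L(2): F^2 is the product of
  t^(1/2) F and t^(-1/2) F, and for t > s the first factor is bounded by the bracket on the right.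
  Its second summand accounts for the part of F before s.\<close>

lemma rint_square_le_Calderon:
 assumes F: "admissible F" and s: "0 < s"
 shows "rint (\<lambda>t. F t powe 2) s \<le> (rint (\<lambda>t. ennreal (t powr (- 1 / 2)) * F t) s + ennreal (s powr (- 1 / 2)) * lint F s) powe 2"
proof -
 note [measurable] = admissibleD(2)[OF F] and anti = admissibleD(1)[OF F]
 let ?X = "rint (\<lambda>t. ennreal (t powr (- 1 / 2)) * F t) s" and ?L = "ennreal (s powr (- 1 / 2)) * lint F s"
 have *: "ennreal (t powr (1 / 2)) * F t \<le> ?X + ?L" if t: "s < t" for t
 proof -
  have t0: "0 < t" using s t by simp
  \<comment> \<open>t = (t - s) + s: the first part is the length of (s,t), where the integrand of X
    is at least its value at t; the second leads to s F(t), which is at most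
    \<open>lint F s\<close>.\<close>
  have "t powr (1 / 2) = t * t powr (- 1 / 2)" using t0 by (simp add: powr_mult_base)
  also have "\<dots> = t powr (- 1 / 2) * (t - s) + t powr (- 1 / 2) * s" by (simp add: algebra_simps)
  also have "\<dots> \<le> t powr (- 1 / 2) * (t - s) + s powr (- 1 / 2) * s"
   using s t by (intro add_left_mono mult_right_mono powr_mono2') auto
  finally have "ennreal (t powr (1 / 2)) * F t \<le> ennreal (t powr (- 1 / 2) * (t - s) + s powr (- 1 / 2) * s) * F t"
   by (intro mult_right_mono ennreal_leI) auto
  also have "\<dots> = (ennreal (t powr (- 1 / 2)) * ennreal (t - s) + ennreal (s powr (- 1 / 2)) * ennreal s) * F t"
   using s t by (simp add: ennreal_mult)
  also have "\<dots> = ennreal (t powr (- 1 / 2)) * F t * ennreal (t - s) + ennreal (s powr (- 1 / 2)) * (ennreal s * F t)"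
   by (simp only: distrib_right distrib_left mult_ac)
  also have "\<dots> \<le> ?X + ?L"
  proof (intro add_mono mult_left_mono)
   have "ennreal (t powr (- 1 / 2)) * F t * ennreal (t - s) = nnl {s<..<t} (\<lambda>y. ennreal (t powr (- 1 / 2)) * F t)"
    using t by (simp add: nn_integral_cmult_indicator)
   also have "\<dots> \<le> ?X" unfolding rint_def
   proof (intro nn_integral_mono)
    fix y :: real
    show "ennreal (t powr (- 1 / 2)) * F t * indicator {s<..<t} y \<le> ennreal (y powr (- 1 / 2)) * F y * indicator {s<..} y"
     using s by (auto simp: indicator_def intro!: mult_mono ennreal_leI powr_mono2' antimonoD[OF anti])
   qed
   finally show "ennreal (t powr (- 1 / 2)) * F t * ennreal (t - s) \<le> ?X" .
   have "ennreal s * F t \<le> ennreal s * F s" using t by (intro mult_left_mono antimonoD[OF anti]) auto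
   also have "\<dots> \<le> lint F s" by (rule lint_ge[OF anti s])
   finally show "ennreal s * F t \<le> lint F s" .
  qed simp
  finally show ?thesis .
 qed
 have "rint (\<lambda>t. F t powe 2) s \<le> (\<integral>\<^sup>+t. (?X + ?L) * (ennreal (t powr (- 1 / 2)) * F t * indicator {s<..} t) \<partial>lborel)"
  unfolding rint_def[of "\<lambda>t. F t powe 2"]
 proof (intro nn_integral_mono)
  fix t :: real
  show "F t powe 2 * indicator {s<..} t \<le> (?X + ?L) * (ennreal (t powr (- 1 / 2)) * F t * indicator {s<..} t)"
  proof (cases "s < t")
   case True
   then have t0: "0 < t" using s by simp
   have "ennreal (t powr (1 / 2)) * ennreal (t powr (- 1 / 2)) = 1"
    using t0 by (simp add: powr_minus flip: ennreal_mult)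
   then have "F t powe 2 = (ennreal (t powr (1 / 2)) * ennreal (t powr (- 1 / 2))) * (F t * F t)"
    by (simp add: powe_2)
   also have "\<dots> = (ennreal (t powr (1 / 2)) * F t) * (ennreal (t powr (- 1 / 2)) * F t)"
    by (simp only: mult_ac)
   also have "\<dots> \<le> (?X + ?L) * (ennreal (t powr (- 1 / 2)) * F t)" by (intro mult_right_mono * True) simp
   finally show ?thesis using True by simp
  qed simp
 qed
 also have "\<dots> = (?X + ?L) * ?X" by (subst nn_integral_cmult) (simp_all add: rint_def)
 also have "\<dots> \<le> (?X + ?L) powe 2" by (simp add: powe_2 mult_left_mono)
 finally show ?thesis .
qed

text \<open>\<open>rint_square_le_Calderon\<close> splits the tail of F^2. The integral of t^(-1/2)
  F over (x,\<infinity>) is a second Hardy operator, treated by \<open>level_inequality\<close> with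
  (BHJH) in the role of (MH); in the other term the powers of x cancel and \<open>hardy_ineq\<close>
  applies.\<close>

theorem tail_of_bhjh_cond:
 fixes u \<kappa> :: "real \<Rightarrow> ennreal"
 assumes q: "0 < q" "q < p" and p: "1 < p" "1 / p + 1 / p' = 1" and r: "1 / r = 1 / q - 1 / p"
  and [measurable]: "u \<in> borel_measurable borel" "\<kappa> \<in> borel_measurable borel"
  and \<kappa>: "\<And>t. 0 < t \<Longrightarrow> \<kappa> t < \<top>"
  and bh: "bhjh_cond p p' q r u (\<lambda>t. \<kappa> t powe (p' - 1))" and hardy: "hardy_ineq p q u \<kappa>"
 shows "tail_ineq p q u \<kappa>"
proof -
 note ei = exponent_identities[OF q r]
 have p': "1 < p'" by (rule conjugate_gt_1[OF p])
 obtain C1 where C1: "C1 < \<top>" "\<And>F. admissible F \<Longrightarrow> wnorm p \<kappa> F < \<top> \<Longrightarrow>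
   nnl {0<..} (\<lambda>x. lint F (1 / x) powe q * u x) \<le> C1 * wnorm p \<kappa> F powe (q / p)"
  using hardy unfolding hardy_ineq_def by blast
 define v where "v t = ennreal (t powr (- p' / 2)) * \<kappa> t powe (p' - 1)" for t
 have [measurable]: "v \<in> borel_measurable borel" unfolding v_def by measurable
 define Z where "Z = nnl {0<..} (\<lambda>x. rint (\<lambda>t. ennreal (t powr (- q / 2)) * u t) x powe (r / p) * rint v (1 / x) powe (r / p') * (ennreal (x powr (- q / 2)) * u x))"
 have Z: "Z < \<top>" using bh unfolding bhjh_cond_def Z_def v_def .
 show ?thesis unfolding tail_ineq_def
 proof (intro exI[of _ "ennreal (2 powr q) * (ennreal (2 * 8 powr q) * Z powe (q / r) + C1)"] conjI allI impI)
  show "ennreal (2 powr q) * (ennreal (2 * 8 powr q) * Z powe (q / r) + C1) < \<top>"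
   using Z q ei(1) C1(1) by (simp add: ennreal_mult_less_top powe_less_top_iff)
  fix F assume F: "admissible F" and M: "wnorm p \<kappa> F < \<top>"
  note [measurable] = admissibleD(2)[OF F]
  let ?f = "\<lambda>t. ennreal (t powr (- 1 / 2)) * F t"
  have fin: "rint ?f y < \<top>" if "0 < y" for y
  proof -
   have "rint ?f y \<le> (\<integral>\<^sup>+t. ennreal (y powr (- 1 / 2)) * (F t * indicator {0<..} t) \<partial>lborel)"
    unfolding rint_def using that
    by (intro nn_integral_mono) (auto simp: indicator_def intro!: mult_right_mono ennreal_leI powr_mono2')
   also have "\<dots> < \<top>" using F by (subst nn_integral_cmult) (auto simp: admissible_def ennreal_mult_less_top)
   finally show ?thesis .
  qed
  define h where "h x = enn2real (rint ?f x)" for x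
  have eh: "ennreal (h x) = rint ?f x" if "0 < x" for x using fin[OF that] by (simp add: h_def)
  have "(\<integral>\<^sup>+x\<in>{0<..}. ennreal (h x) powe q \<partial>umeas q u) \<le>
   ennreal (2 * 8 powr q) * ((\<integral>\<^sup>+x\<in>{0<..}. (0::ennreal) powe q \<partial>umeas q u) +
    wnorm p \<kappa> F powe (q / p) * (\<integral>\<^sup>+x\<in>{0<..}. (rint v x powe (1 / p')) powe r * emeasure (umeas q u) {0<..x} powe (r / p) \<partial>umeas q u) powe (q / r))"
  proof (rule level_inequality[OF sets_umeas q r, where m = "\<lambda>a b. \<integral>\<^sup>+t\<in>{a<..b}. F t powe p * inverse (\<kappa> t) \<partial>lborel"])
   \<comment> \<open>The integrand may fail to be integrable at 0, so continuity is obtained on each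
     half-line away from 0.\<close>
   have loc: "continuous_on {a<..} h" "(h \<longlongrightarrow> 0) at_top" if a: "0 < a" for a
   proof -
    let ?g = "\<lambda>t. ?f t * indicator {a<..} t"
    have r: "rint ?g x = rint ?f x" if "a < x" for x
     unfolding rint_def using that by (intro nn_integral_cong) (auto simp: indicator_def)
    have g: "(\<integral>\<^sup>+t. ?g t \<partial>lborel) < \<top>" using fin[OF a] by (simp add: rint_def)
    have hg: "enn2real (rint ?g x) = h x" if "a < x" for x unfolding h_def r[OF that] ..
    have "continuous_on {a<..} (\<lambda>x. enn2real (rint ?g x))"
     by (rule continuous_on_subset[OF continuous_enn2real_integrals(1)]) (use g in auto)
    then show "continuous_on {a<..} h" by (rule continuous_on_eq) (simp only: greaterThan_iff hg)
    have "((\<lambda>x. enn2real (rint ?g x)) \<longlongrightarrow> 0) at_top"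
     by (rule continuous_enn2real_integrals(2)) (use g in auto)
    moreover have "eventually (\<lambda>x. enn2real (rint ?g x) = h x) at_top"
     using eventually_gt_at_top[of a] by eventually_elim (simp only: hg)
    ultimately show "(h \<longlongrightarrow> 0) at_top" by (rule Lim_transform_eventually)
   qed
   show "(h \<longlongrightarrow> 0) at_top" using loc(2)[of 1] by simp
   show "continuous_on {0<..} h"
   proof (rule continuous_at_imp_continuous_on, rule ballI)
    fix x :: real assume "x \<in> {0<..}"
    then show "isCont h x" using loc(1)[of "x / 2"] by (simp add: continuous_on_eq_continuous_at)
   qed
   show "0 \<le> h x" if "0 < x" for x by (simp add: h_def)
   show "h y \<le> h x" if "0 < x" "x \<le> y" for x y
    unfolding h_def using that fin by (intro enn2real_mono rint_antimono) auto
   show "(\<lambda>x. rint v x powe (1 / p')) \<in> borel_measurable borel" by measurable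
   show "rint v y powe (1 / p') \<le> rint v x powe (1 / p')" if "0 < x" "x \<le> y" for x y
    using that p' by (intro powe_mono rint_antimono) auto
   fix a b :: real assume ab: "0 < a" "a < b"
   have "rint ?f a = rint ?f b + nnl {a<..b} (\<lambda>t. ?f t)"
    using ab by (subst rint_split[of _ a b]) (auto simp: add.commute)
   then have "ennreal (h a - h b) = nnl {a<..b} (\<lambda>t. ennreal (t powr (- 1 / 2)) * F t)"
    unfolding h_def by (rule ennreal_diff_enn2real) (use fin ab in auto)
   also have "\<dots> \<le> nnl {a<..b} (\<lambda>t. F t powe p * inverse (\<kappa> t)) powe (1 / p) *
     nnl {a<..b} (\<lambda>t. ennreal (t powr (- 1 / 2)) powe p' * \<kappa> t powe (p' - 1)) powe (1 / p')"
    using ab by (intro weighted_Hoelder p \<kappa> M) auto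
   also have "\<dots> \<le> nnl {a<..b} (\<lambda>t. F t powe p * inverse (\<kappa> t)) powe (1 / p) * rint v a powe (1 / p')"
    unfolding rint_def v_def using p' ab
    by (intro mult_left_mono powe_mono nn_integral_mono) (auto simp: indicator_def ennreal_powe powr_powr)
   finally show "ennreal (h a - h b) \<le> 0 + nnl {a<..b} (\<lambda>t. F t powe p * inverse (\<kappa> t)) powe (1 / p) * rint v a powe (1 / p')"
    by simp
  next
   fix x :: "nat \<Rightarrow> real" assume x: "strict_mono x" "0 < x 0"
   have xp: "0 < x k" for k using strict_mono_less_eq[OF x(1), of 0 k] x(2) by simp
   have "disjoint_family (\<lambda>k. {x k<..x (Suc k)})"
    unfolding disjoint_family_on_def
   proof (intro ballI impI)
    fix i j :: nat assume "i \<noteq> j"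
    then have "Suc i \<le> j \<or> Suc j \<le> i" by auto
    then have "x (Suc i) \<le> x j \<or> x (Suc j) \<le> x i" using strict_mono_less_eq[OF x(1)] by blast
    then show "{x i<..x (Suc i)} \<inter> {x j<..x (Suc j)} = {}" by auto
   qed
   then show "(\<Sum>k. \<integral>\<^sup>+t\<in>{x k<..x (Suc k)}. F t powe p * inverse (\<kappa> t) \<partial>lborel) \<le> wnorm p \<kappa> F"
    unfolding wnorm_def by (intro suminf_disjoint_le) (auto intro: less_trans[OF xp])
  qed simp_all
  also have "(\<integral>\<^sup>+x\<in>{0<..}. (0::ennreal) powe q \<partial>umeas q u) = 0" using q by simp
  also have "(\<integral>\<^sup>+x\<in>{0<..}. (rint v x powe (1 / p')) powe r * emeasure (umeas q u) {0<..x} powe (r / p) \<partial>umeas q u) = Z"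
  proof -
   have "(\<integral>\<^sup>+x\<in>{0<..}. (rint v x powe (1 / p')) powe r * emeasure (umeas q u) {0<..x} powe (r / p) \<partial>umeas q u)
    = (\<integral>\<^sup>+x\<in>{0<..}. (rint v x powe (1 / p')) powe r * rint (\<lambda>z. ennreal (z powr (- q / 2)) * u z) (1 / x) powe (r / p) \<partial>umeas q u)"
    by (intro nn_integral_cong) (simp add: emeasure_umeas indicator_def)
   also have "\<dots> = Z" by (subst nn_integral_umeas_Ioi) (simp_all add: Z_def powe_powe mult_ac)
   finally show ?thesis .
  qed
  finally have 1: "(\<integral>\<^sup>+x\<in>{0<..}. rint ?f x powe q \<partial>umeas q u) \<le> ennreal (2 * 8 powr q) * (wnorm p \<kappa> F powe (q / p) * Z powe (q / r))"
   by (subst nn_integral_cong[of _ _ "\<lambda>x. ennreal (h x) powe q * indicator {0<..} x"]) (simp_all add: eh indicator_def)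
  have "nnl {0<..} (\<lambda>x. rint (\<lambda>t. F t powe 2) (1 / x) powe (q / 2) * (ennreal (x powr (- q / 2)) * u x)) \<le>
   (\<integral>\<^sup>+x. ennreal (2 powr q) * (rint ?f (1 / x) powe q * (ennreal (x powr (- q / 2)) * u x) * indicator {0<..} x + lint F (1 / x) powe q * u x * indicator {0<..} x) \<partial>lborel)"
  proof (intro nn_integral_mono)
   fix x :: real
   show "rint (\<lambda>t. F t powe 2) (1 / x) powe (q / 2) * (ennreal (x powr (- q / 2)) * u x) * indicator {0<..} x \<le>
    ennreal (2 powr q) * (rint ?f (1 / x) powe q * (ennreal (x powr (- q / 2)) * u x) * indicator {0<..} x + lint F (1 / x) powe q * u x * indicator {0<..} x)"
   proof (cases "0 < x")
    case True
    have e1: "(1 / x) powr (- 1 / 2) = x powr (1 / 2)"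
     using True powr_minus_divide[of x "1 / 2"] by (simp add: powr_divide powr_minus)
    have "rint (\<lambda>t. F t powe 2) (1 / x) powe (q / 2) \<le> ((rint ?f (1 / x) + ennreal ((1 / x) powr (- 1 / 2)) * lint F (1 / x)) powe 2) powe (q / 2)"
     using q True by (intro powe_mono rint_square_le_Calderon[OF F]) auto
    also have "\<dots> = (rint ?f (1 / x) + ennreal (x powr (1 / 2)) * lint F (1 / x)) powe q" unfolding e1 powe_powe by simp
    also have "\<dots> \<le> ennreal (2 powr q) * (rint ?f (1 / x) powe q + (ennreal (x powr (1 / 2)) * lint F (1 / x)) powe q)"
     using q by (intro powe_add_le) auto
    also have "(ennreal (x powr (1 / 2)) * lint F (1 / x)) powe q = ennreal (x powr (q / 2)) * lint F (1 / x) powe q"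
     using q True by (simp add: powe_mult ennreal_powe powr_powr)
    finally have "rint (\<lambda>t. F t powe 2) (1 / x) powe (q / 2) * (ennreal (x powr (- q / 2)) * u x) \<le>
     ennreal (2 powr q) * (rint ?f (1 / x) powe q + ennreal (x powr (q / 2)) * lint F (1 / x) powe q) * (ennreal (x powr (- q / 2)) * u x)"
     by (rule mult_right_mono) simp
    also have "\<dots> = ennreal (2 powr q) * (rint ?f (1 / x) powe q * (ennreal (x powr (- q / 2)) * u x) + (ennreal (x powr (q / 2)) * ennreal (x powr (- q / 2))) * (lint F (1 / x) powe q * u x))"
     by (simp only: distrib_left distrib_right mult_ac)
    also have "ennreal (x powr (q / 2)) * ennreal (x powr (- q / 2)) = 1"
     using True by (simp add: powr_minus flip: ennreal_mult)
    finally show ?thesis using True by simp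
   qed simp
  qed
  also have "\<dots> = ennreal (2 powr q) * ((\<integral>\<^sup>+x\<in>{0<..}. rint ?f x powe q \<partial>umeas q u) + nnl {0<..} (\<lambda>x. lint F (1 / x) powe q * u x))"
   by (subst nn_integral_umeas_Ioi) (simp_all add: nn_integral_cmult nn_integral_add)
  also have "\<dots> \<le> ennreal (2 powr q) * (ennreal (2 * 8 powr q) * (wnorm p \<kappa> F powe (q / p) * Z powe (q / r)) + C1 * wnorm p \<kappa> F powe (q / p))"
   by (intro mult_left_mono add_mono 1 C1(2) F M) simp
  also have "\<dots> = ennreal (2 powr q) * (ennreal (2 * 8 powr q) * Z powe (q / r) + C1) * wnorm p \<kappa> F powe (q / p)"
   by (simp only: distrib_left distrib_right mult_ac)
  finally show "nnl {0<..} (\<lambda>x. rint (\<lambda>t. F t powe 2) (1 / x) powe (q / 2) * (ennreal (x powr (- q / 2)) * u x))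
    \<le> ennreal (2 powr q) * (ennreal (2 * 8 powr q) * Z powe (q / r) + C1) * wnorm p \<kappa> F powe (q / p)" .
 qed
qed

section \<open>Discretization and the condition (SEQ)\<close>

text \<open>(SEQ) after the substitution y = 1/t: (b t - 1)^(q/2) t^(-q) is (b - y)^(q/2) t^(-q/2),
  and the last factor belongs to \<open>umeas\<close>. The bound is for r-th powers and for
  one-sided sequences, which is what the test sequences below are; \<open>Wf\<close> will be
  \<open>lint w\<close>.\<close>

definition seq_bound :: "real measure \<Rightarrow> (real \<Rightarrow> ennreal) \<Rightarrow> real \<Rightarrow> real \<Rightarrow> real \<Rightarrow> ennreal \<Rightarrow> bool" where
 "seq_bound \<mu> Wf p q r B \<longleftrightarrow> (\<forall>s :: nat \<Rightarrow> real. mono s \<longrightarrow> 0 < s 0 \<longrightarrow>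
   (\<Sum>i. (\<integral>\<^sup>+y\<in>{s i<..<s (Suc i)}. ennreal ((s (Suc i) - y) powr (q / 2)) \<partial>\<mu>) powe (r / q) *
    Wf (s (Suc i)) powe (- (r / p))) \<le> B)"

text \<open>Hoelder with exponents p/q and r/q, after inserting \<open>Wf\<close> to the powers q/p
  and -q/p; these cancel because \<open>Wf\<close> is neither 0 nor infinite where c i \<noteq>
  0.\<close>

lemma seq_bound_sum:
 assumes q: "0 < q" "q < p" and r: "1 / r = 1 / q - 1 / p"
  and B: "seq_bound \<mu> Wf p q r B" and s: "mono s" "0 < s 0"
  and W: "\<And>i. c i \<noteq> 0 \<Longrightarrow> Wf (s (Suc i)) \<noteq> 0 \<and> Wf (s (Suc i)) < \<top>"
 shows "(\<Sum>i. c i powe (q / p) * (\<integral>\<^sup>+y\<in>{s i<..<s (Suc i)}. ennreal ((s (Suc i) - y) powr (q / 2)) \<partial>\<mu>))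
  \<le> (\<Sum>i. c i * Wf (s (Suc i))) powe (q / p) * B powe (q / r)"
proof -
 note ei = exponent_identities[OF q r]
 let ?I = "\<lambda>i. \<integral>\<^sup>+y\<in>{s i<..<s (Suc i)}. ennreal ((s (Suc i) - y) powr (q / 2)) \<partial>\<mu>"
 let ?w = "\<lambda>i. Wf (s (Suc i))"
 have "(\<Sum>i. c i powe (q / p) * ?I i) \<le> (\<Sum>i. (c i * ?w i) powe (q / p) * (?I i powe (r / q) * ?w i powe (- (r / p))) powe (1 - q / p))"
 proof (intro suminf_le summableI)
  fix i
  have pos: "0 < q / p" "0 < q / r" "r / q * (q / r) = 1" "- (r / p) * (q / r) = - (q / p)" using q ei(1) by auto
  have *: "(c i * ?w i) powe (q / p) * (?I i powe (r / q) * ?w i powe (- (r / p))) powe (1 - q / p) = c i powe (q / p) * ?I i * (?w i powe (q / p) * ?w i powe (- (q / p)))"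
   unfolding ei(2) powe_mult[OF pos(1)] powe_mult[OF pos(2)] powe_powe pos(3,4) powe_1 by (simp only: mult_ac)
  show "c i powe (q / p) * ?I i \<le> (c i * ?w i) powe (q / p) * (?I i powe (r / q) * ?w i powe (- (r / p))) powe (1 - q / p)"
  proof (cases "c i = 0")
   case True
   then show ?thesis using pos(1) by simp
  next
   case False
   then obtain d where d: "d > 0" "?w i = ennreal d" using W[OF False] by (cases "?w i" rule: powe_cases) auto
   then have "?w i powe (q / p) * ?w i powe (- (q / p)) = 1"
    by (simp add: ennreal_powe powr_minus flip: ennreal_mult)
   then show ?thesis unfolding * by simp
  qed
 qed
 also have "\<dots> \<le> (\<Sum>i. c i * ?w i) powe (q / p) * (\<Sum>i. ?I i powe (r / q) * ?w i powe (- (r / p))) powe (1 - q / p)"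
  using q by (intro suminf_Hoelder) auto
 also have "\<dots> \<le> (\<Sum>i. c i * ?w i) powe (q / p) * B powe (1 - q / p)"
  using B s q unfolding seq_bound_def by (intro mult_left_mono powe_mono) auto
 finally show ?thesis unfolding ei(2) .
qed

text \<open>The next index is the first at which \<eta> has dropped by the factor N, so that in
  between \<eta> stays comparable with its last recorded value. The search succeeds because \<eta> n
  = 0, and the sequence remains at n once it is there.\<close>

lemma stopping_indices:
 fixes \<eta> :: "nat \<Rightarrow> real"
 assumes n: "1 \<le> n" and \<eta>0: "\<And>j. 0 \<le> \<eta> j" and \<eta>n: "\<eta> n = 0" and N: "1 \<le> N"
 obtains jj :: "nat \<Rightarrow> nat" where "jj 0 = 1" "\<And>m. jj m \<le> n" "\<And>m. jj m < n \<Longrightarrow> jj m < jj (Suc m)"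
  "\<And>m. jj m \<le> jj (Suc m)" "\<And>m. \<eta> (jj (Suc m)) \<le> \<eta> (jj m) / N"
  "\<And>m l. jj m \<le> l \<Longrightarrow> l < jj (Suc m) \<Longrightarrow> \<eta> (jj m) \<le> N * \<eta> l"
proof -
 define nxt where "nxt j = (if j < n then (LEAST i. j < i \<and> \<eta> i \<le> \<eta> j / N) else n)" for j
 have nxt: "j < nxt j \<and> nxt j \<le> n \<and> \<eta> (nxt j) \<le> \<eta> j / N" if "j < n" for j
 proof -
  have "j < n \<and> \<eta> n \<le> \<eta> j / N" using that \<eta>n \<eta>0[of j] N by simp
  then have "j < (LEAST i. j < i \<and> \<eta> i \<le> \<eta> j / N) \<and> \<eta> (LEAST i. j < i \<and> \<eta> i \<le> \<eta> j / N) \<le> \<eta> j / N"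
   "(LEAST i. j < i \<and> \<eta> i \<le> \<eta> j / N) \<le> n"
   by (rule LeastI, rule Least_le)
  then show ?thesis using that by (simp add: nxt_def)
 qed
 have nxt': "\<eta> j \<le> N * \<eta> l" if "j < n" "j \<le> l" "l < nxt j" for j l
 proof (cases "l = j")
  case True
  then show ?thesis using N \<eta>0[of j] mult_right_mono[of 1 N "\<eta> j"] by simp
 next
  case False
  then have "\<not> \<eta> l \<le> \<eta> j / N" using not_less_Least[of l "\<lambda>i. j < i \<and> \<eta> i \<le> \<eta> j / N"] that by (auto simp: nxt_def)
  then show ?thesis using N by (simp add: field_simps)
 qed
 define jj where "jj m = (nxt ^^ m) 1" for m
 have jS: "jj (Suc m) = nxt (jj m)" for m by (simp add: jj_def)
 have le: "jj m \<le> n" for m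
 proof (induction m)
  case (Suc m)
  then show ?case using nxt[of "jj m"] by (cases "jj m < n") (auto simp: jS nxt_def)
 qed (use n in \<open>simp add: jj_def\<close>)
 have sat: "jj (Suc m) = n" if "jj m = n" for m using that by (simp add: jS nxt_def)
 show thesis
 proof (rule that[of jj])
  show "jj 0 = 1" by (simp add: jj_def)
  show "jj m \<le> n" for m by (rule le)
  show "jj m < jj (Suc m)" if "jj m < n" for m using nxt[OF that] by (simp add: jS)
  show "jj m \<le> jj (Suc m)" for m
   using nxt[of "jj m"] sat[of m] le[of m] by (cases "jj m < n") (auto simp: jS)
  show "\<eta> (jj (Suc m)) \<le> \<eta> (jj m) / N" for m
   using nxt[of "jj m"] sat[of m] le[of m] \<eta>n by (cases "jj m < n") (auto simp: jS)
  show "\<eta> (jj m) \<le> N * \<eta> l" if "jj m \<le> l" "l < jj (Suc m)" for m l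
   using nxt'[of "jj m" l] that sat[of m] le[of m] by (cases "jj m < n") (auto simp: jS)
 qed
qed

text \<open>Some ratio d l / w l is at least the ratio of the weighted sums S and Y; otherwise the
  reverse strict inequalities would add up to S Y < S Y.\<close>

lemma weighted_choice:
 fixes \<omega> d w :: "nat \<Rightarrow> real"
 assumes "finite L" and \<omega>: "\<And>l. l \<in> L \<Longrightarrow> 0 < \<omega> l" and d: "\<And>l. l \<in> L \<Longrightarrow> 0 \<le> d l" and w: "\<And>l. l \<in> L \<Longrightarrow> 0 < w l"
  and S: "0 < (\<Sum>l\<in>L. \<omega> l * d l)"
 obtains l where "l \<in> L" "0 < d l" "(\<Sum>l\<in>L. \<omega> l * d l) * w l \<le> d l * (\<Sum>l\<in>L. \<omega> l * w l)"
proof -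
 note obt = that
 show thesis
 proof (rule ccontr)
 assume neg: "\<not> thesis"
 let ?S = "\<Sum>l\<in>L. \<omega> l * d l" and ?Y = "\<Sum>l\<in>L. \<omega> l * w l"
 let ?L = "{l\<in>L. 0 < d l}"
 have pull: "(\<Sum>l\<in>?L. \<omega> l * (d l * y)) = (\<Sum>l\<in>?L. \<omega> l * d l) * y"
  "(\<Sum>l\<in>L. \<omega> l * (y * w l)) = y * (\<Sum>l\<in>L. \<omega> l * w l)" for y
  by (simp_all add: sum_distrib_right sum_distrib_left mult_ac)
 have lt: "d l * ?Y < ?S * w l" if "l \<in> ?L" for l
  using neg obt[of l] that by (auto simp: not_le[symmetric])
 have "?L \<noteq> {}"
 proof
  assume "?L = {}"
  then have "\<And>l. l \<in> L \<Longrightarrow> d l = 0" using d by force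
  then show False using S by simp
 qed
 then have "(\<Sum>l\<in>?L. \<omega> l * (d l * ?Y)) < (\<Sum>l\<in>?L. \<omega> l * (?S * w l))"
  using assms(1) \<omega> lt by (intro sum_strict_mono mult_strict_left_mono) auto
 also have "\<dots> \<le> (\<Sum>l\<in>L. \<omega> l * (?S * w l))"
  using assms(1) \<omega> w S by (intro sum_mono2) (auto intro!: mult_nonneg_nonneg less_imp_le)
 also have "\<dots> = ?S * ?Y" using pull(2)[of ?S] .
 also have "(\<Sum>l\<in>?L. \<omega> l * (d l * ?Y)) = (\<Sum>l\<in>?L. \<omega> l * d l) * ?Y" using pull(1)[of ?Y] .
 also have "(\<Sum>l\<in>?L. \<omega> l * d l) = ?S"
  using assms(1) d by (intro sum.mono_neutral_left) (auto simp: le_less)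
 finally show False by simp
 qed
qed

lemma powr_add_le:
 fixes x y :: real
 assumes "0 < P" "0 \<le> x" "0 \<le> y" shows "(x + y) powr P \<le> 2 powr P * (x powr P + y powr P)"
proof -
 have "(x + y) powr P \<le> (2 * max x y) powr P" using assms by (intro powr_mono2) auto
 also have "\<dots> = 2 powr P * max x y powr P" using assms by (simp add: powr_mult)
 also have "\<dots> \<le> 2 powr P * (x powr P + y powr P)" by (intro mult_left_mono) (auto simp: max_def)
 finally show ?thesis .
qed

lemma geometric_tail_le: "(\<Sum>l\<in>{Suc i..n}. (1 / 2 :: real) ^ l) \<le> (1 / 2) ^ i"
proof (induction n)
 case (Suc n)
 have "(\<Sum>l\<in>{Suc i..n}. (1 / 2 :: real) ^ l) + (1/2)^n \<le> (1 / 2) ^ i" if "i \<le> n"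
  using that
 proof (induction n)
  case (Suc n)
  then show ?case by (cases "i \<le> n") (auto simp: not_le le_Suc_eq)
 qed simp
 then show ?case by (cases "i \<le> n") (auto intro: order_trans[rotated])
qed simp

text \<open>For a point mass distribution \<open>\<Sum> 2\<^sup>-\<^sup>l \<delta>(t l)\<close> the values of its potential at
 the nodes are grouped by stopping times at which the potential has dropped by a fixed factor.
 Within a group the potential is carried by the masses of the following two groups, and replacing these
 by a single mass at the node where the ratio of \<open>Wf\<close> to the kernel is minimal costs no more.
 Every third node obtained in this way yields a test sequence.\<close>

lemma seq_bound_potential:
 fixes \<mu> :: "real measure" and t :: "nat \<Rightarrow> real"
 assumes sets [measurable_cong]: "sets \<mu> = sets borel"
  and q: "0 < q" "q < p" and r: "1 / r = 1 / q - 1 / p"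
  and B: "seq_bound \<mu> Wf p q r B" and t: "mono t" "0 < t 0"
  and W: "\<And>l. 1 \<le> l \<Longrightarrow> l \<le> n \<Longrightarrow> Wf (t l) \<noteq> 0 \<and> Wf (t l) < \<top>"
 defines "P \<equiv> p / 2"
 shows "(\<integral>\<^sup>+x\<in>{t 0<..}. ennreal (\<Sum>l=1..n. (1 / 2) ^ l * max 0 (t l - x) powr P) powe (q / p) \<partial>\<mu>) \<le>
  ennreal (2 * 2 powr P * (1 + 12 * 2 powr P * (1 + 2 powr P))) *
   ((\<Sum>l=1..n. ennreal ((1 / 2) ^ l) * Wf (t l)) powe (q / p) * B powe (q / r))"
proof (cases "n = 0")
 case True
 then show ?thesis using q by simp
next
 case False
 then have n: "1 \<le> n" by simp
 have P: "0 < P" using q by (simp add: P_def)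
 define \<theta> where "\<theta> = q / p"
 have \<theta>: "0 < \<theta>" "\<theta> < 1" "P * \<theta> = q / 2" using q by (auto simp: \<theta>_def P_def)
 define CP where "CP = (2::real) powr P"
 have CP: "1 \<le> CP" using P by (simp add: CP_def ge_one_powr_ge_zero)
 define \<omega> where "\<omega> l = (1 / 2 :: real) ^ l" for l :: nat
 have \<omega>0: "0 < \<omega> l" for l by (simp add: \<omega>_def)
 define K where "K y x = max 0 (y - x) powr P" for y x :: real
 have K0: "0 \<le> K y x" for x y by (simp add: K_def)
 have \<omega>K0: "0 \<le> \<omega> l * K y x" for l x y using \<omega>0[of l] K0[of y x] by simp
 have KA: "K y x' \<le> K y x" if "x \<le> x'" for x x' y unfolding K_def using P that by (intro powr_mono2) auto
 have Kz: "K y x = 0" if "y \<le> x" for x y using that P by (simp add: K_def)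
 \<comment> \<open>P-th powers of distances obey the triangle inequality up to CP = 2^P; the further
   constants N and D are built from it.\<close>
 have Ktri: "K y x \<le> CP * (K y z + K z x)" if "x \<le> z" for x y z
 proof -
  have "K y x \<le> (max 0 (y - z) + max 0 (z - x)) powr P"
   unfolding K_def using P that by (intro powr_mono2) auto
  also have "\<dots> \<le> CP * (K y z + K z x)" unfolding K_def CP_def by (rule powr_add_le[OF P]) auto
  finally show ?thesis .
 qed
 define h where "h x = (\<Sum>l=1..n. \<omega> l * K (t l) x)" for x
 have h0: "0 \<le> h x" for x unfolding h_def using \<omega>0 K0 by (intro sum_nonneg mult_nonneg_nonneg) (auto intro: less_imp_le)
 have hA: "h y \<le> h x" if "x \<le> y" for x y
  unfolding h_def using KA[OF that] \<omega>0 by (intro sum_mono mult_left_mono) (auto intro: less_imp_le)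
 have tm: "t i \<le> t j" if "i \<le> j" for i j using t(1) that by (rule monoD)
 have h_from: "h x = (\<Sum>l=j..n. \<omega> l * K (t l) x)" if "1 \<le> j" "t (j - 1) \<le> x" for j x
  unfolding h_def
 proof (rule sum.mono_neutral_right)
  show "\<forall>l\<in>{1..n} - {j..n}. \<omega> l * K (t l) x = 0"
  proof
   fix l assume "l \<in> {1..n} - {j..n}"
   then have "t l \<le> t (j - 1)" by (intro tm) auto
   then show "\<omega> l * K (t l) x = 0" using that(2) by (simp add: Kz)
  qed
 qed (use that in auto)
 define \<eta> where "\<eta> j = h (t j)" for j
 have \<eta>0: "0 \<le> \<eta> j" for j by (simp add: \<eta>_def h0)
 have \<eta>A: "\<eta> j \<le> \<eta> i" if "i \<le> j" for i j unfolding \<eta>_def by (intro hA tm that)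
 have \<eta>n: "\<eta> n = 0" unfolding \<eta>_def h_def using tm by (intro sum.neutral) (auto simp: Kz)
 have \<eta>_sum: "\<eta> i = (\<Sum>l=Suc i..n. \<omega> l * K (t l) (t i))" for i
  unfolding \<eta>_def by (subst h_from[of "Suc i"]) auto
 have \<omega>_tail: "(\<Sum>l=Suc i..n. \<omega> l) \<le> \<omega> i" for i unfolding \<omega>_def by (rule geometric_tail_le)
 \<comment> \<open>The masses beyond node i are seen from x by breaking the distance at t i. Since
   the masses are 2^-l, those beyond i together weigh no more than node i.\<close>
 have split_tail: "(\<Sum>l=Suc i..n. \<omega> l * K (t l) x) \<le> CP * (\<eta> i + \<omega> i * K (t i) x)" if "x \<le> t i" for i x
 proof -
  have "(\<Sum>l=Suc i..n. \<omega> l * K (t l) x) \<le> (\<Sum>l=Suc i..n. \<omega> l * (CP * (K (t l) (t i) + K (t i) x)))"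
   using Ktri[OF that] \<omega>0 by (intro sum_mono mult_left_mono) (auto intro: less_imp_le)
  also have "\<dots> = CP * (\<eta> i + (\<Sum>l=Suc i..n. \<omega> l) * K (t i) x)"
   unfolding \<eta>_sum[of i] by (simp add: sum_distrib_left sum_distrib_right sum.distrib[symmetric] algebra_simps)
  also have "\<dots> \<le> CP * (\<eta> i + \<omega> i * K (t i) x)"
   using CP K0 by (intro mult_left_mono add_left_mono mult_right_mono \<omega>_tail) auto
  finally show ?thesis .
 qed
 \<comment> \<open>Between two nodes the potential is governed by the next node j and by the
   potential \<eta> j there. The first part is estimated with the sequence of all nodes
   (\<open>f1\<close>), the second with sparse sequences (\<open>f2\<close>).\<close>
 have near: "h x \<le> 2 * CP * (\<eta> j + \<omega> j * K (t j) x)" if j: "1 \<le> j" "j \<le> n" "t (j - 1) < x" "x \<le> t j" for j x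
 proof -
  have "h x = \<omega> j * K (t j) x + (\<Sum>l=Suc j..n. \<omega> l * K (t l) x)"
   using j by (subst h_from[of j]) (auto simp: sum.atLeast_Suc_atMost)
  moreover have "\<omega> j * K (t j) x \<le> CP * (\<eta> j + \<omega> j * K (t j) x)"
  proof -
   have "\<omega> j * K (t j) x \<le> CP * (\<omega> j * K (t j) x)"
    using CP mult_right_mono[OF CP, of "\<omega> j * K (t j) x"] \<omega>0[of j] K0[of "t j" x] by simp
   also have "\<dots> \<le> CP * (\<eta> j + \<omega> j * K (t j) x)" using CP \<eta>0[of j] by (intro mult_left_mono) auto
   finally show ?thesis .
  qed
  ultimately show ?thesis using split_tail[OF j(4)] by (simp only: mult.assoc)
 qed
 \<comment> \<open>The drop factor is chosen so that CP \<eta> / N = \<eta> / 2 can be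
   absorbed.\<close>
 define N where "N = 2 * CP"
 have N: "1 \<le> N" using CP by (simp add: N_def)
 obtain jj :: "nat \<Rightarrow> nat" where jj: "jj 0 = 1" "\<And>m. jj m \<le> n" "\<And>m. jj m < n \<Longrightarrow> jj m < jj (Suc m)"
  "\<And>m. jj m \<le> jj (Suc m)" "\<And>m. \<eta> (jj (Suc m)) \<le> \<eta> (jj m) / N"
  "\<And>m l. jj m \<le> l \<Longrightarrow> l < jj (Suc m) \<Longrightarrow> \<eta> (jj m) \<le> N * \<eta> l"
  using stopping_indices[where \<eta> = \<eta>, OF n \<eta>0 \<eta>n N] by blast
 have jjm: "jj i \<le> jj j" if "i \<le> j" for i j using lift_Suc_mono_le[of jj, OF jj(4) that] .
 have jj1: "1 \<le> jj m" for m using jjm[of 0 m] jj(1) by simp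
 define w where "w l = enn2real (Wf (t l))" for l
 have w: "Wf (t l) = ennreal (w l)" "0 < w l" if "1 \<le> l" "l \<le> n" for l
  using W[OF that] by (cases "Wf (t l)" rule: powe_cases; auto simp: w_def)+
 define Y where "Y m = (\<Sum>l=jj (Suc m)..jj (Suc (Suc m)). \<omega> l * w l)" for m
 define good where "good m \<longleftrightarrow> jj m < n \<and> 0 < \<eta> (jj m)" for m
 \<comment> \<open>N is lost between two stopping indices, and 2 (1 + CP) in discarding the nodes
   beyond \<open>jj (Suc (Suc m))\<close>.\<close>
 define D where "D = 2 * N * (1 + CP)"
 have D1: "1 \<le> D" unfolding D_def using N CP by (smt (verit) mult_le_cancel_right1 mult_le_cancel_left1)
 have ex: "\<exists>l. jj (Suc m) \<le> l \<and> l \<le> jj (Suc (Suc m)) \<and> (good m \<longrightarrow>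
   t (jj (Suc m) - 1) < t l \<and> \<eta> (jj m) \<le> D * (Y m / w l) * K (t l) (t (jj (Suc m) - 1)))" for m
 proof (cases "good m")
  case False
  then show ?thesis using jj(4) by blast
 next
  case True
  \<comment> \<open>At the last node before the next stopping index the potential is still at least
    \<eta> (jj m) / N, and only the nodes from \<open>jj (Suc m)\<close> on contribute to
    it.\<close>
  let ?k = "jj (Suc m) - 1" and ?i = "jj (Suc (Suc m))"
  have k: "Suc ?k = jj (Suc m)" using jj1[of "Suc m"] by simp
  have jlt: "jj m < jj (Suc m)" using True jj(3) by (simp add: good_def)
  have ki: "?k \<le> ?i" using jj(4)[of "Suc m"] by simp
  let ?S = "\<Sum>l=jj (Suc m)..?i. \<omega> l * K (t l) (t ?k)"
  have \<eta>k: "\<eta> (jj m) \<le> N * \<eta> ?k" using jj(6)[of m ?k] jlt by auto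
  have "\<eta> ?k = (\<Sum>l=jj (Suc m)..n. \<omega> l * K (t l) (t ?k))" unfolding \<eta>_sum[of ?k] k ..
  also have "\<dots> = ?S + (\<Sum>l=Suc ?i..n. \<omega> l * K (t l) (t ?k))"
  proof -
   have "{jj (Suc m)..n} = {jj (Suc m)..?i} \<union> {Suc ?i..n}"
    using jj(2)[of "Suc (Suc m)"] jj(4)[of "Suc m"] by auto
   then show ?thesis by (simp add: sum.union_disjoint)
  qed
  finally have e0: "\<eta> ?k = ?S + (\<Sum>l=Suc ?i..n. \<omega> l * K (t l) (t ?k))" .
  have e1: "(\<Sum>l=Suc ?i..n. \<omega> l * K (t l) (t ?k)) \<le> CP * (\<eta> ?i + \<omega> ?i * K (t ?i) (t ?k))"
   by (rule split_tail[OF tm[OF ki]])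
  have e2: "\<omega> ?i * K (t ?i) (t ?k) \<le> ?S"
   by (rule member_le_sum) (use jj(4)[of "Suc m"] \<omega>K0 in auto)
  have e3: "\<eta> ?i \<le> \<eta> ?k / N"
  proof -
   have "\<eta> ?i \<le> \<eta> (jj (Suc m)) / N" by (rule jj(5))
   also have "\<dots> \<le> \<eta> ?k / N" using N by (intro divide_right_mono \<eta>A) auto
   finally show ?thesis .
  qed
  have "CP * (\<eta> ?i + \<omega> ?i * K (t ?i) (t ?k)) \<le> CP * (\<eta> ?k / N + ?S)"
   using CP by (intro mult_left_mono add_mono e2 e3) auto
  then have "\<eta> ?k \<le> ?S + CP * (\<eta> ?k / N + ?S)" using e0 e1 by linarith
  also have "CP * (\<eta> ?k / N + ?S) = \<eta> ?k / 2 + CP * ?S" using CP by (simp add: N_def field_simps)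
  finally have \<eta>S: "\<eta> ?k \<le> 2 * (1 + CP) * ?S" by (simp add: algebra_simps)
  have \<eta>D: "\<eta> (jj m) \<le> D * ?S"
  proof -
   have "\<eta> (jj m) \<le> N * (2 * (1 + CP) * ?S)" using \<eta>k \<eta>S N by (smt (verit) mult_left_mono)
   then show ?thesis by (simp add: D_def mult_ac)
  qed
  have Sp: "0 < ?S"
  proof (rule ccontr)
   assume "\<not> 0 < ?S"
   then have "D * ?S \<le> 0" using D1 by (simp add: mult_nonneg_nonpos)
   then show False using \<eta>D True by (simp add: good_def)
  qed
  \<comment> \<open>A node whose kernel per unit of weight is at least the average; it can take over
    the weight of the whole block.\<close>
  obtain l where l: "l \<in> {jj (Suc m)..?i}" "0 < K (t l) (t ?k)" "?S * w l \<le> K (t l) (t ?k) * Y m"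
   unfolding Y_def
  proof (rule weighted_choice[of "{jj (Suc m)..?i}" \<omega> "\<lambda>l. K (t l) (t ?k)" w])
   fix l assume "l \<in> {jj (Suc m)..?i}"
   then show "0 < w l" using jj1[of "Suc m"] jj(2)[of "Suc (Suc m)"] by (intro w(2)) auto
  qed (use \<omega>0 K0 Sp in auto)
  have wl: "0 < w l" using l(1) jj1[of "Suc m"] jj(2)[of "Suc (Suc m)"] by (intro w(2)) auto
  have "t ?k < t l" using l(2) Kz[of "t l" "t ?k"] by (cases "t ?k < t l") auto
  moreover have "\<eta> (jj m) \<le> D * (Y m / w l) * K (t l) (t ?k)"
  proof -
   have "?S \<le> K (t l) (t ?k) * Y m / w l" using l(3) wl by (simp add: field_simps)
   then have "D * ?S \<le> D * (K (t l) (t ?k) * Y m / w l)" using D1 by (intro mult_left_mono) auto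
   then show ?thesis using \<eta>D by (simp add: mult_ac)
  qed
  ultimately show ?thesis using l(1) by (intro exI[of _ l]) auto
 qed
 have "\<exists>L. \<forall>m. jj (Suc m) \<le> L m \<and> L m \<le> jj (Suc (Suc m)) \<and> (good m \<longrightarrow>
   t (jj (Suc m) - 1) < t (L m) \<and> \<eta> (jj m) \<le> D * (Y m / w (L m)) * K (t (L m)) (t (jj (Suc m) - 1)))"
  by (intro choice allI ex)
 then obtain L where L': "\<forall>m. jj (Suc m) \<le> L m \<and> L m \<le> jj (Suc (Suc m)) \<and> (good m \<longrightarrow>
   t (jj (Suc m) - 1) < t (L m) \<and> \<eta> (jj m) \<le> D * (Y m / w (L m)) * K (t (L m)) (t (jj (Suc m) - 1)))"
  by (rule exE)
 then have L: "jj (Suc m) \<le> L m" "L m \<le> jj (Suc (Suc m))"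
  "good m \<Longrightarrow> t (jj (Suc m) - 1) < t (L m)"
  "good m \<Longrightarrow> \<eta> (jj m) \<le> D * (Y m / w (L m)) * K (t (L m)) (t (jj (Suc m) - 1))" for m
  by auto
 have L1: "1 \<le> L m" "L m \<le> n" for m
  using L(1)[of m] L(2)[of m] jj1[of "Suc m"] jj(2)[of "Suc (Suc m)"] by linarith+
 \<comment> \<open>The replacing mass: for good m, c m times w (L m) is Y m, so the cost does not
   change.\<close>
 define c where "c m = (if good m then Y m / w (L m) else 0)" for m
 have Y0: "0 \<le> Y m" for m
  unfolding Y_def using \<omega>0 w(2) jj1[of "Suc m"] jj(2)[of "Suc (Suc m)"]
  by (intro sum_nonneg mult_nonneg_nonneg) (auto intro!: less_imp_le)
 have c0: "0 \<le> c m" for m unfolding c_def using Y0[of m] w(2)[OF L1, of m] by simp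
 \<comment> \<open>Steps of three leave room: L m \<le> jj (m+2), so as long as the stopping indices
   increase strictly, t (L m) lies to the left of every x > t (jj (m+3) - 1). The three residues
   \<rho> cover all m.\<close>
 define \<sigma> where "\<sigma> \<rho> i = (case i of 0 \<Rightarrow> t 0 | Suc i \<Rightarrow> t (L (3 * i + \<rho>)))" for \<rho> i :: nat
 have \<sigma>: "mono (\<sigma> \<rho>)" "0 < \<sigma> \<rho> 0" for \<rho>
 proof -
  show "mono (\<sigma> \<rho>)" unfolding mono_iff_le_Suc
  proof
   fix i show "\<sigma> \<rho> i \<le> \<sigma> \<rho> (Suc i)"
   proof (cases i)
    case 0 then show ?thesis by (simp add: \<sigma>_def tm)
   next
    case (Suc k)
    have "L (3 * k + \<rho>) \<le> jj (Suc (Suc (3 * k + \<rho>)))" by (rule L(2))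
    also have "\<dots> \<le> jj (Suc (3 * Suc k + \<rho>))" by (rule jjm) simp
    also have "\<dots> \<le> L (3 * Suc k + \<rho>)" by (rule L(1))
    finally show ?thesis using Suc by (simp add: \<sigma>_def tm)
   qed
  qed
  show "0 < \<sigma> \<rho> 0" using t(2) by (simp add: \<sigma>_def)
 qed
 let ?Y = "\<Sum>l=1..n. ennreal ((1 / 2) ^ l) * Wf (t l)"
 have Yeq: "?Y = ennreal (\<Sum>l=1..n. \<omega> l * w l)"
 proof -
  have "?Y = (\<Sum>l=1..n. ennreal (\<omega> l * w l))"
  proof (rule sum.cong[OF refl])
   fix l assume "l \<in> {1..n}"
   then show "ennreal ((1 / 2) ^ l) * Wf (t l) = ennreal (\<omega> l * w l)"
    using w(1)[of l] by (simp add: \<omega>_def ennreal_mult')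
  qed
  also have "\<dots> = ennreal (\<Sum>l=1..n. \<omega> l * w l)"
  proof (rule sum_ennreal)
   fix l assume "l \<in> {1..n}"
   then show "0 \<le> \<omega> l * w l" using w(2)[of l] \<omega>0[of l] by simp
  qed
  finally show ?thesis .
 qed
 \<comment> \<open>For a fixed residue the blocks of nodes belonging to different good indices are
   disjoint, so their costs add up to at most the total.\<close>
 have Ysum: "(\<Sum>i. ennreal (c (3 * i + \<rho>)) * Wf (\<sigma> \<rho> (Suc i))) \<le> ?Y" for \<rho>
 proof (rule suminf_le_const[OF summableI])
  fix k
  have strict: "jj (Suc (Suc m)) < jj (Suc m')" if "m + 3 \<le> m'" "good m'" for m m'
  proof -
   have a: "jj (m + 3) < n" using jjm[OF that(1)] that(2) by (simp add: good_def)
   have "jj (Suc (Suc m)) \<le> jj m'" using that(1) by (intro jjm) simp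
   also have "\<dots> < jj (Suc m')" using jj(3) that(2) by (simp add: good_def)
   finally show ?thesis .
  qed
  let ?G = "{i. i < k \<and> good (3 * i + \<rho>)}" and ?A = "\<lambda>i. {jj (Suc (3 * i + \<rho>))..jj (Suc (Suc (3 * i + \<rho>)))}"
  have "(\<Sum>i<k. ennreal (c (3 * i + \<rho>)) * Wf (\<sigma> \<rho> (Suc i))) = (\<Sum>i<k. ennreal (c (3 * i + \<rho>) * w (L (3 * i + \<rho>))))"
   using c0 by (intro sum.cong) (auto simp: \<sigma>_def w(1)[OF L1] ennreal_mult' )
  also have "\<dots> = ennreal (\<Sum>i<k. c (3 * i + \<rho>) * w (L (3 * i + \<rho>)))"
   using c0 less_imp_le[OF w(2)[OF L1]] by (intro sum_ennreal mult_nonneg_nonneg)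
  also have "(\<Sum>i<k. c (3 * i + \<rho>) * w (L (3 * i + \<rho>))) = (\<Sum>i\<in>?G. Y (3 * i + \<rho>))"
  proof -
   have "(\<Sum>i\<in>?G. Y (3 * i + \<rho>)) = (\<Sum>i\<in>?G. c (3 * i + \<rho>) * w (L (3 * i + \<rho>)))"
    using w(2)[OF L1] by (intro sum.cong) (auto simp: c_def less_imp_neq[symmetric])
   also have "\<dots> = (\<Sum>i<k. c (3 * i + \<rho>) * w (L (3 * i + \<rho>)))"
    by (intro sum.mono_neutral_left) (auto simp: c_def)
   finally show ?thesis ..
  qed
  also have "\<dots> = (\<Sum>l\<in>(\<Union>i\<in>?G. ?A i). \<omega> l * w l)"
   unfolding Y_def
  proof (rule sum.UNION_disjoint[symmetric])
   show "\<forall>i\<in>?G. \<forall>j\<in>?G. i \<noteq> j \<longrightarrow> ?A i \<inter> ?A j = {}"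
   proof (intro ballI impI)
    fix i j assume ij: "i \<in> ?G" "j \<in> ?G" "i \<noteq> j"
    then consider "3 * i + \<rho> + 3 \<le> 3 * j + \<rho>" | "3 * j + \<rho> + 3 \<le> 3 * i + \<rho>" by linarith
    then show "?A i \<inter> ?A j = {}"
    proof cases
     case 1 then show ?thesis using strict[OF 1] ij by auto
    next
     case 2 then show ?thesis using strict[OF 2] ij by auto
    qed
   qed
  qed auto
  also have "\<dots> \<le> (\<Sum>l=1..n. \<omega> l * w l)"
  proof (rule sum_mono2)
   show "(\<Union>i\<in>?G. ?A i) \<subseteq> {1..n}"
   proof (rule UN_least)
    fix i
    show "?A i \<subseteq> {1..n}"
     using jj1[of "Suc (3 * i + \<rho>)"] jj(2)[of "Suc (Suc (3 * i + \<rho>))"] by auto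
   qed
   show "0 \<le> \<omega> l * w l" if "l \<in> {1..n} - (\<Union>i\<in>?G. ?A i)" for l
    using that \<omega>0[of l] w(2)[of l] by auto
  qed simp
  finally show "(\<Sum>i<k. ennreal (c (3 * i + \<rho>)) * Wf (\<sigma> \<rho> (Suc i))) \<le> ?Y"
   unfolding Yeq by (simp add: ennreal_leI)
 qed
 define a where "a i = (if i < n then \<omega> (Suc i) else 0)" for i
 \<comment> \<open>\<open>min i n\<close> makes the sequence constant from n on, so that the
   intervals beyond are empty.\<close>
 define s where "s i = t (min i n)" for i
 have s: "mono s" "0 < s 0" using t by (auto simp: s_def mono_def)
 define R where "R = ?Y powe \<theta> * B powe (q / r)"
 define f1 where "f1 x = (\<Sum>i. ennreal (a i) powe \<theta> * (ennreal ((s (Suc i) - x) powr (q / 2)) * indicator {s i<..<s (Suc i)} x))" for x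
 define f2 where "f2 \<rho> x = (\<Sum>i. ennreal (c (3 * i + \<rho>)) powe \<theta> * (ennreal ((\<sigma> \<rho> (Suc i) - x) powr (q / 2)) * indicator {\<sigma> \<rho> i<..<\<sigma> \<rho> (Suc i)} x))" for \<rho> x
 have [measurable]: "f1 \<in> borel_measurable borel" "f2 \<rho> \<in> borel_measurable borel" for \<rho>
  unfolding f1_def f2_def by measurable
 have f1: "(\<integral>\<^sup>+x. f1 x \<partial>\<mu>) \<le> R"
 proof -
  have "(\<integral>\<^sup>+x. f1 x \<partial>\<mu>) = (\<Sum>i. ennreal (a i) powe \<theta> * (\<integral>\<^sup>+y\<in>{s i<..<s (Suc i)}. ennreal ((s (Suc i) - y) powr (q / 2)) \<partial>\<mu>))"
   unfolding f1_def by (subst nn_integral_suminf) (auto intro!: suminf_cong nn_integral_cmult)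
  also have "\<dots> \<le> (\<Sum>i. ennreal (a i) * Wf (s (Suc i))) powe \<theta> * B powe (q / r)"
   unfolding \<theta>_def
  proof (rule seq_bound_sum[OF q r B s])
   fix i assume "ennreal (a i) \<noteq> 0"
   then have "i < n" by (auto simp: a_def split: if_splits)
   then show "Wf (s (Suc i)) \<noteq> 0 \<and> Wf (s (Suc i)) < \<top>" unfolding s_def by (intro W) auto
  qed
  also have "(\<Sum>i. ennreal (a i) * Wf (s (Suc i))) = (\<Sum>i\<in>{..<n}. ennreal (a i) * Wf (s (Suc i)))"
   by (rule suminf_finite) (auto simp: a_def)
  also have "\<dots> = (\<Sum>i\<in>{..<n}. ennreal (\<omega> (Suc i)) * Wf (t (Suc i)))"
   by (intro sum.cong) (auto simp: a_def s_def min_def Suc_le_eq)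
  also have "\<dots> = ?Y"
   using sum.atLeast1_atMost_eq[of "\<lambda>l. ennreal ((1 / 2) ^ l) * Wf (t l)" n] by (simp add: \<omega>_def)
  finally show ?thesis unfolding R_def .
 qed
 have f2: "(\<integral>\<^sup>+x. f2 \<rho> x \<partial>\<mu>) \<le> R" for \<rho>
 proof -
  have "(\<integral>\<^sup>+x. f2 \<rho> x \<partial>\<mu>) = (\<Sum>i. ennreal (c (3 * i + \<rho>)) powe \<theta> * (\<integral>\<^sup>+y\<in>{\<sigma> \<rho> i<..<\<sigma> \<rho> (Suc i)}. ennreal ((\<sigma> \<rho> (Suc i) - y) powr (q / 2)) \<partial>\<mu>))"
   unfolding f2_def by (subst nn_integral_suminf) (auto intro!: suminf_cong nn_integral_cmult)
  also have "\<dots> \<le> (\<Sum>i. ennreal (c (3 * i + \<rho>)) * Wf (\<sigma> \<rho> (Suc i))) powe \<theta> * B powe (q / r)"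
   unfolding \<theta>_def
  proof (rule seq_bound_sum[OF q r B \<sigma>])
   fix i
   show "Wf (\<sigma> \<rho> (Suc i)) \<noteq> 0 \<and> Wf (\<sigma> \<rho> (Suc i)) < \<top>" unfolding \<sigma>_def by (simp add: W[OF L1])
  qed
  also have "\<dots> \<le> R" unfolding R_def using \<theta> Ysum by (intro mult_right_mono powe_mono) auto
  finally show ?thesis .
 qed
 have pt: "ennreal (h x) powe \<theta> \<le> ennreal (2 * CP) * (f1 x + ennreal D * (f2 0 x + f2 1 x + f2 2 x))" if x: "t 0 < x" for x
 proof (cases "t n < x")
  case True
  have "h x = 0" using hA[of "t n" x] True \<eta>n h0[of x] by (simp add: \<eta>_def)
  then show ?thesis using \<theta> by simp
 next
  case False
  define j where "j = (LEAST j. x \<le> t j)"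
  have xj: "x \<le> t j" unfolding j_def by (rule LeastI[of _ n]) (use False in simp)
  have jn: "j \<le> n" unfolding j_def by (rule Least_le) (use False in simp)
  have j1: "1 \<le> j" using xj x by (cases "j = 0") auto
  have xj': "t (j - 1) < x" using not_less_Least[of "j - 1" "\<lambda>j. x \<le> t j"] j1 by (simp add: j_def not_le)
  have KQ: "ennreal (K y z) powe \<theta> = ennreal (max 0 (y - z) powr (q / 2))" for y z
   using \<theta> P by (cases "y \<le> z") (auto simp: K_def ennreal_powe powr_powr)
  have e1: "ennreal (\<omega> j * K (t j) x) powe \<theta> \<le> f1 x"
  proof (cases "x = t j")
   case True
   then show ?thesis using \<theta> by (simp add: Kz)
  next
   case False
   have "ennreal (\<omega> j * K (t j) x) powe \<theta> = ennreal (\<omega> j) powe \<theta> * ennreal ((t j - x) powr (q / 2))"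
    using \<omega>0[of j] K0 xj \<theta> by (subst ennreal_mult) (auto intro: less_imp_le simp: powe_mult KQ max_def)
   also have "\<dots> = ennreal (a (j - 1)) powe \<theta> * (ennreal ((s (Suc (j - 1)) - x) powr (q / 2)) * indicator {s (j - 1)<..<s (Suc (j - 1))} x)"
    using j1 jn xj xj' False by (simp add: a_def s_def min_def)
   also have "\<dots> \<le> f1 x" unfolding f1_def by (rule ennreal_le_suminf)
   finally show ?thesis .
  qed
  have e2: "ennreal (\<eta> j) powe \<theta> \<le> ennreal D * (f2 0 x + f2 1 x + f2 2 x)"
  proof (cases "\<eta> j = 0")
   case True
   then show ?thesis using \<theta> by simp
  next
   case False
   then have \<eta>j: "0 < \<eta> j" using \<eta>0[of j] by simp
   then have "j \<noteq> n" using \<eta>n by auto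
   then have jn': "j < n" using jn by simp
   \<comment> \<open>The stopping indices increase strictly until they reach n, hence they pass j <
     n.\<close>
   have reach: "\<exists>m. j < jj m"
   proof (rule ccontr)
    assume "\<nexists>m. j < jj m"
    then have all: "jj m < n" for m using jn' by (meson le_less_trans not_le)
    have "m < jj m" for m
    proof (induction m)
     case (Suc m) then show ?case using jj(3)[OF all, of m] by simp
    qed (simp add: jj(1))
    from this[of n] all[of n] show False by simp
   qed
   \<comment> \<open>Its predecessor m is the group that contains j: jj m \<le> j < jj
     (m+1).\<close>
   define m' where "m' = (LEAST m. j < jj m)"
   have m': "j < jj m'" unfolding m'_def by (rule LeastI_ex[OF reach])
   then have "m' \<noteq> 0" using jj(1) j1 by (cases "m' = 0") auto
   then obtain m where m: "m' = Suc m" by (cases m') auto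
   have mj: "jj m \<le> j" using not_less_Least[of m "\<lambda>m. j < jj m"] m by (simp add: m'_def)
   have gm: "good m" unfolding good_def using mj jn' \<eta>A[OF mj] \<eta>j by auto
   let ?k = "jj (Suc m) - 1"
   have "j \<le> ?k" using m'[unfolded m] by linarith
   then have xk: "x \<le> t ?k" using xj tm[of j ?k] by linarith
   have lo: "\<sigma> \<rho> i < x" if "m = 3 * i + \<rho>" for i \<rho>
   proof (cases i)
    case 0 then show ?thesis using x by (simp add: \<sigma>_def)
   next
    case (Suc k)
    have "jj (Suc (Suc (3 * k + \<rho>))) < jj m"
    proof -
     have "jj (Suc (Suc (3 * k + \<rho>))) < n" using jjm[of "Suc (Suc (3 * k + \<rho>))" m] that Suc gm by (simp add: good_def)
     then have "jj (Suc (Suc (3 * k + \<rho>))) < jj (Suc (Suc (Suc (3 * k + \<rho>))))" by (rule jj(3))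
     moreover have "m = Suc (Suc (Suc (3 * k + \<rho>)))" using that Suc by simp
     ultimately show ?thesis by (simp only:)
    qed
    then have "L (3 * k + \<rho>) \<le> j - 1" using L(2)[of "3 * k + \<rho>"] mj by linarith
    then show ?thesis using tm[of "L (3 * k + \<rho>)" "j - 1"] xj' Suc by (simp add: \<sigma>_def)
   qed
   have bnd: "ennreal (\<eta> j) powe \<theta> \<le> ennreal D * f2 \<rho> x" if mi: "m = 3 * i + \<rho>" for i \<rho>
   proof -
    have s': "\<sigma> \<rho> (Suc i) = t (L m)" by (simp add: \<sigma>_def mi)
    have xs: "x < \<sigma> \<rho> (Suc i)" using xk L(3)[OF gm] s' by simp
    have "\<eta> j \<le> D * (Y m / w (L m)) * K (t (L m)) (t ?k)" using \<eta>A[OF mj] L(4)[OF gm] by simp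
    also have "\<dots> \<le> D * (Y m / w (L m)) * K (t (L m)) x"
     using KA[OF xk] D1 Y0[of m] w(2)[OF L1, of m] by (intro mult_left_mono) auto
    also have "\<dots> = D * (c m * K (t (L m)) x)" using gm by (simp add: c_def)
    finally have "ennreal (\<eta> j) powe \<theta> \<le> ennreal (D * (c m * K (t (L m)) x)) powe \<theta>"
     using \<theta> by (intro powe_mono ennreal_leI) auto
    also have "\<dots> = ennreal D powe \<theta> * (ennreal (c m) powe \<theta> * ennreal (max 0 (t (L m) - x) powr (q / 2)))"
     using D1 c0[of m] K0[of "t (L m)" x] \<theta> by (simp add: ennreal_mult powe_mult KQ)
    also have "\<dots> \<le> ennreal D * (ennreal (c m) powe \<theta> * ennreal (max 0 (t (L m) - x) powr (q / 2)))"
    proof (rule mult_right_mono)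
     have "D powr \<theta> \<le> D powr 1" using D1 \<theta> by (intro powr_mono) auto
     then show "ennreal D powe \<theta> \<le> ennreal D" using D1 \<theta> by (simp add: ennreal_powe ennreal_leI)
    qed simp
    also have "ennreal (c m) powe \<theta> * ennreal (max 0 (t (L m) - x) powr (q / 2)) = ennreal (c (3 * i + \<rho>)) powe \<theta> * (ennreal ((\<sigma> \<rho> (Suc i) - x) powr (q / 2)) * indicator {\<sigma> \<rho> i<..<\<sigma> \<rho> (Suc i)} x)"
     using lo[OF mi] xs unfolding mi[symmetric] s' by simp
    also have "\<dots> \<le> f2 \<rho> x" unfolding f2_def by (rule ennreal_le_suminf)
    finally show ?thesis by (simp add: mult_left_mono)
   qed
   have "m = 3 * (m div 3) + m mod 3" by simp
   then have "ennreal (\<eta> j) powe \<theta> \<le> ennreal D * f2 (m mod 3) x" by (rule bnd)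
   also have "\<dots> \<le> ennreal D * (f2 0 x + f2 1 x + f2 2 x)"
   proof (rule mult_left_mono)
    have "m mod 3 < 3" by simp
    then consider "m mod 3 = 0" | "m mod 3 = 1" | "m mod 3 = 2" by linarith
    then show "f2 (m mod 3) x \<le> f2 0 x + f2 1 x + f2 2 x" by cases (auto intro: add_increasing add_increasing2)
   qed simp
   finally show ?thesis .
  qed
  have "ennreal (h x) powe \<theta> \<le> ennreal (2 * CP * (\<eta> j + \<omega> j * K (t j) x)) powe \<theta>"
   using near[OF j1 jn xj' xj] \<theta> by (intro powe_mono ennreal_leI) auto
  also have "\<dots> = ennreal (2 * CP) powe \<theta> * (ennreal (\<eta> j) + ennreal (\<omega> j * K (t j) x)) powe \<theta>"
   using CP \<eta>0[of j] \<omega>0[of j] K0[of "t j" x] \<theta> by (simp add: ennreal_mult powe_mult less_imp_le)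
  also have "\<dots> \<le> ennreal (2 * CP) * (ennreal (\<eta> j) powe \<theta> + ennreal (\<omega> j * K (t j) x) powe \<theta>)"
  proof (intro mult_mono powe_subadd)
   have "(2 * CP) powr \<theta> \<le> (2 * CP) powr 1" using CP \<theta> by (intro powr_mono) auto
   then show "ennreal (2 * CP) powe \<theta> \<le> ennreal (2 * CP)" using CP \<theta> by (simp add: ennreal_powe ennreal_leI)
  qed (use \<theta> in auto)
  also have "\<dots> \<le> ennreal (2 * CP) * (ennreal D * (f2 0 x + f2 1 x + f2 2 x) + f1 x)"
   by (intro mult_left_mono add_mono e1 e2) simp
  finally show ?thesis by (simp add: add.commute)
 qed
 have "(\<integral>\<^sup>+x\<in>{t 0<..}. ennreal (h x) powe \<theta> \<partial>\<mu>) \<le> (\<integral>\<^sup>+x. ennreal (2 * CP) * (f1 x + ennreal D * (f2 0 x + f2 1 x + f2 2 x)) \<partial>\<mu>)"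
 proof (intro nn_integral_mono)
  fix x
  show "ennreal (h x) powe \<theta> * indicator {t 0<..} x \<le> ennreal (2 * CP) * (f1 x + ennreal D * (f2 0 x + f2 1 x + f2 2 x))"
   using pt[of x] by (cases "t 0 < x") simp_all
 qed
 also have "\<dots> = ennreal (2 * CP) * ((\<integral>\<^sup>+x. f1 x \<partial>\<mu>) + ennreal D * ((\<integral>\<^sup>+x. f2 0 x \<partial>\<mu>) + (\<integral>\<^sup>+x. f2 1 x \<partial>\<mu>) + (\<integral>\<^sup>+x. f2 2 x \<partial>\<mu>)))"
  by (simp add: nn_integral_cmult nn_integral_add)
 also have "\<dots> \<le> ennreal (2 * CP) * (R + ennreal D * (R + R + R))"
  by (intro mult_left_mono add_mono f1 f2) auto
 also have "R + R + R = 3 * R"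
 proof -
  have "R + R + R = (1 + 1 + 1) * R" by (simp only: distrib_right mult_1)
  then show ?thesis by simp
 qed
 also have "R + ennreal D * (3 * R) = ennreal (1 + 3 * D) * R"
  using D1 by (simp add: ennreal_mult distrib_right distrib_left mult_ac)
 also have "ennreal (2 * CP) * (ennreal (1 + 3 * D) * R) = ennreal (2 * CP * (1 + 3 * D)) * R"
  using CP D1 by (simp add: ennreal_mult mult.assoc)
 \<comment> \<open>D = 4 CP (1 + CP), once for each of the three residues.\<close>
 also have "3 * D = 12 * CP * (1 + CP)" by (simp add: D_def N_def)
 finally show ?thesis unfolding h_def K_def \<theta>_def R_def CP_def \<omega>_def .
qed

text \<open>For l \<ge> 1 the point t l is the right end of the set where F^p exceeds \<gamma> /
  2^l, a bounded set because F is integrable. As \<gamma> is the value at \<epsilon>, none of these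
  ends lies before \<epsilon> = t 0. The value at t l itself is left open.\<close>

lemma level_points:
 fixes F :: "real \<Rightarrow> ennreal"
 assumes F: "admissible F" and p: "0 < p" and e: "0 < \<epsilon>" and \<gamma>: "F \<epsilon> powe p = ennreal \<gamma>" "0 < \<gamma>"
 obtains t :: "nat \<Rightarrow> real" where "mono t" "t 0 = \<epsilon>"
  "\<And>l y. 1 \<le> l \<Longrightarrow> 0 < y \<Longrightarrow> y < t l \<Longrightarrow> ennreal (\<gamma> / 2 ^ l) < F y powe p"
  "\<And>l y. 1 \<le> l \<Longrightarrow> t l < y \<Longrightarrow> F y powe p \<le> ennreal (\<gamma> / 2 ^ l)"
proof -
 note [measurable] = admissibleD(2)[OF F] and anti = admissibleD(1)[OF F]
 define S where "S l = {y. 0 < y \<and> ennreal (\<gamma> / 2 ^ l) < F y powe p}" for l :: nat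
 have down: "y \<in> S l" if "x \<in> S l" "0 < y" "y \<le> x" for x y l
  using that powe_mono[OF less_imp_le[OF p] antimonoD[OF anti, of y x]] by (auto simp: S_def intro: less_le_trans)
 have ex: "\<exists>m\<ge>0. {0<..<m} \<subseteq> S l \<and> S l \<subseteq> {0<..m}" for l
 proof (rule downward_closed_cases[of "S l"])
  show "S l \<subseteq> {0<..}" by (auto simp: S_def)
  assume all: "S l = {0<..}"
  define c where "c = (\<gamma> / 2 ^ l) powr (1 / p)"
  have c: "0 < c" using \<gamma> by (simp add: c_def)
  have "ennreal c \<le> F y" if "0 < y" for y
  proof -
   have "y \<in> S l" using all that by simp
   then have "ennreal (\<gamma> / 2 ^ l) powe (1 / p) < F y" using p by (simp add: S_def powe_less_iff)
   then show ?thesis using \<gamma> by (simp add: c_def ennreal_powe)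
  qed
  then have "(\<integral>\<^sup>+y\<in>{0::real<..}. ennreal c \<partial>lborel) \<le> nnl {0<..} F"
   by (intro nn_integral_mono) (auto simp: indicator_def)
  moreover have "(\<integral>\<^sup>+y\<in>{0::real<..}. ennreal c \<partial>lborel) = \<top>"
   using c by (simp add: nn_integral_cmult_indicator emeasure_lborel_Ioi ennreal_mult_top)
  ultimately show ?thesis using F by (simp add: admissible_def top_unique)
 next
  fix m :: real assume "0 \<le> m" "{0<..<m} \<subseteq> S l" "S l \<subseteq> {0<..m}"
  then show ?thesis by blast
 qed (rule down)
 have "\<exists>T. \<forall>l. T l \<ge> 0 \<and> {0<..<T l} \<subseteq> S l \<and> S l \<subseteq> {0<..T l}" by (intro choice allI) (use ex in blast)
 then obtain T :: "nat \<Rightarrow> real" where T: "\<And>l. 0 \<le> T l" "\<And>l. {0<..<T l} \<subseteq> S l" "\<And>l. S l \<subseteq> {0<..T l}" by blast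
 have SS: "S l \<subseteq> S (Suc l)" for l
 proof
  fix y assume y: "y \<in> S l"
  have "\<gamma> / 2 ^ Suc l \<le> \<gamma> / 2 ^ l" using \<gamma> by (intro divide_left_mono) auto
  then have "ennreal (\<gamma> / 2 ^ Suc l) \<le> ennreal (\<gamma> / 2 ^ l)" by (rule ennreal_leI)
  then show "y \<in> S (Suc l)" using y by (auto simp: S_def intro: le_less_trans)
 qed
 have TT: "T l \<le> T (Suc l)" for l
 proof (rule ccontr)
  assume *: "\<not> T l \<le> T (Suc l)"
  define y where "y = (T l + T (Suc l)) / 2"
  have y: "T (Suc l) < y" "y < T l" "0 < y" using * T(1)[of "Suc l"] by (auto simp: y_def)
  then have "y \<in> S (Suc l)" using T(2)[of l] SS[of l] by (meson greaterThanLessThan_iff subsetD)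
  then show False using T(3)[of "Suc l"] y by auto
 qed
 have e1: "\<epsilon> \<le> T 1"
 proof -
  have "\<epsilon> \<in> S 1" using e \<gamma> by (simp add: S_def ennreal_less_iff)
  then show ?thesis using T(3)[of 1] by auto
 qed
 define t where "t l = (if l = 0 then \<epsilon> else T l)" for l
 show thesis
 proof (rule that[of t])
  show "mono t" unfolding mono_iff_le_Suc using TT e1 by (auto simp: t_def)
  show "t 0 = \<epsilon>" by (simp add: t_def)
  show "ennreal (\<gamma> / 2 ^ l) < F y powe p" if "1 \<le> l" "0 < y" "y < t l" for l y
   using T(2)[of l] that by (auto simp: t_def S_def)
  show "F y powe p \<le> ennreal (\<gamma> / 2 ^ l)" if "1 \<le> l" "t l < y" for l y
  proof (rule ccontr)
   assume "\<not> F y powe p \<le> ennreal (\<gamma> / 2 ^ l)"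
   moreover have "0 < y" using that T(1)[of l] by (simp add: t_def)
   ultimately have "y \<in> S l" by (simp add: S_def not_le)
   then show False using T(3)[of l] that by (auto simp: t_def)
  qed
 qed
qed

text \<open>The levels below X form a finite geometric progression; its sum is at most twice the
  largest term, which is below X.\<close>

lemma dyadic_sum_le:
 fixes X :: ennreal
 assumes \<gamma>: "0 < \<gamma>"
 shows "(\<Sum>l=1..n. if ennreal (\<gamma> / 2 ^ l) < X then ennreal (\<gamma> / 2 ^ l) else 0) \<le> 2 * X"
proof (cases "\<exists>l\<ge>1. ennreal (\<gamma> / 2 ^ l) < X")
 case False
 then have "(\<Sum>l=1..n. if ennreal (\<gamma> / 2 ^ l) < X then ennreal (\<gamma> / 2 ^ l) else 0) = 0"
  by (intro sum.neutral) auto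
 then show ?thesis by simp
next
 case True
 define l0 where "l0 = (LEAST l. 1 \<le> l \<and> ennreal (\<gamma> / 2 ^ l) < X)"
 have l0: "1 \<le> l0" "ennreal (\<gamma> / 2 ^ l0) < X" unfolding l0_def using LeastI_ex[OF True] by auto
 have least: "l0 \<le> l" if "1 \<le> l" "ennreal (\<gamma> / 2 ^ l) < X" for l unfolding l0_def by (rule Least_le) (use that in auto)
 have "(\<Sum>l=1..n. if ennreal (\<gamma> / 2 ^ l) < X then ennreal (\<gamma> / 2 ^ l) else 0) \<le> (\<Sum>l=1..n. if l0 \<le> l then ennreal (\<gamma> / 2 ^ l) else 0)"
  using least by (intro sum_mono) auto
 also have "\<dots> = (\<Sum>l=l0..n. ennreal (\<gamma> / 2 ^ l))"
  using l0(1) by (intro sum.mono_neutral_cong_right) auto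
 also have "\<dots> = ennreal (\<Sum>l=l0..n. \<gamma> / 2 ^ l)" using \<gamma> by (intro sum_ennreal) auto
 also have "(\<Sum>l=l0..n. \<gamma> / 2 ^ l) = \<gamma> * (\<Sum>l=Suc (l0 - 1)..n. (1 / 2) ^ l)"
  using l0(1) by (simp add: sum_distrib_left power_divide)
 also have "ennreal \<dots> \<le> ennreal (\<gamma> * (1 / 2) ^ (l0 - 1))"
  using \<gamma> by (intro ennreal_leI mult_left_mono geometric_tail_le) auto
 also have "\<gamma> * (1 / 2) ^ (l0 - 1) = 2 * (\<gamma> / 2 ^ l0)"
  using l0(1) by (cases l0) (auto simp: power_divide)
 also have "ennreal (2 * (\<gamma> / 2 ^ l0)) = 2 * ennreal (\<gamma> / 2 ^ l0)" using \<gamma> by (subst ennreal_mult) auto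
 also have "\<dots> \<le> 2 * X" using l0(2) by (intro mult_left_mono) auto
 finally show ?thesis .
qed

lemma lint_pos:
 assumes [measurable]: "g \<in> borel_measurable borel" and g: "\<And>t. 0 < t \<Longrightarrow> g t \<noteq> 0" and x: "0 < x"
 shows "lint g x \<noteq> 0"
proof
 assume "lint g x = 0"
 then have "AE t in lborel. g t * indicator {0<..<x} t = 0" unfolding lint_def by (simp add: nn_integral_0_iff_AE)
 then have "AE t in lborel. t \<notin> {0<..<x}" by eventually_elim (use g in \<open>auto simp: indicator_def split: if_splits\<close>)
 then have "{0<..<x} \<in> null_sets lborel" by (subst AE_iff_null_sets) auto
 then have "emeasure lborel {0<..<x} = 0" by (rule null_setsD1)
 then show False using x by simp
qed

text \<open>\<open>dyadic_sum_le\<close> for X = F^p, integrated against 1/\<kappa>: the step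
  function built from the levels of F is at most 2 F^p.\<close>

lemma lint_levels_le:
 fixes F \<kappa> :: "real \<Rightarrow> ennreal"
 assumes [measurable]: "F \<in> borel_measurable borel" "\<kappa> \<in> borel_measurable borel" and \<gamma>: "0 < \<gamma>"
  and t: "\<And>l y. 1 \<le> l \<Longrightarrow> 0 < y \<Longrightarrow> y < t l \<Longrightarrow> ennreal (\<gamma> / 2 ^ l) < F y powe p"
 shows "ennreal \<gamma> * (\<Sum>l=1..n. ennreal ((1 / 2) ^ l) * lint (\<lambda>y. inverse (\<kappa> y)) (t l)) \<le> 2 * wnorm p \<kappa> F"
proof -
 have "ennreal \<gamma> * (\<Sum>l=1..n. ennreal ((1 / 2) ^ l) * lint (\<lambda>y. inverse (\<kappa> y)) (t l)) = (\<Sum>l=1..n. ennreal (\<gamma> / 2 ^ l) * lint (\<lambda>y. inverse (\<kappa> y)) (t l))"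
  unfolding sum_distrib_left using \<gamma>
  by (intro sum.cong refl) (simp add: mult.assoc[symmetric] power_divide ennreal_mult[symmetric])
 also have "\<dots> = (\<integral>\<^sup>+y. (\<Sum>l=1..n. ennreal (\<gamma> / 2 ^ l) * (inverse (\<kappa> y) * indicator {0<..<t l} y)) \<partial>lborel)"
  unfolding lint_def by (subst nn_integral_sum) (auto simp: nn_integral_cmult)
 also have "\<dots> \<le> (\<integral>\<^sup>+y. 2 * (F y powe p * inverse (\<kappa> y) * indicator {0<..} y) \<partial>lborel)"
 proof (intro nn_integral_mono)
  fix y :: real
  show "(\<Sum>l=1..n. ennreal (\<gamma> / 2 ^ l) * (inverse (\<kappa> y) * indicator {0<..<t l} y)) \<le> 2 * (F y powe p * inverse (\<kappa> y) * indicator {0<..} y)"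
  proof (cases "0 < y")
   case True
   have "(\<Sum>l=1..n. ennreal (\<gamma> / 2 ^ l) * (inverse (\<kappa> y) * indicator {0<..<t l} y)) \<le> (\<Sum>l=1..n. (if ennreal (\<gamma> / 2 ^ l) < F y powe p then ennreal (\<gamma> / 2 ^ l) else 0) * inverse (\<kappa> y))"
    using t True by (intro sum_mono) (auto simp: indicator_def)
   also have "\<dots> = (\<Sum>l=1..n. if ennreal (\<gamma> / 2 ^ l) < F y powe p then ennreal (\<gamma> / 2 ^ l) else 0) * inverse (\<kappa> y)"
    by (simp only: sum_distrib_right)
   also have "\<dots> \<le> 2 * F y powe p * inverse (\<kappa> y)" by (intro mult_right_mono dyadic_sum_le \<gamma>) simp
   finally show ?thesis using True by (simp add: mult.assoc)
  qed (simp add: indicator_def)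
 qed
 also have "\<dots> = 2 * wnorm p \<kappa> F" unfolding wnorm_def by (simp add: nn_integral_cmult)
 finally show ?thesis .
qed

lemma nn_integral_Ioi_le:
 fixes \<mu> :: "real measure"
 assumes [measurable_cong]: "sets \<mu> = sets borel" and [measurable]: "f \<in> borel_measurable borel"
  and *: "\<And>\<epsilon>. 0 < \<epsilon> \<Longrightarrow> (\<integral>\<^sup>+x\<in>{\<epsilon><..}. f x \<partial>\<mu>) \<le> c"
 shows "(\<integral>\<^sup>+x\<in>{0<..}. f x \<partial>\<mu>) \<le> c"
proof -
 have "(\<integral>\<^sup>+x\<in>{0<..}. f x \<partial>\<mu>) = (\<integral>\<^sup>+x. (SUP n. f x * indicator {1 / Suc n<..} x) \<partial>\<mu>)"
 proof (intro nn_integral_cong antisym)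
  fix x
  show "(SUP n. f x * indicator {1 / Suc n<..} x) \<le> f x * indicator {0<..} x"
   by (intro SUP_least) (auto simp: indicator_def intro: less_trans[rotated])
  show "f x * indicator {0<..} x \<le> (SUP n. f x * indicator {1 / Suc n<..} x)"
  proof (cases "0 < x")
   case True
   then obtain n where "1 / Suc n < x" using nat_approx_posE by blast
   then show ?thesis using True by (intro SUP_upper2[of n]) (auto simp: indicator_def)
  qed simp
 qed
 also have "\<dots> = (SUP n. \<integral>\<^sup>+x. f x * indicator {1 / Suc n<..} x \<partial>\<mu>)"
 proof (rule nn_integral_monotone_convergence_SUP)
  show "incseq (\<lambda>n x. f x * indicator {1 / real (Suc n)<..} x)"
  proof (intro incseq_SucI le_funI mult_left_mono)
   fix n x
   have "1 / real (Suc (Suc n)) \<le> 1 / real (Suc n)" by (intro divide_left_mono) auto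
   then show "indicator {1 / real (Suc n)<..} x \<le> (indicator {1 / real (Suc (Suc n))<..} x :: ennreal)"
    by (auto simp: indicator_def)
  qed simp
 qed simp
 also have "\<dots> \<le> c" by (intro SUP_least *) simp
 finally show ?thesis .
qed

text \<open>The constant of \<open>seq_bound_potential\<close> times the loss 2^(q/p) from
  \<open>lint_levels_le\<close>.\<close>

definition seq_const :: "real \<Rightarrow> real \<Rightarrow> ennreal" where
 "seq_const p q = ennreal (2 * 2 powr (p / 2) * (1 + 12 * 2 powr (p / 2) * (1 + 2 powr (p / 2)))) * 2 powe (q / p)"

lemma seq_const_less_top: "0 < q \<Longrightarrow> q < p \<Longrightarrow> seq_const p q < \<top>"
 by (simp add: seq_const_def ennreal_mult_less_top powe_less_top_iff)

text \<open>H is \<gamma> times the potential of the masses 2^-l at the level points t l of F, so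
  \<open>seq_bound_potential\<close> bounds its integral by the norm of F. A single summand already
  dominates (y - x)^(p/2) F(y)^p up to the factor 2; for p \<le> 2 subadditivity of the power p/2
  lets the whole sum dominate the tail of F^2.\<close>

lemma seq_bound_levels:
 fixes \<mu> :: "real measure" and F \<kappa> :: "real \<Rightarrow> ennreal"
 assumes sets [measurable_cong]: "sets \<mu> = sets borel"
  and q: "0 < q" "q < p" and r: "1 / r = 1 / q - 1 / p"
  and B: "seq_bound \<mu> (lint (\<lambda>y. inverse (\<kappa> y))) p q r B"
  and [measurable]: "\<kappa> \<in> borel_measurable borel" and \<kappa>: "\<And>t. 0 < t \<Longrightarrow> \<kappa> t < \<top>"
  and F: "admissible F" and M: "wnorm p \<kappa> F < \<top>" and e: "0 < \<epsilon>"
 obtains H where "H \<in> borel_measurable borel"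
  "(\<integral>\<^sup>+x\<in>{\<epsilon><..}. H x powe (q / p) \<partial>\<mu>) \<le> seq_const p q * (wnorm p \<kappa> F powe (q / p) * B powe (q / r))"
  "\<And>x y. \<epsilon> < x \<Longrightarrow> x < y \<Longrightarrow> ennreal ((y - x) powr (p / 2)) * F y powe p \<le> 2 * H x"
  "\<And>x. p \<le> 2 \<Longrightarrow> \<epsilon> < x \<Longrightarrow> rint (\<lambda>t. F t powe 2) x powe (p / 2) \<le> 2 * H x"
proof (cases "F \<epsilon> = 0")
 case True
 have z: "F y = 0" if "\<epsilon> < y" for y
  using antimonoD[OF admissibleD(1)[OF F], of \<epsilon> y] that True by simp
 have rz: "rint (\<lambda>t. F t powe 2) x = 0" if "\<epsilon> < x" for x
 proof -
  have "rint (\<lambda>t. F t powe 2) x = (\<integral>\<^sup>+t. 0 \<partial>(lborel :: real measure))"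
   unfolding rint_def using z that by (intro nn_integral_cong) (auto simp: indicator_def)
  then show ?thesis by simp
 qed
 show thesis
 proof (rule that[of "\<lambda>_. 0"])
  show "ennreal ((y - x) powr (p / 2)) * F y powe p \<le> 2 * 0" if "\<epsilon> < x" "x < y" for x y
   using z[of y] that q by simp
  show "rint (\<lambda>t. F t powe 2) x powe (p / 2) \<le> 2 * 0" if "\<epsilon> < x" for x
   using rz[OF that] q by simp
 qed (use q in auto)
next
 case False
 note [measurable] = admissibleD(2)[OF F] and anti = admissibleD(1)[OF F]
 have p: "0 < p" using q by simp
 define \<theta> where "\<theta> = q / p"
 have \<theta>: "0 < \<theta>" "\<theta> < 1" using q by (auto simp: \<theta>_def)
 define P where "P = p / 2"
 have P: "0 < P" using p by (simp add: P_def)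
 define \<gamma> where "\<gamma> = enn2real (F \<epsilon> powe p)"
 have "F \<epsilon> powe p < \<top>" "F \<epsilon> powe p \<noteq> 0"
  using admissibleD(4)[OF F e] False p by (auto simp: powe_less_top_iff powe_eq_0_iff)
 then have \<gamma>: "F \<epsilon> powe p = ennreal \<gamma>" "0 < \<gamma>"
  by (auto simp: \<gamma>_def enn2real_positive_iff zero_less_iff_neq_zero)
 obtain t :: "nat \<Rightarrow> real" where t: "mono t" "t 0 = \<epsilon>"
  "\<And>l y. 1 \<le> l \<Longrightarrow> 0 < y \<Longrightarrow> y < t l \<Longrightarrow> ennreal (\<gamma> / 2 ^ l) < F y powe p"
  "\<And>l y. 1 \<le> l \<Longrightarrow> t l < y \<Longrightarrow> F y powe p \<le> ennreal (\<gamma> / 2 ^ l)"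
  using level_points[OF F p e \<gamma>] by blast
 let ?W = "lint (\<lambda>y. inverse (\<kappa> y))"
 have te: "\<epsilon> \<le> t l" for l using monoD[OF t(1), of 0 l] t(2) by simp
 have Wsum: "ennreal \<gamma> * (\<Sum>l=1..n. ennreal ((1 / 2) ^ l) * ?W (t l)) \<le> 2 * wnorm p \<kappa> F" for n
  by (rule lint_levels_le[OF _ _ \<gamma>(2) t(3)]) auto
 \<comment> \<open>Nonzero because \<kappa> is finite; finite because the level sum is bounded by
   the finite norm.\<close>
 have Wl: "?W (t l) \<noteq> 0 \<and> ?W (t l) < \<top>" if l: "1 \<le> l" for l
 proof
  show "?W (t l) \<noteq> 0"
   using \<kappa> te[of l] e by (intro lint_pos) (auto simp: less_top)
  have "ennreal ((1 / 2) ^ l) * ?W (t l) \<le> (\<Sum>l=1..l. ennreal ((1 / 2) ^ l) * ?W (t l))"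
   using l by (intro member_le_sum) auto
  then have "ennreal \<gamma> * (ennreal ((1 / 2) ^ l) * ?W (t l)) \<le> 2 * wnorm p \<kappa> F"
   using Wsum[of l] by (meson mult_left_mono order_trans zero_le)
  also have "\<dots> < \<top>" using M by (simp add: ennreal_mult_less_top)
  finally show "?W (t l) < \<top>" using \<gamma>(2) by (auto simp: ennreal_mult_less_top)
 qed
 define h where "h n x = (\<Sum>l=1..n. (1 / 2) ^ l * max 0 (t l - x) powr P)" for n x
 have h0: "0 \<le> h n x" for n x unfolding h_def by (intro sum_nonneg) auto
 have hS: "h n x \<le> h (Suc n) x" for n x unfolding h_def by simp
 have [measurable]: "h n \<in> borel_measurable borel" for n unfolding h_def by measurable
 define H where "H x = (SUP n. ennreal \<gamma> * ennreal (h n x))" for x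
 have Hsup: "ennreal \<gamma> * ennreal (h n x) \<le> H x" for n x unfolding H_def by (rule SUP_upper) simp
 have Hm [measurable]: "H \<in> borel_measurable borel" unfolding H_def by measurable
 have single: "ennreal (\<gamma> / 2 ^ l * max 0 (t l - x) powr P) \<le> H x" if "1 \<le> l" for l x
 proof -
  have "(1 / 2) ^ l * max 0 (t l - x) powr P \<le> h l x"
   unfolding h_def using that by (intro member_le_sum) auto
  then have "\<gamma> * ((1 / 2) ^ l * max 0 (t l - x) powr P) \<le> \<gamma> * h l x" using \<gamma> by (intro mult_left_mono) auto
  then have "ennreal (\<gamma> / 2 ^ l * max 0 (t l - x) powr P) \<le> ennreal (\<gamma> * h l x)"
   by (intro ennreal_leI) (simp add: power_divide)
  also have "\<dots> = ennreal \<gamma> * ennreal (h l x)" using \<gamma> by (intro ennreal_mult) (auto simp: h0)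
  also have "\<dots> \<le> H x" by (rule Hsup)
  finally show ?thesis .
 qed
 \<comment> \<open>l is the first level strictly below F(y)^p, so F(y)^p is at most twice that
   level; this is the factor 2 in the pointwise bounds.\<close>
 have level: "\<exists>l\<ge>1. ennreal (\<gamma> / 2 ^ l) < F y powe p \<and> F y powe p \<le> ennreal (2 * (\<gamma> / 2 ^ l)) \<and> y \<le> t l" if y: "\<epsilon> < y" "F y \<noteq> 0" for y
 proof -
  have "F y powe p \<le> F \<epsilon> powe p" using y p by (intro powe_mono antimonoD[OF anti]) auto
  then have "F y powe p < \<top>" using \<gamma> by (auto intro: le_less_trans)
  moreover have "F y powe p \<noteq> 0" using y p by (simp add: powe_eq_0_iff)
  ultimately obtain c where c: "F y powe p = ennreal c" "0 < c" by (cases "F y powe p" rule: powe_cases) auto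
  have c\<gamma>: "c \<le> \<gamma>" using \<open>F y powe p \<le> F \<epsilon> powe p\<close> c \<gamma> by simp
  obtain k where "\<gamma> / c < 2 ^ k" using real_arch_pow[of 2 "\<gamma> / c"] by auto
  then have ex: "\<exists>l. \<gamma> / 2 ^ l < c" using c by (intro exI[of _ k]) (simp add: field_simps)
  define l where "l = (LEAST l. \<gamma> / 2 ^ l < c)"
  have l: "\<gamma> / 2 ^ l < c" unfolding l_def by (rule LeastI_ex[OF ex])
  have l1: "1 \<le> l" using l c\<gamma> by (cases "l = 0") auto
  then obtain k where k: "l = Suc k" by (cases l) auto
  have "\<not> \<gamma> / 2 ^ k < c" using not_less_Least[of k "\<lambda>l. \<gamma> / 2 ^ l < c"] k by (simp add: l_def)
  then have "c \<le> 2 * (\<gamma> / 2 ^ l)" using k by simp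
  moreover have lt: "ennreal (\<gamma> / 2 ^ l) < F y powe p" using l c \<gamma> by (simp add: ennreal_less_iff)
  moreover have "y \<le> t l" using t(4)[OF l1, of y] lt by (metis leD linorder_not_le)
  ultimately show ?thesis using l1 c by (intro exI[of _ l]) (auto intro: ennreal_leI)
 qed
 show thesis
 proof (rule that[OF Hm])
  show "(\<integral>\<^sup>+x\<in>{\<epsilon><..}. H x powe (q / p) \<partial>\<mu>) \<le> seq_const p q * (wnorm p \<kappa> F powe (q / p) * B powe (q / r))"
  proof -
   have "(\<integral>\<^sup>+x\<in>{\<epsilon><..}. H x powe (q / p) \<partial>\<mu>) = (\<integral>\<^sup>+x. (SUP n. (ennreal \<gamma> * ennreal (h n x)) powe \<theta> * indicator {\<epsilon><..} x) \<partial>\<mu>)"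
    unfolding H_def \<theta>_def[symmetric] powe_SUP[OF \<theta>(1)] by (simp add: SUP_mult_right_ennreal)
   also have "\<dots> = (SUP n. \<integral>\<^sup>+x. (ennreal \<gamma> * ennreal (h n x)) powe \<theta> * indicator {\<epsilon><..} x \<partial>\<mu>)"
    using \<theta> hS by (intro nn_integral_monotone_convergence_SUP incseq_SucI le_funI mult_right_mono powe_mono mult_left_mono ennreal_leI) auto
   also have "\<dots> \<le> seq_const p q * (wnorm p \<kappa> F powe (q / p) * B powe (q / r))"
   proof (rule SUP_least)
    fix n
    let ?C = "ennreal (2 * 2 powr (p / 2) * (1 + 12 * 2 powr (p / 2) * (1 + 2 powr (p / 2))))"
    have "(\<integral>\<^sup>+x. (ennreal \<gamma> * ennreal (h n x)) powe \<theta> * indicator {\<epsilon><..} x \<partial>\<mu>) = ennreal \<gamma> powe \<theta> * (\<integral>\<^sup>+x\<in>{\<epsilon><..}. ennreal (h n x) powe \<theta> \<partial>\<mu>)"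
     using \<theta> by (subst nn_integral_cmult[symmetric]) (auto simp: powe_mult mult.assoc)
    also have "\<dots> \<le> ennreal \<gamma> powe \<theta> * (?C * ((\<Sum>l=1..n. ennreal ((1 / 2) ^ l) * ?W (t l)) powe \<theta> * B powe (q / r)))"
    proof (rule mult_left_mono)
     show "(\<integral>\<^sup>+x\<in>{\<epsilon><..}. ennreal (h n x) powe \<theta> \<partial>\<mu>) \<le> ?C * ((\<Sum>l=1..n. ennreal ((1 / 2) ^ l) * ?W (t l)) powe \<theta> * B powe (q / r))"
      using seq_bound_potential[OF sets q r B t(1), of n] Wl e t(2) unfolding h_def \<theta>_def P_def by simp
    qed simp
    also have "\<dots> = ?C * ((ennreal \<gamma> * (\<Sum>l=1..n. ennreal ((1 / 2) ^ l) * ?W (t l))) powe \<theta> * B powe (q / r))"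
     unfolding powe_mult[OF \<theta>(1)] by (simp only: mult_ac)
    also have "\<dots> \<le> ?C * ((2 * wnorm p \<kappa> F) powe \<theta> * B powe (q / r))"
     using \<theta> by (intro mult_left_mono mult_right_mono powe_mono Wsum) auto
    also have "\<dots> = seq_const p q * (wnorm p \<kappa> F powe (q / p) * B powe (q / r))"
     unfolding \<theta>_def powe_mult[OF \<theta>(1)[unfolded \<theta>_def]] seq_const_def by (simp only: mult_ac)
    finally show "(\<integral>\<^sup>+x. (ennreal \<gamma> * ennreal (h n x)) powe \<theta> * indicator {\<epsilon><..} x \<partial>\<mu>) \<le> seq_const p q * (wnorm p \<kappa> F powe (q / p) * B powe (q / r))" .
   qed
   finally show ?thesis .
  qed
  show "ennreal ((y - x) powr (p / 2)) * F y powe p \<le> 2 * H x" if xy: "\<epsilon> < x" "x < y" for x y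
  proof (cases "F y = 0")
   case True
   then show ?thesis using p by simp
  next
   case False
   then obtain l where l: "1 \<le> l" "F y powe p \<le> ennreal (2 * (\<gamma> / 2 ^ l))" "y \<le> t l" using level[of y] xy by auto
   have "ennreal ((y - x) powr (p / 2)) * F y powe p \<le> ennreal (max 0 (t l - x) powr P) * ennreal (2 * (\<gamma> / 2 ^ l))"
    using l xy P unfolding P_def by (intro mult_mono ennreal_leI powr_mono2) auto
   also have "\<dots> = ennreal (2 * (\<gamma> / 2 ^ l * max 0 (t l - x) powr P))"
    using \<gamma>(2) by (subst ennreal_mult[symmetric]) (auto simp: mult_ac)
   also have "\<dots> = 2 * ennreal (\<gamma> / 2 ^ l * max 0 (t l - x) powr P)"
    using \<gamma>(2) by (subst ennreal_mult) auto
   also have "\<dots> \<le> 2 * H x" by (intro mult_left_mono single l) simp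
   finally show ?thesis .
  qed
  show "rint (\<lambda>t. F t powe 2) x powe (p / 2) \<le> 2 * H x" if p2: "p \<le> 2" and x: "\<epsilon> < x" for x
  proof -
   have P1: "P \<le> 1" using p2 by (simp add: P_def)
   \<comment> \<open>On its layer F^2 is at most (2 \<gamma> / 2^l)^(2/p), and the layer is
     contained in (x, t l]. The index 0 gets the value 0 because the levels start at 1.\<close>
   let ?c = "\<lambda>l. if l = 0 then 0 else ennreal (2 * (\<gamma> / 2 ^ l)) powe (1 / P)"
   have "rint (\<lambda>t. F t powe 2) x \<le> (\<integral>\<^sup>+y. (\<Sum>l. ?c l * indicator {x<..t l} y) \<partial>lborel)"
    unfolding rint_def
   proof (intro nn_integral_mono)
    fix y :: real
    show "F y powe 2 * indicator {x<..} y \<le> (\<Sum>l. ?c l * indicator {x<..t l} y)"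
    proof (cases "x < y \<and> F y \<noteq> 0")
     case True
     then obtain l where l: "1 \<le> l" "F y powe p \<le> ennreal (2 * (\<gamma> / 2 ^ l))" "y \<le> t l" using level[of y] x by auto
     have "F y powe 2 = (F y powe p) powe (1 / P)" using p by (simp add: powe_powe P_def)
     also have "\<dots> \<le> ?c l * indicator {x<..t l} y" using l P True by (auto intro!: powe_mono)
     also have "\<dots> \<le> (\<Sum>l. ?c l * indicator {x<..t l} y)" by (rule ennreal_le_suminf)
     finally show ?thesis using True by simp
    next
     case False
     then have z: "F y powe 2 * indicator {x<..} y = 0" by auto
     show ?thesis unfolding z by simp
    qed
   qed
   also have "\<dots> = (\<Sum>l. ?c l * ennreal (max 0 (t l - x)))"
   proof (subst nn_integral_suminf)
    show "(\<Sum>l. \<integral>\<^sup>+y. ?c l * indicator {x<..t l} y \<partial>lborel) = (\<Sum>l. ?c l * ennreal (max 0 (t l - x)))"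
    proof (rule suminf_cong)
     fix l
     have "emeasure lborel {x<..t l} = ennreal (max 0 (t l - x))"
      by (cases "x \<le> t l") (auto simp: max_def)
     then show "(\<integral>\<^sup>+y. ?c l * indicator {x<..t l} y \<partial>lborel) = ?c l * ennreal (max 0 (t l - x))"
      by (simp add: nn_integral_cmult_indicator)
    qed
   qed simp
   finally have "rint (\<lambda>t. F t powe 2) x powe P \<le> (\<Sum>l. ?c l * ennreal (max 0 (t l - x))) powe P"
    using P by (intro powe_mono) auto
   also have "\<dots> \<le> (\<Sum>l. (?c l * ennreal (max 0 (t l - x))) powe P)" by (rule powe_suminf_subadd[OF P P1])
   also have "\<dots> \<le> 2 * H x"
   proof (rule suminf_le_const[OF summableI])
    fix n
    have "(\<Sum>l<n. (?c l * ennreal (max 0 (t l - x))) powe P) \<le> (\<Sum>l<Suc n. (?c l * ennreal (max 0 (t l - x))) powe P)" by simp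
    also have "\<dots> = (\<Sum>l=1..n. (?c l * ennreal (max 0 (t l - x))) powe P)"
     using P by (intro sum.mono_neutral_right) (auto simp: not_le less_Suc_eq_le Suc_le_eq)
    also have "\<dots> = (\<Sum>l=1..n. ennreal (2 * \<gamma> * ((1 / 2) ^ l * max 0 (t l - x) powr P)))"
    proof (rule sum.cong[OF refl])
     fix l assume "l \<in> {1..n}"
     then have "(?c l * ennreal (max 0 (t l - x))) powe P = ennreal (2 * (\<gamma> / 2 ^ l)) * ennreal (max 0 (t l - x)) powe P"
      using P by (simp add: powe_mult powe_powe)
     also have "ennreal (max 0 (t l - x)) powe P = ennreal (max 0 (t l - x) powr P)"
      using P by (intro ennreal_powe) auto
     also have "ennreal (2 * (\<gamma> / 2 ^ l)) * ennreal (max 0 (t l - x) powr P) = ennreal (2 * (\<gamma> / 2 ^ l) * max 0 (t l - x) powr P)"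
      using \<gamma> by (intro ennreal_mult[symmetric]) auto
     also have "2 * (\<gamma> / 2 ^ l) * max 0 (t l - x) powr P = 2 * \<gamma> * ((1 / 2) ^ l * max 0 (t l - x) powr P)"
      by (simp add: power_divide)
     finally show "(?c l * ennreal (max 0 (t l - x))) powe P = ennreal (2 * \<gamma> * ((1 / 2) ^ l * max 0 (t l - x) powr P))" .
    qed
    also have "\<dots> = ennreal (\<Sum>l=1..n. 2 * \<gamma> * ((1 / 2) ^ l * max 0 (t l - x) powr P))"
     using \<gamma> by (intro sum_ennreal) auto
    also have "(\<Sum>l=1..n. 2 * \<gamma> * ((1 / 2) ^ l * max 0 (t l - x) powr P)) = 2 * (\<gamma> * h n x)"
     unfolding h_def by (simp add: sum_distrib_left mult_ac)
    also have "ennreal (2 * (\<gamma> * h n x)) = 2 * (ennreal \<gamma> * ennreal (h n x))"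
     using \<gamma> h0[of n x] by (simp add: ennreal_mult)
    also have "\<dots> \<le> 2 * H x" by (intro mult_left_mono Hsup) simp
    finally show "(\<Sum>l<n. (?c l * ennreal (max 0 (t l - x))) powe P) \<le> 2 * H x" .
   qed
   finally show ?thesis by (simp add: P_def)
  qed
 qed
qed

text \<open>For p \<le> 2 the function H of \<open>seq_bound_levels\<close> dominates the power p/2
  of the tail of F^2; the power q/p of this gives the integrand of the tail inequality.\<close>

lemma tail_of_seq_bound:
 fixes u \<kappa> :: "real \<Rightarrow> ennreal"
 assumes q: "0 < q" "q < p" and p2: "p \<le> 2" and r: "1 / r = 1 / q - 1 / p"
  and [measurable]: "u \<in> borel_measurable borel" and meas [measurable]: "\<kappa> \<in> borel_measurable borel"
  and \<kappa>: "\<And>t. 0 < t \<Longrightarrow> \<kappa> t < \<top>"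
  and B: "seq_bound (umeas q u) (lint (\<lambda>y. inverse (\<kappa> y))) p q r B" "B < \<top>"
 shows "tail_ineq p q u \<kappa>"
 unfolding tail_ineq_def
proof (intro exI[of _ "2 powe (q / p) * (seq_const p q * B powe (q / r))"] conjI allI impI)
 note ei = exponent_identities[OF q r]
 show "2 powe (q / p) * (seq_const p q * B powe (q / r)) < \<top>"
  using q ei(1) B(2) seq_const_less_top[OF q] by (simp add: ennreal_mult_less_top powe_less_top_iff)
 fix F assume F: "admissible F" and M: "wnorm p \<kappa> F < \<top>"
 have "nnl {0<..} (\<lambda>x. rint (\<lambda>t. F t powe 2) (1 / x) powe (q / 2) * (ennreal (x powr (- q / 2)) * u x))
  = (\<integral>\<^sup>+y\<in>{0<..}. rint (\<lambda>t. F t powe 2) y powe (q / 2) \<partial>umeas q u)"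
  by (subst nn_integral_umeas_Ioi) auto
 also have "\<dots> \<le> 2 powe (q / p) * (seq_const p q * (wnorm p \<kappa> F powe (q / p) * B powe (q / r)))"
 proof (rule nn_integral_Ioi_le[OF sets_umeas])
  fix \<epsilon> :: real assume e: "0 < \<epsilon>"
  obtain H where H [measurable]: "H \<in> borel_measurable borel"
   and H1: "(\<integral>\<^sup>+x\<in>{\<epsilon><..}. H x powe (q / p) \<partial>umeas q u) \<le> seq_const p q * (wnorm p \<kappa> F powe (q / p) * B powe (q / r))"
   and H2: "\<And>x. p \<le> 2 \<Longrightarrow> \<epsilon> < x \<Longrightarrow> rint (\<lambda>t. F t powe 2) x powe (p / 2) \<le> 2 * H x"
   apply (rule seq_bound_levels[OF sets_umeas q r B(1) meas \<kappa> F M e])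
    apply assumption
   subgoal premises prems for H by (rule prems(1)[OF prems(2,3)]) (rule prems(5))
   done
  have "(\<integral>\<^sup>+y\<in>{\<epsilon><..}. rint (\<lambda>t. F t powe 2) y powe (q / 2) \<partial>umeas q u) \<le> (\<integral>\<^sup>+y. 2 powe (q / p) * (H y powe (q / p) * indicator {\<epsilon><..} y) \<partial>umeas q u)"
  proof (intro nn_integral_mono)
   fix y
   show "rint (\<lambda>t. F t powe 2) y powe (q / 2) * indicator {\<epsilon><..} y \<le> 2 powe (q / p) * (H y powe (q / p) * indicator {\<epsilon><..} y)"
   proof (cases "\<epsilon> < y")
    case True
    have "rint (\<lambda>t. F t powe 2) y powe (q / 2) = (rint (\<lambda>t. F t powe 2) y powe (p / 2)) powe (q / p)"
     using q by (simp add: powe_powe)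
    also have "\<dots> \<le> (2 * H y) powe (q / p)" using q by (intro powe_mono H2[OF p2 True]) auto
    also have "\<dots> = 2 powe (q / p) * H y powe (q / p)" by (rule powe_mult) (use q in simp)
    finally show ?thesis using True by simp
   qed simp
  qed
  also have "\<dots> = 2 powe (q / p) * (\<integral>\<^sup>+y\<in>{\<epsilon><..}. H y powe (q / p) \<partial>umeas q u)"
   by (rule nn_integral_cmult) simp
  also have "\<dots> \<le> 2 powe (q / p) * (seq_const p q * (wnorm p \<kappa> F powe (q / p) * B powe (q / r)))"
   by (intro mult_left_mono H1) simp
  finally show "(\<integral>\<^sup>+y\<in>{\<epsilon><..}. rint (\<lambda>t. F t powe 2) y powe (q / 2) \<partial>umeas q u) \<le> 2 powe (q / p) * (seq_const p q * (wnorm p \<kappa> F powe (q / p) * B powe (q / r)))" .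
 qed simp
 finally show "nnl {0<..} (\<lambda>x. rint (\<lambda>t. F t powe 2) (1 / x) powe (q / 2) * (ennreal (x powr (- q / 2)) * u x))
  \<le> 2 powe (q / p) * (seq_const p q * B powe (q / r)) * wnorm p \<kappa> F powe (q / p)"
  by (simp add: mult_ac)
qed

lemma seq_bound_of_cond_SEQ:
 assumes q: "0 < q" "q < p" and r: "1 / r = 1 / q - 1 / p"
  and [measurable]: "u \<in> borel_measurable borel" and S: "cond_SEQ p q r u w"
 obtains B where "B < \<top>" "seq_bound (umeas q u) (lint w) p q r B"
proof -
 have r0: "0 < r" by (rule exponent_identities[OF q r])
 let ?g = "\<lambda>a b. (\<integral>\<^sup>+y\<in>{a<..<b}. ennreal ((b - y) powr (q / 2)) \<partial>umeas q u) powe (r / q) * lint w b powe (- (r / p))"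
 let ?T = "\<lambda>x :: int \<Rightarrow> real. \<Sum>\<^sub>\<infinity>k\<in>UNIV.
      (\<integral>\<^sup>+t\<in>{1 / x (k + 1)<..<1 / x k}.
       ennreal ((x (k + 1) * t - 1) powr (q / 2)) * u t / ennreal (t powr q) \<partial>lborel)
       powe (r / q) *
      nnl {0<..<x (k + 1)} w powe (- r / p)"
 have conv: "nnl {1 / b<..<1 / a} (\<lambda>t. ennreal ((b * t - 1) powr (q / 2)) * u t / ennreal (t powr q))
   = (\<integral>\<^sup>+y\<in>{a<..<b}. ennreal ((b - y) powr (q / 2)) \<partial>umeas q u)" if ab: "0 < a" "0 < b" for a b
 proof -
  have "(\<integral>\<^sup>+y\<in>{a<..<b}. ennreal ((b - y) powr (q / 2)) \<partial>umeas q u) = nnl {0<..} (\<lambda>z. ennreal ((b - 1 / z) powr (q / 2)) * indicator {a<..<b} (1 / z) * (ennreal (z powr (- q / 2)) * u z))"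
   by (rule nn_integral_umeas) auto
  also have "\<dots> = nnl {1 / b<..<1 / a} (\<lambda>t. ennreal ((b * t - 1) powr (q / 2)) * u t / ennreal (t powr q))"
  proof (intro nn_integral_cong)
   fix z :: real
   show "ennreal ((b - 1 / z) powr (q / 2)) * indicator {a<..<b} (1 / z) * (ennreal (z powr (- q / 2)) * u z) * indicator {0<..} z
    = ennreal ((b * z - 1) powr (q / 2)) * u z / ennreal (z powr q) * indicator {1 / b<..<1 / a} z"
   proof (cases "0 < z \<and> a < 1 / z \<and> 1 / z < b")
    case True
    then have z: "0 < z" "1 / b < z" "z < 1 / a" using ab by (auto simp: field_simps)
    then have bz: "0 < b * z - 1" using ab by (simp add: field_simps)
    have "b - 1 / z = (b * z - 1) / z" using z by (simp add: field_simps)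
    then have e1: "(b - 1 / z) powr (q / 2) = (b * z - 1) powr (q / 2) / z powr (q / 2)"
     using z bz by (simp add: powr_divide)
    have e2: "z powr (- q / 2) = inverse (z powr (q / 2))" by (metis minus_divide_left powr_minus)
    have "(b - 1 / z) powr (q / 2) * z powr (- q / 2) = (b * z - 1) powr (q / 2) * inverse (z powr (q / 2) * z powr (q / 2))"
     unfolding e1 e2 by (simp only: divide_inverse inverse_mult_distrib mult.assoc)
    also have "z powr (q / 2) * z powr (q / 2) = z powr q" by (simp flip: powr_add)
    finally have "ennreal ((b - 1 / z) powr (q / 2)) * ennreal (z powr (- q / 2)) = ennreal ((b * z - 1) powr (q / 2)) * inverse (ennreal (z powr q))"
     using z by (simp add: inverse_ennreal flip: ennreal_mult)
    then have "ennreal ((b - 1 / z) powr (q / 2)) * (ennreal (z powr (- q / 2)) * u z) = ennreal ((b * z - 1) powr (q / 2)) * u z / ennreal (z powr q)"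
     unfolding divide_ennreal_def by (metis mult.assoc mult.commute)
    then show ?thesis using z True by simp
   next
    case False
    then have "\<not> (1 / b < z \<and> z < 1 / a)"
    proof (rule contrapos_nn)
     assume *: "1 / b < z \<and> z < 1 / a"
     then have z0: "0 < z" using ab by (meson less_trans zero_less_divide_1_iff)
     show "0 < z \<and> a < 1 / z \<and> 1 / z < b"
      using * z0 ab by (auto simp: field_simps)
    qed
    then have 1: "indicator {1 / b<..<1 / a} z = (0 :: ennreal)" by auto
    have 2: "indicator {a<..<b} (1 / z) * indicator {0<..} z = (0 :: ennreal)" using False by (auto simp: indicator_def)
    have "ennreal ((b - 1 / z) powr (q / 2)) * indicator {a<..<b} (1 / z) * (ennreal (z powr (- q / 2)) * u z) * indicator {0<..} z
     = ennreal ((b - 1 / z) powr (q / 2)) * (ennreal (z powr (- q / 2)) * u z) * (indicator {a<..<b} (1 / z) * indicator {0<..} z)"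
     by (simp only: mult_ac)
    then show ?thesis unfolding 1 2 by simp
   qed
  qed
  finally show ?thesis ..
 qed
 define B0 where "B0 = (SUP x\<in>{x :: int \<Rightarrow> real. mono x \<and> (\<forall>k. x k > 0)}. ?T x powe (1 / r))"
 have B0: "B0 < \<top>" using S unfolding cond_SEQ_def B0_def by simp
 have "seq_bound (umeas q u) (lint w) p q r (B0 powe r)"
  unfolding seq_bound_def
 proof (intro allI impI)
  fix s :: "nat \<Rightarrow> real" assume s: "mono s" "0 < s 0"
  have sp: "0 < s k" for k using monoD[OF s(1), of 0 k] s(2) by simp
  \<comment> \<open>Extension to a two-sided sequence, constant for negative indices; (SEQ) admits
    weakly increasing sequences.\<close>
  define x where "x k = s (nat k)" for k :: int
  have x: "mono x" "\<forall>k. 0 < x k" using sp by (auto simp: x_def mono_def intro!: monoD[OF s(1)])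
  let ?G = "\<lambda>k :: int. ?g (x k) (x (k + 1))"
  have T: "?T x = (\<Sum>\<^sub>\<infinity>k\<in>UNIV. ?G k)"
   unfolding conv[OF x(2)[rule_format] x(2)[rule_format]] by (simp add: lint_def)
  have "(\<Sum>i. ?g (s i) (s (Suc i))) \<le> (\<Sum>\<^sub>\<infinity>k\<in>UNIV. ?G k)"
  proof (rule suminf_le_const[OF summableI])
   fix n
   have "(\<Sum>i<n. ?g (s i) (s (Suc i))) = (\<Sum>i<n. ?G (int i))"
    by (intro sum.cong) (auto simp: x_def nat_add_distrib)
   also have "\<dots> = sum ?G (int ` {..<n})" by (subst sum.reindex) auto
   also have "\<dots> \<le> (\<Sum>\<^sub>\<infinity>k\<in>UNIV. ?G k)"
    by (subst nonneg_infsum_complete) (auto intro!: SUP_upper)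
   finally show "(\<Sum>i<n. ?g (s i) (s (Suc i))) \<le> (\<Sum>\<^sub>\<infinity>k\<in>UNIV. ?G k)" .
  qed
  also have "(\<Sum>\<^sub>\<infinity>k\<in>UNIV. ?G k) \<le> B0 powe r"
  proof -
   have "?T x powe (1 / r) \<le> B0" unfolding B0_def by (rule SUP_upper) (use x in auto)
   then have "(?T x powe (1 / r)) powe r \<le> B0 powe r" using r0 by (intro powe_mono) auto
   then show ?thesis unfolding T using r0 by (simp add: powe_powe)
  qed
  finally show "(\<Sum>i. ?g (s i) (s (Suc i))) \<le> B0 powe r" .
 qed
 moreover have "B0 powe r < \<top>" using B0 r0 by (simp add: powe_less_top_iff)
 ultimately show thesis using that by blast
qed

section \<open>The condition (NH)\<close>

lemma ennreal_inverse_antimono: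
 fixes x y :: ennreal
 assumes "x \<le> y" shows "inverse y \<le> inverse x"
proof (cases "inverse x = 0")
 case True
 then show ?thesis using assms by (simp add: top_unique)
next
 case False
 show ?thesis
 proof (rule ccontr)
  assume "\<not> inverse y \<le> inverse x"
  then have "inverse x < inverse y" by simp
  then show False
   using ennreal_inverse_less[of "inverse y" x] assms by (cases "y = \<top>") (auto simp: zero_less_iff_neq_zero)
 qed
qed

text \<open>Supplies the points at which the primitive of v is doubled or halved.\<close>

lemma lint_IVT:
 assumes [measurable]: "v \<in> borel_measurable borel" and x: "0 \<le> x" "x \<le> y" and fin: "lint v y < \<top>"
  and c: "lint v x \<le> c" "c \<le> lint v y"
 obtains z where "x \<le> z" "z \<le> y" "lint v z = c"
proof -
 define f where "f t = v t * indicator {0<..<y} t" for t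
 have [measurable]: "f \<in> borel_measurable borel" by (simp add: f_def[abs_def])
 have eq: "lint f z = lint v z" if "z \<le> y" for z
  unfolding lint_def f_def using that by (intro nn_integral_cong) (auto simp: indicator_def)
 have "nnl {0<..} f = lint v y"
  unfolding lint_def f_def by (intro nn_integral_cong) (auto simp: indicator_def)
 then have cont: "continuous_on UNIV (\<lambda>z. enn2real (lint f z))" by (intro continuous_lint) (use fin in auto)
 have le: "lint v z < \<top>" if "z \<le> y" for z using lint_mono[OF that, of v] fin by (rule le_less_trans)
 have "\<exists>z\<ge>x. z \<le> y \<and> enn2real (lint f z) = enn2real c"
 proof (rule IVT')
  show "enn2real (lint f x) \<le> enn2real c" unfolding eq[OF x(2)] using c fin by (intro enn2real_mono) auto
  show "enn2real c \<le> enn2real (lint f y)" unfolding eq[OF order_refl] using c fin by (intro enn2real_mono) auto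
 qed (use x cont in \<open>auto intro: continuous_on_subset\<close>)
 then obtain z where z: "x \<le> z" "z \<le> y" "enn2real (lint v z) = enn2real c" using eq by auto
 then have "lint v z = c" using le[OF z(2)] c fin
  by (metis ennreal_enn2real le_less_trans)
 then show thesis using that z by blast
qed

text \<open>In the integral against the non-increasing \<eta>, the function 1 on (a,b) may be
  replaced by 4 \<sigma> v as soon as the primitives compare. Then Hoelder applies, and \<sigma> is
  built so that \<sigma>^P' v integrates to at most the dual integral. The comparison at t \<le> b
  looks ahead to the point where \<open>lint v\<close> has doubled; b0 guarantees that it
  exists.\<close>

lemma Sawyer_inequality:
 fixes v \<eta> :: "real \<Rightarrow> ennreal"
 assumes P: "1 < P" "1 / P + 1 / P' = 1"
  and [measurable]: "v \<in> borel_measurable borel" and W: "\<And>t. 0 < t \<Longrightarrow> lint v t \<noteq> 0"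
  and b: "0 < b" "b \<le> b0" "lint v b0 < \<top>" "lint v b0 = 2 * lint v b"
  and \<eta>: "antimono \<eta>" "\<And>t. b \<le> t \<Longrightarrow> \<eta> t = 0" and a: "0 < a"
 shows "rint \<eta> a \<le> 4 * (nnl {0<..} (\<lambda>t. \<eta> t powe P * v t) powe (1 / P) *
  nnl {a<..} (\<lambda>t. (ennreal (t - a) * inverse (lint v t)) powe P' * v t) powe (1 / P'))"
proof -
 note [measurable] = antimono_borel_measurable[OF \<eta>(1)]
 have P': "1 < P'" by (rule conjugate_gt_1[OF P])
 have P'e: "1 / P' = 1 - 1 / P" using P by simp
 let ?W = "lint v"
 \<comment> \<open>Tonelli turns the integral of \<sigma>^P' v into that of e times
   \<open>lint v\<close>; the last factor of e cancels the latter and leaves the dual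
   integrand.\<close>
 define e where "e s = (ennreal (s - a) * inverse (?W s)) powe P' * v s * inverse (?W s)" for s
 have [measurable]: "e \<in> borel_measurable borel" by (simp add: e_def[abs_def])
 define \<sigma> where "\<sigma> t = rint e t powe (1 / P')" for t
 have [measurable]: "\<sigma> \<in> borel_measurable borel" by (simp add: \<sigma>_def[abs_def])
 have \<sigma>_anti: "\<sigma> t \<le> \<sigma> s" if "s \<le> t" for s t
  unfolding \<sigma>_def using P' that by (intro powe_mono rint_antimono) auto
 have key: "ennreal (t - a) \<le> 4 * lint (\<lambda>s. \<sigma> s * v s) t" if t: "a < t" "t \<le> b" for t
 proof -
  have Wt: "?W t \<noteq> 0" "?W t < \<top>"
   using W[of t] a t b lint_mono[of t b0 v] by (auto intro: le_less_trans)
  have mono: "?W t \<le> ?W b" using t by (intro lint_mono)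
  have tw: "?W t \<le> 2 * ?W t" by (simp add: mult_2)
  have tb: "2 * ?W t \<le> ?W b0" unfolding b(4) by (intro mult_left_mono mono) simp
  have tb0: "t \<le> b0" using t b by simp
  have t0: "0 \<le> t" using a t by simp
  \<comment> \<open>On [t,t') the primitive of v is at most 2w and v has mass w, so e has mass at
    least ((t-a)/(2w))^P' / 2. Since (1/2)^P' \<le> 1/2, this gives \<sigma> t \<ge> (t-a)/(4w),
    whence the constant 4.\<close>
  obtain t' where t': "t \<le> t'" "t' \<le> b0" "?W t' = 2 * ?W t"
   by (rule lint_IVT[OF assms(3) t0 tb0 b(3) tw tb])
  define w where "w = enn2real (?W t)"
  have w: "?W t = ennreal w" "0 < w" using Wt by (auto simp: w_def enn2real_positive_iff zero_less_iff_neq_zero)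
  have w2: "?W t' = ennreal (2 * w)" unfolding t'(3) w(1) using w(2) by (simp add: ennreal_mult)
  have inc: "nnl {t..<t'} v = ennreal w"
  proof -
   have "ennreal (2 * w) = ennreal w + nnl {t..<t'} v"
    using lint_split[of v t t'] a t t' unfolding w(1) w2 by simp
   moreover have "ennreal (2 * w) = ennreal w + ennreal w" using w by (simp flip: ennreal_plus)
   ultimately show ?thesis by (metis ennreal_add_left_cancel ennreal_neq_top infinity_ennreal_def)
  qed
  define k where "k = (ennreal (t - a) * inverse (ennreal (2 * w))) powe P' * inverse (ennreal (2 * w))"
  have "k * ennreal w = nnl {t..<t'} (\<lambda>s. k * v s)"
   unfolding inc[symmetric] by (simp add: nn_integral_cmult mult.assoc)
  also have "\<dots> \<le> nnl {t..<t'} e"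
  proof (intro nn_integral_mono)
   fix s
   show "k * v s * indicator {t..<t'} s \<le> e s * indicator {t..<t'} s"
   proof (cases "t \<le> s \<and> s < t'")
    case True
    then have "?W s \<le> ennreal (2 * w)" unfolding w2[symmetric] by (intro lint_mono) simp
    then have i: "inverse (ennreal (2 * w)) \<le> inverse (?W s)" by (rule ennreal_inverse_antimono)
    have "k * v s = (ennreal (t - a) * inverse (ennreal (2 * w))) powe P' * v s * inverse (ennreal (2 * w))"
     by (simp add: k_def mult_ac)
    also have "\<dots> \<le> e s" unfolding e_def using True P' i
     by (intro mult_mono powe_mono ennreal_leI) auto
    finally show ?thesis by (simp add: mult_right_mono)
   qed simp
  qed
  also have "\<dots> = nnl {t<..t'} e"
  proof (rule nn_integral_cong_AE)
   have "AE s in lborel. s \<noteq> t" "AE s in lborel. s \<noteq> t'" by (rule AE_lborel_singleton)+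
   then show "AE s in lborel. e s * indicator {t..<t'} s = e s * indicator {t<..t'} s"
    by eventually_elim (auto simp: indicator_def)
  qed
  also have "\<dots> \<le> rint e t" unfolding rint_def by (intro nn_integral_mono) (auto simp: indicator_def)
  finally have k: "k * ennreal w \<le> rint e t" .
  have kw: "k * ennreal w = ennreal (((t - a) / (2 * w)) powr P' / 2)"
  proof -
   have i: "inverse (ennreal (2 * w)) = ennreal (1 / (2 * w))" using w(2) by (subst inverse_ennreal) (auto simp: inverse_eq_divide)
   have m1: "ennreal (t - a) * ennreal (1 / (2 * w)) = ennreal ((t - a) * (1 / (2 * w)))"
    using w(2) t by (intro ennreal_mult[symmetric]) auto
   have m2: "ennreal (1 / (2 * w)) * ennreal w = ennreal (1 / (2 * w) * w)"
    using w(2) by (intro ennreal_mult[symmetric]) auto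
   have "k * ennreal w = ennreal ((t - a) * (1 / (2 * w))) powe P' * ennreal (1 / (2 * w) * w)"
    unfolding k_def i m1 mult.assoc m2 ..
   also have "\<dots> = ennreal (((t - a) / (2 * w)) powr P') * ennreal (1 / 2)"
    using w(2) t by (subst ennreal_powe) auto
   also have "\<dots> = ennreal (((t - a) / (2 * w)) powr P' * (1 / 2))" by (rule ennreal_mult[symmetric]) auto
   finally show ?thesis by simp
  qed
  have "ennreal (t - a) \<le> 4 * (ennreal ((t - a) / (4 * w)) * ennreal w)"
  proof -
   have "ennreal (4 * ((t - a) / (4 * w) * w)) = ennreal 4 * (ennreal ((t - a) / (4 * w)) * ennreal w)"
    using w(2) t by (subst ennreal_mult[of 4], simp, simp, subst ennreal_mult[of "(t - a) / (4 * w)" w]) auto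
   moreover have "4 * ((t - a) / (4 * w) * w) = t - a" using w(2) by simp
   ultimately show ?thesis by simp
  qed
  also have "ennreal ((t - a) / (4 * w)) \<le> \<sigma> t"
  proof -
   have "((t - a) / (4 * w)) powr P' = ((t - a) / (2 * w)) powr P' * (1 / 2) powr P'"
    using w t by (subst powr_mult[symmetric]) auto
   also have "\<dots> \<le> ((t - a) / (2 * w)) powr P' * (1 / 2)"
    using powr_mono'[of 1 P' "1 / 2"] P' by (intro mult_left_mono) auto
   finally have "ennreal ((t - a) / (4 * w)) powe P' \<le> ennreal (((t - a) / (2 * w)) powr P' / 2)"
    using w t by (subst ennreal_powe) (auto intro: ennreal_leI)
   also have "\<dots> \<le> rint e t" using k unfolding kw .
   finally show ?thesis unfolding \<sigma>_def using P' by (simp add: powe_le_iff)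
  qed
  then have "4 * (ennreal ((t - a) / (4 * w)) * ennreal w) \<le> 4 * (\<sigma> t * ?W t)"
   unfolding w(1) by (intro mult_left_mono mult_right_mono) auto
  also have "\<sigma> t * ?W t = nnl {0<..<t} (\<lambda>s. \<sigma> t * v s)"
   unfolding lint_def by (simp add: nn_integral_cmult mult.assoc)
  also have "\<dots> \<le> lint (\<lambda>s. \<sigma> s * v s) t"
   unfolding lint_def by (intro nn_integral_mono) (auto simp: indicator_def intro!: mult_right_mono \<sigma>_anti)
  finally show ?thesis by (simp add: mult_left_mono)
 qed
 have "rint \<eta> a = nnl {0<..} (\<lambda>t. indicator {a<..<b} t * \<eta> t)"
  unfolding rint_def using a \<eta>(2) by (intro nn_integral_cong) (auto simp: indicator_def)
 also have "\<dots> \<le> nnl {0<..} (\<lambda>t. 4 * (\<sigma> t * v t) * \<eta> t)"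
 proof (rule Hardy_majorization)
  fix z :: real assume z: "0 < z"
  have c4: "nnl {0<..<z} (\<lambda>t. 4 * (\<sigma> t * v t)) = 4 * lint (\<lambda>s. \<sigma> s * v s) z"
   unfolding lint_def by (simp add: nn_integral_cmult mult.assoc)
  have "nnl {0<..<z} (\<lambda>t. indicator {a<..<b} t) = (\<integral>\<^sup>+t. indicator {a<..<min b z} t \<partial>lborel)"
   using a by (intro nn_integral_cong) (auto simp: indicator_def)
  also have "\<dots> \<le> ennreal (min b z - a)" by (cases "a \<le> min b z") auto
  also have "\<dots> \<le> 4 * lint (\<lambda>s. \<sigma> s * v s) z"
  proof (cases "a < min b z")
   case True
   then have "ennreal (min b z - a) \<le> 4 * lint (\<lambda>s. \<sigma> s * v s) (min b z)" by (intro key) auto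
   also have "\<dots> \<le> 4 * lint (\<lambda>s. \<sigma> s * v s) z" by (intro mult_left_mono lint_mono) auto
   finally show ?thesis .
  next
   case False
   then have "ennreal (min b z - a) = 0" by (intro ennreal_neg) linarith
   then show ?thesis by simp
  qed
  finally show "nnl {0<..<z} (\<lambda>t. indicator {a<..<b} t) \<le> nnl {0<..<z} (\<lambda>t. 4 * (\<sigma> t * v t))"
   unfolding c4 .
 qed (use \<eta>(1) in auto)
 also have "\<dots> = 4 * (\<integral>\<^sup>+t. (\<eta> t powe P * v t * indicator {0<..} t) powe (1 / P) * (\<sigma> t powe P' * v t * indicator {0<..} t) powe (1 - 1 / P) \<partial>lborel)"
 proof (subst nn_integral_cmult[symmetric])
  show "nnl {0<..} (\<lambda>t. 4 * (\<sigma> t * v t) * \<eta> t) = (\<integral>\<^sup>+t. 4 * ((\<eta> t powe P * v t * indicator {0<..} t) powe (1 / P) * (\<sigma> t powe P' * v t * indicator {0<..} t) powe (1 - 1 / P)) \<partial>lborel)"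
  proof (intro nn_integral_cong)
   fix t :: real
   have i: "1 / P > 0" "1 / P' > 0" "1 - 1 / P > 0" using P P' by auto
   have "v t = v t powe (1 / P + 1 / P')" unfolding P(2) by simp
   also have "\<dots> = v t powe (1 / P) * v t powe (1 / P')" using i by (intro powe_add) auto
   finally have v: "v t powe (1 / P) * v t powe (1 / P') = v t" ..
   show "4 * (\<sigma> t * v t) * \<eta> t * indicator {0<..} t = 4 * ((\<eta> t powe P * v t * indicator {0<..} t) powe (1 / P) * (\<sigma> t powe P' * v t * indicator {0<..} t) powe (1 - 1 / P))"
   proof (cases "0 < t")
    case True
    have "(\<eta> t powe P * v t) powe (1 / P) * (\<sigma> t powe P' * v t) powe (1 / P') = \<eta> t * \<sigma> t * (v t powe (1 / P) * v t powe (1 / P'))"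
     unfolding powe_mult[OF i(1)] powe_mult[OF i(2)] powe_powe using P P' by (simp add: mult_ac)
    then show ?thesis using True unfolding v P'e[symmetric] by (simp add: mult_ac)
   qed (use i in simp)
  qed
 qed simp
 also have "\<dots> \<le> 4 * (nnl {0<..} (\<lambda>t. \<eta> t powe P * v t) powe (1 / P) * nnl {0<..} (\<lambda>t. \<sigma> t powe P' * v t) powe (1 - 1 / P))"
  using P by (intro mult_left_mono nn_integral_Hoelder) auto
 also have "nnl {0<..} (\<lambda>t. \<sigma> t powe P' * v t) \<le> nnl {a<..} (\<lambda>t. (ennreal (t - a) * inverse (?W t)) powe P' * v t)"
 proof -
  have "nnl {0<..} (\<lambda>t. \<sigma> t powe P' * v t) = (\<integral>\<^sup>+t. (\<integral>\<^sup>+s. e s * indicator {t<..} s * (v t * indicator {0<..} t) \<partial>lborel) \<partial>lborel)"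
   unfolding \<sigma>_def powe_powe rint_def using P' by (intro nn_integral_cong) (subst nn_integral_multc, auto simp: mult_ac)
  also have "\<dots> = (\<integral>\<^sup>+s. (\<integral>\<^sup>+t. e s * indicator {t<..} s * (v t * indicator {0<..} t) \<partial>lborel) \<partial>lborel)"
  proof (rule lborel_pair.Fubini')
   have "(\<lambda>(s, t). e s * (if t < s then 1 else 0) * (v t * indicator {0<..} t)) \<in> borel_measurable (lborel \<Otimes>\<^sub>M lborel)"
    by measurable
   then show "(\<lambda>(s, t). e s * indicator {t<..} s * (v t * indicator {0<..} t)) \<in> borel_measurable (lborel \<Otimes>\<^sub>M lborel)"
    by (simp add: indicator_def)
  qed
  also have "\<dots> = (\<integral>\<^sup>+s. e s * ?W s \<partial>lborel)"
  proof (intro nn_integral_cong)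
   fix s :: real
   have "(\<integral>\<^sup>+t. e s * indicator {t<..} s * (v t * indicator {0<..} t) \<partial>lborel) = (\<integral>\<^sup>+t. e s * (v t * indicator {0<..<s} t) \<partial>lborel)"
    by (intro nn_integral_cong) (auto simp: indicator_def)
   then show "(\<integral>\<^sup>+t. e s * indicator {t<..} s * (v t * indicator {0<..} t) \<partial>lborel) = e s * ?W s"
    unfolding lint_def by (simp add: nn_integral_cmult)
  qed
  also have "\<dots> \<le> nnl {a<..} (\<lambda>t. (ennreal (t - a) * inverse (?W t)) powe P' * v t)"
  proof (intro nn_integral_mono)
   fix s :: real
   let ?k = "(ennreal (s - a) * inverse (?W s)) powe P' * v s"
   show "e s * ?W s \<le> ?k * indicator {a<..} s"
   proof (cases "a < s")
    case True
    have "inverse (?W s) * ?W s \<le> 1"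
     by (cases "?W s" rule: powe_cases) (auto simp: inverse_ennreal simp flip: ennreal_mult)
    then have "?k * (inverse (?W s) * ?W s) \<le> ?k * 1" by (rule mult_left_mono) simp
    then show ?thesis using True by (simp add: e_def mult.assoc)
   next
    case False
    then show ?thesis using P' by (simp add: e_def ennreal_neg)
   qed
  qed
  finally show ?thesis .
 qed
 finally show ?thesis unfolding P'e using P by (simp add: mult_left_mono powe_mono)
qed

text \<open>F is replaced by 0 where it is at most 1/(n+1). The new function vanishes beyond some
  point, and finite norm makes the integral of 1/\<kappa> up to that point finite; monotone
  convergence restores F.\<close>

lemma tail_ineq_truncated:
 assumes q: "0 < q" and C: "C < \<top>" and [measurable]: "u \<in> borel_measurable borel" "\<kappa> \<in> borel_measurable borel"
  and *: "\<And>F b. admissible F \<Longrightarrow> wnorm p \<kappa> F < \<top> \<Longrightarrow> 0 < b \<Longrightarrow> lint (\<lambda>t. inverse (\<kappa> t)) b < \<top> \<Longrightarrow> (\<And>t. b < t \<Longrightarrow> F t = 0) \<Longrightarrow>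
   (\<integral>\<^sup>+y\<in>{0<..}. rint (\<lambda>t. F t powe 2) y powe (q / 2) \<partial>umeas q u) \<le> C * wnorm p \<kappa> F powe (q / p)"
  and p: "0 < p"
 shows "tail_ineq p q u \<kappa>"
 unfolding tail_ineq_def
proof (intro exI[of _ C] conjI C allI impI)
 fix F assume F: "admissible F" and M: "wnorm p \<kappa> F < \<top>"
 note [measurable] = admissibleD(2)[OF F] and anti = admissibleD(1)[OF F]
 define G where "G n t = (if ennreal (1 / Suc n) < F t then F t else 0)" for n :: nat and t
 have GF: "G n t \<le> F t" for n t by (simp add: G_def)
 have Ganti: "antimono (G n)" for n
 proof (rule antimonoI)
  fix x y :: real assume "x \<le> y"
  then have "F y \<le> F x" by (rule antimonoD[OF anti])
  then show "G n y \<le> G n x" by (auto simp: G_def)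
 qed
 note [measurable] = antimono_borel_measurable[OF Ganti]
 have Gmono: "G m t \<le> G n t" if "m \<le> n" for m n t
 proof -
  have "1 / real (Suc n) \<le> 1 / real (Suc m)" using that by (intro divide_left_mono) auto
  then have "ennreal (1 / Suc n) \<le> ennreal (1 / Suc m)" by (rule ennreal_leI)
  then have "ennreal (1 / Suc m) < F t \<Longrightarrow> ennreal (1 / Suc n) < F t" by (rule le_less_trans)
  then show ?thesis unfolding G_def by (cases "ennreal (1 / Suc m) < F t") (auto simp del: of_nat_Suc)
 qed
 have SUP_G: "(SUP n. G n t powe 2) = F t powe 2" for t
 proof (rule antisym)
  show "(SUP n. G n t powe 2) \<le> F t powe 2" by (intro SUP_least powe_mono GF) simp
  show "F t powe 2 \<le> (SUP n. G n t powe 2)"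
  proof (cases "F t = 0")
   case False
   have "\<exists>n. ennreal (1 / Suc n) < F t"
   proof (cases "F t")
    case (real c)
    then obtain n where "1 / real (Suc n) < c" using False nat_approx_posE[of c] by (auto simp: less_le)
    then show ?thesis using real by (intro exI[of _ n]) (simp add: ennreal_less_iff)
   qed (auto intro: exI[of _ 0])
   then obtain n where "ennreal (1 / Suc n) < F t" by blast
   then have "G n t = F t" by (simp add: G_def)
   then show ?thesis by (metis SUP_upper UNIV_I)
  qed simp
 qed
 have adm: "admissible (G n)" for n
 proof -
  have "nnl {0<..} (\<lambda>t. G n t) \<le> nnl {0<..} F"
   by (intro nn_integral_mono mult_right_mono GF) simp
  then show ?thesis using F Ganti by (auto simp: admissible_def intro: le_less_trans)
 qed
 have wn: "wnorm p \<kappa> (G n) \<le> wnorm p \<kappa> F" for n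
  unfolding wnorm_def using p by (intro nn_integral_mono mult_right_mono powe_mono GF) auto
 have bound: "(\<integral>\<^sup>+y\<in>{0<..}. rint (\<lambda>t. G n t powe 2) y powe (q / 2) \<partial>umeas q u) \<le> C * wnorm p \<kappa> F powe (q / p)" for n
 proof -
  define S where "S = {t. 0 < t \<and> ennreal (1 / Suc n) < F t}"
  have down: "y \<in> S" if "x \<in> S" "0 < y" "y \<le> x" for x y
   using that antimonoD[OF anti, of y x] by (auto simp: S_def intro: less_le_trans)
  have "\<exists>m\<ge>0. {0<..<m} \<subseteq> S \<and> S \<subseteq> {0<..m}"
  proof (rule downward_closed_cases[of S])
   show "S \<subseteq> {0<..}" by (auto simp: S_def)
   assume all: "S = {0<..}"
   have "ennreal (1 / Suc n) \<le> F y" if "0 < y" for y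
   proof -
    have "y \<in> S" using all that by simp
    then show ?thesis unfolding S_def by (blast intro: less_imp_le)
   qed
   then have "(\<integral>\<^sup>+y\<in>{0::real<..}. ennreal (1 / Suc n) \<partial>lborel) \<le> nnl {0<..} F"
    by (intro nn_integral_mono) (auto simp: indicator_def)
   moreover have "(\<integral>\<^sup>+y\<in>{0::real<..}. ennreal (1 / Suc n) \<partial>lborel) = \<top>"
    by (simp add: nn_integral_cmult_indicator emeasure_lborel_Ioi ennreal_mult_top)
   ultimately show ?thesis using F by (simp add: admissible_def top_unique)
  qed (use down in blast)+
  then obtain m where m: "0 \<le> m" "{0<..<m} \<subseteq> S" "S \<subseteq> {0<..m}" by blast
  have z: "G n t = 0" if "m < t" for t
  proof -
   have "t \<notin> S" using m(3) that by auto
   moreover have "0 < t" using that m(1) by simp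
   ultimately show ?thesis by (simp add: S_def G_def)
  qed
  have "(\<integral>\<^sup>+y\<in>{0<..}. rint (\<lambda>t. G n t powe 2) y powe (q / 2) \<partial>umeas q u) \<le> C * wnorm p \<kappa> (G n) powe (q / p)"
  proof (cases "m = 0")
   case True
   have "rint (\<lambda>t. G n t powe 2) y = 0" if "0 < y" for y
   proof -
    have "rint (\<lambda>t. G n t powe 2) y = (\<integral>\<^sup>+t. 0 \<partial>(lborel :: real measure))"
     unfolding rint_def using z that True by (intro nn_integral_cong) (auto simp: indicator_def)
    then show ?thesis by simp
   qed
   then have "(\<integral>\<^sup>+y\<in>{0<..}. rint (\<lambda>t. G n t powe 2) y powe (q / 2) \<partial>umeas q u) = (\<integral>\<^sup>+y. 0 \<partial>umeas q u)"
    using q by (intro nn_integral_cong) (auto simp: indicator_def)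
   then show ?thesis by simp
  next
   case False
   then have m0: "0 < m" using m by simp
   have "ennreal (1 / Suc n) powe p * lint (\<lambda>t. inverse (\<kappa> t)) m = nnl {0<..<m} (\<lambda>t. ennreal (1 / Suc n) powe p * inverse (\<kappa> t))"
    unfolding lint_def by (simp add: nn_integral_cmult mult.assoc)
   also have "\<dots> \<le> wnorm p \<kappa> F"
    unfolding wnorm_def
   proof (intro nn_integral_mono)
    fix t
    show "ennreal (1 / Suc n) powe p * inverse (\<kappa> t) * indicator {0<..<m} t \<le> F t powe p * inverse (\<kappa> t) * indicator {0<..} t"
    proof (cases "0 < t \<and> t < m")
     case True
     then have "t \<in> S" using m(2) by auto
     then have "ennreal (1 / Suc n) \<le> F t" unfolding S_def by (blast intro: less_imp_le)
     then have "ennreal (1 / Suc n) powe p \<le> F t powe p" using p by (intro powe_mono) auto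
     then show ?thesis using True by (auto intro: mult_right_mono)
    qed auto
   qed
   also note M
   finally have *: "ennreal (1 / Suc n) powe p * lint (\<lambda>t. inverse (\<kappa> t)) m < \<top>" .
   have "ennreal (1 / Suc n) powe p = ennreal ((1 / Suc n) powr p)" by (rule ennreal_powe) simp
   then have "ennreal (1 / Suc n) powe p \<noteq> 0" by (simp add: ennreal_eq_0_iff not_le)
   then have "lint (\<lambda>t. inverse (\<kappa> t)) m < \<top>" using * by (auto simp: ennreal_mult_less_top)
   then show ?thesis using adm wn[of n] M m0 z by (intro assms(5)) (auto intro: le_less_trans)
  qed
  also have "\<dots> \<le> C * wnorm p \<kappa> F powe (q / p)"
   using p q by (intro mult_left_mono powe_mono wn) auto
  finally show ?thesis .
 qed
 have r: "rint (\<lambda>t. F t powe 2) y = (SUP n. rint (\<lambda>t. G n t powe 2) y)" for y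
 proof -
  have "rint (\<lambda>t. F t powe 2) y = (\<integral>\<^sup>+t. (SUP n. G n t powe 2 * indicator {y<..} t) \<partial>lborel)"
   unfolding rint_def SUP_G[symmetric] by (intro nn_integral_cong) (simp add: SUP_mult_right_ennreal)
  also have "\<dots> = (SUP n. rint (\<lambda>t. G n t powe 2) y)"
   unfolding rint_def
   by (rule nn_integral_monotone_convergence_SUP)
     (auto intro!: incseq_SucI le_funI mult_right_mono powe_mono Gmono)
  finally show ?thesis .
 qed
 have "nnl {0<..} (\<lambda>x. rint (\<lambda>t. F t powe 2) (1 / x) powe (q / 2) * (ennreal (x powr (- q / 2)) * u x))
  = (\<integral>\<^sup>+y\<in>{0<..}. rint (\<lambda>t. F t powe 2) y powe (q / 2) \<partial>umeas q u)"
  by (subst nn_integral_umeas_Ioi) auto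
 also have "\<dots> = (\<integral>\<^sup>+y. (SUP n. rint (\<lambda>t. G n t powe 2) y powe (q / 2) * indicator {0<..} y) \<partial>umeas q u)"
  unfolding r using q by (intro nn_integral_cong) (simp add: SUP_mult_right_ennreal powe_SUP)
 also have "\<dots> = (SUP n. \<integral>\<^sup>+y\<in>{0<..}. rint (\<lambda>t. G n t powe 2) y powe (q / 2) \<partial>umeas q u)"
 proof (rule nn_integral_monotone_convergence_SUP)
  show "incseq (\<lambda>n y. rint (\<lambda>t. G n t powe 2) y powe (q / 2) * indicator {0<..} y)"
   using q unfolding rint_def by (intro incseq_SucI le_funI mult_right_mono powe_mono nn_integral_mono Gmono) auto
 qed measurable
 also have "\<dots> \<le> C * wnorm p \<kappa> F powe (q / p)" by (intro SUP_least bound)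
 finally show "nnl {0<..} (\<lambda>x. rint (\<lambda>t. F t powe 2) (1 / x) powe (q / 2) * (ennreal (x powr (- q / 2)) * u x)) \<le> C * wnorm p \<kappa> F powe (q / p)" .
qed

text \<open>The summands are the layers of X between consecutive levels; the part
  \<open>min X (c n)\<close> still below the last level makes the induction work.\<close>

lemma sum_layers_le:
 fixes X :: ennreal and c :: "nat \<Rightarrow> ennreal"
 assumes c: "\<And>k. c (Suc k) \<le> c k" and fin: "\<And>k. c k < \<top>"
 shows "(\<Sum>k<n. min X (c k) - c (Suc k)) + min X (c n) \<le> X"
proof (induction n)
 case (Suc n)
 have "(min X (c n) - c (Suc n)) + min X (c (Suc n)) \<le> min X (c n)"
 proof (cases "X \<le> c (Suc n)")
  case True
  then have "min X (c n) - c (Suc n) = 0" using fin[of n] by (intro diff_eq_0_ennreal) (auto simp: min_def not_le)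
  then show ?thesis using True c[of n] by (simp add: min_absorb1 order_trans)
 next
  case False
  then have "c (Suc n) \<le> min X (c n)" "min X (c (Suc n)) = c (Suc n)" using c[of n] by (auto simp: min_def)
  then show ?thesis by (simp add: diff_add_cancel_ennreal)
 qed
 then have "(\<Sum>k<n. min X (c k) - c (Suc k)) + ((min X (c n) - c (Suc n)) + min X (c (Suc n))) \<le> (\<Sum>k<n. min X (c k) - c (Suc k)) + min X (c n)"
  by (rule add_left_mono)
 also note Suc
 finally show ?case by (simp only: sum.lessThan_Suc add.assoc)
qed simp

text \<open>Test sequence \<epsilon>, b, b, ... with a single nonempty interval.\<close>

lemma seq_bound_single:
 fixes \<mu> :: "real measure"
 assumes q: "0 < q" "q < p" and r: "1 / r = 1 / q - 1 / p"
  and sets: "sets \<mu> = sets borel" and B: "seq_bound \<mu> Wf p q r B"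
  and b: "0 < b" "Wf b \<noteq> 0" "Wf b < \<top>"
 shows "(\<integral>\<^sup>+y\<in>{0<..}. ennreal (b - y) powe (q / 2) \<partial>\<mu>) \<le> Wf b powe (q / p) * B powe (q / r)"
proof (rule nn_integral_Ioi_le[OF sets])
 fix \<epsilon> :: real assume e: "0 < \<epsilon>"
 show "(\<integral>\<^sup>+y\<in>{\<epsilon><..}. ennreal (b - y) powe (q / 2) \<partial>\<mu>) \<le> Wf b powe (q / p) * B powe (q / r)"
 proof (cases "\<epsilon> \<le> b")
  case False
  then have "(\<integral>\<^sup>+y\<in>{\<epsilon><..}. ennreal (b - y) powe (q / 2) \<partial>\<mu>) = (\<integral>\<^sup>+y. 0 \<partial>\<mu>)"
   using q by (intro nn_integral_cong) (auto simp: indicator_def ennreal_neg)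
  then show ?thesis by simp
 next
  case True
  define s where "s i = (if i = 0 then \<epsilon> else b)" for i :: nat
  define c :: "nat \<Rightarrow> ennreal" where "c i = (if i = 0 then 1 else 0)" for i
  let ?I = "\<lambda>i. \<integral>\<^sup>+y\<in>{s i<..<s (Suc i)}. ennreal ((s (Suc i) - y) powr (q / 2)) \<partial>\<mu>"
  have "(\<integral>\<^sup>+y\<in>{\<epsilon><..}. ennreal (b - y) powe (q / 2) \<partial>\<mu>) \<le> ?I 0"
  proof (intro nn_integral_mono)
   fix y
   show "ennreal (b - y) powe (q / 2) * indicator {\<epsilon><..} y \<le> ennreal ((s (Suc 0) - y) powr (q / 2)) * indicator {s 0<..<s (Suc 0)} y"
    using q by (cases "y < b") (auto simp: s_def indicator_def ennreal_neg ennreal_powe)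
  qed
  also have "\<dots> = c 0 powe (q / p) * ?I 0" by (simp add: c_def)
  also have "\<dots> \<le> (\<Sum>i. c i powe (q / p) * ?I i)" by (rule ennreal_le_suminf)
  also have "\<dots> \<le> (\<Sum>i. c i * Wf (s (Suc i))) powe (q / p) * B powe (q / r)"
   by (rule seq_bound_sum[OF q r B]) (use True e b in \<open>auto simp: s_def c_def mono_def\<close>)
  also have "(\<Sum>i. c i * Wf (s (Suc i))) = Wf b"
   by (subst suminf_finite[of "{0}"]) (auto simp: c_def s_def)
  finally show ?thesis .
 qed
qed simp

text \<open>\<open>level_inequality\<close> is applied to the tail of F^2, cut off at b. An
  increment over (a,c] is split at the height of F^2 at c: the rectangle below goes into the error
  E, bounded by (SEQ), and the layer above is non-increasing, so \<open>Sawyer_inequality\<close>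
  bounds it with a factor K that (NH) integrates. As p > 2, powers p/2 are superadditive and the
  norms of disjoint layers add up to at most that of F.\<close>

theorem tail_of_seq_bound_and_NH:
 fixes u \<kappa> :: "real \<Rightarrow> ennreal"
 assumes q: "0 < q" "q < 2" "2 < p" and r: "1 / r = 1 / q - 1 / p"
  and u [measurable]: "u \<in> borel_measurable borel" and meas [measurable]: "\<kappa> \<in> borel_measurable borel"
  and \<kappa>: "\<And>t. 0 < t \<Longrightarrow> \<kappa> t < \<top>"
  and B: "seq_bound (umeas q u) (lint (\<lambda>t. inverse (\<kappa> t))) p q r B" "B < \<top>"
  and NH: "cond_NH p q r u (\<lambda>t. inverse (\<kappa> t))"
 shows "tail_ineq p q u \<kappa>"
proof -
 have qp: "q < p" using q by simp
 note ei = exponent_identities[OF q(1) qp r]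
 define \<mu> where "\<mu> = umeas q u"
 have sets [measurable_cong]: "sets \<mu> = sets borel" by (simp add: \<mu>_def sets_umeas)
 define v where "v t = inverse (\<kappa> t)" for t
 have [measurable]: "v \<in> borel_measurable borel" by (simp add: v_def[abs_def])
 let ?W = "lint v"
 have veq: "(\<lambda>t. inverse (\<kappa> t)) = v" by (simp add: v_def fun_eq_iff)
 have W0: "?W t \<noteq> 0" if "0 < t" for t
  using that \<kappa> by (intro lint_pos) (auto simp: v_def less_top[symmetric])
 \<comment> \<open>All exponents are halved because F^2 is the basic function; P' is conjugate to
   P.\<close>
 define P Q R P' where defs: "P = p / 2" "Q = q / 2" "R = r / 2" "P' = p / (p - 2)"
 have P: "1 < P" "1 / P + 1 / P' = 1" and Q: "0 < Q" "Q < 1" "Q < P" and R: "1 / R = 1 / Q - 1 / P" and R0: "0 < R" and P'0: "0 < P'"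
  using q r ei(1) by (auto simp: defs field_simps)
 have QP: "Q / P = q / p" "Q / R = q / r" "R / P = r / p" by (auto simp: defs)
 \<comment> \<open>The dual integral of \<open>Sawyer_inequality\<close>; at the point 1/x it is the
   inner integral of (NH), whose exponent is -P'.\<close>
 define D where "D a = nnl {a<..} (\<lambda>t. (ennreal (t - a) * inverse (?W t)) powe P' * v t)" for a
 have D_anti: "D y \<le> D x" if "x \<le> y" for x y
  unfolding D_def using that P'0
  by (intro nn_integral_mono) (auto simp: indicator_def intro!: mult_right_mono powe_mono ennreal_leI)
 have [measurable]: "D \<in> borel_measurable borel" by (intro antimono_borel_measurable antimonoI D_anti)
 define K where "K a = 4 * D a powe (1 / P')" for a
 have [measurable]: "K \<in> borel_measurable borel" by (simp add: K_def[abs_def])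
 have K_anti: "K y \<le> K x" if "x \<le> y" for x y
  unfolding K_def using that P'0 by (intro mult_left_mono powe_mono D_anti) auto
 define N where "N = (\<integral>\<^sup>+x\<in>{0<..}. K x powe R * emeasure \<mu> {0<..x} powe (R / P) \<partial>\<mu>)"
 let ?g = "\<lambda>z. ennreal (z powr (- q / 2)) * u z"
 have N: "N < \<top>"
 proof -
  let ?A = "\<lambda>x. \<integral>\<^sup>+t\<in>{1 / x<..}. (ennreal (1 / (t - 1 / x)) * ?W t) powe (- p / (p - 2)) * v t \<partial>lborel"
  have DA: "D (1 / x) = ?A x" for x
   unfolding D_def
  proof (intro nn_integral_cong)
   fix t
   show "(ennreal (t - 1 / x) * inverse (?W t)) powe P' * v t * indicator {1 / x<..} t = (ennreal (1 / (t - 1 / x)) * ?W t) powe (- p / (p - 2)) * v t * indicator {1 / x<..} t"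
   proof (cases "1 / x < t")
    case True
    have "(ennreal (1 / (t - 1 / x)) * ?W t) powe (- p / (p - 2)) = (ennreal (1 / (t - 1 / x)) * ?W t) powe (- P')"
     by (simp add: defs)
    also have "\<dots> = inverse (ennreal (1 / (t - 1 / x)) * ?W t) powe P'" by (simp only: powe_minus inverse_powe)
    also have "inverse (ennreal (1 / (t - 1 / x)) * ?W t) = inverse (ennreal (1 / (t - 1 / x))) * inverse (?W t)"
     using True by (intro ennreal_inverse_mult') auto
    also have "inverse (ennreal (1 / (t - 1 / x))) = ennreal (t - 1 / x)"
     using True by (subst inverse_ennreal) auto
    finally show ?thesis by simp
   qed simp
  qed
  have "N = (\<integral>\<^sup>+x\<in>{0<..}. 4 powe R * (D x powe ((r / 2) * (p - 2) / p) * rint ?g (1 / x) powe (r / p)) \<partial>\<mu>)"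
   unfolding N_def
  proof (intro nn_integral_cong)
   fix x
   show "K x powe R * emeasure \<mu> {0<..x} powe (R / P) * indicator {0<..} x = 4 powe R * (D x powe ((r / 2) * (p - 2) / p) * rint ?g (1 / x) powe (r / p)) * indicator {0<..} x"
   proof (cases "0 < x")
    case True
    have "1 / P' * R = (r / 2) * (p - 2) / p" by (simp add: defs mult_ac)
    then have "K x powe R = 4 powe R * D x powe ((r / 2) * (p - 2) / p)"
     unfolding K_def powe_mult[OF R0] powe_powe by simp
    moreover have "emeasure \<mu> {0<..x} = rint ?g (1 / x)" unfolding \<mu>_def by (rule emeasure_umeas[OF u True])
    ultimately show ?thesis unfolding QP by (simp add: mult.assoc)
   qed simp
  qed
  also have "\<dots> = nnl {0<..} (\<lambda>z. 4 powe R * (D (1 / z) powe ((r / 2) * (p - 2) / p) * rint ?g (1 / (1 / z)) powe (r / p)) * ?g z)"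
   unfolding \<mu>_def by (rule nn_integral_umeas_Ioi) auto
  also have "\<dots> = (\<integral>\<^sup>+z. 4 powe R * (?A z powe ((r / 2) * (p - 2) / p) * rint ?g z powe (r / p) * ennreal (z powr (- q / 2)) * u z * indicator {0<..} z) \<partial>lborel)"
   unfolding DA by (intro nn_integral_cong) (simp add: mult_ac)
  also have "\<dots> = 4 powe R * nnl {0<..} (\<lambda>z. ?A z powe ((r / 2) * (p - 2) / p) * rint ?g z powe (r / p) * ennreal (z powr (- q / 2)) * u z)"
   unfolding DA[symmetric] by (rule nn_integral_cmult) simp
  also have "\<dots> < \<top>"
   using NH ei(1) R0 unfolding cond_NH_def veq lint_def rint_def
   by (simp add: ennreal_mult_less_top powe_less_top_iff)
  finally show ?thesis .
 qed
 define C where "C = ennreal (2 * 8 powr Q) * (2 powe (q / p) * (seq_const p q * B powe (q / r)) + N powe (q / r)) + 2 powe (q / p) * B powe (q / r)"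
 have C: "C < \<top>"
  using q qp ei(1) B(2) N seq_const_less_top[OF q(1) qp] by (simp add: C_def ennreal_mult_less_top powe_less_top_iff)
 show ?thesis
 proof (rule tail_ineq_truncated[OF q(1) C u meas])
  show "0 < p" using q by simp
 next
  fix F b0 assume F: "admissible F" and M: "wnorm p \<kappa> F < \<top>" and b0: "0 < b0" "lint (\<lambda>t. inverse (\<kappa> t)) b0 < \<top>" "\<And>t. b0 < t \<Longrightarrow> F t = 0"
  note [measurable] = admissibleD(2)[OF F] and anti = admissibleD(1)[OF F]
  note Wb0 = b0(2)[unfolded veq]
  let ?M = "wnorm p \<kappa> F powe (q / p)"
  \<comment> \<open>Half of the mass of 1/\<kappa> on (0,b0) is reserved beyond b, as
    \<open>Sawyer_inequality\<close> requires; the part of F between b and b0 is treated at the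
    end.\<close>
  obtain b where b: "0 < b" "b \<le> b0" "?W b0 = 2 * ?W b"
  proof -
   define w where "w = enn2real (?W b0)"
   have w: "?W b0 = ennreal w" "0 < w" using Wb0 W0[OF b0(1)] by (auto simp: w_def enn2real_positive_iff zero_less_iff_neq_zero)
   have "?W 0 = 0" unfolding lint_def by simp
   then have "?W 0 \<le> ennreal (w / 2)" "ennreal (w / 2) \<le> ?W b0" unfolding w(1) using w(2) by (auto intro: ennreal_leI)
   from lint_IVT[OF _ order_refl less_imp_le[OF b0(1)] Wb0 this]
   obtain z where z: "0 \<le> z" "z \<le> b0" "?W z = ennreal (w / 2)" by auto
   have "z \<noteq> 0" using z(3) w(2) \<open>?W 0 = 0\<close> by auto
   moreover have "?W b0 = 2 * ?W z" unfolding z(3) w(1) using w(2) by (subst ennreal_numeral[symmetric], subst ennreal_mult[symmetric]) auto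
   ultimately show thesis using that[of z] z by simp
  qed
  define \<phi> where "\<phi> t = (if t < b then F t powe 2 else 0)" for t
  have \<phi>F: "\<phi> t \<le> F t powe 2" for t by (simp add: \<phi>_def)
  have \<phi>_anti: "\<phi> y \<le> \<phi> x" if "x \<le> y" for x y
   using that powe_mono[OF _ antimonoD[OF anti that], of 2] by (auto simp: \<phi>_def)
  have [measurable]: "\<phi> \<in> borel_measurable borel" by (simp add: \<phi>_def[abs_def])
  have \<phi>fin: "rint \<phi> x < \<top>" if x: "0 < x" for x
  proof -
   have "rint \<phi> x \<le> (\<integral>\<^sup>+t. F x * (F t * indicator {0<..} t) \<partial>lborel)"
    unfolding rint_def
   proof (intro nn_integral_mono)
    fix t
    show "\<phi> t * indicator {x<..} t \<le> F x * (F t * indicator {0<..} t)"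
    proof (cases "x < t")
     case True
     have "\<phi> t \<le> F t * F t" using \<phi>F[of t] by (simp add: powe_2)
     also have "\<dots> \<le> F x * F t" using True by (intro mult_right_mono antimonoD[OF anti]) auto
     finally show ?thesis using True x by simp
    qed simp
   qed
   also have "\<dots> = F x * nnl {0<..} F" by (rule nn_integral_cmult) simp
   also have "\<dots> < \<top>" using admissibleD(4)[OF F x] F by (simp add: admissible_def ennreal_mult_less_top)
   finally show ?thesis .
  qed
  define h where "h x = enn2real (rint \<phi> x)" for x
  have hr: "ennreal (h x) = rint \<phi> x" if "0 < x" for x using \<phi>fin[OF that] by (simp add: h_def)
  have loc: "continuous_on {\<epsilon><..} h" "(h \<longlongrightarrow> 0) at_top" if e: "0 < \<epsilon>" for \<epsilon>
  proof -
   let ?f = "\<lambda>t. \<phi> t * indicator {\<epsilon><..} t"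
   have eq: "enn2real (rint ?f x) = h x" if "\<epsilon> < x" for x
    unfolding h_def rint_def using that by (intro arg_cong[of _ _ enn2real] nn_integral_cong) (auto simp: indicator_def)
   have fin: "(\<integral>\<^sup>+t. ?f t \<partial>lborel) < \<top>" using \<phi>fin[OF e] by (simp add: rint_def)
   note c = continuous_enn2real_integrals(1,2)[OF _ fin]
   have "continuous_on {\<epsilon><..} (\<lambda>x. enn2real (rint ?f x))" by (rule continuous_on_subset[OF c(1)]) auto
   then show "continuous_on {\<epsilon><..} h" by (rule continuous_on_eq) (use eq in auto)
   have "eventually (\<lambda>x. enn2real (rint ?f x) = h x) at_top" using eventually_gt_at_top[of \<epsilon>] by eventually_elim (rule eq)
   moreover have "((\<lambda>x. enn2real (rint ?f x)) \<longlongrightarrow> 0) at_top" by (rule c(2)) simp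
   ultimately show "(h \<longlongrightarrow> 0) at_top" by (simp add: tendsto_cong)
  qed
  have h_cont: "continuous_on {0<..} h"
  proof (rule continuous_at_imp_continuous_on, safe)
   fix x :: real assume "0 < x"
   then have "continuous_on {x / 2<..} h" "x \<in> {x / 2<..}" using loc(1)[of "x / 2"] by auto
   then show "isCont h x" by (subst (asm) continuous_on_eq_continuous_at) auto
  qed
  \<comment> \<open>The area of the largest rectangle under \<phi> to the right of x; the supremum
    makes it non-increasing in x.\<close>
  define E where "E x = (SUP y\<in>{x<..}. ennreal (y - x) * \<phi> y)" for x
  have E_anti: "E y \<le> E x" if "x \<le> y" for x y
   unfolding E_def
  proof (rule SUP_least)
   fix z assume z: "z \<in> {y<..}"
   then have "ennreal (z - y) * \<phi> z \<le> ennreal (z - x) * \<phi> z" using that by (intro mult_right_mono ennreal_leI) auto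
   also have "\<dots> \<le> (SUP y\<in>{x<..}. ennreal (y - x) * \<phi> y)" using z that by (intro SUP_upper) auto
   finally show "ennreal (z - y) * \<phi> z \<le> (SUP y\<in>{x<..}. ennreal (y - x) * \<phi> y)" .
  qed
  have [measurable]: "E \<in> borel_measurable borel" by (intro antimono_borel_measurable antimonoI E_anti)
  define \<eta> where "\<eta> a b t = min (\<phi> t) (\<phi> a) - \<phi> b" for a b t
  have \<eta>_anti: "antimono (\<eta> a c)" for a c
   unfolding \<eta>_def by (intro antimonoI ennreal_minus_mono min.mono \<phi>_anti) auto
  have [measurable]: "\<eta> a c \<in> borel_measurable borel" for a c by (rule antimono_borel_measurable[OF \<eta>_anti])
  define m where "m a c = nnl {0<..} (\<lambda>t. \<eta> a c t powe P * v t)" for a c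
  have step: "ennreal (h a - h c) \<le> E a + m a c powe (1 / P) * K a" if ac: "0 < a" "a < c" for a c
  proof -
   have "rint \<phi> a = rint \<phi> c + nnl {a<..c} \<phi>"
    using rint_split[of \<phi> a c] ac by (simp add: add.commute)
   then have "ennreal (h a - h c) = nnl {a<..c} \<phi>"
    unfolding h_def using \<phi>fin[OF ac(1)] by (rule ennreal_diff_enn2real)
   also have "\<dots> \<le> (\<integral>\<^sup>+t. \<phi> c * indicator {a<..c} t + \<eta> a c t * indicator {a<..} t \<partial>lborel)"
   proof (intro nn_integral_mono)
    fix t
    show "\<phi> t * indicator {a<..c} t \<le> \<phi> c * indicator {a<..c} t + \<eta> a c t * indicator {a<..} t"
    proof (cases "a < t \<and> t \<le> c")
     case True
     then have "\<phi> c \<le> \<phi> t" "\<phi> t \<le> \<phi> a" by (auto intro: \<phi>_anti)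
     then have "\<phi> c + \<eta> a c t = \<phi> t" unfolding \<eta>_def by (simp add: min_absorb1 add_diff_inverse_ennreal)
     then show ?thesis using True by simp
    qed auto
   qed
   also have "\<dots> = \<phi> c * ennreal (c - a) + rint (\<eta> a c) a"
    unfolding rint_def using ac by (subst nn_integral_add) (auto simp: nn_integral_cmult_indicator)
   also have "\<dots> \<le> E a + m a c powe (1 / P) * K a"
   proof (rule add_mono)
    have "ennreal (c - a) * \<phi> c \<le> E a" unfolding E_def using ac by (intro SUP_upper) auto
    then show "\<phi> c * ennreal (c - a) \<le> E a" by (simp add: mult.commute)
    have "rint (\<eta> a c) a \<le> 4 * (m a c powe (1 / P) * D a powe (1 / P'))"
     unfolding m_def D_def
    proof (rule Sawyer_inequality[OF P _ W0 b(1,2) Wb0 b(3) \<eta>_anti _ ac(1)])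
     show "\<eta> a c t = 0" if "b \<le> t" for t using that by (simp add: \<eta>_def \<phi>_def)
    qed auto
    then show "rint (\<eta> a c) a \<le> m a c powe (1 / P) * K a" by (simp add: K_def mult_ac)
   qed
   finally show ?thesis .
  qed
  have summ: "(\<Sum>k. m (x k) (x (Suc k))) \<le> wnorm p \<kappa> F" if x: "strict_mono x" "0 < x 0" for x :: "nat \<Rightarrow> real"
  proof (rule suminf_le_const[OF summableI])
   fix n
   have fin_x: "\<phi> (x k) < \<top>" for k
   proof -
    have "0 < x k" using x strict_mono_less_eq[OF x(1), of 0 k] by linarith
    then have "F (x k) powe 2 < \<top>" using admissibleD(4)[OF F] by (simp add: powe_less_top_iff)
    then show ?thesis using \<phi>F by (rule le_less_trans[rotated])
   qed
   have "(\<Sum>k<n. m (x k) (x (Suc k))) = (\<integral>\<^sup>+t. (\<Sum>k<n. \<eta> (x k) (x (Suc k)) t powe P * v t * indicator {0<..} t) \<partial>lborel)"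
    unfolding m_def by (subst nn_integral_sum) auto
   also have "\<dots> \<le> wnorm p \<kappa> F"
    unfolding wnorm_def
   proof (intro nn_integral_mono)
    fix t
    have "(\<Sum>k<n. \<eta> (x k) (x (Suc k)) t powe P) \<le> (\<Sum>k<n. \<eta> (x k) (x (Suc k)) t) powe P"
     using P by (intro powe_sum_superadd) auto
    also have "\<dots> \<le> \<phi> t powe P"
    proof (rule powe_mono)
     have "(\<Sum>k<n. \<eta> (x k) (x (Suc k)) t) \<le> (\<Sum>k<n. \<eta> (x k) (x (Suc k)) t) + min (\<phi> t) (\<phi> (x n))" by simp
     also have "\<dots> \<le> \<phi> t"
      unfolding \<eta>_def using x(1) fin_x by (intro sum_layers_le \<phi>_anti) (auto simp: strict_mono_less_eq)
     finally show "(\<Sum>k<n. \<eta> (x k) (x (Suc k)) t) \<le> \<phi> t" .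
    qed (use P in simp)
    also have "\<dots> \<le> (F t powe 2) powe P" using P by (intro powe_mono \<phi>F) auto
    also have "\<dots> = F t powe p" by (simp add: powe_powe defs)
    finally have "(\<Sum>k<n. \<eta> (x k) (x (Suc k)) t powe P) * (v t * indicator {0<..} t) \<le> F t powe p * (v t * indicator {0<..} t)"
     by (rule mult_right_mono) simp
    then show "(\<Sum>k<n. \<eta> (x k) (x (Suc k)) t powe P * v t * indicator {0<..} t) \<le> F t powe p * inverse (\<kappa> t) * indicator {0<..} t"
     by (simp add: sum_distrib_right mult.assoc v_def)
   qed
   finally show "(\<Sum>k<n. m (x k) (x (Suc k))) \<le> wnorm p \<kappa> F" .
  qed
  have E_bound: "(\<integral>\<^sup>+x\<in>{0<..}. E x powe Q \<partial>\<mu>) \<le> 2 powe (q / p) * (seq_const p q * (?M * B powe (q / r)))"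
  proof (rule nn_integral_Ioi_le[OF sets])
   fix \<epsilon> :: real assume e: "0 < \<epsilon>"
   obtain H where H [measurable]: "H \<in> borel_measurable borel"
    and H1: "(\<integral>\<^sup>+x\<in>{\<epsilon><..}. H x powe (q / p) \<partial>\<mu>) \<le> seq_const p q * (?M * B powe (q / r))"
    and H2: "\<And>x y. \<epsilon> < x \<Longrightarrow> x < y \<Longrightarrow> ennreal ((y - x) powr (p / 2)) * F y powe p \<le> 2 * H x"
    apply (rule seq_bound_levels[OF sets q(1) qp r B(1)[folded \<mu>_def] meas \<kappa> F M e])
     apply assumption
    subgoal premises prems for H by (rule prems(1)[OF prems(2,3)]) (rule prems(4))
    done
   have "(\<integral>\<^sup>+x\<in>{\<epsilon><..}. E x powe Q \<partial>\<mu>) \<le> (\<integral>\<^sup>+x. 2 powe (q / p) * (H x powe (q / p) * indicator {\<epsilon><..} x) \<partial>\<mu>)"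
   proof (intro nn_integral_mono)
    fix x
    show "E x powe Q * indicator {\<epsilon><..} x \<le> 2 powe (q / p) * (H x powe (q / p) * indicator {\<epsilon><..} x)"
    proof (cases "\<epsilon> < x")
     case True
     have "E x powe P = (SUP y\<in>{x<..}. (ennreal (y - x) * \<phi> y) powe P)"
      unfolding E_def using P by (intro powe_SUP) simp
     also have "\<dots> \<le> 2 * H x"
     proof (rule SUP_least)
      fix y assume y: "y \<in> {x<..}"
      have "(ennreal (y - x) * \<phi> y) powe P \<le> (ennreal (y - x) * F y powe 2) powe P"
       using P by (intro powe_mono mult_left_mono \<phi>F) auto
      also have "\<dots> = ennreal (y - x) powe P * F y powe p"
       using P by (subst powe_mult) (auto simp: powe_powe defs)
      also have "ennreal (y - x) powe P = ennreal ((y - x) powr (p / 2))"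
       using y by (subst ennreal_powe) (auto simp: defs)
      also have "ennreal ((y - x) powr (p / 2)) * F y powe p \<le> 2 * H x" using y by (intro H2 True) auto
      finally show "(ennreal (y - x) * \<phi> y) powe P \<le> 2 * H x" .
     qed
     finally have "(E x powe P) powe (q / p) \<le> (2 * H x) powe (q / p)" using q by (intro powe_mono) auto
     moreover have "(E x powe P) powe (q / p) = E x powe Q" using q by (simp add: powe_powe defs)
     moreover have "(2 * H x) powe (q / p) = 2 powe (q / p) * H x powe (q / p)" by (rule powe_mult) (use q in simp)
     ultimately show ?thesis using True by simp
    qed simp
   qed
   also have "\<dots> = 2 powe (q / p) * (\<integral>\<^sup>+x\<in>{\<epsilon><..}. H x powe (q / p) \<partial>\<mu>)" by (rule nn_integral_cmult) simp
   also have "\<dots> \<le> 2 powe (q / p) * (seq_const p q * (?M * B powe (q / r)))" by (intro mult_left_mono H1) simp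
   finally show "(\<integral>\<^sup>+x\<in>{\<epsilon><..}. E x powe Q \<partial>\<mu>) \<le> 2 powe (q / p) * (seq_const p q * (?M * B powe (q / r)))" .
  qed simp
  have main: "(\<integral>\<^sup>+x\<in>{0<..}. ennreal (h x) powe Q \<partial>\<mu>) \<le> ennreal (2 * 8 powr Q) * ((\<integral>\<^sup>+x\<in>{0<..}. E x powe Q \<partial>\<mu>) + wnorm p \<kappa> F powe (Q / P) * N powe (Q / R))"
   unfolding N_def
  proof (rule level_inequality[OF sets Q(1,3) R h_cont loc(2)[of 1] _ _ _ E_anti _ K_anti step summ])
   show "h y \<le> h x" if "0 < x" "x \<le> y" for x y
    unfolding h_def using that \<phi>fin by (intro enn2real_mono rint_antimono) auto
  qed (auto simp: h_def)
  \<comment> \<open>As Q < 1 the power is subadditive. Beyond b the tail is at most the rectangle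
    F(b)^2 (b0 - y), which \<open>seq_bound_single\<close> controls, and
    \<open>?W b0 = 2 * ?W b\<close> brings its cost back to the norm of F.\<close>
  have pw: "rint (\<lambda>t. F t powe 2) y powe Q \<le> ennreal (h y) powe Q + F b powe q * ennreal (b0 - y) powe Q" if y: "0 < y" for y
  proof -
   have "rint (\<lambda>t. F t powe 2) y \<le> (\<integral>\<^sup>+t. \<phi> t * indicator {y<..} t + F b powe 2 * indicator {y<..b0} t \<partial>lborel)"
    unfolding rint_def
   proof (intro nn_integral_mono)
    fix t
    show "F t powe 2 * indicator {y<..} t \<le> \<phi> t * indicator {y<..} t + F b powe 2 * indicator {y<..b0} t"
    proof (cases "t < b \<or> b0 < t")
     case True then show ?thesis using b0(3)[of t] by (auto simp: \<phi>_def indicator_def)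
    next
     case False
     then have "F t powe 2 \<le> F b powe 2" by (intro powe_mono antimonoD[OF anti]) auto
     then show ?thesis using False by (auto simp: \<phi>_def indicator_def)
    qed
   qed
   also have "\<dots> = rint \<phi> y + F b powe 2 * emeasure lborel {y<..b0}"
    unfolding rint_def by (subst nn_integral_add) (auto simp: nn_integral_cmult_indicator)
   also have "emeasure lborel {y<..b0} = ennreal (b0 - y)" by (cases "y \<le> b0") (auto simp: ennreal_neg)
   finally have "rint (\<lambda>t. F t powe 2) y powe Q \<le> (rint \<phi> y + F b powe 2 * ennreal (b0 - y)) powe Q"
    using Q by (intro powe_mono) auto
   also have "\<dots> \<le> rint \<phi> y powe Q + (F b powe 2 * ennreal (b0 - y)) powe Q" using Q by (intro powe_subadd) auto
   also have "(F b powe 2 * ennreal (b0 - y)) powe Q = F b powe q * ennreal (b0 - y) powe Q"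
    using Q by (subst powe_mult) (auto simp: powe_powe defs)
   finally show ?thesis unfolding hr[OF y] .
  qed
  have [measurable]: "h \<in> borel_measurable borel" by (simp add: h_def[abs_def])
  have "(\<integral>\<^sup>+y\<in>{0<..}. rint (\<lambda>t. F t powe 2) y powe Q \<partial>\<mu>) \<le> (\<integral>\<^sup>+y. ennreal (h y) powe Q * indicator {0<..} y + F b powe q * (ennreal (b0 - y) powe Q * indicator {0<..} y) \<partial>\<mu>)"
   using pw by (intro nn_integral_mono) (auto simp: indicator_def)
  also have "\<dots> = (\<integral>\<^sup>+y\<in>{0<..}. ennreal (h y) powe Q \<partial>\<mu>) + F b powe q * (\<integral>\<^sup>+y\<in>{0<..}. ennreal (b0 - y) powe Q \<partial>\<mu>)"
   by (subst nn_integral_add) (auto simp: nn_integral_cmult)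
  also have "\<dots> \<le> ennreal (2 * 8 powr Q) * (2 powe (q / p) * (seq_const p q * (?M * B powe (q / r))) + ?M * N powe (q / r)) + 2 powe (q / p) * (?M * B powe (q / r))"
  proof (rule add_mono)
   show "(\<integral>\<^sup>+y\<in>{0<..}. ennreal (h y) powe Q \<partial>\<mu>) \<le> ennreal (2 * 8 powr Q) * (2 powe (q / p) * (seq_const p q * (?M * B powe (q / r))) + ?M * N powe (q / r))"
    using main unfolding QP by (rule order_trans) (intro mult_left_mono add_mono E_bound order_refl, simp)
   have "F b powe q * (\<integral>\<^sup>+y\<in>{0<..}. ennreal (b0 - y) powe Q \<partial>\<mu>) \<le> F b powe q * (?W b0 powe (q / p) * B powe (q / r))"
    unfolding defs(2)
    by (intro mult_left_mono seq_bound_single[OF q(1) qp r sets B(1)[folded \<mu>_def, unfolded veq] b0(1) W0[OF b0(1)] Wb0]) simp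
   also have "\<dots> = 2 powe (q / p) * ((F b powe p * ?W b) powe (q / p) * B powe (q / r))"
   proof -
    have qp0: "0 < q / p" using q by simp
    show ?thesis unfolding b(3) powe_mult[OF qp0] powe_powe using q by (simp add: mult_ac)
   qed
   also have "\<dots> \<le> 2 powe (q / p) * (?M * B powe (q / r))"
   proof (intro mult_left_mono mult_right_mono powe_mono)
    have "F b powe p * ?W b = nnl {0<..<b} (\<lambda>t. F b powe p * v t)"
     unfolding lint_def by (simp add: nn_integral_cmult mult.assoc)
    also have "\<dots> \<le> wnorm p \<kappa> F"
     unfolding wnorm_def v_def using q
     by (intro nn_integral_mono) (auto simp: indicator_def intro!: mult_right_mono powe_mono antimonoD[OF anti])
    finally show "F b powe p * ?W b \<le> wnorm p \<kappa> F" .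
   qed (use q in auto)
   finally show "F b powe q * (\<integral>\<^sup>+y\<in>{0<..}. ennreal (b0 - y) powe Q \<partial>\<mu>) \<le> 2 powe (q / p) * (?M * B powe (q / r))" .
  qed
  also have "\<dots> = C * ?M" unfolding C_def by (simp only: distrib_left distrib_right mult_ac)
  finally show "(\<integral>\<^sup>+y\<in>{0<..}. rint (\<lambda>t. F t powe 2) y powe (q / 2) \<partial>umeas q u) \<le> C * ?M"
   unfolding \<mu>_def defs(2) .
 qed
qed

section \<open>The conditions (c), (d) and (e)\<close>

lemma lint_powr:
 assumes "-1 < a" "0 \<le> c"
 shows "lint (\<lambda>t. ennreal (t powr a)) c = ennreal (c powr (a + 1) / (a + 1))"
proof -
 have "lint (\<lambda>t. ennreal (t powr a)) c = (\<integral>\<^sup>+t. ennreal (t powr a) * indicator {0..c} t \<partial>lborel)"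
  unfolding lint_def
 proof (rule nn_integral_cong_AE)
  have "AE t in lborel. t \<noteq> 0" "AE t in lborel. t \<noteq> c" by (rule AE_lborel_singleton)+
  then show "AE t in lborel. ennreal (t powr a) * indicator {0<..<c} t = ennreal (t powr a) * indicator {0..c} t"
   by eventually_elim (auto simp: indicator_def)
 qed
 also have "\<dots> = ennreal (c powr (a + 1) / (a + 1))"
  by (rule nn_integral_has_integral_lebesgue'[OF _ has_integral_powr_from_0[OF assms]]) simp
 finally show ?thesis .
qed

lemma rint_powr:
 assumes "e < -1" "0 < a"
 shows "rint (\<lambda>t. ennreal (t powr e)) a = ennreal (a powr (e + 1) / (- e - 1))"
proof -
 have "rint (\<lambda>t. ennreal (t powr e)) a = (\<integral>\<^sup>+t. ennreal (t powr e) * indicator {a..} t \<partial>lborel)"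
  unfolding rint_def
 proof (rule nn_integral_cong_AE)
  have "AE t in lborel. t \<noteq> a" by (rule AE_lborel_singleton)
  then show "AE t in lborel. ennreal (t powr e) * indicator {a<..} t = ennreal (t powr e) * indicator {a..} t"
   by eventually_elim (auto simp: indicator_def)
 qed
 also have "\<dots> = ennreal (- (a powr (e + 1)) / (e + 1))"
  by (rule nn_integral_has_integral_lebesgue'[OF _ has_integral_powr_to_inf[OF assms]]) simp
 also have "- (a powr (e + 1)) / (e + 1) = a powr (e + 1) / (- e - 1)"
  using assms(1) by (simp add: field_simps)
 finally show ?thesis .
qed

text \<open>S is the region with sections A t and B x; as an open set it is measurable in the
  product. The next three lemmas use regions bounded by a hyperbola or by the diagonal.\<close>

lemma swap_general:
 fixes u w :: "real \<Rightarrow> ennreal" and S :: "(real \<times> real) set"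
 assumes [measurable]: "u \<in> borel_measurable borel" "w \<in> borel_measurable borel" and S: "open S"
  and A: "\<And>t x. (x, t) \<in> S \<longleftrightarrow> 0 < t \<and> x \<in> A t" "\<And>t x. (x, t) \<in> S \<longleftrightarrow> 0 < x \<and> t \<in> B x"
  and [measurable]: "\<And>t. A t \<in> sets borel" "\<And>x. B x \<in> sets borel"
 shows "nnl {0<..} (\<lambda>t. w t * (\<integral>\<^sup>+x\<in>A t. u x \<partial>lborel)) = nnl {0<..} (\<lambda>x. u x * (\<integral>\<^sup>+t\<in>B x. w t \<partial>lborel))"
proof -
 have [measurable]: "S \<in> sets (borel \<Otimes>\<^sub>M borel)" by (subst borel_prod) (use S in simp)
 have iA: "indicator S (x, t) = (indicator {0<..} t * indicator (A t) x :: ennreal)" for x t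
  using A(1)[of x t] by (auto simp: indicator_def)
 have iB: "indicator S (x, t) = (indicator {0<..} x * indicator (B x) t :: ennreal)" for x t
  using A(2)[of x t] by (auto simp: indicator_def)
 have "nnl {0<..} (\<lambda>t. w t * (\<integral>\<^sup>+x\<in>A t. u x \<partial>lborel)) = (\<integral>\<^sup>+t. (\<integral>\<^sup>+x. w t * u x * indicator S (x, t) \<partial>lborel) \<partial>lborel)"
 proof (intro nn_integral_cong)
  fix t :: real
  have "(\<integral>\<^sup>+x. w t * u x * indicator S (x, t) \<partial>lborel) = (\<integral>\<^sup>+x. (w t * indicator {0<..} t) * (u x * indicator (A t) x) \<partial>lborel)"
   unfolding iA by (intro nn_integral_cong) (simp add: mult_ac)
  also have "\<dots> = (w t * indicator {0<..} t) * (\<integral>\<^sup>+x\<in>A t. u x \<partial>lborel)" by (rule nn_integral_cmult) simp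
  finally show "w t * (\<integral>\<^sup>+x\<in>A t. u x \<partial>lborel) * indicator {0<..} t = (\<integral>\<^sup>+x. w t * u x * indicator S (x, t) \<partial>lborel)" by (simp add: mult_ac)
 qed
 also have "\<dots> = (\<integral>\<^sup>+x. (\<integral>\<^sup>+t. w t * u x * indicator S (x, t) \<partial>lborel) \<partial>lborel)"
  by (rule lborel_pair.Fubini') measurable
 also have "\<dots> = nnl {0<..} (\<lambda>x. u x * (\<integral>\<^sup>+t\<in>B x. w t \<partial>lborel))"
 proof (intro nn_integral_cong)
  fix x :: real
  have "(\<integral>\<^sup>+t. w t * u x * indicator S (x, t) \<partial>lborel) = (\<integral>\<^sup>+t. (u x * indicator {0<..} x) * (w t * indicator (B x) t) \<partial>lborel)"
   unfolding iB by (intro nn_integral_cong) (simp add: mult_ac)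
  also have "\<dots> = (u x * indicator {0<..} x) * (\<integral>\<^sup>+t\<in>B x. w t \<partial>lborel)" by (rule nn_integral_cmult) simp
  finally show "(\<integral>\<^sup>+t. w t * u x * indicator S (x, t) \<partial>lborel) = u x * (\<integral>\<^sup>+t\<in>B x. w t \<partial>lborel) * indicator {0<..} x" by (simp add: mult_ac)
 qed
 finally show ?thesis .
qed

lemma lint_swap:
 assumes [measurable]: "u \<in> borel_measurable borel" "w \<in> borel_measurable borel"
 shows "rint (\<lambda>t. w t * lint u (1 / t)) 0 = rint (\<lambda>x. u x * lint w (1 / x)) 0"
 unfolding rint_def lint_def
 by (rule swap_general[where S = "{z. 0 < fst z \<and> 0 < snd z \<and> fst z * snd z < 1}"]) (auto intro!: open_Collect_conj open_Collect_less continuous_intros simp: field_simps)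

lemma rint_swap:
 assumes [measurable]: "u \<in> borel_measurable borel" "w \<in> borel_measurable borel" and c: "0 < c"
 shows "rint (\<lambda>t. w t * rint u (c / t)) 0 = rint (\<lambda>x. u x * rint w (c / x)) 0"
 unfolding rint_def
proof (rule swap_general[where S = "{z. 0 < fst z \<and> 0 < snd z \<and> c < fst z * snd z}"])
 have *: "0 < x" if "0 < t" "c < x * t" for x t
  using that c by (metis less_trans zero_less_mult_pos2)
 show "(x, t) \<in> {z. 0 < fst z \<and> 0 < snd z \<and> c < fst z * snd z} \<longleftrightarrow> 0 < t \<and> x \<in> {c / t<..}" for t x
  using *[of t x] by (auto simp: pos_divide_less_eq)
 show "(x, t) \<in> {z. 0 < fst z \<and> 0 < snd z \<and> c < fst z * snd z} \<longleftrightarrow> 0 < x \<and> t \<in> {c / x<..}" for t x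
  using *[of x t] by (auto simp: pos_divide_less_eq mult.commute)
qed (auto intro!: open_Collect_conj open_Collect_less continuous_intros)

lemma lint_rint_swap:
 assumes [measurable]: "u \<in> borel_measurable borel" "w \<in> borel_measurable borel"
 shows "rint (\<lambda>t. w t * rint u t) 0 = rint (\<lambda>x. u x * lint w x) 0"
 unfolding rint_def lint_def
 by (rule swap_general[where S = "{z. 0 < snd z \<and> snd z < fst z}"]) (auto intro!: open_Collect_conj open_Collect_less continuous_intros simp: field_simps)

text \<open>A localized embedding of L(2,q) into L(2). Integration over (t/2,t) bounds t^(q/2)
  F(t)^q by 2J, which explains the cut s/2. Then F^2 = F^q (F^q)^\<alpha> with \<alpha> = 2/q - 1
  leads to a multiple of J^(1+\<alpha>), whose power q/2 is linear in J.\<close>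

lemma tail_square_powe_le:
 fixes F :: "real \<Rightarrow> ennreal"
 assumes F: "antimono F" and q: "0 < q" "q < 2" and s: "0 < s"
 shows "rint (\<lambda>t. F t powe 2) s powe (q / 2) \<le> 2 powe (1 - q / 2) * rint (\<lambda>t. F t powe q * ennreal (t powr (q / 2 - 1))) (s / 2)"
proof -
 note [measurable] = antimono_borel_measurable[OF F]
 define J where "J = rint (\<lambda>t. F t powe q * ennreal (t powr (q / 2 - 1))) (s / 2)"
 define \<alpha> where "\<alpha> = 2 / q - 1"
 have \<alpha>: "0 < \<alpha>" using q by (simp add: \<alpha>_def)
 have G: "F t powe q \<le> 2 * J * ennreal (t powr (- (q / 2)))" if t: "s < t" for t
 proof -
  have t0: "0 < t" using s t by simp
  have "F t powe q * ennreal (t powr (q / 2)) = 2 * nnl {t / 2<..<t} (\<lambda>x. F t powe q * ennreal (t powr (q / 2 - 1)))"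
  proof -
   have "t powr (q / 2) = 2 * (t powr (q / 2 - 1) * (t / 2))"
    using t0 powr_add[of t "q / 2 - 1" 1] by simp
   also have "ennreal \<dots> = 2 * (ennreal (t powr (q / 2 - 1)) * ennreal (t / 2))"
    using t0 by (subst ennreal_mult, simp, simp, subst ennreal_mult) auto
   finally have e: "ennreal (t powr (q / 2)) = 2 * (ennreal (t powr (q / 2 - 1)) * ennreal (t / 2))" .
   show ?thesis unfolding e using t0 by (subst nn_integral_cmult_indicator) (auto simp: mult_ac)
  qed
  also have "\<dots> \<le> 2 * J"
   unfolding J_def rint_def
  proof (intro mult_left_mono nn_integral_mono)
   fix x
   show "F t powe q * ennreal (t powr (q / 2 - 1)) * indicator {t / 2<..<t} x \<le> F x powe q * ennreal (x powr (q / 2 - 1)) * indicator {s / 2<..} x"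
   proof (cases "t / 2 < x \<and> x < t")
    case True
    then have x: "0 < x" "s / 2 < x" using t s by auto
    have "t powr (q / 2 - 1) \<le> x powr (q / 2 - 1)" using True x q by (intro powr_mono2') auto
    then show ?thesis using True x q antimonoD[OF F, of x t]
     by (auto intro!: mult_mono powe_mono ennreal_leI)
   qed simp
  qed simp
  finally have "F t powe q * ennreal (t powr (q / 2)) * ennreal (t powr (- (q / 2))) \<le> 2 * J * ennreal (t powr (- (q / 2)))"
   by (rule mult_right_mono) simp
  moreover have "ennreal (t powr (q / 2)) * ennreal (t powr (- (q / 2))) = 1"
   using t0 by (simp flip: ennreal_mult powr_add)
  ultimately show ?thesis by (simp add: mult.assoc)
 qed
 have "rint (\<lambda>t. F t powe 2) s \<le> (\<integral>\<^sup>+t. (2 * J) powe \<alpha> * (F t powe q * ennreal (t powr (q / 2 - 1)) * indicator {s / 2<..} t) \<partial>lborel)"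
  unfolding rint_def
 proof (intro nn_integral_mono)
  fix t
  show "F t powe 2 * indicator {s<..} t \<le> (2 * J) powe \<alpha> * (F t powe q * ennreal (t powr (q / 2 - 1)) * indicator {s / 2<..} t)"
  proof (cases "s < t")
   case True
   then have t0: "0 < t" using s by simp
   have "F t powe 2 = F t powe (q + q * \<alpha>)" using q by (simp add: \<alpha>_def field_simps)
   also have "\<dots> = F t powe q * (F t powe q) powe \<alpha>" using q \<alpha> by (subst powe_add) (auto simp: powe_powe)
   also have "\<dots> \<le> F t powe q * (2 * J * ennreal (t powr (- (q / 2)))) powe \<alpha>"
    using \<alpha> by (intro mult_left_mono powe_mono G True) auto
   also have "(2 * J * ennreal (t powr (- (q / 2)))) powe \<alpha> = (2 * J) powe \<alpha> * ennreal (t powr (q / 2 - 1))"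
   proof -
    have "- (q / 2) * \<alpha> = q / 2 - 1" using q by (simp add: \<alpha>_def field_simps)
    then have "ennreal (t powr (- (q / 2))) powe \<alpha> = ennreal (t powr (q / 2 - 1))"
     using t0 by (subst ennreal_powe) (auto simp: powr_powr)
    then show ?thesis by (simp only: powe_mult[OF \<alpha>])
   qed
   finally show ?thesis using True s by (simp add: mult_ac)
  qed simp
 qed
 also have "\<dots> = (2 * J) powe \<alpha> * J" unfolding J_def rint_def by (rule nn_integral_cmult) simp
 finally have "rint (\<lambda>t. F t powe 2) s powe (q / 2) \<le> ((2 * J) powe \<alpha> * J) powe (q / 2)"
  using q by (intro powe_mono) auto
 also have "\<dots> = 2 powe (1 - q / 2) * J"
 proof -
  have q2: "0 < q / 2" "0 \<le> 1 - q / 2" "0 < 1 - q / 2" and e: "\<alpha> * (q / 2) = 1 - q / 2" using q by (auto simp: \<alpha>_def field_simps)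
  have "J powe (1 - q / 2) * J powe (q / 2) = J" using powe_add[of "1 - q / 2" "q / 2" J] q2 by simp
  then show ?thesis unfolding powe_mult[OF q2(1)] powe_powe e powe_mult[OF q2(3)] by (simp add: mult.assoc)
 qed
 finally show ?thesis unfolding J_def .
qed

text \<open>Beyond s the values are at most F(s), which is at most the mean of F over (0,s).\<close>

lemma lint_doubling:
 assumes "antimono F" "0 < s" "s \<le> t" shows "lint F t \<le> ennreal (t / s) * lint F s"
proof -
 note [measurable] = antimono_borel_measurable[OF assms(1)]
 have "lint F t = lint F s + nnl {s..<t} F" by (rule lint_split) (use assms in auto)
 also have "nnl {s..<t} F \<le> nnl {s..<t} (\<lambda>x. F s)"
  by (intro nn_integral_mono) (auto simp: indicator_def intro: antimonoD[OF assms(1)])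
 also have "\<dots> = ennreal ((t - s) / s) * (ennreal s * F s)"
 proof -
  have "ennreal (t - s) = ennreal ((t - s) / s) * ennreal s"
   using assms by (subst ennreal_mult[symmetric]) auto
  then show ?thesis using assms by (subst nn_integral_cmult_indicator) (auto simp: mult_ac)
 qed
 also have "\<dots> \<le> ennreal ((t - s) / s) * lint F s" by (intro mult_left_mono lint_ge assms) simp
 also have "lint F s + ennreal ((t - s) / s) * lint F s = (ennreal 1 + ennreal ((t - s) / s)) * lint F s"
  by (simp add: distrib_right)
 also have "ennreal 1 + ennreal ((t - s) / s) = ennreal (t / s)"
  using assms by (subst ennreal_plus[symmetric]) (auto simp: field_simps)
 finally show ?thesis by (simp add: add_left_mono)
qed

text \<open>\<open>tail_square_powe_le\<close> gives a bound that is linear in the non-increasing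
  function F^q, and interchanging integrals exhibits its weight a. Condition (c) majorizes a by a
  multiple of b. Integrating F^q against b and interchanging again leaves the integral of t^(q-1)
  F^q over (0,1/x), which is at most the power q of \<open>lint F (1 / x)\<close> because t F(t)
  \<le> \<open>lint F t\<close> and q \<ge> 1.\<close>

lemma tail_le_of_cond_c_ge_1:
 fixes F u :: "real \<Rightarrow> ennreal"
 assumes F: "admissible F" and q: "1 \<le> q" "q < 2" and [measurable]: "u \<in> borel_measurable borel"
  and c: "\<And>y. 0 < y \<Longrightarrow> ennreal (y powr (q / 2)) * rint (\<lambda>x. ennreal (x powr (- q / 2)) * u x) y
   \<le> \<beta> * (lint u y + ennreal (y powr q) * rint (\<lambda>x. ennreal (x powr (- q)) * u x) y)"
 shows "rint (\<lambda>x. rint (\<lambda>t. F t powe 2) (1 / x) powe (q / 2) * (ennreal (x powr (- q / 2)) * u x)) 0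
  \<le> 2 powe (1 - q / 2) * (ennreal (2 * 2 powr (q / 2)) * \<beta>) * rint (\<lambda>x. u x * lint F (1 / x) powe q) 0"
proof -
 note anti = admissibleD(1)[OF F] and [measurable] = admissibleD(2)[OF F]
 let ?g = "\<lambda>x. ennreal (x powr (- q / 2)) * u x"
 let ?G = "\<lambda>t. F t powe q"
 let ?c = "ennreal (2 * 2 powr (q / 2)) * \<beta>"
 define a where "a t = ennreal (t powr (q / 2 - 1)) * rint ?g (1 / 2 / t)" for t
 define b where "b t = ennreal (t powr (q - 1)) * lint u (1 / t)" for t
 have [measurable]: "a \<in> borel_measurable borel" "b \<in> borel_measurable borel"
  unfolding a_def[abs_def] b_def[abs_def] by measurable
 have "rint (\<lambda>x. rint (\<lambda>t. F t powe 2) (1 / x) powe (q / 2) * ?g x) 0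
  \<le> rint (\<lambda>x. 2 powe (1 - q / 2) * (?g x * rint (\<lambda>t. ?G t * ennreal (t powr (q / 2 - 1))) (1 / 2 / x))) 0"
  unfolding rint_def[of _ 0]
 proof (intro nn_integral_mono)
  fix x :: real
  show "rint (\<lambda>t. F t powe 2) (1 / x) powe (q / 2) * ?g x * indicator {0<..} x
   \<le> 2 powe (1 - q / 2) * (?g x * rint (\<lambda>t. ?G t * ennreal (t powr (q / 2 - 1))) (1 / 2 / x)) * indicator {0<..} x"
  proof (cases "0 < x")
   case True
   have "rint (\<lambda>t. F t powe 2) (1 / x) powe (q / 2) \<le> 2 powe (1 - q / 2) * rint (\<lambda>t. ?G t * ennreal (t powr (q / 2 - 1))) (1 / x / 2)"
    using q True by (intro tail_square_powe_le anti) auto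
   also have "1 / x / 2 = 1 / 2 / x" by simp
   finally have "rint (\<lambda>t. F t powe 2) (1 / x) powe (q / 2) * ?g x \<le> 2 powe (1 - q / 2) * rint (\<lambda>t. ?G t * ennreal (t powr (q / 2 - 1))) (1 / 2 / x) * ?g x"
    by (rule mult_right_mono) simp
   then show ?thesis using True by (simp only: mult_ac indicator_simps greaterThan_iff mult_1_left mult_1_right)
  qed simp
 qed
 also have "\<dots> = 2 powe (1 - q / 2) * rint (\<lambda>x. ?g x * rint (\<lambda>t. ?G t * ennreal (t powr (q / 2 - 1))) (1 / 2 / x)) 0"
  unfolding rint_def[of _ 0] mult.assoc by (rule nn_integral_cmult) simp
 also have "rint (\<lambda>x. ?g x * rint (\<lambda>t. ?G t * ennreal (t powr (q / 2 - 1))) (1 / 2 / x)) 0 = rint (\<lambda>t. ?G t * ennreal (t powr (q / 2 - 1)) * rint ?g (1 / 2 / t)) 0"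
  by (rule rint_swap) auto
 also have "\<dots> = rint (\<lambda>t. a t * ?G t) 0" by (simp add: a_def mult_ac)
 also have "\<dots> \<le> rint (\<lambda>t. ?c * b t * ?G t) 0"
  unfolding rint_def[of _ 0]
 proof (rule Hardy_majorization)
  show "antimono ?G" using q by (intro antimonoI powe_mono antimonoD[OF anti]) auto
  fix z :: real assume z: "0 < z"
  \<comment> \<open>(c) is used at the cut 1/(2t) of a, taken at t = z.\<close>
  define y where "y = 1 / 2 / z"
  have y: "0 < y" "z * y = 1 / 2" using z by (auto simp: y_def)
  define R where "R = lint u y + ennreal (y powr q) * rint (\<lambda>x. ennreal (x powr (- q)) * u x) y"
  have "lint a z \<le> (\<integral>\<^sup>+t. rint ?g y * (ennreal (t powr (q / 2 - 1)) * indicator {0<..<z} t) \<partial>lborel)"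
   unfolding lint_def
  proof (intro nn_integral_mono)
   fix t
   show "a t * indicator {0<..<z} t \<le> rint ?g y * (ennreal (t powr (q / 2 - 1)) * indicator {0<..<z} t)"
   proof (cases "0 < t \<and> t < z")
    case True
    then have "y \<le> 1 / 2 / t" unfolding y_def by (intro divide_left_mono) auto
    then have "rint ?g (1 / 2 / t) \<le> rint ?g y" by (rule rint_antimono)
    then show ?thesis using True by (simp add: a_def mult.commute mult_left_mono)
   qed simp
  qed
  also have "\<dots> = rint ?g y * lint (\<lambda>t. ennreal (t powr (q / 2 - 1))) z" unfolding lint_def by (rule nn_integral_cmult) simp
  also have "lint (\<lambda>t. ennreal (t powr (q / 2 - 1))) z = ennreal (z powr (q / 2) / (q / 2))"
   using q z by (subst lint_powr) auto
  also have "z powr (q / 2) / (q / 2) = 2 * 2 powr (q / 2) * (z powr q / q) * y powr (q / 2)"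
  proof -
   have "z powr (q / 2) = z powr q * z powr (- (q / 2))" by (simp flip: powr_add)
   also have "z powr (- (q / 2)) = (2 * y) powr (q / 2)"
    unfolding y_def using z by (simp add: powr_minus powr_divide inverse_eq_divide)
   also have "(2 * y) powr (q / 2) = 2 powr (q / 2) * y powr (q / 2)" using y by (simp add: powr_mult)
   finally show ?thesis using q by (simp add: field_simps)
  qed
  also have "rint ?g y * ennreal (2 * 2 powr (q / 2) * (z powr q / q) * y powr (q / 2)) = ennreal (2 * 2 powr (q / 2)) * ennreal (z powr q / q) * (ennreal (y powr (q / 2)) * rint ?g y)"
   using q by (subst ennreal_mult, simp, simp, subst ennreal_mult) (auto simp: mult_ac)
  also have "\<dots> \<le> ennreal (2 * 2 powr (q / 2)) * ennreal (z powr q / q) * (\<beta> * R)"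
   unfolding R_def by (intro mult_left_mono c y) simp
  also have "\<dots> = ?c * (ennreal (z powr q / q) * R)" by (simp only: mult_ac)
  also have "ennreal (z powr q / q) * R \<le> lint b z"
  proof -
   \<comment> \<open>By Tonelli \<open>lint b z\<close> is the integral of u(x) min(z,1/x)^q / q.
     Below y the minimum is z; beyond y it is at least 1/(2x) = z y / x, which gives the weight in
     (c).\<close>
   let ?w = "\<lambda>t. ennreal (t powr (q - 1)) * indicator {..<z} t"
   have w: "lint ?w (1 / x) = ennreal (min z (1 / x) powr q / q)" if "0 < x" for x
   proof -
    have "lint ?w (1 / x) = lint (\<lambda>t. ennreal (t powr (q - 1))) (min z (1 / x))"
     unfolding lint_def by (intro nn_integral_cong) (auto simp: indicator_def)
    then show ?thesis using that z q by (simp add: lint_powr)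
   qed
   have "ennreal (z powr q / q) * R = (\<integral>\<^sup>+x. ennreal (z powr q / q) * (u x * indicator {0<..<y} x) + ennreal (z powr q / q) * (ennreal (y powr q) * (ennreal (x powr (- q)) * u x * indicator {y<..} x)) \<partial>lborel)"
    unfolding R_def lint_def rint_def distrib_left by (subst nn_integral_add) (auto simp: nn_integral_cmult)
   also have "\<dots> \<le> rint (\<lambda>x. u x * lint ?w (1 / x)) 0"
    unfolding rint_def[of _ 0]
   proof (intro nn_integral_mono)
    fix x :: real
    show "ennreal (z powr q / q) * (u x * indicator {0<..<y} x) + ennreal (z powr q / q) * (ennreal (y powr q) * (ennreal (x powr (- q)) * u x * indicator {y<..} x)) \<le> u x * lint ?w (1 / x) * indicator {0<..} x"
    proof (cases "0 < x \<and> x \<noteq> y")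
     case True
     show ?thesis
     proof (cases "x < y")
      case xy: True
      then have "z \<le> 1 / x" using True z y_def by (simp add: field_simps)
      then show ?thesis using xy True w[of x] by (simp add: mult.commute min_absorb1)
     next
      case False
      then have xy: "y < x" using True by simp
      have "1 / (2 * x) \<le> min z (1 / x)" using xy True z y_def by (simp add: field_simps)
      then have "(1 / (2 * x)) powr q \<le> min z (1 / x) powr q" using True q by (intro powr_mono2) auto
      moreover have "z powr q * (y powr q * x powr (- q)) = (1 / (2 * x)) powr q"
      proof -
       have "z powr q * y powr q = (1 / 2) powr q" using powr_mult[of z y q] z y(1) unfolding y(2) by simp
       moreover have "(1 / (2 * x)) powr q = (1 / 2) powr q * x powr (- q)"
        using True by (simp add: powr_minus_divide powr_divide powr_mult)
       ultimately show ?thesis by (simp add: mult.assoc[symmetric])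
      qed
      ultimately have "z powr q / q * (y powr q * x powr (- q)) \<le> min z (1 / x) powr q / q"
       using q by (simp add: divide_right_mono)
      then have "ennreal (z powr q / q * (y powr q * x powr (- q))) * u x \<le> ennreal (min z (1 / x) powr q / q) * u x"
       by (intro mult_right_mono ennreal_leI) auto
      moreover have "ennreal (z powr q / q * (y powr q * x powr (- q))) = ennreal (z powr q / q) * (ennreal (y powr q) * ennreal (x powr (- q)))"
       using q by (subst ennreal_mult, simp, simp, subst ennreal_mult) auto
      ultimately show ?thesis using xy True w[of x] by (simp add: mult_ac)
     qed
    qed (use y in \<open>auto simp: indicator_def\<close>)
   qed
   also have "\<dots> = rint (\<lambda>t. ?w t * lint u (1 / t)) 0" by (rule lint_swap[symmetric]) auto
   also have "\<dots> = lint b z"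
    unfolding rint_def lint_def[of b] b_def by (intro nn_integral_cong) (auto simp: indicator_def)
   finally show ?thesis .
  qed
  then have "?c * (ennreal (z powr q / q) * R) \<le> ?c * lint b z" by (rule mult_left_mono) simp
  also have "\<dots> = nnl {0<..<z} (\<lambda>t. ?c * b t)" unfolding lint_def mult.assoc[of ?c] by (rule nn_integral_cmult[symmetric]) simp
  finally show "nnl {0<..<z} a \<le> nnl {0<..<z} (\<lambda>t. ?c * b t)" unfolding lint_def .
 qed auto
 also have "\<dots> = ?c * rint (\<lambda>t. ennreal (t powr (q - 1)) * ?G t * lint u (1 / t)) 0"
  unfolding rint_def b_def by (subst nn_integral_cmult[symmetric]) (auto intro!: nn_integral_cong simp: mult_ac)
 also have "rint (\<lambda>t. ennreal (t powr (q - 1)) * ?G t * lint u (1 / t)) 0 = rint (\<lambda>x. u x * lint (\<lambda>t. ennreal (t powr (q - 1)) * ?G t) (1 / x)) 0"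
  by (rule lint_swap) auto
 also have "\<dots> \<le> rint (\<lambda>x. u x * lint F (1 / x) powe q) 0"
  unfolding rint_def
 proof (intro nn_integral_mono mult_right_mono mult_left_mono)
  fix x :: real
  have "lint (\<lambda>t. ennreal (t powr (q - 1)) * ?G t) (1 / x) \<le> (\<integral>\<^sup>+t. lint F (1 / x) powe (q - 1) * (F t * indicator {0<..<1 / x} t) \<partial>lborel)"
   unfolding lint_def[of "\<lambda>t. ennreal (t powr (q - 1)) * ?G t"]
  proof (intro nn_integral_mono)
   fix t
   show "ennreal (t powr (q - 1)) * ?G t * indicator {0<..<1 / x} t \<le> lint F (1 / x) powe (q - 1) * (F t * indicator {0<..<1 / x} t)"
   proof (cases "0 < t \<and> t < 1 / x")
    case True
    have "ennreal t * F t \<le> lint F t" using True by (intro lint_ge anti) auto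
    also have "\<dots> \<le> lint F (1 / x)" using True by (intro lint_mono) auto
    finally have "(ennreal t * F t) powe (q - 1) \<le> lint F (1 / x) powe (q - 1)" using q by (intro powe_mono) auto
    moreover have "(ennreal t * F t) powe (q - 1) = ennreal (t powr (q - 1)) * F t powe (q - 1)"
    proof (cases "q = 1")
     case False
     then show ?thesis using q True by (subst powe_mult) (auto simp: ennreal_powe)
    qed (use True in simp)
    moreover have "?G t = F t powe (q - 1) * F t" using powe_add[of "q - 1" 1 "F t"] q by simp
    ultimately have "ennreal (t powr (q - 1)) * ?G t \<le> lint F (1 / x) powe (q - 1) * F t"
     by (simp add: mult.assoc[symmetric] mult_right_mono)
    then show ?thesis using True by simp
   qed simp
  qed
  also have "\<dots> = lint F (1 / x) powe (q - 1) * lint F (1 / x)" unfolding lint_def[of F] by (rule nn_integral_cmult) simp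
  also have "\<dots> = lint F (1 / x) powe q" using powe_add[of "q - 1" 1 "lint F (1 / x)"] q by simp
  finally show "lint (\<lambda>t. ennreal (t powr (q - 1)) * ?G t) (1 / x) \<le> lint F (1 / x) powe q" .
 qed auto
 finally show ?thesis by (simp add: mult_left_mono mult.assoc)
qed

section \<open>The condition (c) for q < 1\<close>

lemma geometric_sum_from_le:
 fixes \<rho> :: real
 assumes "0 < \<rho>" "\<rho> < 1"
 shows "(\<Sum>k<n. if k0 \<le> k then \<rho> ^ k else 0) \<le> \<rho> ^ k0 / (1 - \<rho>)"
proof -
 have "(\<Sum>k<n. if k0 \<le> k then \<rho> ^ k else 0) + \<rho> ^ max k0 n / (1 - \<rho>) = \<rho> ^ k0 / (1 - \<rho>)"
 proof (induction n)
  case (Suc n)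
  have "\<rho> ^ n + \<rho> ^ Suc n / (1 - \<rho>) = \<rho> ^ n / (1 - \<rho>)" using assms by (simp add: field_simps)
  then have "(if k0 \<le> n then \<rho> ^ n else 0) + \<rho> ^ max k0 (Suc n) / (1 - \<rho>) = \<rho> ^ max k0 n / (1 - \<rho>)"
   by (auto simp: max_def not_le le_Suc_eq)
  then show ?case using Suc by simp
 qed simp
 moreover have "0 \<le> \<rho> ^ max k0 n / (1 - \<rho>)" using assms by simp
 ultimately show ?thesis by linarith
qed

text \<open>A geometric series that starts at the first k with y < 2^k, where (2^k)^(-q/2) is at
  most 1 and at most y^(-q/2).\<close>

lemma dyadic_tail_le:
 assumes q: "0 < q" and y: "0 < y"
 shows "(\<Sum>k. ennreal ((2 powr (- q / 2)) ^ k) * (if y < 2 ^ k then 1 else 0))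
  \<le> ennreal (1 / (1 - 2 powr (- q / 2))) * ennreal (min 1 (y powr (- q / 2)))"
proof (rule suminf_le_const[OF summableI])
 fix n
 define \<rho> :: real where "\<rho> = 2 powr (- q / 2)"
 have \<rho>: "0 < \<rho>" "\<rho> < 1" using q powr_less_mono[of "- q / 2" 0 2] by (auto simp: \<rho>_def)
 obtain j where "y < 2 ^ j" using real_arch_pow[of 2 y] by auto
 define k0 where "k0 = (LEAST k. y < 2 ^ k)"
 have k0: "y < 2 ^ k0" unfolding k0_def by (rule LeastI) fact
 have least: "k0 \<le> k" if "y < 2 ^ k" for k unfolding k0_def by (rule Least_le) fact
 have "(\<Sum>k<n. ennreal (\<rho> ^ k) * (if y < 2 ^ k then 1 else 0)) \<le> (\<Sum>k<n. ennreal (if k0 \<le> k then \<rho> ^ k else 0))"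
  using least by (intro sum_mono) auto
 also have "\<dots> = ennreal (\<Sum>k<n. if k0 \<le> k then \<rho> ^ k else 0)" using \<rho> by (intro sum_ennreal) auto
 also have "\<dots> \<le> ennreal (\<rho> ^ k0 / (1 - \<rho>))" by (intro ennreal_leI geometric_sum_from_le \<rho>)
 also have "\<dots> \<le> ennreal (1 / (1 - \<rho>) * min 1 (y powr (- q / 2)))"
 proof (rule ennreal_leI)
  have "\<rho> ^ k0 = (2 ^ k0) powr (- q / 2)"
   unfolding \<rho>_def by (simp add: powr_realpow[symmetric] powr_powr mult.commute)
  also have "\<dots> \<le> y powr (- q / 2)" using k0 y q by (intro powr_mono2') auto
  finally have "\<rho> ^ k0 \<le> min 1 (y powr (- q / 2))" using \<rho> by (simp add: power_le_one)
  then show "\<rho> ^ k0 / (1 - \<rho>) \<le> 1 / (1 - \<rho>) * min 1 (y powr (- q / 2))" using \<rho> by (simp add: divide_right_mono)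
 qed
 also have "\<dots> = ennreal (1 / (1 - \<rho>)) * ennreal (min 1 (y powr (- q / 2)))" using \<rho> by (intro ennreal_mult) auto
 finally show "(\<Sum>k<n. ennreal ((2 powr (- q / 2)) ^ k) * (if y < 2 ^ k then 1 else 0)) \<le> ennreal (1 / (1 - 2 powr (- q / 2))) * ennreal (min 1 (y powr (- q / 2)))"
  unfolding \<rho>_def .
qed

text \<open>On the dyadic block from \<sigma> = 2^k s to 2 \<sigma> the function is at most
  F(\<sigma>), and \<sigma> F(\<sigma>) is at most the integral of F over (0,\<sigma>).\<close>

lemma rint_square_dyadic_le:
 fixes F :: "real \<Rightarrow> ennreal"
 assumes F: "antimono F" and s: "0 < s"
 shows "rint (\<lambda>t. F t powe 2) s \<le> (\<Sum>k. ennreal (1 / (2 ^ k * s)) * lint F (2 ^ k * s) powe 2)"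
proof -
 note [measurable] = antimono_borel_measurable[OF F]
 have "rint (\<lambda>t. F t powe 2) s \<le> (\<integral>\<^sup>+t. (\<Sum>k. F (2 ^ k * s) powe 2 * indicator {2 ^ k * s<..2 ^ Suc k * s} t) \<partial>lborel)"
  unfolding rint_def
 proof (intro nn_integral_mono)
  fix t
  show "F t powe 2 * indicator {s<..} t \<le> (\<Sum>k. F (2 ^ k * s) powe 2 * indicator {2 ^ k * s<..2 ^ Suc k * s} t)"
  proof (cases "s < t")
   case True
   obtain j where j: "t / s < 2 ^ j" using real_arch_pow[of 2 "t / s"] by auto
   define l where "l = (LEAST j. t \<le> 2 ^ j * s)"
   have l: "t \<le> 2 ^ l * s" unfolding l_def by (rule LeastI[of _ j]) (use j s in \<open>simp add: field_simps\<close>)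
   then obtain k where k: "l = Suc k" using True by (cases l) auto
   then have "\<not> t \<le> 2 ^ k * s" using not_less_Least[of k "\<lambda>j. t \<le> 2 ^ j * s"] unfolding l_def by simp
   then have t: "2 ^ k * s < t" "t \<le> 2 ^ Suc k * s" using l unfolding k by auto
   have "F t powe 2 * indicator {s<..} t \<le> F (2 ^ k * s) powe 2 * indicator {2 ^ k * s<..2 ^ Suc k * s} t"
    using t True powe_mono[OF _ antimonoD[OF F less_imp_le[OF t(1)]], of 2] by simp
   also have "\<dots> \<le> (\<Sum>k. F (2 ^ k * s) powe 2 * indicator {2 ^ k * s<..2 ^ Suc k * s} t)" by (rule ennreal_le_suminf)
   finally show ?thesis .
  qed simp
 qed
 also have "\<dots> = (\<Sum>k. F (2 ^ k * s) powe 2 * ennreal (2 ^ k * s))"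
 proof (subst nn_integral_suminf)
  have "(\<integral>\<^sup>+t. F (2 ^ k * s) powe 2 * indicator {2 ^ k * s<..2 ^ Suc k * s} t \<partial>lborel) = F (2 ^ k * s) powe 2 * ennreal (2 ^ k * s)" for k
   using s by (subst nn_integral_cmult_indicator) (auto simp: mult.commute)
  then show "(\<Sum>k. \<integral>\<^sup>+t. F (2 ^ k * s) powe 2 * indicator {2 ^ k * s<..2 ^ Suc k * s} t \<partial>lborel) = (\<Sum>k. F (2 ^ k * s) powe 2 * ennreal (2 ^ k * s))"
   by simp
 qed simp
 also have "\<dots> \<le> (\<Sum>k. ennreal (1 / (2 ^ k * s)) * lint F (2 ^ k * s) powe 2)"
 proof (intro suminf_le summableI)
  fix k :: nat
  define \<sigma> where "\<sigma> = 2 ^ k * s"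
  have \<sigma>: "0 < \<sigma>" using s by (simp add: \<sigma>_def)
  have "F \<sigma> powe 2 * ennreal \<sigma> = ennreal (1 / \<sigma> * \<sigma>) * (F \<sigma> powe 2 * ennreal \<sigma>)" using \<sigma> by simp
  also have "\<dots> = ennreal (1 / \<sigma>) * (ennreal \<sigma> * F \<sigma>) powe 2"
   using \<sigma> by (subst ennreal_mult) (auto simp: powe_2 mult_ac)
  also have "\<dots> \<le> ennreal (1 / \<sigma>) * lint F \<sigma> powe 2" by (intro mult_left_mono powe_mono lint_ge F \<sigma>) auto
  finally show "F (2 ^ k * s) powe 2 * ennreal (2 ^ k * s) \<le> ennreal (1 / (2 ^ k * s)) * lint F (2 ^ k * s) powe 2"
   unfolding \<sigma>_def .
 qed
 finally show ?thesis .
qed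

text \<open>The non-increasing function is now k, the power q of \<open>lint F (1 / x)\<close>: the
  dyadic bound and subadditivity of the power q/2 lead to its integral against a superposition a of
  dilates of u. Condition (c), with exponent 1, majorizes a by a multiple of the integral of u(x)/x
  over (t,\<infinity>). Undoing this average costs 1/(1-q), since k(z) \<le> (x/z)^q k(x) for z < x
  and z^(-q) is integrable at 0.\<close>

lemma tail_le_of_cond_c_lt_1:
 fixes F u :: "real \<Rightarrow> ennreal"
 assumes F: "admissible F" and q: "0 < q" "q < 1" and [measurable]: "u \<in> borel_measurable borel"
  and c: "\<And>y. 0 < y \<Longrightarrow> ennreal (y powr (q / 2)) * rint (\<lambda>x. ennreal (x powr (- q / 2)) * u x) y
   \<le> \<beta> * (lint u y + ennreal y * rint (\<lambda>x. ennreal (1 / x) * u x) y)"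
 shows "rint (\<lambda>x. rint (\<lambda>t. F t powe 2) (1 / x) powe (q / 2) * (ennreal (x powr (- q / 2)) * u x)) 0
  \<le> ennreal (1 / (1 - 2 powr (- q / 2))) * (1 + \<beta>) * ennreal (1 / (1 - q)) * rint (\<lambda>x. u x * lint F (1 / x) powe q) 0"
proof -
 note anti = admissibleD(1)[OF F] and [measurable] = admissibleD(2)[OF F]
 let ?g = "\<lambda>x. ennreal (x powr (- q / 2)) * u x" and ?f = "\<lambda>x. ennreal (1 / x) * u x"
 let ?K = "ennreal (1 / (1 - 2 powr (- q / 2)))"
 define \<rho> :: real where "\<rho> = 2 powr (- q / 2)"
 have \<rho>: "0 < \<rho>" "\<rho> < 1" using q powr_less_mono[of "- q / 2" 0 2] by (auto simp: \<rho>_def)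
 \<comment> \<open>The value \<top> off the half-line makes k non-increasing on the whole
   line.\<close>
 define k where "k x = (if 0 < x then lint F (1 / x) powe q else \<top>)" for x
 have k_anti: "antimono k"
 proof (rule antimonoI)
  fix x y :: real assume xy: "x \<le> y"
  show "k y \<le> k x"
  proof (cases "0 < x")
   case True
   then have "1 / y \<le> 1 / x" using xy by (intro divide_left_mono) auto
   then show ?thesis using True xy q by (simp add: k_def powe_mono lint_mono)
  qed (simp add: k_def)
 qed
 note [measurable] = antimono_borel_measurable[OF k_anti]
 \<comment> \<open>A change of variables by 2^j moves the dilation from k to u; the geometric
   weights \<rho>^j sum to the constant \<open>?K\<close>.\<close>
 define a where "a z = (\<Sum>j. ennreal (\<rho> ^ j) * ennreal (2 ^ j) * u (2 ^ j * z))" for z :: real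
 have [measurable]: "a \<in> borel_measurable borel" unfolding a_def[abs_def] by measurable
 have scale: "(\<integral>\<^sup>+x. h x \<partial>lborel) = ennreal (2 ^ j) * (\<integral>\<^sup>+x. h (2 ^ j * x) \<partial>lborel)"
  if "h \<in> borel_measurable borel" for h :: "real \<Rightarrow> ennreal" and j :: nat
  using nn_integral_real_affine[OF that, of "2 ^ j" 0] by simp
 have "rint (\<lambda>x. rint (\<lambda>t. F t powe 2) (1 / x) powe (q / 2) * ?g x) 0 \<le> rint (\<lambda>x. \<Sum>j. ennreal (\<rho> ^ j) * (k (x / 2 ^ j) * u x)) 0"
  unfolding rint_def[of _ 0]
 proof (intro nn_integral_mono)
  fix x :: real
  show "rint (\<lambda>t. F t powe 2) (1 / x) powe (q / 2) * ?g x * indicator {0<..} x \<le> (\<Sum>j. ennreal (\<rho> ^ j) * (k (x / 2 ^ j) * u x)) * indicator {0<..} x"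
  proof (cases "0 < x")
   case True
   have "rint (\<lambda>t. F t powe 2) (1 / x) powe (q / 2) \<le> (\<Sum>j. ennreal (1 / (2 ^ j * (1 / x))) * lint F (2 ^ j * (1 / x)) powe 2) powe (q / 2)"
    using True q by (intro powe_mono rint_square_dyadic_le anti) auto
   also have "\<dots> \<le> (\<Sum>j. (ennreal (1 / (2 ^ j * (1 / x))) * lint F (2 ^ j * (1 / x)) powe 2) powe (q / 2))"
    using q by (intro powe_suminf_subadd) auto
   finally have "rint (\<lambda>t. F t powe 2) (1 / x) powe (q / 2) * ennreal (x powr (- q / 2))
    \<le> (\<Sum>j. (ennreal (1 / (2 ^ j * (1 / x))) * lint F (2 ^ j * (1 / x)) powe 2) powe (q / 2)) * ennreal (x powr (- q / 2))"
    by (rule mult_right_mono) simp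
   also have "\<dots> = (\<Sum>j. (ennreal (1 / (2 ^ j * (1 / x))) * lint F (2 ^ j * (1 / x)) powe 2) powe (q / 2) * ennreal (x powr (- q / 2)))"
    by (rule ennreal_suminf_multc[symmetric])
   also have "\<dots> = (\<Sum>j. ennreal (\<rho> ^ j) * k (x / 2 ^ j))"
   proof (rule suminf_cong)
    fix j :: nat
    have e: "1 / (1 / (x / 2 ^ j)) = x / 2 ^ j" "2 ^ j * (1 / x) = 1 / (x / 2 ^ j)" using True by auto
    have "(x / 2 ^ j) powr (q / 2) * x powr (- q / 2) = \<rho> ^ j"
    proof -
     have "(x / 2 ^ j) powr (q / 2) = x powr (q / 2) * (2 ^ j) powr (- q / 2)"
      using True by (simp add: powr_divide powr_minus_divide)
     also have "(2 ^ j) powr (- q / 2) = \<rho> ^ j" unfolding \<rho>_def by (simp add: powr_realpow[symmetric] powr_powr mult.commute)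
     finally have "(x / 2 ^ j) powr (q / 2) * x powr (- q / 2) = \<rho> ^ j * (x powr (q / 2) * x powr (- q / 2))" by simp
     also have "x powr (q / 2) * x powr (- q / 2) = 1" using True by (simp flip: powr_add)
     finally show ?thesis by simp
    qed
    then have a1: "ennreal ((x / 2 ^ j) powr (q / 2)) * ennreal (x powr (- q / 2)) = ennreal (\<rho> ^ j)" by (simp flip: ennreal_mult)
    have a2: "(ennreal (x / 2 ^ j) * lint F (1 / (x / 2 ^ j)) powe 2) powe (q / 2) = ennreal ((x / 2 ^ j) powr (q / 2)) * lint F (1 / (x / 2 ^ j)) powe q"
     using True q by (subst powe_mult) (auto simp: powe_powe ennreal_powe)
    have a3: "k (x / 2 ^ j) = lint F (1 / (x / 2 ^ j)) powe q" using True by (simp add: k_def)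
    show "(ennreal (1 / (2 ^ j * (1 / x))) * lint F (2 ^ j * (1 / x)) powe 2) powe (q / 2) * ennreal (x powr (- q / 2)) = ennreal (\<rho> ^ j) * k (x / 2 ^ j)"
     unfolding e a2 a3 a1[symmetric] by (simp only: mult_ac)
   qed
   finally have "rint (\<lambda>t. F t powe 2) (1 / x) powe (q / 2) * ennreal (x powr (- q / 2)) * u x \<le> (\<Sum>j. ennreal (\<rho> ^ j) * k (x / 2 ^ j)) * u x"
    by (rule mult_right_mono) simp
   then show ?thesis using True by (simp add: mult.assoc flip: ennreal_suminf_multc)
  qed simp
 qed
 also have "\<dots> = (\<Sum>j. \<integral>\<^sup>+x. ennreal (\<rho> ^ j) * (k (x / 2 ^ j) * u x * indicator {0<..} x) \<partial>lborel)"
  unfolding rint_def by (subst nn_integral_suminf[symmetric]) (auto intro!: nn_integral_cong simp: mult.assoc simp flip: ennreal_suminf_multc)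
 also have "\<dots> = (\<Sum>j. \<integral>\<^sup>+x. ennreal (\<rho> ^ j) * ennreal (2 ^ j) * u (2 ^ j * x) * k x * indicator {0<..} x \<partial>lborel)"
 proof (rule suminf_cong)
  fix j :: nat
  have "(\<integral>\<^sup>+x. ennreal (\<rho> ^ j) * (k (x / 2 ^ j) * u x * indicator {0<..} x) \<partial>lborel)
   = ennreal (2 ^ j) * (\<integral>\<^sup>+x. ennreal (\<rho> ^ j) * (k (2 ^ j * x / 2 ^ j) * u (2 ^ j * x) * indicator {0<..} (2 ^ j * x)) \<partial>lborel)"
   by (rule scale) simp
  also have "\<dots> = (\<integral>\<^sup>+x. ennreal (2 ^ j) * (ennreal (\<rho> ^ j) * (k (2 ^ j * x / 2 ^ j) * u (2 ^ j * x) * indicator {0<..} (2 ^ j * x))) \<partial>lborel)"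
   by (rule nn_integral_cmult[symmetric]) simp
  also have "\<dots> = (\<integral>\<^sup>+x. ennreal (\<rho> ^ j) * ennreal (2 ^ j) * u (2 ^ j * x) * k x * indicator {0<..} x \<partial>lborel)"
   by (intro nn_integral_cong) (auto simp: indicator_def zero_less_mult_iff mult_ac)
  finally show "(\<integral>\<^sup>+x. ennreal (\<rho> ^ j) * (k (x / 2 ^ j) * u x * indicator {0<..} x) \<partial>lborel) = (\<integral>\<^sup>+x. ennreal (\<rho> ^ j) * ennreal (2 ^ j) * u (2 ^ j * x) * k x * indicator {0<..} x \<partial>lborel)" .
 qed
 also have "\<dots> = nnl {0<..} (\<lambda>x. a x * k x)"
  unfolding a_def by (subst nn_integral_suminf[symmetric]) (auto simp flip: ennreal_suminf_multc)
 also have "\<dots> \<le> nnl {0<..} (\<lambda>z. ?K * (1 + \<beta>) * rint ?f z * k z)"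
 proof (rule Hardy_majorization)
  fix z :: real assume z: "0 < z"
  have "nnl {0<..<z} a = (\<Sum>j. \<integral>\<^sup>+t. ennreal (\<rho> ^ j) * ennreal (2 ^ j) * u (2 ^ j * t) * indicator {0<..<z} t \<partial>lborel)"
   unfolding a_def by (subst nn_integral_suminf[symmetric]) (auto simp flip: ennreal_suminf_multc)
  \<comment> \<open>With the dilation undone, x is counted for those j with x < 2^j z. By
    \<open>dyadic_tail_le\<close> they contribute at most \<open>?K\<close> below z and
    \<open>?K\<close> (z/x)^(q/2) beyond z, the weight on the left of (c).\<close>
  also have "\<dots> = (\<Sum>j. \<integral>\<^sup>+x. ennreal (\<rho> ^ j) * (if x / z < 2 ^ j then 1 else 0) * (u x * indicator {0<..} x) \<partial>lborel)"
  proof (rule suminf_cong)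
   fix j :: nat
   have "(\<integral>\<^sup>+x. ennreal (\<rho> ^ j) * (if x / z < 2 ^ j then 1 else 0) * (u x * indicator {0<..} x) \<partial>lborel)
    = ennreal (2 ^ j) * (\<integral>\<^sup>+x. ennreal (\<rho> ^ j) * (if 2 ^ j * x / z < 2 ^ j then 1 else 0) * (u (2 ^ j * x) * indicator {0<..} (2 ^ j * x)) \<partial>lborel)"
    by (rule scale) measurable
   also have "\<dots> = (\<integral>\<^sup>+x. ennreal (2 ^ j) * (ennreal (\<rho> ^ j) * (if 2 ^ j * x / z < 2 ^ j then 1 else 0) * (u (2 ^ j * x) * indicator {0<..} (2 ^ j * x))) \<partial>lborel)"
    by (rule nn_integral_cmult[symmetric]) measurable
   also have "\<dots> = (\<integral>\<^sup>+t. ennreal (\<rho> ^ j) * ennreal (2 ^ j) * u (2 ^ j * t) * indicator {0<..<z} t \<partial>lborel)"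
    using z by (intro nn_integral_cong) (auto simp: indicator_def zero_less_mult_iff mult_ac pos_divide_less_eq)
   finally show "(\<integral>\<^sup>+t. ennreal (\<rho> ^ j) * ennreal (2 ^ j) * u (2 ^ j * t) * indicator {0<..<z} t \<partial>lborel) = (\<integral>\<^sup>+x. ennreal (\<rho> ^ j) * (if x / z < 2 ^ j then 1 else 0) * (u x * indicator {0<..} x) \<partial>lborel)" ..
  qed
  also have "\<dots> = (\<integral>\<^sup>+x. (\<Sum>j. ennreal (\<rho> ^ j) * (if x / z < 2 ^ j then 1 else 0)) * (u x * indicator {0<..} x) \<partial>lborel)"
   by (subst nn_integral_suminf[symmetric]) (auto simp flip: ennreal_suminf_multc)
  also have "\<dots> \<le> (\<integral>\<^sup>+x. ?K * (u x * indicator {0<..z} x + ennreal (z powr (q / 2)) * (?g x * indicator {z<..} x)) \<partial>lborel)"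
  proof (intro nn_integral_mono)
   fix x :: real
   show "(\<Sum>j. ennreal (\<rho> ^ j) * (if x / z < 2 ^ j then 1 else 0)) * (u x * indicator {0<..} x) \<le> ?K * (u x * indicator {0<..z} x + ennreal (z powr (q / 2)) * (?g x * indicator {z<..} x))"
   proof (cases "0 < x")
    case True
    have "(\<Sum>j. ennreal (\<rho> ^ j) * (if x / z < 2 ^ j then 1 else 0)) \<le> ?K * ennreal (min 1 ((x / z) powr (- q / 2)))"
     unfolding \<rho>_def using True z q by (intro dyadic_tail_le) auto
    then have "(\<Sum>j. ennreal (\<rho> ^ j) * (if x / z < 2 ^ j then 1 else 0)) * u x \<le> ?K * ennreal (min 1 ((x / z) powr (- q / 2))) * u x"
     by (rule mult_right_mono) simp
    also have "\<dots> \<le> ?K * (u x * indicator {0<..z} x + ennreal (z powr (q / 2)) * (?g x * indicator {z<..} x))"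
    proof (cases "x \<le> z")
     case xz: True
     have "ennreal (min 1 ((x / z) powr (- q / 2))) \<le> ennreal 1" by (intro ennreal_leI) simp
     then have "?K * (ennreal (min 1 ((x / z) powr (- q / 2))) * u x) \<le> ?K * (ennreal 1 * u x)"
      by (intro mult_left_mono mult_right_mono) auto
     then show ?thesis using True xz by (simp add: mult.assoc)
    next
     case False
     have "(x / z) powr (- q / 2) = z powr (q / 2) * x powr (- q / 2)"
      using True z by (simp add: powr_divide powr_minus_divide)
     then have "ennreal (min 1 ((x / z) powr (- q / 2))) \<le> ennreal (z powr (q / 2)) * ennreal (x powr (- q / 2))"
      by (subst ennreal_mult[symmetric]) (auto intro!: ennreal_leI)
     then have "?K * (ennreal (min 1 ((x / z) powr (- q / 2))) * u x) \<le> ?K * (ennreal (z powr (q / 2)) * ennreal (x powr (- q / 2)) * u x)"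
      by (intro mult_left_mono mult_right_mono) auto
     then show ?thesis using True False by (simp add: mult.assoc)
    qed
    finally show ?thesis using True by simp
   qed simp
  qed
  also have "\<dots> = ?K * (lint u z + ennreal (z powr (q / 2)) * rint ?g z)"
   unfolding rint_def lint_eq_Ioc[symmetric, OF \<open>u \<in> borel_measurable borel\<close>]
   by (subst nn_integral_cmult, simp, subst nn_integral_add) (auto simp: nn_integral_cmult)
  also have "\<dots> \<le> ?K * ((1 + \<beta>) * (lint u z + ennreal z * rint ?f z))"
  proof (rule mult_left_mono)
   have "lint u z + ennreal (z powr (q / 2)) * rint ?g z \<le> (lint u z + ennreal z * rint ?f z) + \<beta> * (lint u z + ennreal z * rint ?f z)"
    by (intro add_mono c z) simp
   then show "lint u z + ennreal (z powr (q / 2)) * rint ?g z \<le> (1 + \<beta>) * (lint u z + ennreal z * rint ?f z)"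
    by (simp add: distrib_right)
  qed simp
  \<comment> \<open>By Tonelli both sides integrate u(x)/x against min(x,z).\<close>
  also have "lint u z + ennreal z * rint ?f z \<le> lint (rint ?f) z"
  proof -
   have "lint u z + ennreal z * rint ?f z = (\<integral>\<^sup>+x. u x * indicator {0<..<z} x + ennreal z * (?f x * indicator {z<..} x) \<partial>lborel)"
    unfolding lint_def rint_def by (subst nn_integral_add) (auto simp: nn_integral_cmult)
   also have "\<dots> \<le> rint (\<lambda>x. ?f x * lint (\<lambda>t. indicator {..<z} t) x) 0"
    unfolding rint_def
   proof (intro nn_integral_mono)
    fix x :: real
    have l: "lint (\<lambda>t. indicator {..<z} t) x = ennreal (min x z)" if "0 < x"
    proof -
     have "lint (\<lambda>t. indicator {..<z} t) x = (\<integral>\<^sup>+t. indicator {0<..<min x z} t \<partial>lborel)"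
      unfolding lint_def by (intro nn_integral_cong) (auto simp: indicator_def)
     then show ?thesis using that z by simp
    qed
    show "u x * indicator {0<..<z} x + ennreal z * (?f x * indicator {z<..} x) \<le> ?f x * lint (\<lambda>t. indicator {..<z} t) x * indicator {0<..} x"
    proof (cases "0 < x")
     case True
     then have "ennreal (1 / x) * ennreal x = 1" by (simp flip: ennreal_mult)
     then have "ennreal (1 / x) * u x * ennreal x = u x" by (metis mult.commute mult.left_commute mult_1)
     then show ?thesis using True z unfolding l[OF True] by (cases "x < z"; cases "x = z") (auto simp: mult.commute min_def)
    qed (use z in simp)
   qed
   also have "\<dots> = rint (\<lambda>t. indicator {..<z} t * rint ?f t) 0" by (rule lint_rint_swap[symmetric]) auto
   also have "\<dots> = lint (rint ?f) z"
    unfolding rint_def[of _ 0] lint_def by (intro nn_integral_cong) (auto simp: indicator_def)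
   finally show ?thesis .
  qed
  then have "?K * ((1 + \<beta>) * (lint u z + ennreal z * rint ?f z)) \<le> ?K * ((1 + \<beta>) * lint (rint ?f) z)"
   by (intro mult_left_mono) auto
  also have "\<dots> = nnl {0<..<z} (\<lambda>t. ?K * (1 + \<beta>) * rint ?f t)"
   unfolding lint_def mult.assoc[symmetric] by (subst nn_integral_cmult[symmetric]) (auto simp: mult.assoc)
  finally show "nnl {0<..<z} a \<le> nnl {0<..<z} (\<lambda>t. ?K * (1 + \<beta>) * rint ?f t)" .
 qed (use k_anti in auto)
 also have "\<dots> = ?K * (1 + \<beta>) * rint (\<lambda>z. k z * rint ?f z) 0"
  unfolding rint_def[of _ 0] by (subst nn_integral_cmult[symmetric]) (auto intro!: nn_integral_cong simp: mult_ac)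
 also have "rint (\<lambda>z. k z * rint ?f z) 0 = rint (\<lambda>x. ?f x * lint k x) 0" by (rule lint_rint_swap) auto
 also have "\<dots> \<le> rint (\<lambda>x. ennreal (1 / (1 - q)) * (u x * lint F (1 / x) powe q)) 0"
  unfolding rint_def
 proof (intro nn_integral_mono)
  fix x :: real
  show "?f x * lint k x * indicator {0<..} x \<le> ennreal (1 / (1 - q)) * (u x * lint F (1 / x) powe q) * indicator {0<..} x"
  proof (cases "0 < x")
   case True
   have "lint k x \<le> (\<integral>\<^sup>+z. ennreal (x powr q) * lint F (1 / x) powe q * (ennreal (z powr (- q)) * indicator {0<..<x} z) \<partial>lborel)"
    unfolding lint_def[of k]
   proof (intro nn_integral_mono)
    fix z
    show "k z * indicator {0<..<x} z \<le> ennreal (x powr q) * lint F (1 / x) powe q * (ennreal (z powr (- q)) * indicator {0<..<x} z)"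
    proof (cases "0 < z \<and> z < x")
     case z: True
     have "lint F (1 / z) \<le> ennreal (1 / z / (1 / x)) * lint F (1 / x)"
      using z by (intro lint_doubling anti) (auto simp: divide_left_mono)
     then have "lint F (1 / z) powe q \<le> (ennreal (x / z) * lint F (1 / x)) powe q" using q by (intro powe_mono) auto
     also have "\<dots> = ennreal (x powr q * z powr (- q)) * lint F (1 / x) powe q"
      using q z True by (subst powe_mult) (auto simp: ennreal_powe powr_divide powr_minus_divide)
     also have "ennreal (x powr q * z powr (- q)) = ennreal (x powr q) * ennreal (z powr (- q))" by (rule ennreal_mult) auto
     finally show ?thesis using z by (simp add: k_def mult_ac)
    qed simp
   qed
   also have "\<dots> = ennreal (x powr q) * lint F (1 / x) powe q * lint (\<lambda>z. ennreal (z powr (- q))) x"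
    unfolding lint_def[of "\<lambda>z. ennreal (z powr (- q))"] by (rule nn_integral_cmult) simp
   also have "lint (\<lambda>z. ennreal (z powr (- q))) x = ennreal (x powr (1 - q) / (1 - q))"
    using q True by (subst lint_powr) auto
   finally have "?f x * lint k x \<le> ?f x * (ennreal (x powr q) * lint F (1 / x) powe q * ennreal (x powr (1 - q) / (1 - q)))"
    by (rule mult_left_mono) simp
   also have "\<dots> = ennreal (1 / x) * ennreal (x powr q) * ennreal (x powr (1 - q) / (1 - q)) * (u x * lint F (1 / x) powe q)"
    by (simp only: mult_ac)
   also have "ennreal (1 / x) * ennreal (x powr q) * ennreal (x powr (1 - q) / (1 - q)) = ennreal (1 / x * x powr q * (x powr (1 - q) / (1 - q)))"
    using True q by (subst ennreal_mult, simp, simp, subst ennreal_mult) auto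
   also have "1 / x * x powr q * (x powr (1 - q) / (1 - q)) = 1 / (1 - q)"
   proof -
    have "x powr q * x powr (1 - q) = x" using True by (simp flip: powr_add)
    then show ?thesis using True by (simp add: mult.assoc)
   qed
   finally show ?thesis using True by simp
  qed simp
 qed
 also have "\<dots> = ennreal (1 / (1 - q)) * rint (\<lambda>x. u x * lint F (1 / x) powe q) 0"
  unfolding rint_def mult.assoc by (rule nn_integral_cmult) simp
 finally show ?thesis by (simp add: mult_left_mono mult.assoc)
qed

theorem tail_of_cond_c:
 assumes q: "0 < q" "q < 2" and [measurable]: "u \<in> borel_measurable borel"
  and c: "cond_c q u" and H: "hardy_ineq p q u \<kappa>"
 shows "tail_ineq p q u \<kappa>"
proof -
 define m where "m = max 1 q"
 have rw: "nnl {y<..} (\<lambda>x. u x / ennreal (x powr s)) = rint (\<lambda>x. ennreal (x powr (- s)) * u x) y" if "0 < y" for y s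
  unfolding rint_def
 proof (intro nn_integral_cong)
  fix x
  show "u x / ennreal (x powr s) * indicator {y<..} x = ennreal (x powr (- s)) * u x * indicator {y<..} x"
   using that by (cases "y < x") (auto simp: divide_ennreal_def inverse_ennreal powr_minus mult.commute)
 qed
 obtain \<beta> where \<beta>: "\<beta> < \<top>" and c': "\<And>y. 0 < y \<Longrightarrow> ennreal (y powr (q / 2)) * rint (\<lambda>x. ennreal (x powr (- (q / 2))) * u x) y
   \<le> \<beta> * (lint u y + ennreal (y powr m) * rint (\<lambda>x. ennreal (x powr (- m)) * u x) y)"
  using c unfolding cond_c_def lint_def[symmetric] m_def infinity_ennreal_def by (auto simp: rw)
 have "\<exists>C<\<top>. \<forall>F. admissible F \<longrightarrow> rint (\<lambda>x. rint (\<lambda>t. F t powe 2) (1 / x) powe (q / 2) * (ennreal (x powr (- q / 2)) * u x)) 0 \<le> C * rint (\<lambda>x. u x * lint F (1 / x) powe q) 0"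
 proof (cases "1 \<le> q")
  case True
  then have "m = q" by (simp add: m_def)
  then have "2 powe (1 - q / 2) * (ennreal (2 * 2 powr (q / 2)) * \<beta>) < \<top>" using q \<beta> by (simp add: ennreal_mult_less_top powe_less_top_iff)
  moreover have "ennreal (y powr (q / 2)) * rint (\<lambda>x. ennreal (x powr (- q / 2)) * u x) y
   \<le> \<beta> * (lint u y + ennreal (y powr q) * rint (\<lambda>x. ennreal (x powr (- q)) * u x) y)" if "0 < y" for y
   using c'[OF that] unfolding \<open>m = q\<close> by simp
  ultimately show ?thesis using tail_le_of_cond_c_ge_1[OF _ True q(2) assms(3), of _ \<beta>] by blast
 next
  case False
  then have m: "m = 1" by (simp add: m_def)
  let ?C = "ennreal (1 / (1 - 2 powr (- q / 2))) * (1 + \<beta>) * ennreal (1 / (1 - q))"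
  have C: "?C < \<top>" using \<beta> by (simp add: ennreal_mult_less_top)
  have "ennreal (y powr (q / 2)) * rint (\<lambda>x. ennreal (x powr (- q / 2)) * u x) y \<le> \<beta> * (lint u y + ennreal y * rint (\<lambda>x. ennreal (1 / x) * u x) y)" if y: "0 < y" for y
  proof -
   have "rint (\<lambda>x. ennreal (x powr (- 1)) * u x) y = rint (\<lambda>x. ennreal (1 / x) * u x) y"
    unfolding rint_def using y by (intro nn_integral_cong) (auto simp: indicator_def powr_minus_divide)
   then show ?thesis using c'[OF y] y unfolding m by simp
  qed
  then show ?thesis using C tail_le_of_cond_c_lt_1[OF _ q(1) _ assms(3), of _ \<beta>] False by (intro exI[of _ ?C] conjI allI impI) (blast, meson not_le)
 qed
 then obtain C where C: "C < \<top>" "\<And>F. admissible F \<Longrightarrow> rint (\<lambda>x. rint (\<lambda>t. F t powe 2) (1 / x) powe (q / 2) * (ennreal (x powr (- q / 2)) * u x)) 0 \<le> C * rint (\<lambda>x. u x * lint F (1 / x) powe q) 0"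
  by blast
 obtain C' where C': "C' < \<top>" "\<And>F. admissible F \<Longrightarrow> wnorm p \<kappa> F < \<top> \<Longrightarrow> nnl {0<..} (\<lambda>x. lint F (1 / x) powe q * u x) \<le> C' * wnorm p \<kappa> F powe (q / p)"
  using H unfolding hardy_ineq_def by blast
 show ?thesis
  unfolding tail_ineq_def
 proof (intro exI[of _ "C * C'"] conjI allI impI)
  show "C * C' < \<top>" using C C' by (simp add: ennreal_mult_less_top)
  fix F assume F: "admissible F" "wnorm p \<kappa> F < \<top>"
  note C(2)[OF F(1)]
  also have "rint (\<lambda>x. u x * lint F (1 / x) powe q) 0 \<le> C' * wnorm p \<kappa> F powe (q / p)"
   using C'(2)[OF F] by (simp add: rint_def mult.commute)
  finally show "nnl {0<..} (\<lambda>x. rint (\<lambda>t. F t powe 2) (1 / x) powe (q / 2) * (ennreal (x powr (- q / 2)) * u x)) \<le> C * C' * wnorm p \<kappa> F powe (q / p)"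
   by (simp add: rint_def mult_left_mono mult.assoc)
 qed
qed

lemma cond_c_of_d:
 assumes "cond_d q u" shows "cond_c q u"
proof -
 obtain \<beta> where \<beta>: "\<beta> < \<infinity>" "\<And>y. 0 < y \<Longrightarrow> ennreal (y powr (q / 2)) * nnl {y<..} (\<lambda>x. u x / ennreal (x powr (q / 2))) \<le> \<beta> * nnl {0<..<y} u"
  using assms unfolding cond_d_def B_class_def by blast
 show ?thesis
  unfolding cond_c_def
  by (intro exI[of _ \<beta>] conjI allI impI \<beta>(1) order_trans[OF \<beta>(2)] mult_left_mono) auto
qed

text \<open>Monotonicity of t^(2-q) u gives u(x) \<le> (y/x)^(2-q) u(y) for x > y. The resulting
  power x^(q/2-2) is integrable at infinity as q < 2, whence the constant 1/(1-q/2), and y u(y) is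
  at most the integral of u over (0,y).\<close>

lemma cond_c_of_e:
 assumes e: "cond_e q u" and u: "antimono u" and q: "q < 2"
 shows "cond_c q u"
 unfolding cond_c_def
proof (intro exI[of _ "ennreal (1 / (1 - q / 2))"] conjI allI impI)
 note [measurable] = antimono_borel_measurable[OF u]
 fix y :: real assume y: "0 < y"
 have q1: "1 < q" and anti: "antimono_on {0<..} (\<lambda>t. ennreal (t powr (2 - q)) * u t)"
  using e by (auto simp: cond_e_def)
 have "nnl {y<..} (\<lambda>x. u x / ennreal (x powr (q / 2))) \<le> (\<integral>\<^sup>+x. ennreal (y powr (2 - q)) * u y * (ennreal (x powr (q / 2 - 2)) * indicator {y<..} x) \<partial>lborel)"
 proof (intro nn_integral_mono)
  fix x
  show "u x / ennreal (x powr (q / 2)) * indicator {y<..} x \<le> ennreal (y powr (2 - q)) * u y * (ennreal (x powr (q / 2 - 2)) * indicator {y<..} x)"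
  proof (cases "y < x")
   case True
   then have x: "0 < x" using y by simp
   have "u x / ennreal (x powr (q / 2)) = ennreal (x powr (2 - q)) * u x * ennreal (x powr (q / 2 - 2))"
   proof -
    have "inverse (x powr (q / 2)) = x powr (2 - q) * x powr (q / 2 - 2)" by (simp flip: powr_add powr_minus)
    then have "inverse (ennreal (x powr (q / 2))) = ennreal (x powr (2 - q)) * ennreal (x powr (q / 2 - 2))"
     using x by (simp add: inverse_ennreal ennreal_mult)
    then show ?thesis by (simp add: divide_ennreal_def mult_ac)
   qed
   also have "\<dots> \<le> ennreal (y powr (2 - q)) * u y * ennreal (x powr (q / 2 - 2))"
    using True x y by (intro mult_right_mono monotone_onD[OF anti]) auto
   finally show ?thesis using True by simp
  qed simp
 qed
 also have "\<dots> = ennreal (y powr (2 - q)) * u y * rint (\<lambda>x. ennreal (x powr (q / 2 - 2))) y"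
  unfolding rint_def by (rule nn_integral_cmult) simp
 also have "rint (\<lambda>x. ennreal (x powr (q / 2 - 2))) y = ennreal (y powr (q / 2 - 1) / (1 - q / 2))"
  using q y by (subst rint_powr) auto
 finally have "ennreal (y powr (q / 2)) * nnl {y<..} (\<lambda>x. u x / ennreal (x powr (q / 2)))
  \<le> ennreal (y powr (q / 2)) * (ennreal (y powr (2 - q)) * u y * ennreal (y powr (q / 2 - 1) / (1 - q / 2)))"
  by (rule mult_left_mono) simp
 also have "\<dots> = ennreal (1 / (1 - q / 2)) * (ennreal y * u y)"
 proof -
  have "y powr (q / 2) * y powr (2 - q) * y powr (q / 2 - 1) = y" using y by (simp flip: powr_add)
  then have "y powr (q / 2) * y powr (2 - q) * (y powr (q / 2 - 1) / (1 - q / 2)) = 1 / (1 - q / 2) * y" by simp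
  then have E: "ennreal (y powr (q / 2)) * ennreal (y powr (2 - q)) * ennreal (y powr (q / 2 - 1) / (1 - q / 2)) = ennreal (1 / (1 - q / 2)) * ennreal y"
   using q y by (simp flip: ennreal_mult)
  have "ennreal (y powr (q / 2)) * (ennreal (y powr (2 - q)) * u y * ennreal (y powr (q / 2 - 1) / (1 - q / 2)))
   = ennreal (y powr (q / 2)) * ennreal (y powr (2 - q)) * ennreal (y powr (q / 2 - 1) / (1 - q / 2)) * u y"
   by (simp only: mult_ac)
  then show ?thesis unfolding E by (simp only: mult_ac)
 qed
 also have "ennreal y * u y \<le> lint u y" by (intro lint_ge u y)
 also have "lint u y \<le> lint u y + ennreal (y powr max 1 q) * nnl {y<..} (\<lambda>x. u x / ennreal (x powr max 1 q))" by simp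
 finally show "ennreal (y powr (q / 2)) * nnl {y<..} (\<lambda>x. u x / ennreal (x powr (q / 2)))
  \<le> ennreal (1 / (1 - q / 2)) * (nnl {0<..<y} u + ennreal (y powr max 1 q) * nnl {y<..} (\<lambda>x. u x / ennreal (x powr max 1 q)))"
  by (simp add: lint_def mult_left_mono)
qed simp

section \<open>Duality and the main theorem\<close>

text \<open>An integration by parts in the form of inequalities:
  \<open>emeasure_Ioc_power_le\<close> bounds the power r/q of \<open>lint u\<close> by a multiple
  of the integral of a, the integral of b is at most the power r/p' of \<open>lint v\<close> because
  r/q' + 1 = r/p', and Tonelli links the two.\<close>

lemma mh_cond_dual:
 assumes q: "1 < q" "q < p" and p: "1 < p" "1 / p + 1 / p' = 1" and q': "1 / q + 1 / q' = 1" and r: "1 / r = 1 / q - 1 / p"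
  and [measurable]: "u \<in> borel_measurable borel" "v \<in> borel_measurable borel"
  and mh: "mh_cond p p' r u v"
 shows "mh_cond q' q r v u"
proof -
 have q0: "0 < q" using q by simp
 note ei = exponent_identities[OF q0 q(2) r]
 have p'1: "1 < p'" and q'1: "1 < q'" using conjugate_gt_1[OF p] conjugate_gt_1[OF q(1) q'] .
 have e: "r / q' + 1 = r / p'"
 proof -
  have d: "1 / p' - 1 / q' = 1 / r" using r p(2) q' by linarith
  have "r * (1 / p') - r * (1 / q') = r * (1 / r)" unfolding d[symmetric] by (simp only: right_diff_distrib)
  then show ?thesis using ei(1) by simp
 qed
 have s: "0 < r / p" "0 < r / q'" using ei(1) p q'1 by auto
 define a where "a x = lint u x powe (r / p) * u x" for x
 define b where "b t = lint v t powe (r / q') * v t" for t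
 have [measurable]: "a \<in> borel_measurable borel" "b \<in> borel_measurable borel"
  unfolding a_def[abs_def] b_def[abs_def] by measurable
 let ?C = "ennreal (2 powr (r / p + 1))"
 have U: "lint u y powe (r / q) \<le> ?C * lint a y" for y
 proof -
  define \<mu> where "\<mu> = density lborel (\<lambda>x. u x * indicator {0<..} x)"
  have em: "emeasure \<mu> {0<..x} = lint u x" for x
  proof -
   have "emeasure \<mu> {0<..x} = nnl {0<..x} u"
    unfolding \<mu>_def by (subst emeasure_density) (auto intro!: nn_integral_cong simp: indicator_def)
   then show ?thesis by (simp add: lint_eq_Ioc)
  qed
  have "emeasure \<mu> {0<..y} powe (r / p + 1) \<le> ?C * (\<integral>\<^sup>+x\<in>{0<..y}. emeasure \<mu> {0<..x} powe (r / p) \<partial>\<mu>)"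
   by (rule emeasure_Ioc_power_le) (use s in \<open>auto simp: \<mu>_def\<close>)
  also have "(\<integral>\<^sup>+x\<in>{0<..y}. emeasure \<mu> {0<..x} powe (r / p) \<partial>\<mu>) = nnl {0<..y} a"
   unfolding em unfolding \<mu>_def a_def
   by (subst nn_integral_density) (auto intro!: nn_integral_cong simp: indicator_def mult.commute)
  finally show ?thesis unfolding em ei(3) by (simp add: lint_eq_Ioc)
 qed
 have V: "lint b s \<le> lint v s powe (r / p')" for s
 proof -
  have "lint b s \<le> (\<integral>\<^sup>+t. lint v s powe (r / q') * (v t * indicator {0<..<s} t) \<partial>lborel)"
   unfolding lint_def[of b] b_def
  proof (intro nn_integral_mono)
   fix t
   show "lint v t powe (r / q') * v t * indicator {0<..<s} t \<le> lint v s powe (r / q') * (v t * indicator {0<..<s} t)"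
    using powe_mono[OF _ lint_mono[of t s v], of "r / q'"] s by (auto simp: indicator_def intro: mult_right_mono)
  qed
  also have "\<dots> = lint v s powe (r / q') * lint v s" unfolding lint_def[of v] by (rule nn_integral_cmult) simp
  also have "\<dots> = lint v s powe (r / p')" unfolding e[symmetric] using s by (subst powe_add) auto
  finally show ?thesis .
 qed
 have "nnl {0<..} (\<lambda>x. lint v x powe (r / q') * lint u (1 / x) powe (r / q) * v x) \<le> (\<integral>\<^sup>+x. ?C * (b x * lint a (1 / x) * indicator {0<..} x) \<partial>lborel)"
 proof (intro nn_integral_mono)
  fix x
  have "b x * lint u (1 / x) powe (r / q) * indicator {0<..} x \<le> b x * (?C * lint a (1 / x)) * indicator {0<..} x"
   by (intro mult_right_mono mult_left_mono U) auto
  then show "lint v x powe (r / q') * lint u (1 / x) powe (r / q) * v x * indicator {0<..} x \<le> ?C * (b x * lint a (1 / x) * indicator {0<..} x)"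
   by (simp only: b_def mult_ac)
 qed
 also have "\<dots> = ?C * rint (\<lambda>x. b x * lint a (1 / x)) 0" unfolding rint_def by (rule nn_integral_cmult) simp
 also have "rint (\<lambda>x. b x * lint a (1 / x)) 0 = rint (\<lambda>x. a x * lint b (1 / x)) 0" by (rule lint_swap) auto
 also have "\<dots> \<le> rint (\<lambda>x. lint u x powe (r / p) * lint v (1 / x) powe (r / p') * u x) 0"
  unfolding rint_def
 proof (intro nn_integral_mono mult_right_mono)
  fix x
  have "a x * lint b (1 / x) \<le> a x * lint v (1 / x) powe (r / p')" by (intro mult_left_mono V) simp
  then show "a x * lint b (1 / x) \<le> lint u x powe (r / p) * lint v (1 / x) powe (r / p') * u x" by (simp only: a_def mult_ac)
 qed simp
 also have "?C * \<dots> < \<top>" using mh by (simp add: mh_cond_def rint_def ennreal_mult_less_top)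
 finally show ?thesis unfolding mh_cond_def by (simp add: mult_left_mono)
qed

text \<open>An infinite value at t > 0 is taken on all of (0,t], so every integral of that weight
  from 0 is infinite. As the other weight does not vanish identically, the integrand of (MH) would
  be infinite on an interval next to 0.\<close>

lemma mh_cond_finite:
 assumes e: "0 < r / p" "0 < r / p'" and u: "antimono u" and v: "antimono v" and mh: "mh_cond p p' r u v"
  and a: "0 < a" "u a \<noteq> 0" and b: "0 < b" "v b \<noteq> 0" and t: "0 < t"
 shows "u t < \<top>" "v t < \<top>"
proof -
 have pos: "lint f x \<noteq> 0" if "antimono f" "0 < c" "f c \<noteq> 0" "0 < x" for f :: "real \<Rightarrow> ennreal" and c x
 proof -
  have "f c \<le> f (min x c)" by (rule antimonoD[OF that(1)]) simp
  then have "ennreal (min x c) * f (min x c) \<noteq> 0" using that by (auto simp: ennreal_eq_0_iff)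
  moreover have "ennreal (min x c) * f (min x c) \<le> lint f (min x c)" using that by (intro lint_ge) auto
  moreover have "lint f (min x c) \<le> lint f x" by (intro lint_mono) simp
  ultimately show ?thesis by auto
 qed
 have inf: "lint f x = \<top>" if "antimono f" "f t = \<top>" "0 < x" for f :: "real \<Rightarrow> ennreal" and x
 proof -
  have "f t \<le> f (min x t)" by (rule antimonoD[OF that(1)]) simp
  then have "ennreal (min x t) * f (min x t) = \<top>" using that t by (auto simp: top_unique ennreal_mult_eq_top_iff ennreal_eq_0_iff)
  moreover have "ennreal (min x t) * f (min x t) \<le> lint f (min x t)" using that t by (intro lint_ge) auto
  moreover have "lint f (min x t) \<le> lint f x" by (intro lint_mono) simp
  ultimately show ?thesis by (simp add: top_unique)
 qed
 have False if top: "u t = \<top> \<or> v t = \<top>"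
 proof -
  define c where "c = min a t"
  have c: "0 < c" using a t by (simp add: c_def)
  have "(\<integral>\<^sup>+x\<in>{0<..<c}. \<top> \<partial>(lborel :: real measure)) \<le> nnl {0<..} (\<lambda>x. lint u x powe (r / p) * lint v (1 / x) powe (r / p') * u x)"
  proof (intro nn_integral_mono)
   fix x :: real
   show "\<top> * indicator {0<..<c} x \<le> lint u x powe (r / p) * lint v (1 / x) powe (r / p') * u x * indicator {0<..} x"
   proof (cases "0 < x \<and> x < c")
    case True
    then have x: "0 < x" "0 < 1 / x" "x \<le> a" "x \<le> t" by (auto simp: c_def)
    have A: "lint u x powe (r / p) \<noteq> 0" "lint v (1 / x) powe (r / p') \<noteq> 0"
     using pos[OF u a x(1)] pos[OF v b x(2)] e by (auto simp: powe_eq_0_iff)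
    have ux: "u a \<le> u x" "u t \<le> u x" using antimonoD[OF u] x by auto
    have "lint u x powe (r / p) * lint v (1 / x) powe (r / p') * u x = \<top>"
    proof (cases "u t = \<top>")
     case True
     then have "u x = \<top>" using ux by (simp add: top_unique)
     then show ?thesis using A by (simp add: ennreal_mult_eq_top_iff)
    next
     case False
     then have "lint v (1 / x) powe (r / p') = \<top>" using top inf[OF v _ x(2)] e by (simp add: powe_eq_top_iff)
     moreover have "u x \<noteq> 0" using ux a by auto
     ultimately show ?thesis using A by (simp add: ennreal_mult_eq_top_iff)
    qed
    then show ?thesis using True by simp
   qed simp
  qed
  moreover have "(\<integral>\<^sup>+x\<in>{0<..<c}. \<top> \<partial>(lborel :: real measure)) = \<top>"
   using c by (subst nn_integral_cmult_indicator) (auto simp: ennreal_top_mult ennreal_eq_0_iff)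
  ultimately show False using mh by (simp add: mh_cond_def top_unique)
 qed
 then show "u t < \<top>" "v t < \<top>" using less_top by blast+
qed

text \<open>The set where g is infinite lies in each set where g exceeds \<gamma> \<epsilon>, whose
  measure is at most \<epsilon>.\<close>

lemma is_rearrangement_AE_less_top:
 assumes g: "is_rearrangement M g \<gamma>" and [measurable]: "g \<in> borel_measurable M"
  and fin: "\<And>t. 0 < t \<Longrightarrow> \<gamma> t < \<top>"
 shows "AE x in M. g x < \<top>"
proof -
 have "emeasure M {x \<in> space M. g x = \<top>} \<le> 0"
 proof (rule ennreal_le_epsilon)
  fix \<epsilon> :: real assume e: "0 < \<epsilon>"
  have "emeasure M {x \<in> space M. g x = \<top>} \<le> emeasure M {x \<in> space M. \<gamma> \<epsilon> < g x}"
   using fin[OF e] by (intro emeasure_mono) auto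
  also have "\<dots> = emeasure lborel {t. 0 < t \<and> \<gamma> \<epsilon> < \<gamma> t}" by (rule is_rearrangementD(3)[OF g, symmetric])
  also have "\<dots> \<le> emeasure lborel {0<..<\<epsilon>}"
  proof (intro emeasure_mono subsetI)
   fix t assume "t \<in> {t. 0 < t \<and> \<gamma> \<epsilon> < \<gamma> t}"
   then have "0 < t" "\<not> \<epsilon> \<le> t" using antimonoD[OF is_rearrangementD(1)[OF g], of \<epsilon> t] by auto
   then show "t \<in> {0<..<\<epsilon>}" by simp
  qed simp
  also have "\<dots> = ennreal \<epsilon>" using e by simp
  finally show "emeasure M {x \<in> space M. g x = \<top>} \<le> 0 + ennreal \<epsilon>" by simp
 qed
 then have "AE x in M. \<not> g x = \<top>" by (subst AE_iff_measurable[OF _ refl]) auto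
 then show ?thesis by eventually_elim (simp add: less_top)
qed

lemma is_rearrangement_AE_zero:
 assumes g: "is_rearrangement M g \<gamma>" and [measurable]: "g \<in> borel_measurable M"
  and z: "\<And>t. 0 < t \<Longrightarrow> \<gamma> t = 0"
 shows "AE x in M. g x = 0"
proof -
 have E: "{t. 0 < t \<and> 0 < \<gamma> t} = {}" using z by auto
 have "emeasure M {x \<in> space M. g x \<noteq> 0} = 0"
  using is_rearrangementD(3)[OF g, of 0] unfolding E by (simp add: zero_less_iff_neq_zero)
 then show ?thesis by (subst AE_iff_measurable[OF _ refl]) auto
qed

section \<open>Degenerate weights\<close>

lemma fourier_ineq_zero:
 fixes U W :: "real ^ 'n \<Rightarrow> ennreal"
 assumes q: "0 < q" and U: "AE x in lebesgue. U x = 0"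
 shows "fourier_ineq p q U W"
 unfolding fourier_ineq_def
proof (intro exI[of _ 1] conjI allI impI)
 fix f :: "real ^ 'n \<Rightarrow> complex"
 have "(\<integral>\<^sup>+y. ennreal (norm (fourier f y) powr q) * U y \<partial>lebesgue) = (\<integral>\<^sup>+y. 0 \<partial>(lebesgue :: (real ^ 'n) measure))"
  by (rule nn_integral_cong_AE) (use U in eventually_elim, simp)
 then show "(\<integral>\<^sup>+y. ennreal (norm (fourier f y) powr q) * U y \<partial>lebesgue) powe (1 / q) \<le> 1 * (\<integral>\<^sup>+x. ennreal (norm (f x) powr p) * W x \<partial>lebesgue) powe (1 / p)"
  using q by simp
qed simp

text \<open>The right side is infinite unless f vanishes almost everywhere.\<close>

lemma fourier_ineq_top:
 fixes U W :: "real ^ 'n \<Rightarrow> ennreal"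
 assumes pq: "0 < p" "0 < q" and [measurable]: "W \<in> borel_measurable lebesgue" and W: "AE x in lebesgue. W x = \<top>"
 shows "fourier_ineq p q U W"
 unfolding fourier_ineq_def
proof (intro exI[of _ 1] conjI allI impI)
 fix f :: "real ^ 'n \<Rightarrow> complex" assume f: "integrable lebesgue f"
 note [measurable] = borel_measurable_integrable[OF f]
 show "(\<integral>\<^sup>+y. ennreal (norm (fourier f y) powr q) * U y \<partial>lebesgue) powe (1 / q) \<le> 1 * (\<integral>\<^sup>+x. ennreal (norm (f x) powr p) * W x \<partial>lebesgue) powe (1 / p)"
 proof (cases "(\<integral>\<^sup>+x. ennreal (norm (f x) powr p) * W x \<partial>lebesgue) = \<top>")
  case True
  then show ?thesis using pq by (simp add: powe_eq_top_iff[THEN iffD2])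
 next
  case False
  then have "AE x in lebesgue. ennreal (norm (f x) powr p) * W x \<noteq> \<infinity>" by (intro nn_integral_PInf_AE) auto
  with W have f0: "AE x in lebesgue. f x = 0"
   by eventually_elim (auto simp: ennreal_mult_top ennreal_eq_0_iff split: if_splits)
  have "fourier f y = 0" for y
   unfolding fourier_def by (intro integral_eq_zero_AE) (use f0 in eventually_elim, simp)
  then show ?thesis using pq by simp
 qed
qed simp

section \<open>Independence of the values of the weights outside the half-line\<close>

lemma nn_integral_pos_cong:
 "(\<And>t. 0 < t \<Longrightarrow> f t = g t) \<Longrightarrow> A \<subseteq> {0<..} \<Longrightarrow> (\<integral>\<^sup>+t\<in>A. f t \<partial>lborel) = (\<integral>\<^sup>+t\<in>A. g t \<partial>(lborel :: real measure))"
 by (intro nn_integral_cong) (auto simp: indicator_def)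

lemma inverse_less_pos: "0 < (a :: real) \<Longrightarrow> 1 / a < t \<Longrightarrow> 0 < t"
 by (meson less_trans zero_less_divide_1_iff)

lemma cond_MH_imp:
 assumes u: "\<And>t. 0 < t \<Longrightarrow> u t = u' t" and v: "\<And>t. 0 < t \<Longrightarrow> w t powe (1 - p') = v t" and r: "0 < r"
  and "cond_MH p p' r u w"
 shows "mh_cond p p' r u' v"
proof -
 have "nnl {0<..} (\<lambda>x. nnl {0<..<x} u powe (r / p) * nnl {0<..<1 / x} (\<lambda>t. w t powe (1 - p')) powe (r / p') * u x)
  = nnl {0<..} (\<lambda>x. lint u' x powe (r / p) * lint v (1 / x) powe (r / p') * u' x)"
  unfolding lint_def
  by (intro nn_integral_pos_cong arg_cong2[where f = "(*) :: ennreal \<Rightarrow> _"] arg_cong2[where f = "(powe)"] refl u v) auto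
 then show ?thesis using assms(4) r unfolding cond_MH_def mh_cond_def by (simp add: powe_less_top_iff)
qed

lemma cond_BHJH_imp:
 assumes u: "\<And>t. 0 < t \<Longrightarrow> u t = u' t" and v: "\<And>t. 0 < t \<Longrightarrow> w t powe (1 - p') = v t" and r: "0 < r"
  and "cond_BHJH p p' q r u w"
 shows "bhjh_cond p p' q r u' v"
proof -
 have "nnl {0<..} (\<lambda>x. nnl {x<..} (\<lambda>t. ennreal (t powr (- q / 2)) * u t) powe (r / p) *
    nnl {1 / x<..} (\<lambda>t. ennreal (t powr (- p' / 2)) * w t powe (1 - p')) powe (r / p') * ennreal (x powr (- q / 2)) * u x)
  = nnl {0<..} (\<lambda>x. nnl {x<..} (\<lambda>t. ennreal (t powr (- q / 2)) * u' t) powe (r / p) *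
    nnl {1 / x<..} (\<lambda>t. ennreal (t powr (- p' / 2)) * v t) powe (r / p') * ennreal (x powr (- q / 2)) * u' x)"
  by (intro nn_integral_pos_cong arg_cong2[where f = "(*) :: ennreal \<Rightarrow> _"] arg_cong2[where f = "(powe)"] refl u v)
    (auto intro: inverse_less_pos less_trans)
 then show ?thesis using assms(4) r unfolding cond_BHJH_def bhjh_cond_def rint_def by (simp add: powe_less_top_iff mult.assoc)
qed

lemma cond_NH_cong:
 assumes u: "\<And>t. 0 < t \<Longrightarrow> u t = u' t" and w: "\<And>t. 0 < t \<Longrightarrow> w t = w' t"
 shows "cond_NH p q r u w = cond_NH p q r u' w'"
proof -
 have "nnl {0<..} (\<lambda>x. nnl {1 / x<..} (\<lambda>t. (ennreal (1 / (t - 1 / x)) * nnl {0<..<t} w) powe (- p / (p - 2)) * w t) powe ((r / 2) * (p - 2) / p) *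
    nnl {x<..} (\<lambda>t. ennreal (t powr (- q / 2)) * u t) powe (r / p) * ennreal (x powr (- q / 2)) * u x)
  = nnl {0<..} (\<lambda>x. nnl {1 / x<..} (\<lambda>t. (ennreal (1 / (t - 1 / x)) * nnl {0<..<t} w') powe (- p / (p - 2)) * w' t) powe ((r / 2) * (p - 2) / p) *
    nnl {x<..} (\<lambda>t. ennreal (t powr (- q / 2)) * u' t) powe (r / p) * ennreal (x powr (- q / 2)) * u' x)"
  by (intro nn_integral_pos_cong arg_cong2[where f = "(*) :: ennreal \<Rightarrow> _"] arg_cong2[where f = "(powe)"] refl u w)
    (auto intro: inverse_less_pos less_trans)
 then show ?thesis unfolding cond_NH_def by simp
qed

lemma cond_SEQ_cong:
 assumes u: "\<And>t. 0 < t \<Longrightarrow> u t = u' t" and w: "\<And>t. 0 < t \<Longrightarrow> w t = w' t"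
 shows "cond_SEQ p q r u w = cond_SEQ p q r u' w'"
 unfolding cond_SEQ_def
 by (intro arg_cong2[where f = "(<) :: ennreal \<Rightarrow> _"] SUP_cong arg_cong2[where f = "(powe)"] infsum_cong arg_cong2[where f = "(*) :: ennreal \<Rightarrow> _"]
    arg_cong2[where f = "(/) :: ennreal \<Rightarrow> _"] nn_integral_pos_cong refl u w)
   (auto intro: inverse_less_pos)

lemma cond_c_cong:
 assumes u: "\<And>t. 0 < t \<Longrightarrow> u t = u' t"
 shows "cond_c q u = cond_c q u'"
proof -
 have "nnl {y<..} (\<lambda>x. u x / ennreal (x powr s)) = nnl {y<..} (\<lambda>x. u' x / ennreal (x powr s))" if "0 < y" for y s
  using that by (intro nn_integral_pos_cong arg_cong2[where f = "(/) :: ennreal \<Rightarrow> _"] refl u) auto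
 moreover have "nnl {0<..<y} u = nnl {0<..<y} u'" for y
  by (intro nn_integral_pos_cong u) auto
 ultimately show ?thesis unfolding cond_c_def by simp
qed

lemma cond_e_cong: "(\<And>t. 0 < t \<Longrightarrow> u t = u' t) \<Longrightarrow> cond_e q u = cond_e q u'"
 unfolding cond_e_def monotone_on_def by simp

text \<open>If u or \<kappa> vanishes on the half-line, then U = 0 or W = \<infinity> almost
  everywhere and the inequality is trivial. Otherwise (MH) makes both finite, and
  \<open>tail\<close> offers two routes: the inequality itself, or its dual with exponents q' and
  p', where q \<ge> 2 is replaced by p' \<ge> 2 and the tail inequality comes from (c) for
  w^(1-p').\<close>

lemma fourier_ineq_of_mh_cond:
 fixes U W :: "real ^ 'n \<Rightarrow> ennreal"
 assumes q: "0 < q" "q < p" and p: "1 < p" "1 / p + 1 / p' = 1" and r: "1 / r = 1 / q - 1 / p"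
  and meas [measurable]: "U \<in> borel_measurable lebesgue" "W \<in> borel_measurable lebesgue"
  and u: "is_rearrangement lebesgue U u"
  and \<kappa>: "is_rearrangement lebesgue (\<lambda>x. inverse (W x)) \<kappa>"
  and mh: "mh_cond p p' r u (\<lambda>t. \<kappa> t powe (p' - 1))"
  and tail: "(\<And>t. 0 < t \<Longrightarrow> \<kappa> t < \<top>) \<Longrightarrow> hardy_ineq p q u \<kappa> \<Longrightarrow>
   (2 \<le> q \<or> tail_ineq p q u \<kappa>) \<or> 1 < q \<and> (2 \<le> p' \<or> cond_c p' (\<lambda>t. \<kappa> t powe (p' - 1)))"
 shows "fourier_ineq p q U W"
proof -
 define v where "v t = \<kappa> t powe (p' - 1)" for t
 have p': "1 < p'" by (rule conjugate_gt_1[OF p])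
 have p0: "0 < p" using p by simp
 note ei = exponent_identities[OF q r]
 have v: "is_rearrangement lebesgue (\<lambda>x. inverse (W x) powe (p' - 1)) v"
  unfolding v_def using p' by (intro is_rearrangement_powe \<kappa>) auto
 note [measurable] = is_rearrangementD(2)[OF u] is_rearrangementD(2)[OF \<kappa>] is_rearrangementD(2)[OF v]
 consider "\<forall>t>0. u t = 0" | "\<forall>t>0. \<kappa> t = 0" | a b where "0 < a" "u a \<noteq> 0" "0 < b" "\<kappa> b \<noteq> 0" by blast
 then show ?thesis
 proof cases
  case 1
  then show ?thesis by (intro fourier_ineq_zero q is_rearrangement_AE_zero[OF u]) auto
 next
  case 2
  then have "AE x in lebesgue. inverse (W x) = 0" by (intro is_rearrangement_AE_zero[OF \<kappa>]) auto
  then show ?thesis by (intro fourier_ineq_top p0 q) auto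
 next
  case 3
  have vb: "v b \<noteq> 0" using 3 p' by (simp add: v_def powe_eq_0_iff)
  have fin: "u t < \<top>" "v t < \<top>" if "0 < t" for t
   using mh_cond_finite[OF _ _ is_rearrangementD(1)[OF u] is_rearrangementD(1)[OF v] mh[folded v_def] 3(1,2,3) vb that] ei(1) p0 p' by auto
  have \<kappa>fin: "\<kappa> t < \<top>" if "0 < t" for t using fin(2)[OF that] p' by (simp add: v_def powe_less_top_iff)
  have hardy: "hardy_ineq p q u \<kappa>" by (rule hardy_of_mh_cond[OF q p r _ _ \<kappa>fin mh]) auto
  show ?thesis
  proof (cases "2 \<le> q \<or> tail_ineq p q u \<kappa>")
   case True
   show ?thesis by (rule fourier_ineq_of_hardy[OF p0 q(1) meas u \<kappa> hardy True])
  next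
   case False
   then have q1: "1 < q" and c: "2 \<le> p' \<or> cond_c p' v" using tail[OF \<kappa>fin hardy] unfolding v_def[abs_def] by auto
   define q' where "q' = q / (q - 1)"
   have q': "1 / q + 1 / q' = 1" "1 / q' + 1 / q = 1" "(q' - 1) * (q - 1) = 1" using q1 by (auto simp: q'_def field_simps)
   have q'1: "1 < q'" by (rule conjugate_gt_1[OF q1 q'(1)])
   have "1 / q' < 1 / p'" using p(2) q'(1) q q1 frac_less2[of 1 1 q p] by linarith
   then have pq': "0 < p'" "p' < q'" using p' q'1 by (auto simp: field_simps)
   have r': "1 / r = 1 / p' - 1 / q'" using r p(2) q'(1) by linarith
   \<comment> \<open>In the dual inequality \<theta> plays the role of \<kappa>; \<theta>^(q-1) = u
     because (q'-1)(q-1) = 1, so the dual (MH) is the original one with u and v exchanged.\<close>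
   define \<theta> where "\<theta> t = u t powe (q' - 1)" for t
   have L: "is_rearrangement lebesgue (\<lambda>x. inverse (inverse (U x powe (q' - 1)))) \<theta>"
    unfolding \<theta>_def ennreal_inverse_inverse using q'1 by (intro is_rearrangement_powe u) auto
   note [measurable] = is_rearrangementD(2)[OF L]
   have "mh_cond q' q r v u" by (rule mh_cond_dual[OF q1 q(2) p q'(1) r _ _ mh[folded v_def]]) auto
   moreover have "(\<lambda>t. \<theta> t powe (q - 1)) = u" unfolding \<theta>_def powe_powe q'(3) by simp
   ultimately have mh': "mh_cond q' q r v (\<lambda>t. \<theta> t powe (q - 1))" by simp
   have Lfin: "\<theta> t < \<top>" if "0 < t" for t using fin(1)[OF that] q'1 by (simp add: \<theta>_def powe_less_top_iff)
   have hardy': "hardy_ineq q' p' v \<theta>" by (rule hardy_of_mh_cond[OF pq' q'1 q'(2) r' _ _ Lfin mh']) auto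
   have tail': "2 \<le> p' \<or> tail_ineq q' p' v \<theta>"
   proof (cases "2 \<le> p'")
    case False
    then show ?thesis using c tail_of_cond_c[OF pq'(1) _ _ _ hardy'] by auto
   qed simp
   have "fourier_ineq q' p' (\<lambda>x. inverse (W x) powe (p' - 1)) (\<lambda>x. inverse (U x powe (q' - 1)))"
    by (rule fourier_ineq_of_hardy[OF _ _ _ _ v L hardy' tail']) (use q'1 pq' in auto)
   moreover have "AE x in lebesgue. U x < \<top>" using fin by (intro is_rearrangement_AE_less_top[OF u]) auto
   moreover have "AE x in lebesgue. W x \<noteq> 0"
   proof -
    have "AE x in lebesgue. inverse (W x) < \<top>" using \<kappa>fin by (intro is_rearrangement_AE_less_top[OF \<kappa>]) auto
    then show ?thesis by eventually_elim auto
   qed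
   ultimately show ?thesis by (intro fourier_ineq_dual[OF p q1 q'(1) meas]) auto
  qed
 qed
qed

theorem theorem3p4:
  fixes p q p' r :: real
    and U W :: "real ^ 'n \<Rightarrow> ennreal"
    and u w :: "real \<Rightarrow> ennreal"
  assumes "0 < q" "q < p" "1 < p"
    and "1 / p + 1 / p' = 1"
    and "1 / r = 1 / q - 1 / p"
    and "U \<in> borel_measurable lebesgue" "W \<in> borel_measurable lebesgue"
    and "\<And>t. t > 0 \<Longrightarrow> u t = rearrangement lebesgue U t"
    and "\<And>t. t > 0 \<Longrightarrow> 1 / w t = rearrangement lebesgue (\<lambda>x. 1 / W x) t"
    and "cond_MH p p' r u w"
    and "(2 \<le> q \<and> q < p \<or> 1 < q \<and> q < p \<and> p \<le> 2)
       \<or> (1 < q \<and> q < 2 \<and> 2 < p \<and>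
            ((cond_c q u \<or> cond_d q u \<or> cond_e q u \<or> cond_f p' q w \<or> cond_g p' q w \<or> cond_h p' q w)
             \<or> cond_BHJH p p' q r u w
             \<or> (cond_SEQ p q r u w \<and> cond_NH p q r u w)))
       \<or> (0 < q \<and> q < 1 \<and> 1 < p \<and>
            ((cond_c q u \<or> cond_d q u)
             \<or> cond_BHJH p p' q r u w
             \<or> (p \<le> 2 \<and> cond_SEQ p q r u w)
             \<or> (p > 2 \<and> cond_SEQ p q r u w \<and> cond_NH p q r u w)))"
  shows "\<exists>C<\<infinity>. \<forall>f :: real ^ 'n \<Rightarrow> complex. integrable lebesgue f \<longrightarrow>
           (\<integral>\<^sup>+y. ennreal (norm (fourier f y) powr q) * U y \<partial>lebesgue) powe (1 / q)
             \<le> C * (\<integral>\<^sup>+x. ennreal (norm (f x) powr p) * W x \<partial>lebesgue) powe (1 / p)"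
proof -
 define u0 where "u0 = rearrangement lebesgue U"
 define \<kappa> where "\<kappa> = rearrangement lebesgue (\<lambda>x. inverse (W x))"
 note q = assms(1,2) and p = assms(3,4) and r = assms(5)
 note [measurable] = assms(6,7)
 note ei = exponent_identities[OF q r]
 have p': "1 < p'" by (rule conjugate_gt_1[OF p])
 have R: "is_rearrangement lebesgue U u0" "is_rearrangement lebesgue (\<lambda>x. inverse (W x)) \<kappa>"
  unfolding u0_def \<kappa>_def by (auto intro!: is_rearrangement_rearrangement)
 note [measurable] = is_rearrangementD(2)[OF R(1)] is_rearrangementD(2)[OF R(2)]
 have u: "u t = u0 t" if "0 < t" for t using assms(8)[OF that] by (simp add: u0_def)
 have w: "w t = inverse (\<kappa> t)" if "0 < t" for t
 proof -
  have "inverse (w t) = \<kappa> t" using assms(9)[OF that] by (simp add: \<kappa>_def divide_ennreal_def)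
  then show ?thesis by (metis ennreal_inverse_inverse)
 qed
 define v where "v t = \<kappa> t powe (p' - 1)" for t
 have v: "w t powe (1 - p') = v t" if "0 < t" for t
  unfolding w[OF that] v_def inverse_powe powe_minus[symmetric] by simp
 have v_anti: "antimono v"
  unfolding v_def using p' by (intro antimonoI powe_mono antimonoD[OF is_rearrangementD(1)[OF R(2)]]) auto
 \<comment> \<open>(f), (g), (h) are (c), (d), (e) for the exponent p' and the weight w^(1-p'),
   where max 1 p' = p'.\<close>
 have dual: "cond_c p' v" if "cond_f p' q w \<or> cond_g p' q w \<or> cond_h p' q w" "p' < 2"
 proof -
  have "cond_c p' v" if "cond_c p' (\<lambda>t. w t powe (1 - p'))"
   using that cond_c_cong[of "\<lambda>t. w t powe (1 - p')" v p'] v by blast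
  moreover have "cond_c p' v" if "cond_e p' (\<lambda>t. w t powe (1 - p'))"
   using that cond_e_cong[of "\<lambda>t. w t powe (1 - p')" v p'] v cond_c_of_e[OF _ v_anti \<open>p' < 2\<close>] by blast
  ultimately show ?thesis
   using that(1) p' cond_c_of_d[of p' "\<lambda>t. w t powe (1 - p')"]
   unfolding cond_f_def cond_g_def cond_h_def cond_c_def[of p' "\<lambda>t. w t powe (1 - p')"]
    cond_d_def[of p' "\<lambda>t. w t powe (1 - p')"] cond_e_def[of p' "\<lambda>t. w t powe (1 - p')"]
   by (auto simp: max_absorb2)
 qed
 have "fourier_ineq p q U W"
 proof (rule fourier_ineq_of_mh_cond[OF q p r assms(6,7) R])
  show "mh_cond p p' r u0 (\<lambda>t. \<kappa> t powe (p' - 1))"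
   using cond_MH_imp[OF u v ei(1) assms(10)] by (simp add: v_def[abs_def])
  assume \<kappa>fin: "\<And>t. 0 < t \<Longrightarrow> \<kappa> t < \<top>" and hardy: "hardy_ineq p q u0 \<kappa>"
  have c: "tail_ineq p q u0 \<kappa>" if "cond_c q u \<or> cond_d q u \<or> cond_e q u" "q < 2"
  proof -
   have "cond_c q u0"
    using that cond_c_of_d[of q u] cond_c_cong[of u u0 q] cond_e_cong[of u u0 q] u
     cond_c_of_e[of q u0, OF _ is_rearrangementD(1)[OF R(1)]] by blast
   then show ?thesis by (intro tail_of_cond_c[OF q(1) that(2) _ _ hardy]) auto
  qed
  have bh: "tail_ineq p q u0 \<kappa>" if "cond_BHJH p p' q r u w"
   using cond_BHJH_imp[OF u v ei(1) that]
   by (intro tail_of_bhjh_cond[OF q p r _ _ \<kappa>fin _ hardy]) (auto simp: v_def[abs_def])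
  have sq: "\<exists>B<\<top>. seq_bound (umeas q u0) (lint (\<lambda>t. inverse (\<kappa> t))) p q r B" if "cond_SEQ p q r u w"
  proof -
   have "cond_SEQ p q r u0 (\<lambda>t. inverse (\<kappa> t))" using that cond_SEQ_cong[of u u0 w "\<lambda>t. inverse (\<kappa> t)"] u w by blast
   from seq_bound_of_cond_SEQ[OF q r _ this] show ?thesis by (metis is_rearrangementD(2)[OF R(1)])
  qed
  have sq1: "tail_ineq p q u0 \<kappa>" if s: "cond_SEQ p q r u w" and "p \<le> 2"
  proof -
   obtain B where B: "B < \<top>" "seq_bound (umeas q u0) (lint (\<lambda>t. inverse (\<kappa> t))) p q r B" using sq[OF s] by blast
   show ?thesis by (rule tail_of_seq_bound[OF q \<open>p \<le> 2\<close> r _ _ \<kappa>fin B(2,1)]) auto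
  qed
  have sq2: "tail_ineq p q u0 \<kappa>" if s: "cond_SEQ p q r u w" "cond_NH p q r u w" and "q < 2" "2 < p"
  proof -
   obtain B where B: "B < \<top>" "seq_bound (umeas q u0) (lint (\<lambda>t. inverse (\<kappa> t))) p q r B" using sq[OF s(1)] by blast
   have N: "cond_NH p q r u0 (\<lambda>t. inverse (\<kappa> t))" using s(2) cond_NH_cong[of u u0 w "\<lambda>t. inverse (\<kappa> t)"] u w by blast
   show ?thesis by (rule tail_of_seq_bound_and_NH[OF q(1) \<open>q < 2\<close> \<open>2 < p\<close> r _ _ \<kappa>fin B(2,1) N]) auto
  qed
  have p'2: "2 \<le> p'" if "p \<le> 2"
  proof -
   have "1 / 2 \<le> 1 / p" using that p by (intro divide_left_mono) auto
   then have "1 / p' \<le> 1 / 2" using p(2) by linarith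
   then show ?thesis using p' by (simp add: field_simps)
  qed
  \<comment> \<open>Direct route: q \<ge> 2, (c), (d), (e), (BHJH), and (SEQ) with or without (NH)
    according to p. Dual route: 1 < q < p \<le> 2, where p' \<ge> 2, and (f), (g), (h).\<close>
  show "(2 \<le> q \<or> tail_ineq p q u0 \<kappa>) \<or> 1 < q \<and> (2 \<le> p' \<or> cond_c p' (\<lambda>t. \<kappa> t powe (p' - 1)))"
   using assms(11)
  proof (elim disjE)
   assume "1 < q \<and> q < 2 \<and> 2 < p \<and>
    ((cond_c q u \<or> cond_d q u \<or> cond_e q u \<or> cond_f p' q w \<or> cond_g p' q w \<or> cond_h p' q w)
     \<or> cond_BHJH p p' q r u w \<or> (cond_SEQ p q r u w \<and> cond_NH p q r u w))"
   then show ?thesis using c bh sq2 dual unfolding v_def[abs_def] by (meson not_le)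
  next
   assume "0 < q \<and> q < 1 \<and> 1 < p \<and>
    ((cond_c q u \<or> cond_d q u) \<or> cond_BHJH p p' q r u w \<or> (p \<le> 2 \<and> cond_SEQ p q r u w)
     \<or> (p > 2 \<and> cond_SEQ p q r u w \<and> cond_NH p q r u w))"
   moreover then have "q < 2" by simp
   ultimately show ?thesis using c bh sq1 sq2 by blast
  qed (use p'2 in auto)
 qed
 then show ?thesis unfolding fourier_ineq_def .
qed

end
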